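(* For all integers $a,b\ge0$, $$\zeta(\{2\}^a,4,\{2\}^b)=(-1)^{a+b}\big(T_1+T_2+T_3\big),$$ where (all summation variables run over integers $\geq 0$) \begin{align*} T_1={}&-\sum_{p+q=a}4\,\zeta(2p+2,2b+2)\frac{(\mathrm i\pi)^{2q}}{(2q+1)!}+\sum_{r+s=b-1}4\,\zeta(2r+3,2a+3)\frac{(\mathrm i\pi)^{2s}}{(2s+1)!}\\ &+\sum_{2u+i+j=2a+2b}\bigg(\frac1{2^i}\binom{i+1}{2a-2u+1}+\frac1{2^j}\binom{j+1}{2b+1}\bigg)\zeta(i+2,j+2)\frac{(\mathrm i\pi)^{2u}}{(2u+1)!}, \end{align*} \begin{align*} T_2={}&\sum_{u+v+w=a-1}4\binom{2w+2b+2}{2b+1}\bigg(\zeta(\overline{2b+2w+3})-\frac{\zeta(2b+2w+3)}{2^{2b+2w+3}}\bigg)\zeta(2v+3)\frac{(\mathrm i\pi)^{2u}}{(2u+1)!}\\ &-\sum_{\substack{p+q=a\\ r+s=b}}4\binom{2p+2s}{2s-1}\zeta(2r+3)\zeta(\overline{2s+2p+1})\frac{(\mathrm i\pi)^{2q}}{(2q+1)!}\\ &-\sum_{u+v+w=b-1}4\binom{2a+2v+2}{2v}\zeta(2w+3)\zeta(2a+2v+3)\frac{(\mathrm i\pi)^{2u}}{(2u+1)!}\\ &+\sum_{\substack{p+q=a\\ r+s=b}}4\binom{2q+2r}{2r}\zeta(2p+3)\zeta(2q+2r+1)\frac{(\mathrm i\pi)^{2s}}{(2s+1)!}\\ &-\sum_{p+q=a-1}2\,\zeta(2p+3)\zeta(2q+3)\frac{(\mathrm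 i\pi)^{2b}}{(2b+1)!}-\sum_{r+s=b-1}4\,\zeta(2a+3)\zeta(2r+3)\frac{(\mathrm i\pi)^{2s}}{(2s+1)!}, \end{align*} \begin{align*} T_3={}&-\sum_{\substack{i+j+2k=2a+2\\ p+q+2r=2b}}3\zeta(2)\frac{(-1)^pE_{i+p}E_{j+q}}{i!\,j!\,p!\,q!}\Big(\frac{\mathrm i\pi}2\Big)^{2a+2b+2}\frac{2^{2k+2r}}{(2k+1)!(2r+1)!}\\ &+\sum_{\substack{i+j+2k+2\ell=2a\\ p+q+2r=2b}}3\zeta(2)\frac{(-1)^pE_{i+p}E_{j+q}}{i!\,j!\,p!\,q!}\Big(\frac{\mathrm i\pi}2\Big)^{2a+2b-2\ell}\frac{2^{2k+2r}}{(2k+1)!(2r+1)!}\zeta(2\ell+2)\\ &+\frac{(\mathrm i\pi)^{2a+2b+4}}{(2a+2b+5)!}+2\zeta(2b+2)\frac{(\mathrm i\pi)^{2a+2}}{(2a+3)!}-4\zeta(2a+4)\frac{(\mathrm i\pi)^{2b}}{(2b+1)!}\\ &-\sum_{p+q=a+1}\frac1{2^{2p+2b-1}}\binom{2p+2b}{2b+1}\zeta(2p+2b+2)\frac{(\mathrm i\pi)^{2q}}{(2q+1)!}\\ &-\sum_{\substack{p+q=a\\ r+s=b}}4\binom{2p+2r+1}{2p+1}\zeta(\overline{2p+2r+2})\zeta(2s+2)\frac{(\mathrm i\pi)^{2q}}{(2q+1)!}\\ &+\sum_{r+s=b}2\,\zeta(2s+2r+4)\bigg(\binom{2a+2r+3}{2a+3}-\binom{2a+2r+3}{2r+1}\bigg)\frac{(\mathrm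 i\pi)^{2s}}{(2s+1)!}\\ &+\sum_{r+s=b}2\,\zeta(2a+2r+4)\frac{(\mathrm i\pi)^{2s}}{(2s+1)!}+\sum_{p+q=a}2\,\zeta(2p+2)\zeta(2q+2)\frac{(\mathrm i\pi)^{2b}}{(2b+1)!}. \end{align*}
   Context: Multiple zeta values are $\zeta(k_1,\dots,k_d)=\sum_{0<n_1<\cdots<n_d}n_1^{-k_1}\cdots n_d^{-k_d}$ for positive integers $k_i$ with $k_d\ge2$; $\{2\}^m$ denotes $2$ repeated $m$ times. In the formula, $\zeta(\overline n)$ is shorthand for $-(1-2^{1-n})\zeta(n)$, with the conventions $\zeta(0)=\zeta(\overline0)=-\tfrac12$ and $\zeta(1)=0$. $E_n$ is the $n$-th Euler number, $\operatorname{sech}(t)=\sum_{n\ge0}\frac{E_n}{n!}t^n$. Here $\mathrm i=\sqrt{-1}$ in powers of $\mathrm i\pi$, while $i$ elsewhere is a summation index. Empty sums are $0$, and $\binom nk=0$ for $k<0$ or $k>n$ ($n\ge0$).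
   Formalization: In the third-from-last sum of T_3 (over r+s=b, with the difference of two binomials), the printed factor ζ(2s+2r+4) is replaced by ζ(2a+2r+4); as printed the identity is false, e.g. for a=1, b=0. *)

theory Defs
  imports "HOL-Analysis.Analysis"
begin

(* Unordered summation; the terms are nonnegative and, for positive arguments, the family is
   summable exactly when the argument list is empty or its last entry is at least 2. *)
definition mzv :: "nat list \<Rightarrow> real" where
  "mzv ks = (\<Sum>\<^sub>\<infinity>ns | length ns = length ks \<and> sorted_wrt (<) ns \<and> (\<forall>n\<in>set ns. 0 < n).
     \<Prod>i<length ks. 1 / real (ns ! i) ^ (ks ! i))"

definition zeta1 :: "nat \<Rightarrow> real" where
  "zeta1 n = (if n = 0 then - 1 / 2 else if n = 1 then 0 else mzv [n])"

definition zeta_bar :: "nat \<Rightarrow> real" where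
  "zeta_bar n = - (1 - 2 powi (1 - int n)) * zeta1 n"

lemma zeta_bar_0: "zeta_bar 0 = - 1 / 2"
  by (simp add: zeta_bar_def zeta1_def)

definition euler_number :: "nat \<Rightarrow> real" where
  "euler_number n = fact n * fps_nth (inverse (fps_const (1 / 2) * (fps_exp 1 + fps_exp (- 1)))) n"

lemma sech_has_fps_expansion:
  "(\<lambda>t::real. inverse (cosh t)) has_fps_expansion Abs_fps (\<lambda>n. euler_number n / fact n)"
proof -
  have "(\<lambda>t::real. 1 / 2 * (exp (1 * t) + exp (- 1 * t))) has_fps_expansion
          fps_const (1 / 2) * (fps_exp 1 + fps_exp (- 1))"
    by (intro has_fps_expansion_cmult_left has_fps_expansion_add has_fps_expansion_exp)
  also have "(\<lambda>t::real. 1 / 2 * (exp (1 * t) + exp (- 1 * t))) = cosh"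
    by (simp add: fun_eq_iff cosh_field_def)
  finally have "(\<lambda>t::real. inverse (cosh t)) has_fps_expansion
          inverse (fps_const (1 / 2) * (fps_exp 1 + fps_exp (- 1)))"
    by (rule has_fps_expansion_inverse) simp
  then show ?thesis
    by (simp add: euler_number_def fps_nth_inverse)
qed

(* Only needed where the lower index can be negative. *)
definition binom :: "nat \<Rightarrow> int \<Rightarrow> nat" where
  "binom n k = (if k < 0 then 0 else n choose nat k)"

(* Every index set below is a finite set of tuples of naturals.  A constraint such as r + s = b - 1
   over the integers is written r + s + 1 = b, so that the sum is empty for b = 0. *)

definition T1 :: "nat \<Rightarrow> nat \<Rightarrow> complex" where
  "T1 a b =
     - (\<Sum>(p, q) \<in> {(p, q). p + q = a}.
          4 * of_real (mzv [2 * p + 2, 2 * b + 2]) * ((\<i> * of_real pi) ^ (2 * q) / fact (2 * q + 1)))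
     + (\<Sum>(r, s) \<in> {(r, s). r + s + 1 = b}.
          4 * of_real (mzv [2 * r + 3, 2 * a + 3]) * ((\<i> * of_real pi) ^ (2 * s) / fact (2 * s + 1)))
     + (\<Sum>(u, i, j) \<in> {(u, i, j). 2 * u + i + j = 2 * a + 2 * b}.
          (1 / 2 ^ i * of_nat (binom (i + 1) (2 * int a - 2 * int u + 1))
             + 1 / 2 ^ j * of_nat ((j + 1) choose (2 * b + 1)))
          * of_real (mzv [i + 2, j + 2]) * ((\<i> * of_real pi) ^ (2 * u) / fact (2 * u + 1)))"

definition T2 :: "nat \<Rightarrow> nat \<Rightarrow> complex" where
  "T2 a b =
     (\<Sum>(u, v, w) \<in> {(u, v, w). u + v + w + 1 = a}.
          4 * of_nat ((2 * w + 2 * b + 2) choose (2 * b + 1))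
          * of_real (zeta_bar (2 * b + 2 * w + 3)
               - zeta1 (2 * b + 2 * w + 3) / 2 ^ (2 * b + 2 * w + 3))
          * of_real (zeta1 (2 * v + 3)) * ((\<i> * of_real pi) ^ (2 * u) / fact (2 * u + 1)))
     - (\<Sum>(p, q, r, s) \<in> {(p, q, r, s). p + q = a \<and> r + s = b}.
          4 * of_nat (binom (2 * p + 2 * s) (2 * int s - 1))
          * of_real (zeta1 (2 * r + 3)) * of_real (zeta_bar (2 * s + 2 * p + 1))
          * ((\<i> * of_real pi) ^ (2 * q) / fact (2 * q + 1)))
     - (\<Sum>(u, v, w) \<in> {(u, v, w). u + v + w + 1 = b}.
          4 * of_nat ((2 * a + 2 * v + 2) choose (2 * v))
          * of_real (zeta1 (2 * w + 3)) * of_real (zeta1 (2 * a + 2 * v + 3))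
          * ((\<i> * of_real pi) ^ (2 * u) / fact (2 * u + 1)))
     + (\<Sum>(p, q, r, s) \<in> {(p, q, r, s). p + q = a \<and> r + s = b}.
          4 * of_nat ((2 * q + 2 * r) choose (2 * r))
          * of_real (zeta1 (2 * p + 3)) * of_real (zeta1 (2 * q + 2 * r + 1))
          * ((\<i> * of_real pi) ^ (2 * s) / fact (2 * s + 1)))
     - (\<Sum>(p, q) \<in> {(p, q). p + q + 1 = a}.
          2 * of_real (zeta1 (2 * p + 3)) * of_real (zeta1 (2 * q + 3))
          * ((\<i> * of_real pi) ^ (2 * b) / fact (2 * b + 1)))
     - (\<Sum>(r, s) \<in> {(r, s). r + s + 1 = b}.
          4 * of_real (zeta1 (2 * a + 3)) * of_real (zeta1 (2 * r + 3))
          * ((\<i> * of_real pi) ^ (2 * s) / fact (2 * s + 1)))"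

(* In the last sum but two, the zeta argument is 2a + 2r + 4.  The source prints 2s + 2r + 4, a
   misprint: that term would not have weight 2a + 2b + 4 like all the others, and the
   resulting identity fails numerically already for (a, b) = (0, 1) and (1, 0).
   In the second sum the constraint forces l \<le> a, so the exponent is never truncated. *)
definition T3 :: "nat \<Rightarrow> nat \<Rightarrow> complex" where
  "T3 a b =
     - (\<Sum>(i, j, k, p, q, r) \<in>
            {(i, j, k, p, q, r). i + j + 2 * k = 2 * a + 2 \<and> p + q + 2 * r = 2 * b}.
          3 * of_real (zeta1 2)
          * ((- 1) ^ p * of_real (euler_number (i + p)) * of_real (euler_number (j + q))
               / (fact i * fact j * fact p * fact q))
          * (\<i> * of_real pi / 2) ^ (2 * a + 2 * b + 2)
          * (2 ^ (2 * k + 2 * r) / (fact (2 * k + 1) * fact (2 * r + 1))))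
     + (\<Sum>(i, j, k, l, p, q, r) \<in>
            {(i, j, k, l, p, q, r). i + j + 2 * k + 2 * l = 2 * a \<and> p + q + 2 * r = 2 * b}.
          3 * of_real (zeta1 2)
          * ((- 1) ^ p * of_real (euler_number (i + p)) * of_real (euler_number (j + q))
               / (fact i * fact j * fact p * fact q))
          * (\<i> * of_real pi / 2) ^ (2 * a + 2 * b - 2 * l)
          * (2 ^ (2 * k + 2 * r) / (fact (2 * k + 1) * fact (2 * r + 1)))
          * of_real (zeta1 (2 * l + 2)))
     + (\<i> * of_real pi) ^ (2 * a + 2 * b + 4) / fact (2 * a + 2 * b + 5)
     + 2 * of_real (zeta1 (2 * b + 2)) * ((\<i> * of_real pi) ^ (2 * a + 2) / fact (2 * a + 3))
     - 4 * of_real (zeta1 (2 * a + 4)) * ((\<i> * of_real pi) ^ (2 * b) / fact (2 * b + 1))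
     - (\<Sum>(p, q) \<in> {(p, q). p + q = a + 1}.
          1 / 2 powi (2 * int p + 2 * int b - 1) * of_nat ((2 * p + 2 * b) choose (2 * b + 1))
          * of_real (zeta1 (2 * p + 2 * b + 2))
          * ((\<i> * of_real pi) ^ (2 * q) / fact (2 * q + 1)))
     - (\<Sum>(p, q, r, s) \<in> {(p, q, r, s). p + q = a \<and> r + s = b}.
          4 * of_nat ((2 * p + 2 * r + 1) choose (2 * p + 1))
          * of_real (zeta_bar (2 * p + 2 * r + 2)) * of_real (zeta1 (2 * s + 2))
          * ((\<i> * of_real pi) ^ (2 * q) / fact (2 * q + 1)))
     + (\<Sum>(r, s) \<in> {(r, s). r + s = b}.
          2 * of_real (zeta1 (2 * a + 2 * r + 4))
          * (of_nat ((2 * a + 2 * r + 3) choose (2 * a + 3))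
               - of_nat ((2 * a + 2 * r + 3) choose (2 * r + 1)))
          * ((\<i> * of_real pi) ^ (2 * s) / fact (2 * s + 1)))
     + (\<Sum>(r, s) \<in> {(r, s). r + s = b}.
          2 * of_real (zeta1 (2 * a + 2 * r + 4))
          * ((\<i> * of_real pi) ^ (2 * s) / fact (2 * s + 1)))
     + (\<Sum>(p, q) \<in> {(p, q). p + q = a}.
          2 * of_real (zeta1 (2 * p + 2)) * of_real (zeta1 (2 * q + 2))
          * ((\<i> * of_real pi) ^ (2 * b) / fact (2 * b + 1)))"

end

theory Submission
  imports Defs "HOL-Analysis.Analysis"
begin

text \<open>
  Both sides are compared through their generating functions in $x^{2a} y^{2b}$ for small real
  $x \neq y$. Up to the sign $(-1)^{a+b}$, the left-hand side has the generating function
  $F(x,y) = \sum_n n^{-4} \prod_{m<n} (1 - x^2/m^2) \prod_{m>n} (1 - y^2/m^2)$. For $z = k \mp y$, the numbers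
  $1 / (z \prod_{j\le n} (1 - z^2/j^2))$ weighted by harmonic sums $\sum_{m<k} 2/(m \mp y) + 1/(k \mp y)$
  telescope in $k$ to the factor needed in $F$; exchanging the two summations leaves a sum over $n$ that
  telescopes as well, and $F$ becomes a combination of double series in $k$ and $m$.

  Cut off at $N$, these double series satisfy stuffle relations (products of partial sums) and shuffle
  relations (partial fractions); together with the splitting of $\{(m, n) : m < n\}$ by the parity of $n - m$
  they reduce $F$ to the generating functions of $\zeta(k,l)$ and of $\zeta(k)$, $\zeta(\overline k)$ at the
  points $\pm x$, $\pm y$, $\pm x \pm y$ and $(\pm x \pm y)/2$. The binomial coefficients on the right-hand
  side come from expanding in powers of $x \pm y$, the factors $(\mathrm i\pi)^{2q}/(2q+1)!$ from $\sin(\pi x)/(\pi x)$, and the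
  Euler numbers from $1/\cos(\pi(x \pm y)/2)$. What is left is an identity between trigonometric functions,
  since even zeta values sum to cotangents.
\<close>

subsection \<open>Finite sine products\<close>

text \<open>The obstacle is divergence. The double series in k and m converge only as a whole: split
  into single products 1/((n - X) (m - Y)) they grow like powers of log N, so every relation is
  proved at a finite level N and the limit is taken at the end. The cut-off has a price. A product
  of partial sums runs over the square m, l \<le> N, a shuffle only over the triangle m + l \<le> N.
  The corner between them contributes \<zeta>(2) = pi^2/6 when there are no signs and 0 when one
  factor alternates. All multiples of \<open>hs 1 0 N\<close>, the harmonic number, must disappear.
  The quadratic ones cancel algebraically; a linear one survives in the alternating part, multiplied
  by tails of series with terms O(1/n^3). Subtracting 1/n from 1/(n - X) is the form that the
  convention \<zeta>(1) = 0 takes in generating functions. The signed sums over \<plusminus>x and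
  \<plusminus>y do more than select the powers x^(2a) y^(2b): they also remove the double sums that
  no relation evaluates. The points x = y are left out because x - y and x^2 - y^2 occur as
  denominators; the coefficients are determined without them.\<close>

definition sinc :: "real \<Rightarrow> real" where "sinc z = sin (pi * z) / (pi * z)"

definition rcp :: "real \<Rightarrow> nat \<Rightarrow> real" where "rcp X n = 1 / (real n - X)"

definition sprod :: "nat \<Rightarrow> real \<Rightarrow> real" where "sprod n z = (\<Prod>j=1..n. 1 - z\<^sup>2 / (real j)\<^sup>2)"

definition rho :: "nat \<Rightarrow> real \<Rightarrow> real" where "rho n z = 1 / (z * sprod n z)"

text \<open>The last entry counts half as much as the others. With this weight
  \<open>hsum X k * rcp X k\<close> is the increment of the square of the partial sum, and the
  telescoping in \<open>sums_hsum_rho\<close> closes.\<close>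

definition hsum :: "real \<Rightarrow> nat \<Rightarrow> real" where
  "hsum X k = 2 * (\<Sum>m=1..<k. rcp X m) + rcp X k"

lemma sprod_0 [simp]: "sprod 0 z = 1" by (simp add: sprod_def)

lemma sprod_Suc: "sprod (Suc n) z = sprod n z * (1 - z\<^sup>2 / (real (Suc n))\<^sup>2)"
  by (simp add: sprod_def)

lemma sprod_minus [simp]: "sprod n (- z) = sprod n z" by (simp add: sprod_def)

lemma rho_minus [simp]: "rho n (- z) = - rho n z" by (simp add: rho_def)

lemma sprod_nonzero: "z \<notin> \<int> \<Longrightarrow> sprod n z \<noteq> 0"
proof (induction n)
  case (Suc n)
  have "z\<^sup>2 \<noteq> (real (Suc n))\<^sup>2"
  proof
    assume "z\<^sup>2 = (real (Suc n))\<^sup>2"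
    then have "z = real (Suc n) \<or> z = - real (Suc n)" by (simp add: power2_eq_iff)
    then show False using Suc.prems by (metis Ints_minus Ints_of_nat)
  qed
  with Suc show ?case by (simp add: sprod_Suc)
qed simp

text \<open>Up to the factor (-1)^n/(n!)^2 the polynomial z * \<open>sprod n z\<close> is (z -
  n)...(z + n), so a step from z to z + 1 trades the factor z - n for z + n + 1.\<close>

lemma sprod_shift:
  "(z + 1) * sprod n (z + 1) * (z - real n) = z * sprod n z * (z + 1 + real n)"
proof (induction n)
  case (Suc n)
  have eq: "1 - (z + 1)\<^sup>2 / (real (Suc n))\<^sup>2 = (real n - z) * (real n + z + 2) / (real (Suc n))\<^sup>2"
    "1 - z\<^sup>2 / (real (Suc n))\<^sup>2 = - (z - real n - 1) * (z + 1 + real n) / (real (Suc n))\<^sup>2"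
    by (simp_all add: divide_simps power2_eq_square del: of_nat_Suc) (simp_all add: algebra_simps)
  have "(z + 1) * sprod (Suc n) (z + 1) * (z - real (Suc n))
     = ((z + 1) * sprod n (z + 1) * (z - real n)) * (- (real n + z + 2) * (z - real n - 1) / (real (Suc n))\<^sup>2)"
    unfolding sprod_Suc eq by (simp add: field_simps)
  also have "\<dots> = z * sprod (Suc n) z * (z + 1 + real (Suc n))"
    unfolding Suc.IH sprod_Suc eq by (simp add: field_simps)
  finally show ?case .
qed simp

lemma rho_shift:
  assumes "z \<notin> \<int>"
  shows "(z + 1 + real n) * rho n (z + 1) = (z - real n) * rho n z"
proof -
  have z: "z \<noteq> 0" "z + 1 \<noteq> 0" using assms by (auto simp: add_eq_0_iff2)
  have z1: "z + 1 \<notin> \<int>" using assms by (metis Ints_1 Ints_diff add_diff_cancel)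
  show ?thesis
    using sprod_shift[of z n] sprod_nonzero[OF assms, of n] sprod_nonzero[OF z1, of n] z
    by (simp add: rho_def frac_eq_eq) (simp add: algebra_simps)
qed

text \<open>The factor with j = 1 already gives z^2 - 1, and the assumption makes every other factor
  at least 1 in absolute value.\<close>

lemma sprod_ge:
  assumes "n \<ge> 1" and "z\<^sup>2 \<ge> 2 * (real n)\<^sup>2"
  shows "\<bar>sprod n z\<bar> \<ge> z\<^sup>2 - 1"
proof -
  have "z\<^sup>2 - 1 \<le> \<bar>sprod n' z\<bar>" if "1 \<le> n'" "n' \<le> n" for n'
    using that
  proof (induction n' rule: nat_induct_at_least)
    case base
    then show ?case by (simp add: sprod_def)
  next
    case (Suc m)
    have m: "(real (Suc m))\<^sup>2 \<le> (real n)\<^sup>2" using Suc.prems by (intro power_mono) auto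
    then have "2 * (real (Suc m))\<^sup>2 \<le> z\<^sup>2" using assms(2) by linarith
    then have "z\<^sup>2 / (real (Suc m))\<^sup>2 \<ge> 2" by (simp add: field_simps)
    then have "\<bar>1 - z\<^sup>2 / (real (Suc m))\<^sup>2\<bar> \<ge> 1" by linarith
    then have "\<bar>sprod m z\<bar> * 1 \<le> \<bar>sprod (Suc m) z\<bar>"
      unfolding sprod_Suc abs_mult by (intro mult_left_mono) auto
    then show ?case using Suc by simp
  qed
  then show ?thesis using assms(1) by auto
qed

lemma not_Ints_small: "0 < \<bar>X\<bar> \<Longrightarrow> \<bar>X\<bar> < 1 \<Longrightarrow> real k - X \<notin> \<int>"
proof
  assume X: "0 < \<bar>X\<bar>" "\<bar>X\<bar> < 1" and "real k - X \<in> \<int>"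
  then have "X \<in> \<int>" by (metis Ints_diff Ints_of_nat diff_diff_eq2 add_diff_cancel_left')
  then show False using X by (metis Ints_nonzero_abs_less1 abs_zero less_irrefl)
qed

lemma rcp_bound:
  assumes "\<bar>X\<bar> \<le> 1/2" "n \<ge> 1"
  shows "0 < rcp X n" "rcp X n \<le> 2 / real n" "\<bar>rcp X n\<bar> \<le> 2 / real n"
proof -
  have "real n - X \<ge> real n / 2" using assms by (simp add: abs_le_iff field_simps)
  moreover have "real n > 0" using assms by simp
  ultimately show "0 < rcp X n" "rcp X n \<le> 2 / real n"
    by (auto simp: rcp_def field_simps)
  then show "\<bar>rcp X n\<bar> \<le> 2 / real n" by simp
qed

text \<open>A root replaces the logarithm, since every use leaves room for a power: sqrt k / k^2 is
  summable and sqrt N / N tends to 0.\<close>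

lemma harm_le_sqrt: "(\<Sum>m=1..k. 1 / real m) \<le> 2 * sqrt (real k)"
proof (induction k)
  case (Suc k)
  have *: "sqrt (real (Suc k)) - sqrt (real k) \<ge> 1 / (2 * real (Suc k))"
  proof -
    have "(sqrt (real (Suc k)) - sqrt (real k)) * (sqrt (real (Suc k)) + sqrt (real k)) = 1"
      by (simp add: algebra_simps)
    moreover have "sqrt (real (Suc k)) + sqrt (real k) \<le> 2 * real (Suc k)"
    proof -
      have "sqrt (real (Suc k)) \<le> real (Suc k)" by (rule real_le_lsqrt) (auto simp: power2_eq_square)
      moreover have "sqrt (real k) \<le> sqrt (real (Suc k))" by simp
      ultimately show ?thesis by (simp only: mult_2)
    qed
    moreover have "sqrt (real (Suc k)) - sqrt (real k) \<ge> 0" by simp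
    ultimately have "1 \<le> (sqrt (real (Suc k)) - sqrt (real k)) * (2 * real (Suc k))"
      by (metis mult_left_mono)
    then show ?thesis by (simp add: field_simps)
  qed
  have "1 / real (Suc k) = 2 * (1 / (2 * real (Suc k)))" by (simp add: field_simps)
  then have "1 / real (Suc k) \<le> 2 * (sqrt (real (Suc k)) - sqrt (real k))"
    using mult_left_mono[OF *, of 2] by (simp only: mult.assoc)
  then have "1 / real (Suc k) + (\<Sum>m=1..k. 1 / real m) \<le> 2 * sqrt (real (Suc k))"
    using Suc unfolding right_diff_distrib by linarith
  then show ?case by (simp add: add.commute)
qed simp

lemma sum_rcp_le:
  assumes "\<bar>X\<bar> \<le> 1/2"
  shows "\<bar>\<Sum>m=1..<k. rcp X m\<bar> \<le> 4 * sqrt (real k)"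
proof -
  have "\<bar>\<Sum>m=1..<k. rcp X m\<bar> \<le> (\<Sum>m=1..<k. 2 * (1 / real m))"
    by (rule order_trans[OF sum_abs]) (use rcp_bound[OF assms] in \<open>auto intro!: sum_mono\<close>)
  also have "\<dots> \<le> (\<Sum>m=1..k. 2 * (1 / real m))" by (intro sum_mono2) auto
  also have "\<dots> = 2 * (\<Sum>m=1..k. 1 / real m)" by (simp only: sum_distrib_left)
  also have "\<dots> \<le> 4 * sqrt (real k)" using harm_le_sqrt[of k] by linarith
  finally show ?thesis .
qed

lemma hsum_le:
  assumes "\<bar>X\<bar> \<le> 1/2" "k \<ge> 1"
  shows "\<bar>hsum X k\<bar> \<le> 10 * sqrt (real k)"
proof -
  have "2 / real k \<le> 2" using assms by (simp add: field_simps)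
  also have "2 \<le> 2 * sqrt (real k)" using assms by simp
  finally have "\<bar>rcp X k\<bar> \<le> 2 * sqrt (real k)"
    using rcp_bound(3)[OF assms] by linarith
  then show ?thesis using sum_rcp_le[OF assms(1), of k] unfolding hsum_def by linarith
qed

text \<open>Summation by parts. For z = k - X, \<open>rho_shift\<close> turns t (k + 1) into (z - n)
  rho n z / (2n), hence t k - t (k + 1) = rho n z. The 1/n added to the harmonic sum in
  \<open>U\<close> produces the last summand of \<open>hsum\<close>, because rho/n - (z - n) rho/(z
  n) = rho/z.\<close>

lemma sums_hsum_rho:
  assumes X: "0 < \<bar>X\<bar>" "\<bar>X\<bar> \<le> 1/2" and n: "n \<ge> 1"
  shows "(\<lambda>k. hsum X (Suc k) * rho n (real (Suc k) - X)) sums ((X + n) * rho n X / (2 * (real n)\<^sup>2))"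
proof -
  define t where "t k = (real k - X + n) * rho n (real k - X) / (2 * n)" for k
  define U where "U k = (2 * (\<Sum>m=1..<k. rcp X m) + 1 / n) * t k" for k
  have n0: "real n > 0" using n by simp
  have nI: "real k - X \<notin> \<int>" for k using not_Ints_small[of X k] X by simp
  have t_Suc: "t (Suc k) = (real k - X - n) * rho n (real k - X) / (2 * n)" for k
  proof -
    have "real (Suc k) - X = real k - X + 1" by simp
    then show ?thesis unfolding t_def by (simp only: rho_shift[OF nI[of k], of n])
  qed
  have step: "U (Suc k) - U (Suc (Suc k)) = hsum X (Suc k) * rho n (real (Suc k) - X)" for k
  proof -
    define z where "z = real (Suc k) - X"
    define h where "h = (\<Sum>m=1..<Suc k. rcp X m)"
    have z: "z \<noteq> 0" unfolding z_def using nI[of "Suc k"] by (metis Ints_0)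
    have r: "rcp X (Suc k) = 1 / z" by (simp add: rcp_def z_def)
    have "U (Suc k) - U (Suc (Suc k)) = (2 * h + 1 / n) * ((z + n) * rho n z / (2 * n))
          - (2 * (h + 1 / z) + 1 / n) * ((z - n) * rho n z / (2 * n))"
    proof -
      have "(\<Sum>m=1..<Suc (Suc k). rcp X m) = h + 1 / z" by (simp add: h_def r)
      moreover have "t (Suc k) = (z + n) * rho n z / (2 * n)" by (simp only: t_def z_def)
      moreover have "t (Suc (Suc k)) = (z - n) * rho n z / (2 * n)" by (simp only: t_Suc z_def)
      ultimately show ?thesis by (simp only: U_def h_def)
    qed
    also have "\<dots> = (2 * h + 1 / z) * rho n z"
      using z n0 by (simp add: field_simps)
    finally show ?thesis by (simp add: hsum_def h_def r z_def)
  qed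
  have "(\<lambda>k. U (Suc k)) \<longlonglongrightarrow> 0"
  proof (rule Lim_null_comparison)
    show "\<forall>\<^sub>F k in sequentially. norm (U (Suc k)) \<le> 1000 / sqrt (real (Suc k))"
      unfolding eventually_sequentially
    \<comment> \<open>From here on z is at least 2n, so \<open>sprod_ge\<close> applies:
      \<open>t\<close> decays like 1/k^2 against a harmonic sum of order sqrt k.\<close>
    proof (intro exI[of _ "2 * n + 2"] allI impI)
      fix k assume k: "2 * n + 2 \<le> k"
      define K where "K = real (Suc k)"
      define z where "z = K - X"
      have K: "K \<ge> 2 * real n + 2" using k unfolding K_def by linarith
      have z: "z \<ge> K / 2" "z \<le> 2 * K" "z \<ge> 2 * n" "z \<ge> 1" unfolding z_def using K X by (auto simp: abs_le_iff)
      have "z\<^sup>2 \<ge> (2 * real n)\<^sup>2" using z by (intro power_mono) auto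
      then have zz: "z\<^sup>2 \<ge> 2 * (real n)\<^sup>2"
        by (rule order_trans[rotated]) (simp add: power_mult_distrib)
      have sp: "\<bar>sprod n z\<bar> \<ge> z\<^sup>2 - 1" by (rule sprod_ge[OF n zz])
      have "(real n)\<^sup>2 \<ge> 1" using n by simp
      then have z2: "z\<^sup>2 \<ge> 2" using zz by linarith
      then have sp2: "\<bar>sprod n z\<bar> \<ge> z\<^sup>2 / 2" using sp by linarith
      have K0: "K > 0" using K n0 by linarith
      have z0: "z > 0" using z by linarith
      have "(K/2)\<^sup>2 \<le> z\<^sup>2" using z K0 by (intro power_mono) auto
      then have sp3: "\<bar>sprod n z\<bar> \<ge> K\<^sup>2 / 8" using sp2 by (simp add: power_divide)
      have "\<bar>t (Suc k)\<bar> = (z + n) / (z * (2 * n)) / \<bar>sprod n z\<bar>"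
      proof -
        have "t (Suc k) = (z + n) * (1 / (z * sprod n z)) / (2 * n)"
          by (simp only: t_def rho_def z_def K_def)
        then show ?thesis using z0 n0 by (simp add: abs_mult)
      qed
      also have "\<dots> \<le> 1 / \<bar>sprod n z\<bar>"
      proof (intro divide_right_mono)
        have "real n * 1 \<le> real n * z" using z by (intro mult_left_mono) auto
        moreover have "z * 1 \<le> z * real n" using n z0 by (intro mult_left_mono) auto
        ultimately have "z + real n \<le> z * (2 * real n)" by (simp add: algebra_simps)
        then show "(z + n) / (z * (2 * n)) \<le> 1" using z0 n0 by (simp add: field_simps)
      qed auto
      also have "\<dots> \<le> 1 / (K\<^sup>2 / 8)" using sp3 K0 by (intro divide_left_mono mult_pos_pos) auto
      finally have t: "\<bar>t (Suc k)\<bar> \<le> 8 / K\<^sup>2" by simp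
      have "sqrt K \<ge> 1" using K n0 by simp
      moreover have "1 / real n \<le> 1" using n by simp
      ultimately have "\<bar>2 * (\<Sum>m=1..<Suc k. rcp X m) + 1 / n\<bar> \<le> 9 * sqrt K"
        using sum_rcp_le[OF X(2), of "Suc k"] n0 unfolding K_def[symmetric]
        by (simp only: abs_le_iff) (smt (verit) divide_nonneg_pos)
      then have "\<bar>U (Suc k)\<bar> \<le> 9 * sqrt K * (8 / K\<^sup>2)"
        unfolding U_def abs_mult using t K0 by (intro mult_mono) auto
      also have "\<dots> = 72 * (sqrt K / K) / K" by (simp add: power2_eq_square)
      also have "sqrt K / K = 1 / sqrt K" using K0 by (simp add: real_div_sqrt field_simps)
      also have "72 * (1 / sqrt K) / K \<le> 72 * (1 / sqrt K) / 1" using K n0 K0 by (intro divide_left_mono) auto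
      also have "\<dots> \<le> 1000 / sqrt K" using K0 by (simp add: field_simps)
      finally show "norm (U (Suc k)) \<le> 1000 / sqrt (real (Suc k))" by (simp add: K_def)
    qed
    show "(\<lambda>k. 1000 / sqrt (real (Suc k))) \<longlonglongrightarrow> 0"
      by (intro tendsto_divide_0[OF tendsto_const] filterlim_at_top_imp_at_infinity
         filterlim_compose[OF sqrt_at_top] filterlim_compose[OF filterlim_real_sequentially] filterlim_Suc)
  qed
  then have "(\<lambda>k. U (Suc k) - U (Suc (Suc k))) sums (U (Suc 0) - 0)"
    by (rule telescope_sums')
  \<comment> \<open>The harmonic sum is empty at k = 1, so only t 1 / n is left, and
    \<open>rho\<close> is odd.\<close>
  moreover have "U (Suc 0) = (X + n) * rho n X / (2 * (real n)\<^sup>2)"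
    unfolding U_def t_Suc[of 0] using n0 by (simp add: power2_eq_square field_simps)
  ultimately show ?thesis unfolding step by simp
qed

lemma summable_n_sqrt: "summable (\<lambda>k. sqrt (real (Suc k)) / (real (Suc k))\<^sup>2)"
proof -
  have "summable (\<lambda>k. real (Suc k) powr (-3/2))"
    using summable_real_powr_iff[of "-3/2"] by (subst summable_Suc_iff) simp
  moreover have "real (Suc k) powr (-3/2) = sqrt (real (Suc k)) / (real (Suc k))\<^sup>2" for k
  proof -
    have "real (Suc k) powr (-3/2) = real (Suc k) powr (1/2 - 2)" by simp
    also have "\<dots> = sqrt (real (Suc k)) / (real (Suc k))\<^sup>2"
      by (simp only: powr_diff powr_half_sqrt of_nat_0_le_iff) (simp add: powr_numeral)
    finally show ?thesis .
  qed
  ultimately show ?thesis by simp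
qed

section \<open>Passage to the infinite sine product\<close>

lemma sprod_tendsto: "z \<noteq> 0 \<Longrightarrow> (\<lambda>n. sprod n z) \<longlonglongrightarrow> sinc z"
  using sin_product_formula_real'[of z] unfolding sprod_def sinc_def by simp

text \<open>Compare each factor with its value at |z| = n + 1, in absolute value (n + 1 - j)(n + 1 +
  j)/j^2. The numbers n + 1 - j run through 1, ..., n in reverse and cancel one factor j each; the
  remaining quotients exceed 1.\<close>

lemma sprod_ge_1:
  assumes "\<bar>z\<bar> \<ge> real n + 1"
  shows "\<bar>sprod n z\<bar> \<ge> 1"
proof -
  have "1 \<le> (\<Prod>j=1..n. real (Suc n - j) / real j) * (\<Prod>j=1..n. real (n + 1 + j) / real j)"
  proof -
    have "(\<Prod>j=1..n. real (Suc n - j)) = (\<Prod>j=1..n. real j)"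
      using prod.atLeastAtMost_rev[of real 1 n] by simp
    then have "(\<Prod>j=1..n. real (Suc n - j) / real j) = 1" by (simp add: prod_dividef)
    moreover have "1 \<le> (\<Prod>j=1..n. real (n + 1 + j) / real j)" by (intro prod_ge_1) auto
    ultimately show ?thesis by simp
  qed
  also have "\<dots> \<le> (\<Prod>j=1..n. \<bar>1 - z\<^sup>2 / (real j)\<^sup>2\<bar>)"
    unfolding prod.distrib[symmetric]
  proof (intro prod_mono conjI)
    fix j assume j: "j \<in> {1..n}"
    have "(real n + 1)\<^sup>2 \<le> \<bar>z\<bar>\<^sup>2" using assms by (intro power_mono) auto
    moreover have "real (Suc n - j) / real j * (real (n + 1 + j) / real j) = (real n + 1)\<^sup>2 / (real j)\<^sup>2 - 1"
      using j by (simp add: of_nat_diff field_simps power2_eq_square)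
    ultimately have "real (Suc n - j) / real j * (real (n + 1 + j) / real j) \<le> z\<^sup>2 / (real j)\<^sup>2 - 1"
      by (simp add: divide_right_mono)
    then show "real (Suc n - j) / real j * (real (n + 1 + j) / real j) \<le> \<bar>1 - z\<^sup>2 / (real j)\<^sup>2\<bar>"
      by linarith
  qed auto
  also have "\<dots> = \<bar>sprod n z\<bar>" by (simp add: sprod_def abs_prod)
  finally show ?thesis .
qed

text \<open>A lower bound uniform in n, as dominated convergence requires. For |z| < n + 1 all
  further factors lie in [0, 1], so the absolute values decrease to their limit; otherwise |sinc z|
  \<le> 1 \<le> |sprod n z|.\<close>

lemma abs_sinc_le:
  assumes "z \<noteq> 0"
  shows "\<bar>sinc z\<bar> \<le> \<bar>sprod n z\<bar>"
proof (cases "\<bar>z\<bar> \<ge> real n + 1")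
  case True
  have "\<bar>sin (pi * z)\<bar> \<le> \<bar>pi * z\<bar>" by (rule abs_sin_x_le_abs_x)
  then have "\<bar>sinc z\<bar> \<le> 1" using assms by (simp add: sinc_def abs_divide divide_le_eq_1)
  then show ?thesis using sprod_ge_1[OF True] by linarith
next
  case False
  have "\<bar>sprod (n + m) z\<bar> \<le> \<bar>sprod n z\<bar>" for m
  proof (induction m)
    case (Suc m)
    have "\<bar>z\<bar>\<^sup>2 \<le> (real (Suc (n + m)))\<^sup>2" using False by (intro power_mono) auto
    then have "0 \<le> z\<^sup>2 / (real (Suc (n + m)))\<^sup>2" "z\<^sup>2 / (real (Suc (n + m)))\<^sup>2 \<le> 1"
      by (auto simp: field_simps)
    then have "\<bar>1 - z\<^sup>2 / (real (Suc (n + m)))\<^sup>2\<bar> \<le> 1" by linarith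
    then have "\<bar>sprod (n + Suc m) z\<bar> \<le> \<bar>sprod (n + m) z\<bar> * 1"
      unfolding add_Suc_right sprod_Suc abs_mult by (intro mult_left_mono) auto
    then show ?case using Suc by simp
  qed simp
  moreover have "(\<lambda>m. \<bar>sprod (n + m) z\<bar>) \<longlonglongrightarrow> \<bar>sinc z\<bar>"
    using LIMSEQ_ignore_initial_segment[OF tendsto_rabs[OF sprod_tendsto[OF assms]], of n]
    by (simp add: add.commute)
  ultimately show ?thesis by (intro LIMSEQ_le_const2) auto
qed

text \<open>A step from n - 1 to n multiplies \<open>sprod\<close> by 1 - x^2/n^2 and divides
  \<open>rho\<close> by 1 - z^2/n^2, so their product grows by sprod (n - 1) x * rho n z * (z^2 -
  x^2)/n^2.\<close>

lemma sprod_telescope: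
  assumes "z \<notin> \<int>" "z\<^sup>2 \<noteq> x\<^sup>2"
  shows "(\<Sum>n=1..N. sprod (n - 1) x * rho n z / (real n)\<^sup>2)
     = (sprod N x * rho N z - 1 / z) / (z\<^sup>2 - x\<^sup>2)"
proof (induction N)
  case (Suc N)
  have z: "z \<noteq> 0" using assms by auto
  have nz: "sprod N z \<noteq> 0" "sprod (Suc N) z \<noteq> 0" using sprod_nonzero[OF assms(1)] by auto
  define w where "w = 1 - z\<^sup>2 / (real (Suc N))\<^sup>2"
  have w: "w \<noteq> 0" using nz by (simp add: sprod_Suc w_def)
  have rho: "rho N z = w * rho (Suc N) z"
    using nz z w unfolding rho_def sprod_Suc w_def[symmetric] by simp
  have "(\<Sum>n=1..Suc N. sprod (n - 1) x * rho n z / (real n)\<^sup>2)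
     = (sprod N x * rho N z - 1 / z) / (z\<^sup>2 - x\<^sup>2) + sprod N x * rho (Suc N) z / (real (Suc N))\<^sup>2"
    using Suc by simp
  also have "\<dots> = (sprod N x * (w + (z\<^sup>2 - x\<^sup>2) / (real (Suc N))\<^sup>2) * rho (Suc N) z - 1 / z) / (z\<^sup>2 - x\<^sup>2)"
    unfolding rho using assms(2) by (simp add: divide_simps del: of_nat_Suc) (simp add: algebra_simps)
  also have "w + (z\<^sup>2 - x\<^sup>2) / (real (Suc N))\<^sup>2 = 1 - x\<^sup>2 / (real (Suc N))\<^sup>2"
    unfolding w_def diff_divide_distrib by simp
  finally show ?case by (simp add: sprod_Suc)
qed (simp add: rho_def)

lemma sprod_le_1: "\<bar>x\<bar> \<le> 1 \<Longrightarrow> \<bar>sprod N x\<bar> \<le> 1"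
proof (induction N)
  case (Suc N)
  have "x\<^sup>2 \<le> 1\<^sup>2" using Suc.prems abs_le_square_iff[of x 1] by simp
  also have "1\<^sup>2 \<le> (real (Suc N))\<^sup>2" by (intro power_mono) auto
  finally have "x\<^sup>2 / (real (Suc N))\<^sup>2 \<le> 1" by simp
  then have "\<bar>1 - x\<^sup>2 / (real (Suc N))\<^sup>2\<bar> \<le> 1" by (auto simp: abs_le_iff)
  with Suc have "\<bar>sprod N x\<bar> * \<bar>1 - x\<^sup>2 / (real (Suc N))\<^sup>2\<bar> \<le> 1" by (intro mult_le_one) auto
  then show ?case by (simp add: sprod_Suc abs_mult)
qed simp

text \<open>The two boundary terms of \<open>sprod_telescope\<close>, weighted by
  \<open>hsum\<close>: in the limit the upper one leads to \<open>aser\<close>, with the sign (-1)^k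
  stemming from sin (pi (k - X)), and the lower one to \<open>bser\<close>.\<close>

definition aser :: "real \<Rightarrow> real \<Rightarrow> nat \<Rightarrow> real" where
  "aser x X k = (-1) ^ k * hsum X k / ((real k - X)\<^sup>2 - x\<^sup>2)"

definition bser :: "real \<Rightarrow> real \<Rightarrow> nat \<Rightarrow> real" where
  "bser x X k = hsum X k / ((real k - X) * ((real k - X)\<^sup>2 - x\<^sup>2))"

lemma shifted_square_ge:
  assumes "\<bar>x\<bar> \<le> 1/4" "\<bar>X\<bar> \<le> 1/4" "k \<ge> 1"
  shows "(real k - X)\<^sup>2 - x\<^sup>2 \<ge> (real k)\<^sup>2 / 4" "real k - X \<ge> 1/2"
proof -
  have k: "real k \<ge> 1" using assms by simp
  have a: "real k - X \<ge> 3/4 * real k" using assms k by (simp add: abs_le_iff)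
  then have "(real k - X)\<^sup>2 \<ge> (3/4 * real k)\<^sup>2" using k by (intro power_mono) auto
  moreover have "\<bar>x\<bar>\<^sup>2 \<le> (1/4 * real k)\<^sup>2" using assms k by (intro power_mono) auto
  moreover have eqs: "(3/4 * real k)\<^sup>2 = 9/16 * (real k)\<^sup>2" "(1/4 * real k)\<^sup>2 = 1/16 * (real k)\<^sup>2"
    by (simp_all add: power2_eq_square)
  ultimately show "(real k - X)\<^sup>2 - x\<^sup>2 \<ge> (real k)\<^sup>2 / 4"
    using zero_le_power2[of "real k"] eqs unfolding power2_abs by linarith
  show "real k - X \<ge> 1/2" using a k by linarith
qed

lemma sinc_minus [simp]: "sinc (- z) = sinc z" by (simp add: sinc_def)

lemma sin_pi_of_nat_diff: "sin (pi * (real k - X)) = - ((-1) ^ k * sin (pi * X))"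
proof -
  have "sin (pi * (real k - X)) = sin (pi * real k) * cos (pi * X) - cos (pi * real k) * sin (pi * X)"
    by (simp add: right_diff_distrib sin_diff)
  then show ?thesis by (simp add: mult.commute[of pi "real k"])
qed

lemma sin_pi_nonzero: "z \<notin> \<int> \<Longrightarrow> sin (pi * z) \<noteq> 0"
  by (metis sin_zero_iff_int2 Ints_of_int mult.commute mult_cancel_left pi_neq_zero)

lemma sum_shift_limit:
  assumes X: "0 < \<bar>X\<bar>" "\<bar>X\<bar> \<le> 1/4" and x: "0 < \<bar>x\<bar>" "\<bar>x\<bar> \<le> 1/4"
  shows "summable (\<lambda>k. aser x X (Suc k))" "summable (\<lambda>k. bser x X (Suc k))"
    "(\<lambda>N. \<Sum>n=1..N. sprod (n - 1) x * ((X + n) * rho n X / (2 * (real n)\<^sup>2)) / (real n)\<^sup>2)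
       \<longlonglongrightarrow> - (sinc x / (X * sinc X)) * (\<Sum>k. aser x X (Suc k)) - (\<Sum>k. bser x X (Suc k))"
proof -
  define z where "z k = real (Suc k) - X" for k
  define d where "d k = (z k)\<^sup>2 - x\<^sup>2" for k
  define h where "h k = hsum X (Suc k)" for k
  \<comment> \<open>A bound for |rho N (z k)|: by \<open>abs_sinc_le\<close> it is at most 1/|z k *
    sinc (z k)|, and z sinc z = sin (pi z)/pi has the same absolute value at all points k -
    X.\<close>
  define C where "C = 1 / (\<bar>X\<bar> * \<bar>sinc X\<bar>)"
  have zI: "z k \<notin> \<int>" for k unfolding z_def using not_Ints_small[of X "Suc k"] X by simp
  have z0: "z k \<noteq> 0" for k using zI by (metis Ints_0)
  have d: "d k \<ge> (real (Suc k))\<^sup>2 / 4" "z k \<ge> 1/2" for k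
    unfolding d_def z_def using shifted_square_ge[of x X "Suc k"] X x by auto
  have d0: "d k > 0" for k using d(1)[of k] by (rule less_le_trans[rotated]) simp
  have hd: "\<bar>h k / d k\<bar> \<le> 40 * (sqrt (real (Suc k)) / (real (Suc k))\<^sup>2)" for k
  proof -
    have "\<bar>h k / d k\<bar> = \<bar>h k\<bar> / d k" using d0[of k] by (simp add: abs_divide)
    also have "\<dots> \<le> (10 * sqrt (real (Suc k))) / ((real (Suc k))\<^sup>2 / 4)"
      using hsum_le[of X "Suc k"] X d(1)[of k] unfolding h_def by (intro frac_le) auto
    finally show ?thesis by simp
  qed
  have hd_sum: "summable (\<lambda>k. K * (40 * (sqrt (real (Suc k)) / (real (Suc k))\<^sup>2)))" for K
    by (intro summable_mult summable_n_sqrt)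
  have sum_hd: "summable (\<lambda>k. c k * (h k / d k))" if "\<And>k. \<bar>c k\<bar> \<le> K" for c :: "nat \<Rightarrow> real" and K
  proof (rule summable_comparison_test[OF _ hd_sum[of K]], intro exI allI impI)
    fix k
    have "K \<ge> 0" using that[of 0] by linarith
    then show "norm (c k * (h k / d k)) \<le> K * (40 * (sqrt (real (Suc k)) / (real (Suc k))\<^sup>2))"
      unfolding real_norm_def abs_mult[of "c k"] using that hd by (intro mult_mono) auto
  qed
  have aser: "aser x X (Suc k) = (-1) ^ Suc k * (h k / d k)" for k
    by (simp add: aser_def h_def d_def z_def)
  have bser: "bser x X (Suc k) = 1 / z k * (h k / d k)" for k
    by (simp add: bser_def h_def d_def z_def)
  have iz: "\<bar>1 / z k\<bar> \<le> 2" for k using d(2)[of k] by (simp add: field_simps)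
  show sa: "summable (\<lambda>k. aser x X (Suc k))" unfolding aser by (rule sum_hd[of _ 1]) simp
  show sb: "summable (\<lambda>k. bser x X (Suc k))" unfolding bser by (rule sum_hd[of _ 2]) (rule iz)

  have rho_bound: "\<bar>rho N (z k)\<bar> \<le> C" for N k
  proof -
    have "sin (pi * z k) = - ((-1) ^ Suc k * sin (pi * X))"
      unfolding z_def by (rule sin_pi_of_nat_diff)
    then have "\<bar>sinc (z k)\<bar> = \<bar>X\<bar> * \<bar>sinc X\<bar> / \<bar>z k\<bar>"
      using X by (simp add: sinc_def abs_mult power_abs)
    then have *: "\<bar>X\<bar> * \<bar>sinc X\<bar> \<le> \<bar>z k * sprod N (z k)\<bar>"
      using mult_left_mono[OF abs_sinc_le[OF z0[of k], of N], of "\<bar>z k\<bar>"] z0[of k]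
      by (simp add: abs_mult)
    have "sinc X \<noteq> 0"
    proof -
      have "X \<notin> \<int>" using not_Ints_small[of "X" 0] X Ints_minus[of "X"] by auto
      then have "sin (pi * X) \<noteq> 0" by (rule sin_pi_nonzero)
      then show ?thesis using X by (simp add: sinc_def)
    qed
    then have "0 < \<bar>X\<bar> * \<bar>sinc X\<bar>" using X by simp
    then show ?thesis using * unfolding rho_def C_def abs_divide by (intro frac_le) auto
  qed
  have lim: "(\<lambda>N. (sprod N x * rho N (z k) - 1 / z k) * (h k / d k)) \<longlonglongrightarrow>
       (sinc x * (1 / (z k * sinc (z k))) - 1 / z k) * (h k / d k)" for k
  proof -
    have "sin (pi * z k) \<noteq> 0" by (rule sin_pi_nonzero[OF zI])
    then have "z k * sinc (z k) \<noteq> 0" using z0 by (simp add: sinc_def)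
    then show ?thesis unfolding rho_def using x z0
      by (intro tendsto_intros sprod_tendsto) auto
  qed
  \<comment> \<open>Tannery's theorem performs the limit under the sum over k; the constant
    \<open>C + 2\<close> combines |sprod N x| \<le> 1, the bound \<open>C\<close>, and |1 / z k|
    \<le> 2.\<close>
  have T: "(\<lambda>N. \<Sum>k. (sprod N x * rho N (z k) - 1 / z k) * (h k / d k)) \<longlonglongrightarrow>
       (\<Sum>k. (sinc x * (1 / (z k * sinc (z k))) - 1 / z k) * (h k / d k))"
  proof (rule tannerys_theorem[OF lim _ hd_sum[of "C + 2"], THEN conjunct2, THEN conjunct2])
    show "\<forall>\<^sub>F (k, N) in sequentially \<times>\<^sub>F sequentially.
       norm ((sprod N x * rho N (z k) - 1 / z k) * (h k / d k))
         \<le> (C + 2) * (40 * (sqrt (real (Suc k)) / (real (Suc k))\<^sup>2))"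
    proof (intro always_eventually allI, clarify)
      fix k N
      have "\<bar>sprod N x * rho N (z k)\<bar> \<le> 1 * C" unfolding abs_mult
        using sprod_le_1[of x N] rho_bound[of N k] x by (intro mult_mono) auto
      then have "\<bar>sprod N x * rho N (z k) - 1 / z k\<bar> \<le> C + 2" using iz[of k] by linarith
      moreover have "C \<ge> 0" by (simp add: C_def)
      ultimately show "norm ((sprod N x * rho N (z k) - 1 / z k) * (h k / d k))
         \<le> (C + 2) * (40 * (sqrt (real (Suc k)) / (real (Suc k))\<^sup>2))"
        unfolding real_norm_def abs_mult[of _ "h k / d k"] using hd[of k] by (intro mult_mono) auto
    qed
  qed auto
  have lim_eq: "(\<Sum>k. (sinc x * (1 / (z k * sinc (z k))) - 1 / z k) * (h k / d k))
      = - (sinc x / (X * sinc X)) * (\<Sum>k. aser x X (Suc k)) - (\<Sum>k. bser x X (Suc k))"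
  proof -
    have "(sinc x * (1 / (z k * sinc (z k))) - 1 / z k) * (h k / d k)
       = - (sinc x / (X * sinc X)) * aser x X (Suc k) - bser x X (Suc k)" for k
    proof -
      have s: "sin (pi * z k) = - ((-1) ^ Suc k * sin (pi * X))"
        unfolding z_def by (rule sin_pi_of_nat_diff)
      have e: "1 / (z k * sinc (z k)) = - ((-1) ^ Suc k) / (X * sinc X)"
        using z0[of k] X unfolding sinc_def s by (cases "even k") auto
      show ?thesis unfolding e aser bser by (simp add: algebra_simps)
    qed
    then have "(\<Sum>k. (sinc x * (1 / (z k * sinc (z k))) - 1 / z k) * (h k / d k))
       = (\<Sum>k. - (sinc x / (X * sinc X)) * aser x X (Suc k) - bser x X (Suc k))" by (rule suminf_cong)
    also have "\<dots> = (\<Sum>k. - (sinc x / (X * sinc X)) * aser x X (Suc k)) - (\<Sum>k. bser x X (Suc k))"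
      by (rule suminf_diff[OF summable_mult[OF sa] sb, symmetric])
    also have "(\<Sum>k. - (sinc x / (X * sinc X)) * aser x X (Suc k)) = - (sinc x / (X * sinc X)) * (\<Sum>k. aser x X (Suc k))"
      by (rule suminf_mult[OF sa])
    finally show ?thesis .
  qed
  have "(\<Sum>n=1..N. sprod (n - 1) x * ((X + n) * rho n X / (2 * (real n)\<^sup>2)) / (real n)\<^sup>2)
     = (\<Sum>k. (sprod N x * rho N (z k) - 1 / z k) * (h k / d k))" for N
  proof -
    have "(\<lambda>k. \<Sum>n=1..N. sprod (n - 1) x / (real n)\<^sup>2 * (h k * rho n (z k)))
       sums (\<Sum>n=1..N. sprod (n - 1) x / (real n)\<^sup>2 * ((X + n) * rho n X / (2 * (real n)\<^sup>2)))"
      unfolding h_def z_def using X by (intro sums_sum sums_mult sums_hsum_rho) auto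
    moreover have "(\<Sum>n=1..N. sprod (n - 1) x / (real n)\<^sup>2 * (h k * rho n (z k)))
       = (sprod N x * rho N (z k) - 1 / z k) * (h k / d k)" for k
    proof -
      have "(\<Sum>n=1..N. sprod (n - 1) x / (real n)\<^sup>2 * (h k * rho n (z k)))
        = h k * (\<Sum>n=1..N. sprod (n - 1) x * rho n (z k) / (real n)\<^sup>2)"
        unfolding sum_distrib_left by (intro sum.cong) auto
      also have "\<dots> = h k * ((sprod N x * rho N (z k) - 1 / z k) / d k)"
        using d0[of k] unfolding d_def by (subst sprod_telescope[OF zI]) auto
      finally show ?thesis by simp
    qed
    ultimately show ?thesis by (simp add: sums_iff ac_simps)
  qed
  then show "(\<lambda>N. \<Sum>n=1..N. sprod (n - 1) x * ((X + n) * rho n X / (2 * (real n)\<^sup>2)) / (real n)\<^sup>2)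
       \<longlonglongrightarrow> - (sinc x / (X * sinc X)) * (\<Sum>k. aser x X (Suc k)) - (\<Sum>k. bser x X (Suc k))"
    using T lim_eq by simp
qed

text \<open>As \<open>rho\<close> is odd, adding the cases X = y and X = -y turns (X + n) rho n X
  into 2 y rho n y = 2 / sprod n y. The quotient sinc y / sprod n y is the infinite product over m >
  n.\<close>

lemma gf_limit:
  assumes "0 < x" "x \<le> 1/4" "0 < y" "y \<le> 1/4"
  shows "(\<lambda>N. \<Sum>n=1..N. sprod (n - 1) x * (sinc y / sprod n y) / (real n) ^ 4) \<longlonglongrightarrow>
     sinc x / y * ((\<Sum>k. aser x (-y) (Suc k)) - (\<Sum>k. aser x y (Suc k)))
      - sinc y * ((\<Sum>k. bser x y (Suc k)) + (\<Sum>k. bser x (-y) (Suc k)))"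
proof -
  have yI: "y \<notin> \<int>" using not_Ints_small[of "-y" 0] assms by auto
  then have "sin (pi * y) \<noteq> 0" by (rule sin_pi_nonzero)
  then have sy: "sinc y \<noteq> 0" using assms by (simp add: sinc_def)
  define G where "G X N = (\<Sum>n=1..N. sprod (n - 1) x * ((X + n) * rho n X / (2 * (real n)\<^sup>2)) / (real n)\<^sup>2)" for X N
  have G: "(\<Sum>n=1..N. sprod (n - 1) x * (sinc y / sprod n y) / (real n) ^ 4) = sinc y * (G y N + G (-y) N)" for N
    unfolding G_def sum.distrib[symmetric] sum_distrib_left
  proof (intro sum.cong refl)
    fix n assume n: "n \<in> {1..N}"
    have "1 / sprod n y = y * rho n y" using assms by (simp add: rho_def)
    then have "sinc y / sprod n y = sinc y * y * rho n y" by (simp add: divide_inverse)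
    then have "sprod (n - 1) x * (sinc y / sprod n y) / (real n) ^ 4
        = sinc y * sprod (n - 1) x * (y * rho n y) / (real n) ^ 4" by simp
    also have "\<dots> = sinc y * (sprod (n - 1) x * ((y + real n) * rho n y / (2 * (real n)\<^sup>2)) / (real n)\<^sup>2 +
              sprod (n - 1) x * ((- y + real n) * rho n (- y) / (2 * (real n)\<^sup>2)) / (real n)\<^sup>2)"
      using n by (simp add: power2_eq_square power4_eq_xxxx field_simps)
    finally show "sprod (n - 1) x * (sinc y / sprod n y) / (real n) ^ 4 =
         sinc y * (sprod (n - 1) x * ((y + real n) * rho n y / (2 * (real n)\<^sup>2)) / (real n)\<^sup>2 +
              sprod (n - 1) x * ((- y + real n) * rho n (- y) / (2 * (real n)\<^sup>2)) / (real n)\<^sup>2)" .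
  qed
  have "(\<lambda>N. sinc y * (G y N + G (-y) N)) \<longlonglongrightarrow> sinc y *
    ((- (sinc x / (y * sinc y)) * (\<Sum>k. aser x y (Suc k)) - (\<Sum>k. bser x y (Suc k)))
    + (- (sinc x / ((-y) * sinc (-y))) * (\<Sum>k. aser x (-y) (Suc k)) - (\<Sum>k. bser x (-y) (Suc k))))"
    unfolding G_def using assms by (intro tendsto_intros sum_shift_limit) auto
  also have "sinc y *
    ((- (sinc x / (y * sinc y)) * (\<Sum>k. aser x y (Suc k)) - (\<Sum>k. bser x y (Suc k)))
    + (- (sinc x / ((-y) * sinc (-y))) * (\<Sum>k. aser x (-y) (Suc k)) - (\<Sum>k. bser x (-y) (Suc k))))
    = sinc x / y * ((\<Sum>k. aser x (-y) (Suc k)) - (\<Sum>k. aser x y (Suc k)))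
      - sinc y * ((\<Sum>k. bser x y (Suc k)) + (\<Sum>k. bser x (-y) (Suc k)))"
    using sy assms by (simp add: divide_simps) (simp add: algebra_simps)
  finally show ?thesis unfolding G .
qed

subsection \<open>The generating function of the left-hand side\<close>

lemma has_sum_fibers:
  fixes f :: "'a \<Rightarrow> 'b::banach"
  assumes "(f has_sum S) A"
  shows "((\<lambda>c. infsum f {z\<in>A. g z = c}) has_sum S) UNIV"
proof -
  have "((\<lambda>(c, z). f z) has_sum S) (Sigma UNIV (\<lambda>c. {z\<in>A. g z = c}))"
    by (subst has_sum_reindex_bij_witness[where i = "\<lambda>z. (g z, z)" and j = snd and T = A and h = f and s' = S])
      (use assms in auto)
  moreover have "((\<lambda>z. (case (c, z) of (c, z) \<Rightarrow> f z)) has_sum infsum f {z\<in>A. g z = c}) {z\<in>A. g z = c}" for c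
    using summable_on_subset_banach[OF has_sum_imp_summable[OF assms], of "{z\<in>A. g z = c}"] by auto
  ultimately show ?thesis by (rule has_sum_SigmaD)
qed

text \<open>The shape of the exhausting sets is free. This freedom later compares one double series
  cut off along two different regions.\<close>

lemma has_sum_exhaust:
  fixes B :: "nat \<Rightarrow> 'a set"
  assumes "(f has_sum S) A" "\<And>N. finite (B N)" "\<And>N. B N \<subseteq> A" "mono B" "A \<subseteq> (\<Union>N. B N)"
  shows "(\<lambda>N. sum f (B N)) \<longlonglongrightarrow> S"
proof -
  have ev: "\<exists>N0. \<forall>N\<ge>N0. X \<subseteq> B N" if "finite X" "X \<subseteq> A" for X
    using that
  proof (induction X rule: finite_induct)
    case (insert z X)
    then obtain N0 where N0: "\<forall>N\<ge>N0. X \<subseteq> B N" by auto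
    obtain N1 where "z \<in> B N1" using insert.prems assms(5) by auto
    then have "\<forall>N\<ge>N1. z \<in> B N" using assms(4) by (meson monoD subset_iff)
    with N0 show ?case by (intro exI[of _ "max N0 N1"]) auto
  qed auto
  have "filterlim B (finite_subsets_at_top A) sequentially"
    unfolding filterlim_finite_subsets_at_top eventually_sequentially
    using ev assms(2,3) by meson
  then show ?thesis using assms(1) unfolding has_sum_def by (rule filterlim_compose[rotated])
qed

lemma has_sum_Times:
  fixes f :: "'i \<Rightarrow> 'a::{real_normed_field, banach}"
  assumes f: "(f has_sum a) A" "(\<lambda>i. norm (f i)) summable_on A" and g: "(g has_sum b) B" "(\<lambda>j. norm (g j)) summable_on B"
  shows "((\<lambda>(i, j). f i * g j) has_sum a * b) (A \<times> B)" "(\<lambda>t. norm (case t of (i, j) \<Rightarrow> f i * g j)) summable_on (A \<times> B)"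
proof -
  show abs: "(\<lambda>t. norm (case t of (i, j) \<Rightarrow> f i * g j)) summable_on (A \<times> B)"
    unfolding Infinite_Sum.abs_summable_on_Sigma_iff
    using f(2) g(2) by (auto simp: norm_mult infsum_cmult_right' abs_mult infsum_nonneg intro!: summable_on_cmult_right summable_on_cmult_left)
  show "((\<lambda>(i, j). f i * g j) has_sum a * b) (A \<times> B)"
    by (rule has_sum_SigmaI[where g = "\<lambda>i. f i * b"])
       (use f g abs in \<open>auto intro!: has_sum_cmult_right has_sum_cmult_left abs_summable_summable\<close>)
qed

lemma has_sum_Times_complex:
  fixes f :: "'i \<Rightarrow> complex"
  assumes "(f has_sum a) A" "(g has_sum b) B"
  shows "((\<lambda>(i, j). f i * g j) has_sum a * b) (A \<times> B)"
  by (rule has_sum_Times) (use assms in \<open>auto simp flip: summable_on_iff_abs_summable_on_complex intro: has_sum_imp_summable\<close>)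

lemma has_sum_Times_real:
  fixes f :: "'i \<Rightarrow> real"
  assumes "(f has_sum a) A" "(g has_sum b) B"
  shows "((\<lambda>(i, j). f i * g j) has_sum a * b) (A \<times> B)"
  by (rule has_sum_Times) (use assms in \<open>auto simp del: real_norm_def simp flip: summable_on_iff_abs_summable_on_real intro: has_sum_imp_summable\<close>)

section \<open>Products expanded over increasing lists\<close>

definition slists :: "nat \<Rightarrow> nat \<Rightarrow> nat list set" where
  "slists n M = {vs. sorted_wrt (<) vs \<and> set vs \<subseteq> {n<..M}}"

definition slists_above :: "nat \<Rightarrow> nat list set" where
  "slists_above n = {vs. sorted_wrt (<) vs \<and> set vs \<subseteq> {n<..}}"

definition lprod :: "real \<Rightarrow> nat list \<Rightarrow> real" where
  "lprod c vs = prod_list (map (\<lambda>v. c / (real v)\<^sup>2) vs)"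

lemma slists_self: "slists n n = {[]}" by (auto simp: slists_def)

lemma slists_Suc:
  assumes "n \<le> M"
  shows "slists n (Suc M) = slists n M \<union> (\<lambda>vs. vs @ [Suc M]) ` slists n M"
proof (intro equalityI subsetI)
  fix vs assume vs: "vs \<in> slists n (Suc M)"
  show "vs \<in> slists n M \<union> (\<lambda>vs. vs @ [Suc M]) ` slists n M"
  proof (cases vs rule: rev_cases)
    case Nil
    then show ?thesis by (simp add: slists_def)
  next
    case (snoc us u)
    have us: "sorted_wrt (<) us" "\<forall>w\<in>set us. w < u" "\<forall>w\<in>set us. n < w" "n < u" "u \<le> Suc M"
      using vs by (auto simp: slists_def snoc sorted_wrt_append)
    show ?thesis
    proof (cases "u = Suc M")
      case True
      then have "us \<in> slists n M" using us by (auto simp: slists_def less_Suc_eq_le)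
      then show ?thesis using True snoc by auto
    next
      case False
      then have "vs \<in> slists n M" using us vs by (force simp: slists_def snoc)
      then show ?thesis by simp
    qed
  qed
next
  fix vs assume "vs \<in> slists n M \<union> (\<lambda>vs. vs @ [Suc M]) ` slists n M"
  then show "vs \<in> slists n (Suc M)" using assms by (force simp: slists_def sorted_wrt_append)
qed

text \<open>A strictly increasing list encodes a subset of {n<..M}: expanding the product means
  choosing 1 or c/j^2 for every j.\<close>

lemma sum_lprod_slists:
  assumes "n \<le> M"
  shows "finite (slists n M) \<and> (\<Sum>vs\<in>slists n M. lprod c vs) = (\<Prod>j\<in>{n<..M}. 1 + c / (real j)\<^sup>2)"
  using assms
proof (induction M rule: nat_induct_at_least)
  case base
  then show ?case by (simp add: slists_self lprod_def)
next
  case (Suc M)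
  have inj: "inj_on (\<lambda>vs. vs @ [Suc M]) (slists n M)" by (auto simp: inj_on_def)
  have disj: "slists n M \<inter> (\<lambda>vs. vs @ [Suc M]) ` slists n M = {}" by (auto simp: slists_def)
  have "(\<Sum>vs\<in>slists n (Suc M). lprod c vs) = (\<Sum>vs\<in>slists n M. lprod c vs) * (1 + c / (real (Suc M))\<^sup>2)"
    unfolding slists_Suc[OF Suc.hyps] using Suc.IH
    by (subst sum.union_disjoint) (use disj in \<open>auto simp: sum.reindex[OF inj] lprod_def sum_distrib_right algebra_simps simp flip: sum_divide_distrib sum_distrib_left\<close>)
  moreover have "{n<..Suc M} = insert (Suc M) {n<..M}" using Suc.hyps by auto
  ultimately show ?case using Suc.IH by (simp add: slists_Suc[OF Suc.hyps])
qed

lemma lprod_nonneg: "c \<ge> 0 \<Longrightarrow> lprod c vs \<ge> 0"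
  unfolding lprod_def by (intro prod_list_nonneg) auto

lemma abs_lprod: "\<bar>lprod c vs\<bar> = lprod \<bar>c\<bar> vs"
  by (induction vs) (auto simp: lprod_def abs_mult abs_divide)

lemma sum_inverse_squares_le: "(\<Sum>j=1..M. 1 / (real j)\<^sup>2) \<le> 2"
proof -
  have "(\<Sum>j=1..Suc M. 1 / (real j)\<^sup>2) \<le> 2 - 1 / real (Suc M)" for M
  proof (induction M)
    case (Suc M)
    have "1 / (real (Suc (Suc M)))\<^sup>2 \<le> 1 / (real (Suc M) * real (Suc (Suc M)))"
      unfolding power2_eq_square by (intro divide_left_mono mult_right_mono) auto
    also have "\<dots> = 1 / real (Suc M) - 1 / real (Suc (Suc M))" by (simp add: divide_simps)
    finally show ?case using Suc by simp
  qed simp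
  from this[of "M - 1"] show ?thesis
    by (cases M) (auto intro: order_trans[of _ "2 - 1 / real M"])
qed

lemma prod_1_plus_le:
  assumes "c \<ge> 0"
  shows "(\<Prod>j\<in>{n<..M}. 1 + c / (real j)\<^sup>2) \<le> exp (2 * c)"
proof -
  have "(\<Prod>j\<in>{n<..M}. 1 + c / (real j)\<^sup>2) \<le> (\<Prod>j\<in>{n<..M}. exp (c / (real j)\<^sup>2))"
    using assms by (intro prod_mono) (auto intro: add_nonneg_nonneg)
  also have "\<dots> = exp (\<Sum>j\<in>{n<..M}. c * (1 / (real j)\<^sup>2))" by (simp add: exp_sum)
  also have "(\<Sum>j\<in>{n<..M}. c * (1 / (real j)\<^sup>2)) \<le> (\<Sum>j=1..M. c * (1 / (real j)\<^sup>2))"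
    using assms by (intro sum_mono2) auto
  also have "\<dots> = c * (\<Sum>j=1..M. 1 / (real j)\<^sup>2)" by (simp only: sum_distrib_left)
  also have "\<dots> \<le> c * 2" using assms sum_inverse_squares_le by (intro mult_left_mono)
  finally show ?thesis by (simp add: mult.commute)
qed

lemma slists_above_finite_subset:
  assumes "finite F" "F \<subseteq> slists_above n"
  shows "\<exists>M\<ge>n. F \<subseteq> slists n M"
proof -
  have "finite (\<Union>(set ` F))" using assms(1) by auto
  then obtain M where M: "\<forall>v\<in>\<Union>(set ` F). v \<le> M" using finite_nat_set_iff_bounded_le by metis
  then have "F \<subseteq> slists n (max n M)" using assms(2) by (force simp: slists_def slists_above_def)
  then show ?thesis by (meson max.cobounded1)
qed

lemma summable_lprod_above:
  assumes "c \<ge> 0"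
  shows "lprod c summable_on slists_above n" "infsum (lprod c) (slists_above n) \<le> exp (2 * c)"
proof -
  have le: "sum (lprod c) F \<le> exp (2 * c)" if "finite F" "F \<subseteq> slists_above n" for F
  proof -
    obtain M where M: "n \<le> M" "F \<subseteq> slists n M" using slists_above_finite_subset[OF \<open>finite F\<close> \<open>F \<subseteq> slists_above n\<close>] by auto
    then have "sum (lprod c) F \<le> sum (lprod c) (slists n M)"
      using sum_lprod_slists[OF M(1)] lprod_nonneg[OF assms] by (intro sum_mono2) auto
    also have "\<dots> \<le> exp (2 * c)" using sum_lprod_slists[OF M(1), of c] prod_1_plus_le[OF assms] by simp
    finally show ?thesis .
  qed
  show s: "lprod c summable_on slists_above n"
    by (rule nonneg_bdd_above_summable_on) (use le lprod_nonneg[OF assms] in \<open>auto intro!: bdd_aboveI2[where M = "exp (2 * c)"]\<close>)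
  show "infsum (lprod c) (slists_above n) \<le> exp (2 * c)"
    by (rule infsum_le_finite_sums[OF s]) (use le in auto)
qed

lemma sprod_conv: "(\<Prod>j\<in>{0<..n}. 1 + (- x\<^sup>2) / (real j)\<^sup>2) = sprod n x"
  unfolding sprod_def by (intro prod.cong) auto

text \<open>The finite products over {n<..n + M} are quotients sprod (n + M) y / sprod n y, whose
  limit is known; absolute summability is the case y^2 in place of -y^2.\<close>

lemma has_sum_lprod_above:
  assumes "0 < \<bar>y\<bar>" "\<bar>y\<bar> < 1"
  shows "(lprod (- y\<^sup>2) has_sum (sinc y / sprod n y)) (slists_above n)"
proof -
  have yI: "y \<notin> \<int>" using not_Ints_small[of "-y" 0] assms by simp
  have "(\<lambda>vs. norm (lprod (- y\<^sup>2) vs)) summable_on slists_above n"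
    using summable_lprod_above(1)[of "y\<^sup>2" n] by (simp add: abs_lprod)
  then have "lprod (- y\<^sup>2) summable_on slists_above n" by (rule abs_summable_summable)
  then obtain S where S: "(lprod (- y\<^sup>2) has_sum S) (slists_above n)" by (auto simp: summable_on_def)
  have "(\<lambda>M. sum (lprod (- y\<^sup>2)) (slists n (n + M))) \<longlonglongrightarrow> S"
  proof (rule has_sum_exhaust[OF S])
    show "finite (slists n (n + N))" for N using sum_lprod_slists[of n "n + N"] by simp
    show "slists n (n + N) \<subseteq> slists_above n" for N by (auto simp: slists_def slists_above_def)
    show "mono (\<lambda>N. slists n (n + N))" by (auto simp: mono_def slists_def)
    show "slists_above n \<subseteq> (\<Union>N. slists n (n + N))"
    proof
      fix vs assume "vs \<in> slists_above n"
      then obtain M where "n \<le> M" "{vs} \<subseteq> slists n M" using slists_above_finite_subset[of "{vs}" n] by auto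
      then show "vs \<in> (\<Union>N. slists n (n + N))" by (intro UN_I[of "M - n"]) auto
    qed
  qed
  moreover have "sum (lprod (- y\<^sup>2)) (slists n (n + M)) = sprod (M + n) y / sprod n y" for M
  proof -
    have "{0<..n + M} = {0<..n} \<union> {n<..n + M}" "{0<..n} \<inter> {n<..n + M} = {}" by auto
    then have "sprod (n + M) y = sprod n y * (\<Prod>j\<in>{n<..n + M}. 1 + (- y\<^sup>2) / (real j)\<^sup>2)"
      unfolding sprod_conv[symmetric] by (simp add: prod.union_disjoint)
    then show ?thesis using sum_lprod_slists[of n "n + M" "- y\<^sup>2"] sprod_nonzero[OF yI, of n]
      by (simp add: add.commute)
  qed
  moreover have "(\<lambda>M. sprod (M + n) y / sprod n y) \<longlonglongrightarrow> sinc y / sprod n y"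
    using sprod_nonzero[OF yI, of n] assms
    by (intro tendsto_intros LIMSEQ_ignore_initial_segment sprod_tendsto) auto
  ultimately have "S = sinc y / sprod n y" using LIMSEQ_unique by auto
  then show ?thesis using S by simp
qed

lemma prod_nth_map2:
  "length ns = length ks \<Longrightarrow> (\<Prod>i<length ks. f (ns ! i) (ks ! i)) = prod_list (map2 f ns ks)"
proof (induction ns ks rule: list_induct2)
  case (Cons n ns k ks)
  then show ?case by (simp add: prod.lessThan_Suc_shift del: prod.lessThan_Suc)
qed simp

lemma map2_replicate: "length us = a \<Longrightarrow> map2 f us (replicate a c) = map (\<lambda>u. f u c) us"
  by (induction us arbitrary: a) auto

lemma lprod_eq: "lprod c vs = c ^ length vs * lprod 1 vs"
  by (induction vs) (auto simp: lprod_def)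

text \<open>The entry with exponent 4, at position a, cuts an increasing list into a part below it
  and a part above it, which vary independently.\<close>

lemma mzv_2_4_2:
  "mzv (replicate a 2 @ [4] @ replicate b 2) =
     (\<Sum>\<^sub>\<infinity>(n, us, vs) \<in> {(n, us, vs). 0 < n \<and> us \<in> slists 0 (n - 1) \<and> vs \<in> slists_above n \<and> length us = a \<and> length vs = b}.
       1 / real n ^ 4 * (lprod 1 us * lprod 1 vs))"
  unfolding mzv_def
proof (rule infsum_reindex_bij_witness[where i = "\<lambda>(n, us, vs). us @ n # vs" and j = "\<lambda>ns. (ns ! a, take a ns, drop (Suc a) ns)"])
  let ?ks = "replicate a 2 @ [4] @ replicate b (2::nat)"
  fix ns :: "nat list" assume "ns \<in> {ns. length ns = length ?ks \<and> sorted_wrt (<) ns \<and> (\<forall>n\<in>set ns. 0 < n)}"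
  then have ns: "length ns = Suc (a + b)" "sorted_wrt (<) ns" "\<forall>n\<in>set ns. 0 < n" by auto
  define us :: "nat list" and n :: nat and vs :: "nat list" where "us = take a ns" and "n = ns ! a" and "vs = drop (Suc a) ns"
  have eq: "ns = us @ n # vs" unfolding us_def n_def vs_def using ns(1) by (simp add: id_take_nth_drop)
  have len: "length us = a" "length vs = b" using ns(1) by (auto simp: us_def vs_def)
  show "(case (ns ! a, take a ns, drop (Suc a) ns) of (n, us, vs) \<Rightarrow> us @ n # vs) = ns"
    using eq by (simp add: us_def n_def vs_def)
  have "sorted_wrt (<) us" "sorted_wrt (<) vs" "\<forall>u\<in>set us. u < n \<and> 0 < u" "\<forall>v\<in>set vs. n < v" "0 < n"
    using ns unfolding eq by (auto simp: sorted_wrt_append)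
  then have "(n, us, vs) \<in> {(n, us, vs). 0 < n \<and> us \<in> slists 0 (n - 1) \<and> vs \<in> slists_above n \<and> length us = a \<and> length vs = b}"
    using len by (auto simp: slists_def slists_above_def)
  then show "(ns ! a, take a ns, drop (Suc a) ns) \<in> {(n, us, vs). 0 < n \<and> us \<in> slists 0 (n - 1) \<and> vs \<in> slists_above n \<and> length us = a \<and> length vs = b}"
    by (simp only: us_def n_def vs_def)
  have "(\<Prod>i<length ?ks. 1 / real (ns ! i) ^ (?ks ! i)) = prod_list (map2 (\<lambda>n k. 1 / real n ^ k) ns ?ks)"
    using ns(1) by (intro prod_nth_map2) simp
  also have "\<dots> = 1 / real n ^ 4 * (lprod 1 us * lprod 1 vs)"
    using len by (simp add: eq map2_replicate lprod_def)
  finally show "(case (ns ! a, take a ns, drop (Suc a) ns) of (n, us, vs) \<Rightarrow> 1 / real n ^ 4 * (lprod 1 us * lprod 1 vs)) =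
     (\<Prod>i<length ?ks. 1 / real (ns ! i) ^ (?ks ! i))" by (simp add: us_def n_def vs_def)
next
  fix t assume "t \<in> {(n, us, vs). 0 < n \<and> us \<in> slists 0 (n - 1) \<and> vs \<in> slists_above n \<and> length us = a \<and> length vs = b}"
  then obtain n us vs where t: "t = (n, us, vs)" "0 < n" "us \<in> slists 0 (n - 1)" "vs \<in> slists_above n" "length us = a" "length vs = b"
    by auto
  then show "((case t of (n, us, vs) \<Rightarrow> us @ n # vs) ! a, take a (case t of (n, us, vs) \<Rightarrow> us @ n # vs),
              drop (Suc a) (case t of (n, us, vs) \<Rightarrow> us @ n # vs)) = t" by auto
  show "(case t of (n, us, vs) \<Rightarrow> us @ n # vs) \<in> {ns. length ns = length (replicate a 2 @ [4] @ replicate b (2::nat)) \<and> sorted_wrt (<) ns \<and> (\<forall>n\<in>set ns. 0 < n)}"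
    using t by (fastforce simp: slists_def slists_above_def sorted_wrt_append)
qed

lemma summable_on_inverse_power:
  assumes "k \<ge> 2"
  shows "(\<lambda>n. 1 / real n ^ k) summable_on {1..}"
proof -
  have "summable (\<lambda>n. 1 / real n ^ k)" using inverse_power_summable[OF assms, where 'a = real] by (simp add: inverse_eq_divide)
  then have "(\<lambda>n. 1 / real n ^ k) summable_on UNIV" by (intro summable_nonneg_imp_summable_on) auto
  then show ?thesis by (rule summable_on_subset_banach) auto
qed

text \<open>One family over triples (n, us, vs) is summed in two ways: by n, which leads to
  \<open>gf_limit\<close>, and by the lengths of us and vs, which leads to the coefficients.\<close>

lemma has_sum_mzv_gf:
  assumes xy: "0 < x" "x \<le> 1/4" "0 < y" "y \<le> 1/4"
  shows "((\<lambda>(a, b). (-1) ^ (a + b) * mzv (replicate a 2 @ [4] @ replicate b 2) * x ^ (2 * a) * y ^ (2 * b)) has_sum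
     (sinc x / y * ((\<Sum>k. aser x (-y) (Suc k)) - (\<Sum>k. aser x y (Suc k)))
      - sinc y * ((\<Sum>k. bser x y (Suc k)) + (\<Sum>k. bser x (-y) (Suc k))))) UNIV"
proof -
  define f :: "nat \<times> nat list \<times> nat list \<Rightarrow> real" where
    "f = (\<lambda>(n, us, vs). 1 / real n ^ 4 * (lprod (- x\<^sup>2) us * lprod (- y\<^sup>2) vs))"
  define T :: "(nat \<times> nat list \<times> nat list) set" where "T = Sigma {1..} (\<lambda>n. slists 0 (n - 1) \<times> slists_above n)"
  have fin: "finite (slists 0 (n - 1))" for n using sum_lprod_slists[of 0 "n - 1"] by simp
  have g: "((\<lambda>(us, vs). lprod c us * lprod d vs) has_sum (\<Sum>us\<in>slists 0 (n - 1). lprod c us) * infsum (lprod d) (slists_above n))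
      (slists 0 (n - 1) \<times> slists_above n)" for c d n
  proof (rule has_sum_Times_real)
    show "(lprod c has_sum (\<Sum>us\<in>slists 0 (n - 1). lprod c us)) (slists 0 (n - 1))" using fin by (rule has_sum_finite)
    have "(\<lambda>vs. norm (lprod d vs)) summable_on slists_above n"
      using summable_lprod_above(1)[of "\<bar>d\<bar>" n] by (simp add: abs_lprod)
    then show "(lprod d has_sum infsum (lprod d) (slists_above n)) (slists_above n)"
      by (rule has_sum_infsum[OF abs_summable_summable])
  qed
  \<comment> \<open>Absolute values replace -x^2 and -y^2 by x^2 and y^2. The two products then stay
    below exp (2 x^2) and exp (2 y^2), and 1/n^4 is summable.\<close>
  have "(\<lambda>t. norm (f t)) summable_on T"
    unfolding T_def
  proof (rule summable_on_SigmaI)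
    fix n :: nat assume "n \<in> {1..}"
    show "((\<lambda>t. norm (f (n, t))) has_sum (1 / real n ^ 4 * ((\<Sum>us\<in>slists 0 (n - 1). lprod (x\<^sup>2) us) * infsum (lprod (y\<^sup>2)) (slists_above n))))
       (slists 0 (n - 1) \<times> slists_above n)"
      using has_sum_cmult_right[OF g[of "x\<^sup>2" "y\<^sup>2" n], of "1 / real n ^ 4"]
      by (simp add: f_def case_prod_unfold abs_mult abs_lprod)
  next
    show "(\<lambda>n. 1 / real n ^ 4 * ((\<Sum>us\<in>slists 0 (n - 1). lprod (x\<^sup>2) us) * infsum (lprod (y\<^sup>2)) (slists_above n))) summable_on {1..}"
    proof (rule summable_on_comparison_test)
      show "(\<lambda>n. 1 / real n ^ 4 * (exp (2 * x\<^sup>2) * exp (2 * y\<^sup>2))) summable_on {1..}"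
        by (intro summable_on_cmult_left summable_on_inverse_power) auto
      fix n :: nat assume "n \<in> {1..}"
      have nn: "0 \<le> (\<Sum>us\<in>slists 0 (n - 1). lprod (x\<^sup>2) us)" "0 \<le> infsum (lprod (y\<^sup>2)) (slists_above n)"
        by (auto intro!: sum_nonneg infsum_nonneg lprod_nonneg)
      then show "0 \<le> 1 / real n ^ 4 * ((\<Sum>us\<in>slists 0 (n - 1). lprod (x\<^sup>2) us) * infsum (lprod (y\<^sup>2)) (slists_above n))"
        by (intro mult_nonneg_nonneg) auto
      show "1 / real n ^ 4 * ((\<Sum>us\<in>slists 0 (n - 1). lprod (x\<^sup>2) us) * infsum (lprod (y\<^sup>2)) (slists_above n))
         \<le> 1 / real n ^ 4 * (exp (2 * x\<^sup>2) * exp (2 * y\<^sup>2))"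
        using nn sum_lprod_slists[of 0 "n - 1" "x\<^sup>2"] prod_1_plus_le[of "x\<^sup>2" 0 "n - 1"] summable_lprod_above(2)[of "y\<^sup>2" n]
        by (intro mult_left_mono mult_mono) auto
    qed
  qed auto
  then have "f summable_on T" by (rule abs_summable_summable)
  then obtain S where S: "(f has_sum S) T" by (auto simp: summable_on_def)
  have "((\<lambda>n. 1 / real n ^ 4 * (sprod (n - 1) x * (sinc y / sprod n y))) has_sum S) {1..}"
  proof (rule has_sum_SigmaD[OF S[unfolded T_def]])
    fix n :: nat
    show "((\<lambda>t. f (n, t)) has_sum 1 / real n ^ 4 * (sprod (n - 1) x * (sinc y / sprod n y))) (slists 0 (n - 1) \<times> slists_above n)"
      using has_sum_cmult_right[OF g[of "-x\<^sup>2" "-y\<^sup>2" n], of "1 / real n ^ 4"]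
        infsumI[OF has_sum_lprod_above[of y n]] xy sum_lprod_slists[of 0 "n - 1" "-x\<^sup>2"] sprod_conv[of x "n - 1"]
      by (simp add: f_def case_prod_unfold)
  qed
  then have "(\<lambda>N. \<Sum>n\<in>{1..N}. 1 / real n ^ 4 * (sprod (n - 1) x * (sinc y / sprod n y))) \<longlonglongrightarrow> S"
    by (rule has_sum_exhaust) (auto simp: mono_def)
  with gf_limit[OF xy] have S_eq: "S = (sinc x / y * ((\<Sum>k. aser x (-y) (Suc k)) - (\<Sum>k. aser x y (Suc k)))
      - sinc y * ((\<Sum>k. bser x y (Suc k)) + (\<Sum>k. bser x (-y) (Suc k))))"
    by (intro LIMSEQ_unique) (auto simp: mult.commute)
  have "((\<lambda>c. infsum f {z\<in>T. (\<lambda>(n, us, vs). (length us, length vs)) z = c}) has_sum S) UNIV"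
    by (rule has_sum_fibers[OF S])
  moreover have "infsum f {z\<in>T. (\<lambda>(n, us, vs). (length us, length vs)) z = c} =
      (\<lambda>(a, b). (-1) ^ (a + b) * mzv (replicate a 2 @ [4] @ replicate b 2) * x ^ (2 * a) * y ^ (2 * b)) c" for c
  proof -
    obtain a b where c: "c = (a, b)" by force
    have "infsum f {z\<in>T. (\<lambda>(n, us, vs). (length us, length vs)) z = c} =
       (\<Sum>\<^sub>\<infinity>(n, us, vs) \<in> {(n, us, vs). 0 < n \<and> us \<in> slists 0 (n - 1) \<and> vs \<in> slists_above n \<and> length us = a \<and> length vs = b}.
       ((- x\<^sup>2) ^ a * (- y\<^sup>2) ^ b) * (1 / real n ^ 4 * (lprod 1 us * lprod 1 vs)))"
      by (rule infsum_cong_neutral) (auto simp: T_def f_def c lprod_eq[of "-x\<^sup>2"] lprod_eq[of "-y\<^sup>2"])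
    also have "\<dots> = (- x\<^sup>2) ^ a * (- y\<^sup>2) ^ b * mzv (replicate a 2 @ [4] @ replicate b 2)"
      unfolding mzv_2_4_2 case_prod_unfold by (rule infsum_cmult_right')
    also have "(- x\<^sup>2) ^ a * (- y\<^sup>2) ^ b = (-1) ^ (a + b) * (x ^ (2 * a) * y ^ (2 * b))"
      by (simp add: power_minus[of "x\<^sup>2"] power_minus[of "y\<^sup>2"] power_add power_mult)
    finally show ?thesis by (simp add: c)
  qed
  ultimately show ?thesis unfolding S_eq by simp
qed

subsection \<open>Truncated double series\<close>

definition hs :: "real \<Rightarrow> real \<Rightarrow> nat \<Rightarrow> real" where
  "hs s X N = (\<Sum>n=1..N. s ^ n * rcp X n)"

definition zs :: "real \<Rightarrow> real \<Rightarrow> real \<Rightarrow> real \<Rightarrow> nat \<Rightarrow> real" where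
  "zs s t X Y N = (\<Sum>m=1..N. \<Sum>n=1..<m. s ^ n * t ^ m * (rcp X n * rcp Y m))"

definition dg :: "real \<Rightarrow> real \<Rightarrow> real \<Rightarrow> nat \<Rightarrow> real" where
  "dg t X Y N = (\<Sum>n=1..N. t ^ n * (rcp X n * rcp Y n))"

text \<open>The terms of hs s X N * hs t Y N restricted to the triangle m + l \<le> N, grouped by k
  = m + l.\<close>

definition sh :: "real \<Rightarrow> real \<Rightarrow> real \<Rightarrow> real \<Rightarrow> nat \<Rightarrow> real" where
  "sh s t X Y N = (\<Sum>k=1..N. \<Sum>m=1..<k. s ^ m * t ^ (k - m) * (rcp X m * rcp Y (k - m)))"

lemma hs_Suc: "hs s X (Suc N) = hs s X N + s ^ Suc N * rcp X (Suc N)" by (simp add: hs_def)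

lemma hs_0 [simp]: "hs s X 0 = 0" by (simp add: hs_def)

lemma dg_Suc: "dg t X Y (Suc N) = dg t X Y N + t ^ Suc N * (rcp X (Suc N) * rcp Y (Suc N))" by (simp add: dg_def)

lemma zs_Suc: "zs s t X Y (Suc N) = zs s t X Y N + hs s X N * (t ^ Suc N * rcp Y (Suc N))"
proof -
  have "{1..<Suc N} = {1..N}" by auto
  then show ?thesis by (simp add: zs_def hs_def sum_distrib_right sum_distrib_left algebra_simps)
qed

lemma zs_0 [simp]: "zs s t X Y 0 = 0" by (simp add: zs_def)

lemma dg_0 [simp]: "dg t X Y 0 = 0" by (simp add: dg_def)

lemma dg_commute: "dg t X Y N = dg t Y X N" by (simp add: dg_def mult.commute)

lemma stuffle: "zs s t X Y N + zs t s Y X N + dg (s * t) X Y N = hs s X N * hs t Y N"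
proof (induction N)
  case (Suc N)
  have "zs s t X Y (Suc N) + zs t s Y X (Suc N) + dg (s * t) X Y (Suc N) =
     (zs s t X Y N + zs t s Y X N + dg (s * t) X Y N)
     + hs s X N * (t ^ Suc N * rcp Y (Suc N)) + hs t Y N * (s ^ Suc N * rcp X (Suc N))
     + (s * t) ^ Suc N * (rcp X (Suc N) * rcp Y (Suc N))"
    by (simp only: zs_Suc dg_Suc ac_simps)
  then show ?case unfolding Suc.IH hs_Suc power_mult_distrib by (simp only: algebra_simps)
qed simp

text \<open>Partial fractions: with l = k - m, 1/((m - X)(l - Y)) = (1/(m - X) + 1/(l - Y))/(k - X -
  Y). The signs are \<plusminus>1, so t^(k - m) = t^k t^m; the second half is reindexed by m -> k -
  m.\<close>

lemma shuffle:
  assumes b: "\<bar>X\<bar> \<le> 1/2" "\<bar>Y\<bar> \<le> 1/2" "\<bar>X + Y\<bar> \<le> 1/2" and s: "s * s = 1" and t: "t * t = 1"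
  shows "sh s t X Y N = zs (s * t) t X (X + Y) N + zs (s * t) s Y (X + Y) N"
proof -
  have "(\<Sum>m=1..<k. s ^ m * t ^ (k - m) * (rcp X m * rcp Y (k - m))) =
     (\<Sum>m=1..<k. (s * t) ^ m * t ^ k * (rcp X m * rcp (X + Y) k)) + (\<Sum>m=1..<k. (s * t) ^ m * s ^ k * (rcp Y m * rcp (X + Y) k))" for k
  proof -
    have pw: "u ^ (k - m) = u ^ k * u ^ m" if "m < k" "u * u = 1" for u :: real and m
    proof -
      have "u ^ k = u ^ (k - m) * u ^ m" using that by (simp flip: power_add)
      moreover have "u ^ m * u ^ m = 1" using that by (simp flip: power_mult_distrib)
      ultimately show ?thesis by (simp add: mult.assoc)
    qed
    have "(\<Sum>m=1..<k. s ^ m * t ^ (k - m) * (rcp X m * rcp Y (k - m))) =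
        (\<Sum>m=1..<k. (s * t) ^ m * t ^ k * (rcp X m * rcp (X + Y) k) + s ^ m * t ^ (k - m) * (rcp Y (k - m) * rcp (X + Y) k))"
    proof (intro sum.cong refl)
      fix m assume m: "m \<in> {1..<k}"
      have nz: "real m - X > 0" "real (k - m) - Y > 0" "real k - (X + Y) > 0"
        using b m by (auto simp: abs_le_iff)
      have "rcp X m * rcp Y (k - m) = (rcp X m + rcp Y (k - m)) * rcp (X + Y) k"
        using nz m by (simp add: rcp_def of_nat_diff divide_simps)
      then show "s ^ m * t ^ (k - m) * (rcp X m * rcp Y (k - m)) =
          (s * t) ^ m * t ^ k * (rcp X m * rcp (X + Y) k) + s ^ m * t ^ (k - m) * (rcp Y (k - m) * rcp (X + Y) k)"
        using pw[of m t] t m by (simp add: power_mult_distrib algebra_simps)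
    qed
    also have "\<dots> = (\<Sum>m=1..<k. (s * t) ^ m * t ^ k * (rcp X m * rcp (X + Y) k)) + (\<Sum>m=1..<k. s ^ m * t ^ (k - m) * (rcp Y (k - m) * rcp (X + Y) k))"
      by (rule sum.distrib)
    also have "(\<Sum>m=1..<k. s ^ m * t ^ (k - m) * (rcp Y (k - m) * rcp (X + Y) k)) =
        (\<Sum>m=1..<k. (s * t) ^ m * s ^ k * (rcp Y m * rcp (X + Y) k))"
    proof (rule sum.reindex_bij_witness[of _ "\<lambda>m. k - m" "\<lambda>m. k - m"])
      fix m assume m: "m \<in> {1..<k}"
      have "s ^ k * s ^ k = 1" using s by (simp flip: power_mult_distrib)
      then have "(s * t) ^ (k - m) * s ^ k = s ^ m * t ^ (k - m)"
        using pw[of m s] m s by (simp add: power_mult_distrib)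
      then show "(s * t) ^ (k - m) * s ^ k * (rcp Y (k - m) * rcp (X + Y) k) = s ^ m * t ^ (k - m) * (rcp Y (k - m) * rcp (X + Y) k)"
        by (simp only:)
    qed auto
    finally show ?thesis .
  qed
  then show ?thesis by (simp add: sh_def zs_def sum.distrib)
qed

text \<open>Sorts the triangle by m alone. The corner hs 1 X N * hs t Y N - sh 1 t X Y N thereby
  becomes a sum over m of \<open>rcp X m\<close> times the part of \<open>hs t Y\<close> between N -
  m and N.\<close>

lemma sh_conv: "sh 1 t X Y N = (\<Sum>m=1..N. rcp X m * hs t Y (N - m))"
proof (induction N)
  case (Suc N)
  have "(\<Sum>m=1..Suc N. rcp X m * hs t Y (Suc N - m)) = (\<Sum>m=1..N. rcp X m * hs t Y (Suc (N - m)))"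
    by (simp add: Suc_diff_le)
  also have "\<dots> = (\<Sum>m=1..N. rcp X m * hs t Y (N - m)) + (\<Sum>m=1..N. t ^ (Suc N - m) * (rcp X m * rcp Y (Suc N - m)))"
    unfolding sum.distrib[symmetric] hs_Suc
    by (intro sum.cong refl) (simp add: Suc_diff_le algebra_simps)
  also have "(\<Sum>m=1..N. t ^ (Suc N - m) * (rcp X m * rcp Y (Suc N - m))) = (\<Sum>m=1..<Suc N. t ^ (Suc N - m) * (rcp X m * rcp Y (Suc N - m)))"
    by (intro sum.cong) auto
  finally show ?case using Suc by (simp add: sh_def)
qed (simp add: sh_def)

section \<open>The corner between the square and the triangle\<close>

lemma sum_convolution_tendsto: "(\<lambda>N. \<Sum>m=1..N. 1 / (real m * real (N + 1 - m))) \<longlonglongrightarrow> 0"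
proof (rule Lim_null_comparison)
  show "\<forall>\<^sub>F N in sequentially. norm (\<Sum>m=1..N. 1 / (real m * real (N + 1 - m))) \<le> 4 / sqrt (real N)"
    using eventually_gt_at_top[of 0]
  proof eventually_elim
    case (elim N)
    \<comment> \<open>Partial fractions with the constant sum m + (N + 1 - m) leave two harmonic
      sums divided by N + 1.\<close>
    have "(\<Sum>m=1..N. 1 / (real m * real (N + 1 - m))) = (\<Sum>m=1..N. (1 / real (N + 1)) * (1 / real m + 1 / real (N + 1 - m)))"
      by (intro sum.cong refl) (auto simp: of_nat_diff divide_simps)
    also have "\<dots> = (1 / real (N + 1)) * ((\<Sum>m=1..N. 1 / real m) + (\<Sum>m=1..N. 1 / real (N + 1 - m)))"
      by (simp only: sum_distrib_left[symmetric] sum.distrib)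
    also have "(\<Sum>m=1..N. 1 / real (N + 1 - m)) = (\<Sum>m=1..N. 1 / real m)"
      by (rule sum.reindex_bij_witness[of _ "\<lambda>m. N + 1 - m" "\<lambda>m. N + 1 - m"]) auto
    also have "(1 / real (N + 1)) * ((\<Sum>m=1..N. 1 / real m) + (\<Sum>m=1..N. 1 / real m)) \<le> (1 / real N) * (4 * sqrt (real N))"
      using harm_le_sqrt[of N] elim by (intro mult_mono) (auto intro!: divide_left_mono sum_nonneg)
    also have "\<dots> = 4 / sqrt (real N)" using elim by (simp add: field_simps)
    finally have le: "(\<Sum>m=1..N. 1 / (real m * real (N + 1 - m))) \<le> 4 / sqrt (real N)" .
    have nn: "0 \<le> (\<Sum>m=1..N. 1 / (real m * real (N + 1 - m)))" by (intro sum_nonneg) simp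
    show ?case unfolding real_norm_def abs_of_nonneg[OF nn] by (rule le)
  qed
  show "(\<lambda>N. 4 / sqrt (real N)) \<longlonglongrightarrow> 0"
    by (intro tendsto_divide_0[OF tendsto_const] filterlim_at_top_imp_at_infinity
         filterlim_compose[OF sqrt_at_top] filterlim_real_sequentially)
qed

lemma rcp_antimono: "\<bar>X\<bar> \<le> 1/2 \<Longrightarrow> 1 \<le> m \<Longrightarrow> m \<le> n \<Longrightarrow> rcp X n \<le> rcp X m"
  unfolding rcp_def by (intro divide_left_mono mult_pos_pos) (auto simp: abs_le_iff)

text \<open>Leibniz: a block of an alternating sum with decreasing terms has the sign of its first
  term and does not exceed it. The induction runs downwards from M = N.\<close>

lemma hs_alternating:
  assumes "\<bar>Y\<bar> \<le> 1/2" "M \<le> N"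
  shows "0 \<le> (-1) ^ Suc M * (hs (-1) Y N - hs (-1) Y M) \<and> (-1) ^ Suc M * (hs (-1) Y N - hs (-1) Y M) \<le> rcp Y (Suc M)"
  using assms(2)
proof (induction rule: inc_induct)
  case base
  then show ?case using rcp_bound(1)[OF assms(1), of "Suc N"] by simp
next
  case (step M)
  have "(-1) ^ Suc M * (hs (-1) Y N - hs (-1) Y M) = rcp Y (Suc M) - (-1) ^ Suc (Suc M) * (hs (-1) Y N - hs (-1) Y (Suc M))"
    by (cases "even M") (auto simp: hs_Suc algebra_simps)
  then show ?case using step.IH rcp_antimono[OF assms(1), of "Suc M" "Suc (Suc M)"] by auto
qed

text \<open>The alternating blocks are O(1/(N + 1 - m)), which bounds the corner by a convolution of
  two harmonic sequences.\<close>

lemma corner_alternating: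
  assumes "\<bar>X\<bar> \<le> 1/2" "\<bar>Y\<bar> \<le> 1/2"
  shows "(\<lambda>N. hs 1 X N * hs (-1) Y N - sh 1 (-1) X Y N) \<longlonglongrightarrow> 0"
proof (rule Lim_null_comparison)
  show "(\<lambda>N. 4 * (\<Sum>m=1..N. 1 / (real m * real (N + 1 - m)))) \<longlonglongrightarrow> 0"
    using tendsto_mult_left[OF sum_convolution_tendsto, of 4] by simp
  show "\<forall>\<^sub>F N in sequentially. norm (hs 1 X N * hs (-1) Y N - sh 1 (-1) X Y N) \<le> 4 * (\<Sum>m=1..N. 1 / (real m * real (N + 1 - m)))"
  proof (intro always_eventually allI)
    fix N
    have "hs 1 X N * hs (-1) Y N - sh 1 (-1) X Y N = (\<Sum>m=1..N. rcp X m * (hs (-1) Y N - hs (-1) Y (N - m)))"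
      by (simp add: sh_conv hs_def[of 1] sum_distrib_right right_diff_distrib sum_subtractf)
    also have "norm \<dots> \<le> (\<Sum>m=1..N. 4 * (1 / (real m * real (N + 1 - m))))"
    proof (rule sum_norm_le)
      fix m assume m: "m \<in> {1..N}"
      have "\<bar>hs (-1) Y N - hs (-1) Y (N - m)\<bar> = \<bar>(-1) ^ Suc (N - m) * (hs (-1) Y N - hs (-1) Y (N - m))\<bar>"
        by (simp add: abs_mult)
      also have "\<dots> \<le> rcp Y (Suc (N - m))" using hs_alternating[OF assms(2), of "N - m" N] by simp
      also have "\<dots> \<le> 2 / real (N + 1 - m)" using rcp_bound(2)[OF assms(2), of "Suc (N - m)"] m by (simp add: Suc_diff_le)
      finally have "norm (rcp X m * (hs (-1) Y N - hs (-1) Y (N - m))) \<le> 2 / real m * (2 / real (N + 1 - m))"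
        unfolding real_norm_def abs_mult using rcp_bound(3)[OF assms(1), of m] m by (intro mult_mono) auto
      then show "norm (rcp X m * (hs (-1) Y N - hs (-1) Y (N - m))) \<le> 4 * (1 / (real m * real (N + 1 - m)))" by simp
    qed
    finally show "norm (hs 1 X N * hs (-1) Y N - sh 1 (-1) X Y N) \<le> 4 * (\<Sum>m=1..N. 1 / (real m * real (N + 1 - m)))"
      by (simp only: sum_distrib_left)
  qed
qed

lemma rcp_diff_0: "\<bar>X\<bar> \<le> 1/2 \<Longrightarrow> 1 \<le> m \<Longrightarrow> \<bar>rcp X m - rcp 0 m\<bar> \<le> 1 / (real m)\<^sup>2"
proof -
  assume X: "\<bar>X\<bar> \<le> 1/2" and m: "1 \<le> m"
  have mX: "real m - X > 0" using X m by (auto simp: abs_le_iff)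
  have "rcp X m - rcp 0 m = X * rcp X m * (1 / real m)" using m mX by (simp add: rcp_def field_simps)
  then have "\<bar>rcp X m - rcp 0 m\<bar> = \<bar>X\<bar> * \<bar>rcp X m\<bar> * (1 / real m)" by (simp add: abs_mult)
  also have "\<dots> \<le> 1/2 * (2 / real m) * (1 / real m)"
    using rcp_bound(3)[OF X m] X by (intro mult_mono) auto
  finally show ?thesis by (simp add: power2_eq_square)
qed

lemma sums_zeta2: "(\<lambda>N. dg 1 0 0 N) \<longlonglongrightarrow> pi\<^sup>2 / 6"
proof -
  have "dg 1 0 0 N = (\<Sum>n<N. 1 / (1 + real n)\<^sup>2)" for N
    by (induction N) (auto simp: dg_Suc rcp_def power2_eq_square)
  then show ?thesis using inverse_squares_sums unfolding sums_def by (simp add: add.commute)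
qed

lemma sh_commute:
  assumes b: "\<bar>X\<bar> \<le> 1/2" "\<bar>Y\<bar> \<le> 1/2" "\<bar>X + Y\<bar> \<le> 1/2"
  shows "sh 1 1 X Y N = sh 1 1 Y X N"
  using shuffle[of X Y 1 1 N] shuffle[of Y X 1 1 N] b by (simp add: add.commute)

text \<open>Replacing X by 0 changes the first factor by O(1/m^2), while the block of
  \<open>hs 1 Y\<close> has m terms of size O(1/(N + 1 - m)); their product is again a convolution
  term.\<close>

lemma corner_diff:
  assumes "\<bar>X\<bar> \<le> 1/2" "\<bar>Y\<bar> \<le> 1/2"
  shows "(\<lambda>N. (hs 1 X N * hs 1 Y N - sh 1 1 X Y N) - (hs 1 0 N * hs 1 Y N - sh 1 1 0 Y N)) \<longlonglongrightarrow> 0"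
proof (rule Lim_null_comparison)
  show "(\<lambda>N. 2 * (\<Sum>m=1..N. 1 / (real m * real (N + 1 - m)))) \<longlonglongrightarrow> 0"
    using tendsto_mult_left[OF sum_convolution_tendsto, of 2] by simp
  show "\<forall>\<^sub>F N in sequentially. norm ((hs 1 X N * hs 1 Y N - sh 1 1 X Y N) - (hs 1 0 N * hs 1 Y N - sh 1 1 0 Y N)) \<le> 2 * (\<Sum>m=1..N. 1 / (real m * real (N + 1 - m)))"
  proof (intro always_eventually allI)
    fix N
    have "hs 1 X N * hs 1 Y N - sh 1 1 X Y N = (\<Sum>m=1..N. rcp X m * (hs 1 Y N - hs 1 Y (N - m)))" for X
      unfolding sh_conv hs_def[of 1 X] by (simp add: sum_distrib_right right_diff_distrib sum_subtractf)
    then have "(hs 1 X N * hs 1 Y N - sh 1 1 X Y N) - (hs 1 0 N * hs 1 Y N - sh 1 1 0 Y N) = (\<Sum>m=1..N. (rcp X m - rcp 0 m) * (hs 1 Y N - hs 1 Y (N - m)))"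
      by (simp only: sum_subtractf[symmetric] left_diff_distrib)
    also have "norm \<dots> \<le> (\<Sum>m=1..N. 2 * (1 / (real m * real (N + 1 - m))))"
    proof (rule sum_norm_le)
      fix m assume m: "m \<in> {1..N}"
      have "{1..N} = {1..N - m} \<union> {N - m + 1..N}" "{1..N - m} \<inter> {N - m + 1..N} = {}" using m by auto
      then have "hs 1 Y N - hs 1 Y (N - m) = (\<Sum>l=N - m + 1..N. rcp Y l)" by (simp add: hs_def sum.union_disjoint)
      also have "norm \<dots> \<le> of_nat (card {N - m + 1..N}) * (2 / real (N + 1 - m))"
      proof (rule sum_norm_bound)
        fix l assume l: "l \<in> {N - m + 1..N}"
        have "\<bar>rcp Y l\<bar> \<le> 2 / real l" using rcp_bound(3)[OF assms(2), of l] l by auto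
        also have "\<dots> \<le> 2 / real (N + 1 - m)" using l m by (intro divide_left_mono) auto
        finally show "norm (rcp Y l) \<le> 2 / real (N + 1 - m)" by simp
      qed
      also have "card {N - m + 1..N} = m" using m by simp
      finally have "norm ((rcp X m - rcp 0 m) * (hs 1 Y N - hs 1 Y (N - m))) \<le> 1 / (real m)\<^sup>2 * (real m * (2 / real (N + 1 - m)))"
        unfolding real_norm_def abs_mult using rcp_diff_0[OF assms(1), of m] m by (intro mult_mono) auto
      then show "norm ((rcp X m - rcp 0 m) * (hs 1 Y N - hs 1 Y (N - m))) \<le> 2 * (1 / (real m * real (N + 1 - m)))"
        using m by (simp add: power2_eq_square)
    qed
    finally show "norm ((hs 1 X N * hs 1 Y N - sh 1 1 X Y N) - (hs 1 0 N * hs 1 Y N - sh 1 1 0 Y N)) \<le> 2 * (\<Sum>m=1..N. 1 / (real m * real (N + 1 - m)))"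
      by (simp only: sum_distrib_left)
  qed
qed

text \<open>For X = Y = 0 the stuffle and the shuffle of the same product differ exactly by the
  diagonal, a partial sum of 1/n^2. The shifts are then introduced one at a time by
  \<open>corner_diff\<close>, \<open>sh\<close> being symmetric in the absence of signs.\<close>

lemma corner:
  assumes "\<bar>X\<bar> \<le> 1/2" "\<bar>Y\<bar> \<le> 1/2"
  shows "(\<lambda>N. hs 1 X N * hs 1 Y N - sh 1 1 X Y N) \<longlonglongrightarrow> pi\<^sup>2 / 6"
proof -
  have 0: "hs 1 0 N * hs 1 0 N - sh 1 1 0 0 N = dg 1 0 0 N" for N
    using shuffle[of 0 0 1 1 N] stuffle[of 1 1 0 0 N] by simp
  have "sh 1 1 0 Y N = sh 1 1 Y 0 N" for N using sh_commute[of 0 Y N] assms by simp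
  then have "hs 1 X N * hs 1 Y N - sh 1 1 X Y N =
     ((hs 1 X N * hs 1 Y N - sh 1 1 X Y N) - (hs 1 0 N * hs 1 Y N - sh 1 1 0 Y N))
     + ((hs 1 Y N * hs 1 0 N - sh 1 1 Y 0 N) - (hs 1 0 N * hs 1 0 N - sh 1 1 0 0 N)) + dg 1 0 0 N"
    for N using 0[of N] by (simp add: mult.commute)
  then have "(\<lambda>N. hs 1 X N * hs 1 Y N - sh 1 1 X Y N) = (\<lambda>N.
     ((hs 1 X N * hs 1 Y N - sh 1 1 X Y N) - (hs 1 0 N * hs 1 Y N - sh 1 1 0 Y N))
     + ((hs 1 Y N * hs 1 0 N - sh 1 1 Y 0 N) - (hs 1 0 N * hs 1 0 N - sh 1 1 0 0 N)) + dg 1 0 0 N)"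
    by (rule ext)
  moreover have "(\<lambda>N. ((hs 1 X N * hs 1 Y N - sh 1 1 X Y N) - (hs 1 0 N * hs 1 Y N - sh 1 1 0 Y N))
     + ((hs 1 Y N * hs 1 0 N - sh 1 1 Y 0 N) - (hs 1 0 N * hs 1 0 N - sh 1 1 0 0 N)) + dg 1 0 0 N) \<longlonglongrightarrow> 0 + 0 + pi\<^sup>2 / 6"
    using assms by (intro tendsto_add corner_diff sums_zeta2) auto
  ultimately show ?thesis by (simp only: add_0)
qed

section \<open>Even and odd parts in the shift\<close>

definition eps :: "real \<Rightarrow> real \<Rightarrow> nat \<Rightarrow> real" where
  "eps s X N = (\<Sum>n=1..N. s ^ n * (X\<^sup>2 / (real n * ((real n)\<^sup>2 - X\<^sup>2))))"

text \<open>\<open>eps\<close> and \<open>ops\<close> collect the even and the odd part in X of 1/(n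
  - X) - 1/n. The subtraction makes both sums converge, also for s = 1.\<close>

definition ops :: "real \<Rightarrow> real \<Rightarrow> nat \<Rightarrow> real" where
  "ops s X N = (\<Sum>n=1..N. s ^ n * (X / ((real n)\<^sup>2 - X\<^sup>2)))"

definition esr :: "real \<Rightarrow> real \<Rightarrow> real" where
  "esr s X = (\<Sum>n. s ^ Suc n * (X\<^sup>2 / (real (Suc n) * ((real (Suc n))\<^sup>2 - X\<^sup>2))))"

definition osr :: "real \<Rightarrow> real \<Rightarrow> real" where
  "osr s X = (\<Sum>n. s ^ Suc n * (X / ((real (Suc n))\<^sup>2 - X\<^sup>2)))"

definition d2 :: "real \<Rightarrow> real" where
  "d2 X = (\<Sum>n. (rcp X (Suc n))\<^sup>2)"

lemma eps_minus [simp]: "eps s (- X) N = eps s X N" by (simp add: eps_def)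
lemma ops_minus [simp]: "ops s (- X) N = - ops s X N" by (simp add: ops_def sum_negf)
lemma esr_minus [simp]: "esr s (- X) = esr s X" by (simp add: esr_def)

lemma square_gap: "\<bar>X\<bar> \<le> 1/2 \<Longrightarrow> 1 \<le> n \<Longrightarrow> (real n)\<^sup>2 - X\<^sup>2 \<ge> (real n)\<^sup>2 / 2"
proof -
  assume "\<bar>X\<bar> \<le> 1/2" "1 \<le> n"
  then have "\<bar>X\<bar>\<^sup>2 \<le> (1/2)\<^sup>2" "1\<^sup>2 \<le> (real n)\<^sup>2" by (intro power_mono, auto)+
  then show ?thesis by (simp add: power_divide)
qed

lemma eps_term: "\<bar>X\<bar> \<le> 1/2 \<Longrightarrow> \<bar>s\<bar> = 1 \<Longrightarrow> 1 \<le> n \<Longrightarrow> \<bar>s ^ n * (X\<^sup>2 / (real n * ((real n)\<^sup>2 - X\<^sup>2)))\<bar> \<le> 1 / real n ^ 3"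
proof -
  assume X: "\<bar>X\<bar> \<le> 1/2" "\<bar>s\<bar> = 1" "1 \<le> n"
  have g: "(real n)\<^sup>2 - X\<^sup>2 \<ge> (real n)\<^sup>2 / 2" "(real n)\<^sup>2 > 0" using square_gap[OF X(1,3)] X by auto
  have "\<bar>X\<bar>\<^sup>2 \<le> (1/2)\<^sup>2" using X by (intro power_mono) auto
  then have X2: "X\<^sup>2 \<le> 1/2" by (simp add: power_divide)
  have "(real n)\<^sup>2 - X\<^sup>2 > 0" using g by linarith
  then have "\<bar>s ^ n * (X\<^sup>2 / (real n * ((real n)\<^sup>2 - X\<^sup>2)))\<bar> = X\<^sup>2 / (real n * ((real n)\<^sup>2 - X\<^sup>2))"
    using X unfolding abs_mult power_abs abs_divide by simp
  also have "\<dots> \<le> (1/2) / (real n * ((real n)\<^sup>2 / 2))"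
    using g X X2 by (intro frac_le mult_left_mono) auto
  also have "\<dots> = 1 / real n ^ 3" using X by (simp add: power2_eq_square power3_eq_cube)
  finally show ?thesis .
qed

lemma ops_term: "\<bar>X\<bar> \<le> 1/2 \<Longrightarrow> \<bar>s\<bar> = 1 \<Longrightarrow> 1 \<le> n \<Longrightarrow> \<bar>s ^ n * (X / ((real n)\<^sup>2 - X\<^sup>2))\<bar> \<le> 1 / (real n)\<^sup>2"
proof -
  assume X: "\<bar>X\<bar> \<le> 1/2" "\<bar>s\<bar> = 1" "1 \<le> n"
  have g: "(real n)\<^sup>2 - X\<^sup>2 \<ge> (real n)\<^sup>2 / 2" "(real n)\<^sup>2 > 0" using square_gap[OF X(1,3)] X by auto
  have "(real n)\<^sup>2 - X\<^sup>2 > 0" using g by linarith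
  then have "\<bar>s ^ n * (X / ((real n)\<^sup>2 - X\<^sup>2))\<bar> = \<bar>X\<bar> / ((real n)\<^sup>2 - X\<^sup>2)"
    using X unfolding abs_mult power_abs abs_divide by simp
  also have "\<dots> \<le> (1/2) / ((real n)\<^sup>2 / 2)" using g X by (intro frac_le) auto
  finally show ?thesis by simp
qed

lemma sum_from_1_tendsto:
  fixes f :: "nat \<Rightarrow> real"
  assumes "summable (\<lambda>n. f (Suc n))"
  shows "(\<lambda>N. \<Sum>n=1..N. f n) \<longlonglongrightarrow> (\<Sum>n. f (Suc n))"
  using summable_LIMSEQ[OF assms] by (simp add: sum.atLeast1_atMost_eq)

lemma summable_inverse_square: "summable (\<lambda>n. 1 / (real (Suc n))\<^sup>2)"
  using inverse_squares_sums by (simp add: sums_iff add.commute)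

lemma summable_square_bound:
  fixes f :: "nat \<Rightarrow> real"
  assumes "\<And>n. 1 \<le> n \<Longrightarrow> \<bar>f n\<bar> \<le> C / (real n)\<^sup>2"
  shows "summable (\<lambda>n. f (Suc n))"
proof (rule summable_comparison_test)
  show "summable (\<lambda>n. C * (1 / (real (Suc n))\<^sup>2))" by (intro summable_mult summable_inverse_square)
  show "\<exists>N. \<forall>n\<ge>N. norm (f (Suc n)) \<le> C * (1 / (real (Suc n))\<^sup>2)" using assms[of "Suc _"] by (auto simp del: of_nat_Suc)
qed

lemma cube_le_square: "1 \<le> n \<Longrightarrow> 1 / real n ^ 3 \<le> 1 / (real n)\<^sup>2"
  by (intro divide_left_mono power_increasing) auto

lemma eps_tendsto:
  assumes "\<bar>X\<bar> \<le> 1/2" "\<bar>s\<bar> = 1"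
  shows "(\<lambda>N. eps s X N) \<longlonglongrightarrow> esr s X"
  unfolding eps_def esr_def
  by (intro sum_from_1_tendsto summable_square_bound[where C = 1] order_trans[OF eps_term[OF assms]] cube_le_square)

lemma ops_tendsto:
  assumes "\<bar>X\<bar> \<le> 1/2" "\<bar>s\<bar> = 1"
  shows "(\<lambda>N. ops s X N) \<longlonglongrightarrow> osr s X"
  unfolding ops_def osr_def
  by (intro sum_from_1_tendsto summable_square_bound[where C = 1] ops_term[OF assms])

lemma dg_tendsto:
  assumes "\<bar>X\<bar> \<le> 1/2"
  shows "(\<lambda>N. dg 1 X X N) \<longlonglongrightarrow> d2 X"
proof -
  have "(\<lambda>N. \<Sum>n=1..N. (rcp X n)\<^sup>2) \<longlonglongrightarrow> d2 X" unfolding d2_def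
  proof (intro sum_from_1_tendsto summable_square_bound[where C = 4])
    fix n :: nat assume n: "1 \<le> n"
    have "\<bar>rcp X n\<bar>\<^sup>2 \<le> (2 / real n)\<^sup>2" using rcp_bound[OF assms n] by (intro power_mono) auto
    then show "\<bar>(rcp X n)\<^sup>2\<bar> \<le> 4 / (real n)\<^sup>2" by (simp add: power_divide)
  qed
  then show ?thesis by (simp add: dg_def power2_eq_square)
qed

lemma hs_decomp:
  assumes "\<bar>X\<bar> \<le> 1/2"
  shows "hs s X N = hs s 0 N + eps s X N + ops s X N"
  unfolding hs_def eps_def ops_def sum.distrib[symmetric]
proof (intro sum.cong refl)
  fix n assume n: "n \<in> {1..N}"
  have nz: "real n - X > 0" "real n + X > 0" "real n > 0" using assms n by (auto simp: abs_le_iff)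
  have "rcp X n = rcp 0 n + X\<^sup>2 / (real n * ((real n)\<^sup>2 - X\<^sup>2)) + X / ((real n)\<^sup>2 - X\<^sup>2)"
  proof -
    have e: "(real n)\<^sup>2 - X\<^sup>2 = (real n - X) * (real n + X)" by (simp add: power2_eq_square algebra_simps)
    show ?thesis unfolding e rcp_def using nz by (simp add: divide_simps power2_eq_square) (simp add: algebra_simps)
  qed
  then show "s ^ n * rcp X n = s ^ n * rcp 0 n + s ^ n * (X\<^sup>2 / (real n * ((real n)\<^sup>2 - X\<^sup>2))) + s ^ n * (X / ((real n)\<^sup>2 - X\<^sup>2))"
    by (simp add: algebra_simps)
qed

text \<open>The even parts have terms O(1/n^3), so their tails beat the harmonic number. Bounding
  the latter by N and moving N into the tail leaves a tail of the sum of 1/n^2.\<close>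

lemma eps_log_tendsto:
  assumes "\<bar>X\<bar> \<le> 1/2" "\<bar>s\<bar> = 1"
  shows "(\<lambda>N. hs 1 0 N * (eps s X N - esr s X)) \<longlonglongrightarrow> 0"
proof -
  define f where "f n = s ^ n * (X\<^sup>2 / (real n * ((real n)\<^sup>2 - X\<^sup>2)))" for n
  have f: "\<bar>f n\<bar> \<le> 1 / real n ^ 3" if "1 \<le> n" for n using eps_term[OF assms that] by (simp add: f_def)
  have sf: "summable (\<lambda>n. f (Suc n))"
    by (intro summable_square_bound[where C = 1] order_trans[OF f] cube_le_square)
  define g where "g n = 1 / (real (Suc n))\<^sup>2" for n
  have sg: "summable g" unfolding g_def by (rule summable_inverse_square)
  have tail: "(\<lambda>N. \<Sum>k. g (k + N)) \<longlonglongrightarrow> 0"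
  proof -
    have "(\<Sum>k. g (k + N)) = suminf g - (\<Sum>k<N. g k)" for N using suminf_minus_initial_segment[OF sg] by simp
    moreover have "(\<lambda>N. suminf g - (\<Sum>k<N. g k)) \<longlonglongrightarrow> suminf g - suminf g"
      by (intro tendsto_intros summable_LIMSEQ sg)
    ultimately show ?thesis by simp
  qed
  have hN: "\<bar>hs 1 0 N\<bar> \<le> real N" for N
  proof -
    have "\<bar>hs 1 0 N\<bar> \<le> (\<Sum>n=1..N. \<bar>1 ^ n * rcp 0 n\<bar>)" unfolding hs_def by (rule sum_abs)
    also have "\<dots> \<le> (\<Sum>n=1..N. 1)" by (intro sum_mono) (auto simp: rcp_def)
    finally show ?thesis by simp
  qed
  show ?thesis
  proof (rule Lim_null_comparison[OF _ tail], intro always_eventually allI)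
    fix N
    have "eps s X N = (\<Sum>k<N. f (Suc k))" by (simp add: eps_def f_def sum.atLeast1_atMost_eq)
    moreover have "esr s X = (\<Sum>k. f (Suc k))" by (simp add: esr_def f_def)
    ultimately have "esr s X - eps s X N = (\<Sum>k. f (Suc (k + N)))" using suminf_minus_initial_segment[OF sf, of N] by simp
    then have "norm (hs 1 0 N * (eps s X N - esr s X)) = \<bar>hs 1 0 N\<bar> * \<bar>\<Sum>k. f (Suc (k + N))\<bar>"
      by (simp add: abs_mult abs_minus_commute)
    also have "\<dots> \<le> real N * \<bar>\<Sum>k. f (Suc (k + N))\<bar>" using hN by (intro mult_right_mono) auto
    also have "\<dots> = norm (\<Sum>k. real N * f (Suc (k + N)))"
      using suminf_mult[OF summable_ignore_initial_segment[OF sf, of N], of "real N"] by (simp add: abs_mult)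
    also have "\<dots> \<le> (\<Sum>k. g (k + N))"
    proof (rule norm_suminf_le)
      fix k
      have "\<bar>real N * f (Suc (k + N))\<bar> \<le> real (Suc (k + N)) * (1 / real (Suc (k + N)) ^ 3)"
        unfolding abs_mult using f[of "Suc (k + N)"] by (intro mult_mono) auto
      then show "norm (real N * f (Suc (k + N))) \<le> g (k + N)" by (simp add: g_def power3_eq_cube power2_eq_square del: of_nat_Suc)
    qed (use sg in \<open>rule summable_ignore_initial_segment\<close>)
    finally show "norm (hs 1 0 N * (eps s X N - esr s X)) \<le> (\<Sum>k. g (k + N))" .
  qed
qed

text \<open>Adding the sums with signs 1 and (-1)^n keeps the even terms twice, so 2N terms of
  \<open>f\<close> become N terms of \<open>g\<close>. In the applications n -> 2n amounts to
  halving the shift.\<close>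

lemma even_part_limit:
  fixes f g :: "nat \<Rightarrow> real"
  assumes f1: "(\<lambda>N. \<Sum>n=1..N. 1 ^ n * f n) \<longlonglongrightarrow> a" and f2: "(\<lambda>N. \<Sum>n=1..N. (-1) ^ n * f n) \<longlonglongrightarrow> b"
    and g: "(\<lambda>N. \<Sum>n=1..N. 1 ^ n * g n) \<longlonglongrightarrow> c" and fg: "\<And>n. n \<ge> 1 \<Longrightarrow> 2 * f (2 * n) = g n"
  shows "a + b = c"
proof -
  have "(\<Sum>n=1..2*N. 1 ^ n * f n) + (\<Sum>n=1..2*N. (-1) ^ n * f n) = (\<Sum>n=1..N. 1 ^ n * g n)" for N
  proof (induction N)
    case (Suc N)
    have "2 * Suc N = Suc (Suc (2 * N))" by simp
    then show ?case using Suc fg[of "Suc N"] by simp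
  qed simp
  moreover have "(\<lambda>N. (\<Sum>n=1..2*N. 1 ^ n * f n) + (\<Sum>n=1..2*N. (-1) ^ n * f n)) \<longlonglongrightarrow> a + b"
    by (intro tendsto_add filterlim_compose[OF f1] filterlim_compose[OF f2])
       (auto intro!: filterlim_subseq simp: strict_mono_def)
  ultimately show ?thesis using g LIMSEQ_unique by auto
qed

lemma half_gap: "(real n)\<^sup>2 - (X / 2)\<^sup>2 = ((real (2 * n))\<^sup>2 - X\<^sup>2) / 4"
  by (simp add: power2_eq_square)

lemma esr_half: "\<bar>X\<bar> \<le> 1/2 \<Longrightarrow> esr 1 X + esr (-1) X = esr 1 (X / 2)"
  by (rule even_part_limit[OF eps_tendsto[unfolded eps_def] eps_tendsto[unfolded eps_def] eps_tendsto[unfolded eps_def]])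
     (auto simp: half_gap power_divide)

lemma osr_half: "\<bar>X\<bar> \<le> 1/2 \<Longrightarrow> osr 1 X + osr (-1) X = osr 1 (X / 2)"
  by (rule even_part_limit[OF ops_tendsto[unfolded ops_def] ops_tendsto[unfolded ops_def] ops_tendsto[unfolded ops_def]])
     (auto simp: half_gap)

text \<open>Partial fractions: a diagonal with two different shifts reduces to single sums, at the
  cost of the denominator Y - X.\<close>

lemma dg_eq:
  assumes "\<bar>X\<bar> \<le> 1/2" "\<bar>Y\<bar> \<le> 1/2" "X \<noteq> Y"
  shows "dg t X Y N = (hs t Y N - hs t X N) / (Y - X)"
proof -
  have "hs t Y N - hs t X N = (\<Sum>n=1..N. (Y - X) * (t ^ n * (rcp X n * rcp Y n)))"
    unfolding hs_def sum_subtractf[symmetric]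
  proof (intro sum.cong refl)
    fix n assume n: "n \<in> {1..N}"
    have "real n - X > 0" "real n - Y > 0" using assms n by (auto simp: abs_le_iff)
    then have "rcp Y n - rcp X n = (Y - X) * (rcp X n * rcp Y n)" by (simp add: rcp_def divide_simps)
    then show "t ^ n * rcp Y n - t ^ n * rcp X n = (Y - X) * (t ^ n * (rcp X n * rcp Y n))"
      by (metis mult.left_commute right_diff_distrib)
  qed
  then show ?thesis using assms by (simp add: dg_def sum_distrib_left[symmetric])
qed

section \<open>Double series made convergent by subtraction\<close>

definition less_pairs :: "(nat \<times> nat) set" where "less_pairs = {(n, m). 0 < n \<and> n < m}"

definition dzeta_upto :: "real \<Rightarrow> real \<Rightarrow> nat \<Rightarrow> real" where
  "dzeta_upto X Y N = zs 1 1 X Y N - zs 1 1 0 Y N - zs 1 1 X 0 N + zs 1 1 0 0 N"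

text \<open>The generating function of \<zeta>(i + 2, j + 2) in X^(i+1) Y^(j+1); subtracting 1/n and
  1/m removes exactly the terms in which an exponent 1 would occur.\<close>

definition dzeta :: "real \<Rightarrow> real \<Rightarrow> real" where
  "dzeta X Y = (\<Sum>\<^sub>\<infinity>(n, m)\<in>less_pairs. (rcp X n - rcp 0 n) * (rcp Y m - rcp 0 m))"

lemma summable_on_square_square: "(\<lambda>(n, m). C * ((1 / real n ^ 2) * (1 / real m ^ 2))) summable_on less_pairs"
proof -
  have "((\<lambda>(n, m). (1 / real n ^ 2) * (1 / real m ^ 2)) has_sum
      (infsum (\<lambda>n. 1 / real n ^ 2) {1..}) * infsum (\<lambda>n. 1 / real n ^ 2) {1..}) ({1..} \<times> {1..})"
    by (intro has_sum_Times_real has_sum_infsum summable_on_inverse_power) auto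
  then have "(\<lambda>(n, m). (1 / real n ^ 2) * (1 / real m ^ 2)) summable_on less_pairs"
    by (intro summable_on_subset_banach[OF has_sum_imp_summable]) (auto simp: less_pairs_def)
  then show ?thesis unfolding case_prod_unfold by (rule summable_on_cmult_right)
qed

lemma has_sum_less_pairs:
  fixes u :: "nat \<Rightarrow> nat \<Rightarrow> real"
  assumes "\<And>n m. 0 < n \<Longrightarrow> n < m \<Longrightarrow> \<bar>u n m\<bar> \<le> C * ((1 / (real n)\<^sup>2) * (1 / (real m)\<^sup>2))"
  shows "((\<lambda>(n, m). u n m) has_sum (\<Sum>\<^sub>\<infinity>(n, m)\<in>less_pairs. u n m)) less_pairs"
proof (rule has_sum_infsum[OF abs_summable_summable])
  show "(\<lambda>t. norm (case t of (n, m) \<Rightarrow> u n m)) summable_on less_pairs"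
    by (rule Infinite_Sum.abs_summable_on_comparison_test'[OF summable_on_square_square[of C]]) (use assms in \<open>auto simp: less_pairs_def\<close>)
qed

lemma less_pairs_triangle:
  fixes u :: "nat \<Rightarrow> nat \<Rightarrow> real"
  assumes "((\<lambda>(n, m). u n m) has_sum S) less_pairs"
  shows "(\<lambda>N. \<Sum>m=1..N. \<Sum>n=1..<m. u n m) \<longlonglongrightarrow> S"
proof -
  have "(\<lambda>N. \<Sum>(n, m)\<in>(\<lambda>(m, n). (n, m)) ` (SIGMA m:{1..N}. {1..<m}). u n m) \<longlonglongrightarrow> S"
    by (rule has_sum_exhaust[OF assms]) (auto simp: less_pairs_def mono_def image_iff)
  moreover have "(\<Sum>(n, m)\<in>(\<lambda>(m, n). (n, m)) ` (SIGMA m:{1..N}. {1..<m}). u n m) = (\<Sum>m=1..N. \<Sum>n=1..<m. u n m)" for N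
    by (subst sum.reindex) (auto simp: inj_on_def sum.Sigma case_prod_unfold)
  ultimately show ?thesis by simp
qed

lemma has_sum_dzeta:
  assumes "\<bar>X\<bar> \<le> 1/2" "\<bar>Y\<bar> \<le> 1/2"
  shows "((\<lambda>(n, m). (rcp X n - rcp 0 n) * (rcp Y m - rcp 0 m)) has_sum dzeta X Y) less_pairs"
  unfolding dzeta_def
proof (rule has_sum_less_pairs[where C = 1])
  fix n m :: nat assume "0 < n" "n < m"
  then show "\<bar>(rcp X n - rcp 0 n) * (rcp Y m - rcp 0 m)\<bar> \<le> 1 * (1 / (real n)\<^sup>2 * (1 / (real m)\<^sup>2))"
    unfolding abs_mult using rcp_diff_0[OF assms(1), of n] rcp_diff_0[OF assms(2), of m]
    by (simp only: mult_1) (intro mult_mono, auto)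
qed

lemma dzeta_upto_tendsto:
  assumes "\<bar>X\<bar> \<le> 1/2" "\<bar>Y\<bar> \<le> 1/2"
  shows "(\<lambda>N. dzeta_upto X Y N) \<longlonglongrightarrow> dzeta X Y"
proof -
  have "dzeta_upto X Y N = (\<Sum>m=1..N. \<Sum>n=1..<m. (rcp X n - rcp 0 n) * (rcp Y m - rcp 0 m))" for N
    by (simp add: dzeta_upto_def zs_def sum_subtractf sum.distrib algebra_simps)
  then show ?thesis using less_pairs_triangle[OF has_sum_dzeta[OF assms]] by simp
qed

lemma hsum_Suc: "hsum X (Suc N) = 2 * hs 1 X N + rcp X (Suc N)"
proof -
  have "{1..<Suc N} = {1..N}" by auto
  then show ?thesis by (simp add: hsum_def hs_def)
qed

text \<open>Partial fractions: x^2/(z (z^2 - x^2)) = (1/(z - x) + 1/(z + x))/2 - 1/z. Thanks to the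
  half weight in \<open>hsum\<close> the last part adds up to the square of
  \<open>hs 1 X\<close>.\<close>

lemma sum_bser:
  assumes "\<bar>x\<bar> \<le> 1/4" "\<bar>X\<bar> \<le> 1/4"
  shows "x\<^sup>2 * (\<Sum>k=1..N. bser x X k) =
    (zs 1 1 X (X + x) N + dg 1 X (X + x) N / 2) + (zs 1 1 X (X - x) N + dg 1 X (X - x) N / 2) - (hs 1 X N)\<^sup>2"
proof (induction N)
  case (Suc N)
  define z where "z = real (Suc N) - X"
  have nz: "z > 0" "z - x > 0" "z + x > 0" using assms unfolding z_def by (auto simp: abs_le_iff)
  have r: "rcp X (Suc N) = 1 / z" "rcp (X + x) (Suc N) = 1 / (z - x)" "rcp (X - x) (Suc N) = 1 / (z + x)"
    by (simp_all add: rcp_def z_def algebra_simps)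
  have "x\<^sup>2 * bser x X (Suc N) = hsum X (Suc N) * (x\<^sup>2 / (z * (z\<^sup>2 - x\<^sup>2)))"
    by (simp add: bser_def z_def)
  also have "x\<^sup>2 / (z * (z\<^sup>2 - x\<^sup>2)) = (1 / (z - x) + 1 / (z + x)) / 2 - 1 / z"
  proof -
    have e: "z\<^sup>2 - x\<^sup>2 = (z - x) * (z + x)" by (simp add: power2_eq_square algebra_simps)
    show ?thesis unfolding e using nz by (simp add: divide_simps power2_eq_square) (simp add: algebra_simps)
  qed
  finally have "x\<^sup>2 * bser x X (Suc N) = (2 * hs 1 X N + 1 / z) * ((1 / (z - x) + 1 / (z + x)) / 2 - 1 / z)"
    by (simp add: hsum_Suc r)
  moreover have "x\<^sup>2 * (\<Sum>k=1..Suc N. bser x X k) = x\<^sup>2 * (\<Sum>k=1..N. bser x X k) + x\<^sup>2 * bser x X (Suc N)"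
    by (simp add: distrib_left)
  moreover have "P + (2 * h + c) * ((a + b) / 2 - c) =
      A + h * (1 * a) + (A' + 1 * (c * a)) / 2 + (B + h * (1 * b) + (B' + 1 * (c * b)) / 2) - (h + 1 * c)\<^sup>2"
    if "P = A + A' / 2 + (B + B' / 2) - h\<^sup>2" for P A A' B B' a b c h :: real
    using that by (simp add: power2_eq_square algebra_simps add_divide_distrib)
  ultimately show ?case using Suc.IH unfolding zs_Suc dg_Suc hs_Suc r power_one by presburger
qed simp

text \<open>Here x/(z^2 - x^2) = (1/(z - x) - 1/(z + x))/2, so the shifts X + x and X - x enter with
  opposite signs.\<close>

lemma sum_aser:
  assumes "0 < x" "x \<le> 1/4" "\<bar>X\<bar> \<le> 1/4"
  shows "x * (\<Sum>k=1..N. aser x X k) =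
    (zs 1 (-1) X (X + x) N + dg (-1) X (X + x) N / 2) - (zs 1 (-1) X (X - x) N + dg (-1) X (X - x) N / 2)"
proof (induction N)
  case (Suc N)
  define z where "z = real (Suc N) - X"
  have nz: "z > 0" "z - x > 0" "z + x > 0" using assms unfolding z_def by (auto simp: abs_le_iff)
  have r: "rcp X (Suc N) = 1 / z" "rcp (X + x) (Suc N) = 1 / (z - x)" "rcp (X - x) (Suc N) = 1 / (z + x)"
    by (simp_all add: rcp_def z_def algebra_simps)
  have "x * aser x X (Suc N) = (-1) ^ Suc N * hsum X (Suc N) * (x / (z\<^sup>2 - x\<^sup>2))"
    by (simp add: aser_def z_def)
  also have "x / (z\<^sup>2 - x\<^sup>2) = (1 / (z - x) - 1 / (z + x)) / 2"
  proof -
    have e: "z\<^sup>2 - x\<^sup>2 = (z - x) * (z + x)" by (simp add: power2_eq_square algebra_simps)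
    show ?thesis unfolding e using nz by (simp add: divide_simps)
  qed
  finally have "x * aser x X (Suc N) = (-1) ^ Suc N * (2 * hs 1 X N + 1 / z) * ((1 / (z - x) - 1 / (z + x)) / 2)"
    by (simp add: hsum_Suc r)
  moreover have "x * (\<Sum>k=1..Suc N. aser x X k) = x * (\<Sum>k=1..N. aser x X k) + x * aser x X (Suc N)"
    by (simp add: distrib_left)
  moreover have "P + s * (2 * h + c) * ((a - b) / 2) =
      A + h * (s * a) + (A' + s * (c * a)) / 2 - (B + h * (s * b) + (B' + s * (c * b)) / 2)"
    if "P = A + A' / 2 - (B + B' / 2)" for P A A' B B' a b c h s :: real
    using that by (simp add: algebra_simps add_divide_distrib diff_divide_distrib)
  ultimately show ?case using Suc.IH unfolding zs_Suc dg_Suc hs_Suc r by presburger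
qed simp

text \<open>The outer shift X + D mixes the two variables. Three relations remove it: the shuffle of
  X with D, the stuffle of D with X + D, and the shuffle of X + D with -X, whose shifts add up to
  D.\<close>

lemma zs_reduce:
  assumes "\<bar>X\<bar> \<le> 1/2" "\<bar>D\<bar> \<le> 1/2" "\<bar>X + D\<bar> \<le> 1/2"
  shows "zs 1 1 X (X + D) N = sh 1 1 X D N - hs 1 D N * hs 1 (X + D) N + dg 1 D (X + D) N + sh 1 1 (X + D) (- X) N - zs 1 1 (- X) D N"
  using shuffle[of X D 1 1 N] stuffle[of 1 1 D "X + D" N] shuffle[of "X + D" "- X" 1 1 N] assms by simp

subsection \<open>Evaluation of the limit series\<close>

lemma osr_minus: "\<bar>X\<bar> \<le> 1/2 \<Longrightarrow> \<bar>s\<bar> = 1 \<Longrightarrow> osr s (- X) = - osr s X"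
  using LIMSEQ_unique[OF ops_tendsto[of "- X" s] tendsto_minus[OF ops_tendsto[of X s], unfolded ops_minus[symmetric]]] by simp

definition kp :: "real \<Rightarrow> real \<Rightarrow> real \<Rightarrow> nat \<Rightarrow> real" where
  "kp t X Y N = hs 1 X N * hs t Y N - sh 1 t X Y N"

lemma kp_tendsto: "\<bar>X\<bar> \<le> 1/2 \<Longrightarrow> \<bar>Y\<bar> \<le> 1/2 \<Longrightarrow> (\<lambda>N. kp 1 X Y N) \<longlonglongrightarrow> pi\<^sup>2 / 6"
  "\<bar>X\<bar> \<le> 1/2 \<Longrightarrow> \<bar>Y\<bar> \<le> 1/2 \<Longrightarrow> (\<lambda>N. kp (-1) X Y N) \<longlonglongrightarrow> 0"
  unfolding kp_def using corner[of X Y] corner_alternating[of X Y] by blast+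

definition pps :: "real \<Rightarrow> real \<Rightarrow> nat \<Rightarrow> real" where "pps s X N = eps s X N + ops s X N"

definition psr :: "real \<Rightarrow> real \<Rightarrow> real" where "psr s X = esr s X + osr s X"

lemma hs_pps: "\<bar>X\<bar> \<le> 1/2 \<Longrightarrow> hs s X N = hs s 0 N + pps s X N"
  using hs_decomp[of X s N] by (simp add: pps_def)

lemma pps_tendsto: "\<bar>X\<bar> \<le> 1/2 \<Longrightarrow> \<bar>s\<bar> = 1 \<Longrightarrow> (\<lambda>N. pps s X N) \<longlonglongrightarrow> psr s X"
  unfolding pps_def psr_def by (intro tendsto_add eps_tendsto ops_tendsto)

text \<open>The share of one choice X = \<plusminus>y, D = \<plusminus>x in the sum of
  \<open>bser\<close> plus double zeta values. The square is halved because each X occurs with two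
  values of D.\<close>

definition tB :: "real \<Rightarrow> real \<Rightarrow> nat \<Rightarrow> real" where
  "tB X D N = zs 1 1 X (X + D) N + dg 1 X (X + D) N / 2 + dzeta_upto X D N - (hs 1 X N)\<^sup>2 / 2"

lemma tB_eq:
  assumes "\<bar>X\<bar> \<le> 1/4" "\<bar>D\<bar> \<le> 1/4"
  shows "tB X D N = hs 1 X N * hs 1 D N - hs 1 D N * hs 1 (X + D) N + hs 1 (X + D) N * hs 1 (- X) N
     - hs 1 0 N * hs 1 D N + (hs 1 D N)\<^sup>2 / 2 - (hs 1 X N)\<^sup>2 + (hs 1 0 N)\<^sup>2 / 2
     - kp 1 X D N - kp 1 (X + D) (- X) N + kp 1 0 D N - kp 1 0 X N
     + dg 1 D (X + D) N + dg 1 X (X + D) N / 2 - dg 1 D D N / 2 + dg 1 X 0 N + dg 1 X X N / 2 - dg 1 0 0 N / 2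
     + zs 1 1 X D N - zs 1 1 (- X) D N"
proof -
  have b: "\<bar>X\<bar> \<le> 1/2" "\<bar>D\<bar> \<le> 1/2" "\<bar>X + D\<bar> \<le> 1/2" using assms by linarith+
  note z1 = zs_reduce[OF b, of N]
  have z2: "sh 1 1 0 D N = zs 1 1 0 D N + zs 1 1 D D N" using shuffle[of 0 D 1 1 N] b by simp
  have z3: "2 * zs 1 1 D D N + dg 1 D D N = hs 1 D N * hs 1 D N" using stuffle[of 1 1 D D N] by simp
  have z4: "zs 1 1 X 0 N + zs 1 1 0 X N + dg 1 X 0 N = hs 1 X N * hs 1 0 N" using stuffle[of 1 1 X 0 N] by simp
  have z5: "sh 1 1 0 X N = zs 1 1 0 X N + zs 1 1 X X N" using shuffle[of 0 X 1 1 N] b by simp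
  have z6: "2 * zs 1 1 X X N + dg 1 X X N = hs 1 X N * hs 1 X N" using stuffle[of 1 1 X X N] by simp
  have z7: "2 * zs 1 1 0 0 N + dg 1 0 0 N = hs 1 0 N * hs 1 0 N" using stuffle[of 1 1 0 0 N] by simp
  have k: "kp 1 X D N = hs 1 X N * hs 1 D N - sh 1 1 X D N"
     "kp 1 (X + D) (- X) N = hs 1 (X + D) N * hs 1 (- X) N - sh 1 1 (X + D) (- X) N"
     "kp 1 0 D N = hs 1 0 N * hs 1 D N - sh 1 1 0 D N"
     "kp 1 0 X N = hs 1 X N * hs 1 0 N - sh 1 1 0 X N" by (simp_all add: kp_def)
  show ?thesis unfolding tB_def dzeta_upto_def power2_eq_square using z1 z2 z3 z4 z5 z6 z7 k by linarith
qed

lemma tB_tendsto: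
  assumes "0 < y" "y \<le> 1/4" "\<bar>D\<bar> \<le> 1/4" "D \<noteq> 0" "\<bar>D\<bar> \<noteq> y"
  shows "(\<lambda>N. tB y D N + tB (- y) D N) \<longlonglongrightarrow>
     (psr 1 y + psr 1 (- y)) * psr 1 D - psr 1 D * (psr 1 (y + D) + psr 1 (D - y))
     + psr 1 (y + D) * psr 1 (- y) + psr 1 (D - y) * psr 1 y
     + (psr 1 D)\<^sup>2 - (psr 1 y)\<^sup>2 - (psr 1 (- y))\<^sup>2 - 5 * (pi\<^sup>2 / 6)
     + (psr 1 (y + D) - psr 1 (D - y)) / y + (psr 1 (y + D) + psr 1 (D - y) - psr 1 y - psr 1 (- y)) / (2 * D)
     - d2 D + (psr 1 y - psr 1 (- y)) / y + (d2 y + d2 (- y)) / 2"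
    (is "_ \<longlonglongrightarrow> ?lim")
proof -
  have b: "\<bar>y\<bar> \<le> 1/2" "\<bar>- y\<bar> \<le> 1/2" "\<bar>D\<bar> \<le> 1/2" "\<bar>y + D\<bar> \<le> 1/2" "\<bar>D - y\<bar> \<le> 1/2" "\<bar>- y + D\<bar> \<le> 1/2" "\<bar>0::real\<bar> \<le> 1/2"
    "\<bar>y\<bar> \<le> 1/4" "\<bar>- y\<bar> \<le> 1/4"
    using assms by linarith+
  have ne: "y + D \<noteq> 0" "D \<noteq> y" "y \<noteq> 0" "- y \<noteq> D" using assms by auto
  have h: "hs 1 y N = hs 1 0 N + pps 1 y N" "hs 1 (- y) N = hs 1 0 N + pps 1 (- y) N" "hs 1 D N = hs 1 0 N + pps 1 D N"
      "hs 1 (y + D) N = hs 1 0 N + pps 1 (y + D) N" "hs 1 (D - y) N = hs 1 0 N + pps 1 (D - y) N" for N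
    by (intro hs_pps b)+
  have dgs: "dg 1 D (y + D) N = (pps 1 (y + D) N - pps 1 D N) / y"
     "dg 1 D (D - y) N = - ((pps 1 (D - y) N - pps 1 D N) / y)"
     "dg 1 y (y + D) N = (pps 1 (y + D) N - pps 1 y N) / D"
     "dg 1 (- y) (D - y) N = (pps 1 (D - y) N - pps 1 (- y) N) / D"
     "dg 1 y 0 N = pps 1 y N / y" "dg 1 (- y) 0 N = - (pps 1 (- y) N / y)" for N
    using dg_eq[OF b(3) b(4), of 1 N] dg_eq[OF b(3) b(5), of 1 N] dg_eq[OF b(1) b(4), of 1 N]
      dg_eq[OF b(2) b(5), of 1 N] dg_eq[OF b(1) b(7), of 1 N] dg_eq[OF b(2) b(7), of 1 N] ne assms(4)
    by (simp_all add: h)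
  \<comment> \<open>With \<open>hs 1 Z N\<close> = \<open>hs 1 0 N\<close> +
    \<open>pps 1 Z N\<close> all multiples of \<open>hs 1 0 N\<close> have cancelled, so only
    convergent quantities remain. The corners and the diagonal at 0 contribute 2 - 6 - 1 = -5 times
    pi^2/6.\<close>
  define PP where "PP N = (pps 1 y N + pps 1 (- y) N) * pps 1 D N - pps 1 D N * (pps 1 (y + D) N + pps 1 (D - y) N)
     + pps 1 (y + D) N * pps 1 (- y) N + pps 1 (D - y) N * pps 1 y N
     + (pps 1 D N)\<^sup>2 - (pps 1 y N)\<^sup>2 - (pps 1 (- y) N)\<^sup>2
     + (2 * kp 1 0 D N - kp 1 y D N - kp 1 (- y) D N - kp 1 (y + D) (- y) N - kp 1 (D - y) y N - kp 1 0 y N - kp 1 0 (- y) N - dg 1 0 0 N)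
     + (pps 1 (y + D) N - pps 1 (D - y) N) / y + (pps 1 (y + D) N + pps 1 (D - y) N - pps 1 y N - pps 1 (- y) N) / (2 * D)
     - dg 1 D D N + (pps 1 y N - pps 1 (- y) N) / y + (dg 1 y y N + dg 1 (- y) (- y) N) / 2" for N
  have "PP \<longlonglongrightarrow> (psr 1 y + psr 1 (- y)) * psr 1 D - psr 1 D * (psr 1 (y + D) + psr 1 (D - y))
     + psr 1 (y + D) * psr 1 (- y) + psr 1 (D - y) * psr 1 y
     + (psr 1 D)\<^sup>2 - (psr 1 y)\<^sup>2 - (psr 1 (- y))\<^sup>2
     + (2 * (pi\<^sup>2 / 6) - pi\<^sup>2 / 6 - pi\<^sup>2 / 6 - pi\<^sup>2 / 6 - pi\<^sup>2 / 6 - pi\<^sup>2 / 6 - pi\<^sup>2 / 6 - pi\<^sup>2 / 6)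
     + (psr 1 (y + D) - psr 1 (D - y)) / y + (psr 1 (y + D) + psr 1 (D - y) - psr 1 y - psr 1 (- y)) / (2 * D)
     - d2 D + (psr 1 y - psr 1 (- y)) / y + (d2 y + d2 (- y)) / 2"
    unfolding PP_def using b assms
    by (intro tendsto_intros kp_tendsto pps_tendsto dg_tendsto sums_zeta2) auto
  moreover have "tB y D N + tB (- y) D N = PP N" for N
  proof -

    have e: "- y + D = D - y" "- (- y) = y" by simp_all
    show ?thesis unfolding tB_eq[OF b(8) assms(3)] tB_eq[OF b(9) assms(3)] e PP_def dgs h
      by (simp add: power2_eq_square algebra_simps add_divide_distrib diff_divide_distrib)
  qed
  ultimately show ?thesis by (simp add: algebra_simps)
qed

section \<open>Splitting pairs by the parity of their difference\<close>

definition v1 :: "real \<Rightarrow> real \<Rightarrow> nat \<Rightarrow> real" where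
  "v1 Z X N = (\<Sum>m=1..N. \<Sum>q=1..<m. (1 + (-1) ^ (m + q)) / 2 * (rcp Z (m + q) * rcp X m))"

definition v2 :: "real \<Rightarrow> real \<Rightarrow> nat \<Rightarrow> real" where
  "v2 Z X N = (\<Sum>m=1..N. \<Sum>q=1..<m. (1 + (-1) ^ (m + q)) / 2 * (rcp Z (m + q) * rcp X q))"

lemma rcp_half: "rcp (Z / 2) n = 2 * rcp Z (2 * n)"
proof -
  have "2 * (real n - Z / 2) = real (2 * n) - Z" by simp
  then show ?thesis unfolding rcp_def by (metis mult_divide_mult_cancel_left mult.right_neutral times_divide_eq_right zero_neq_numeral)
qed

lemma hs_half: "hs 1 (Z / 2) N = (\<Sum>l=1..2*N+1. (1 + (-1) ^ l) * rcp Z l)"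
  by (induction N) (simp_all add: hs_Suc rcp_half)

text \<open>As \<open>rcp (Z / 2) n\<close> is twice \<open>rcp Z (2 * n)\<close>, the left side
  runs over even l < 2m. The ranges l < m, l = m, and l = m + q with 0 < q < m give the terms on the
  right.\<close>

lemma zs_half:
  "zs 1 1 (Z / 2) X N = zs 1 1 Z X N + zs (-1) 1 Z X N + dg 1 Z X N + dg (-1) Z X N + 2 * v1 Z X N"
proof (induction N)
  case (Suc N)
  have "hs 1 (Z / 2) N = (\<Sum>l\<in>{1..Suc N} \<union> {Suc N + 1..Suc N + N}. (1 + (-1) ^ l) * rcp Z l)"
    unfolding hs_half by (intro sum.cong) auto
  also have "\<dots> = (\<Sum>l=1..Suc N. (1 + (-1) ^ l) * rcp Z l) + (\<Sum>l=Suc N + 1..Suc N + N. (1 + (-1) ^ l) * rcp Z l)"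
    by (rule sum.union_disjoint) auto
  also have "(\<Sum>l=Suc N + 1..Suc N + N. (1 + (-1) ^ l) * rcp Z l) = (\<Sum>q=1..<Suc N. (1 + (-1) ^ (Suc N + q)) * rcp Z (Suc N + q))"
    by (rule sum.reindex_bij_witness[of _ "\<lambda>q. Suc N + q" "\<lambda>l. l - Suc N"]) auto
  also have "(\<Sum>l=1..Suc N. (1 + (-1) ^ l) * rcp Z l) = hs 1 Z N + hs (-1) Z N + (1 + (-1) ^ Suc N) * rcp Z (Suc N)"
    by (simp add: hs_def sum.distrib algebra_simps)
  finally have h: "hs 1 (Z / 2) N = hs 1 Z N + hs (-1) Z N + (1 + (-1) ^ Suc N) * rcp Z (Suc N)
     + (\<Sum>q=1..<Suc N. (1 + (-1) ^ (Suc N + q)) * rcp Z (Suc N + q))" .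
  have v: "2 * v1 Z X (Suc N) = 2 * v1 Z X N + (\<Sum>q=1..<Suc N. (1 + (-1) ^ (Suc N + q)) * rcp Z (Suc N + q)) * rcp X (Suc N)"
  proof -
    have "2 * v1 Z X (Suc N) = 2 * v1 Z X N + 2 * (\<Sum>q=1..<Suc N. (1 + (-1) ^ (Suc N + q)) / 2 * (rcp Z (Suc N + q) * rcp X (Suc N)))"
      by (simp add: v1_def del: sum.op_ivl_Suc)
    also have "2 * (\<Sum>q=1..<Suc N. (1 + (-1) ^ (Suc N + q)) / 2 * (rcp Z (Suc N + q) * rcp X (Suc N)))
       = (\<Sum>q=1..<Suc N. (1 + (-1) ^ (Suc N + q)) * rcp Z (Suc N + q)) * rcp X (Suc N)"
      unfolding sum_distrib_left sum_distrib_right by (intro sum.cong refl) simp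
    finally show ?thesis .
  qed
  show ?case unfolding zs_Suc dg_Suc v h Suc.IH by (simp add: algebra_simps del: sum.op_ivl_Suc)
qed (simp add: v1_def)

text \<open>The partial fractions of the shuffle, restricted to even m + q; on the right the weight
  (1 + (-1)^(m+q))/2 separates into an unsigned and a doubly alternating sum.\<close>

lemma v1_v2:
  assumes "\<bar>X\<bar> \<le> 1/4" "\<bar>D\<bar> \<le> 1/4"
  shows "2 * (v1 (X + D) X N + v2 (X + D) D N) = zs 1 1 D X N + zs (-1) (-1) D X N"
  unfolding v1_def v2_def zs_def sum_distrib_left sum.distrib[symmetric]
proof (intro sum.cong refl)
  fix m q assume mq: "m \<in> {1..N}" "q \<in> {1..<m}"
  have nz: "real m - X > 0" "real q - D > 0" "real (m + q) - (X + D) > 0"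
    using assms mq by (auto simp: abs_le_iff)
  have "rcp (X + D) (m + q) * rcp X m + rcp (X + D) (m + q) * rcp D q = rcp D q * rcp X m"
    using nz by (simp add: rcp_def divide_simps)
  then have "2 * ((1 + (-1) ^ (m + q)) / 2 * (rcp (X + D) (m + q) * rcp X m) + (1 + (-1) ^ (m + q)) / 2 * (rcp (X + D) (m + q) * rcp D q))
     = (1 + (-1) ^ (m + q)) * (rcp D q * rcp X m)"
    by (simp flip: distrib_left)
  also have "\<dots> = 1 ^ q * 1 ^ m * (rcp D q * rcp X m) + (- 1) ^ q * (- 1) ^ m * (rcp D q * rcp X m)"
    by (simp add: power_add algebra_simps)
  finally show "2 * ((1 + (-1) ^ (m + q)) / 2 * (rcp (X + D) (m + q) * rcp X m) + (1 + (-1) ^ (m + q)) / 2 * (rcp (X + D) (m + q) * rcp D q))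
     = 1 ^ q * 1 ^ m * (rcp D q * rcp X m) + (- 1) ^ q * (- 1) ^ m * (rcp D q * rcp X m)" .
qed

lemma odd_pow: "1 + (- 1 :: real) ^ k \<noteq> 0 \<Longrightarrow> even k" by (cases "even k") auto

text \<open>Pairs q < p of equal parity correspond to pairs q < m by m = (p + q)/2. The bound p
  \<le> N turns into 2m \<le> N + q, another exhaustion of the same index set, and absolute
  convergence makes the limit independent of it.\<close>

lemma parity_pairs_limit:
  fixes u :: "nat \<Rightarrow> nat \<Rightarrow> real"
  assumes "((\<lambda>(n, m). u n m) has_sum S) less_pairs" and w: "\<And>q p. even (p + q) \<Longrightarrow> w q p = u q ((p + q) div 2)"
  shows "(\<lambda>N. \<Sum>m=1..N. \<Sum>q=1..<m. (1 + (-1) ^ (m + q)) / 2 * w q m) \<longlonglongrightarrow> S"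
proof -
  define B where "B N = {(n, m). 0 < n \<and> n < m \<and> 2 * m \<le> N + n}" for N :: nat
  have fin: "finite (B N)" for N by (rule finite_subset[of _ "{..N} \<times> {..N}"]) (auto simp: B_def)
  have "(\<lambda>N. \<Sum>(n, m)\<in>B N. u n m) \<longlonglongrightarrow> S"
  proof (rule has_sum_exhaust[OF assms(1) fin])
    show "less_pairs \<subseteq> (\<Union>N. B N)"
    proof
      fix t assume "t \<in> less_pairs"
      then show "t \<in> (\<Union>N. B N)" by (intro UN_I[of "2 * snd t"]) (auto simp: less_pairs_def B_def)
    qed
  qed (auto simp: B_def less_pairs_def mono_def)
  moreover have "(\<Sum>(n, m)\<in>B N. u n m) = (\<Sum>m=1..N. \<Sum>q=1..<m. (1 + (-1) ^ (m + q)) / 2 * w q m)" for N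
  proof -
    have "(\<Sum>m=1..N. \<Sum>q=1..<m. (1 + (-1) ^ (m + q)) / 2 * w q m)
       = (\<Sum>(m, q)\<in>(SIGMA m:{1..N}. {1..<m}). (1 + (-1) ^ (m + q)) / 2 * w q m)"
      by (simp add: sum.Sigma)
    also have "\<dots> = (\<Sum>(m, q)\<in>{(m, q). (m, q) \<in> (SIGMA m:{1..N}. {1..<m}) \<and> even (m + q)}. (1 + (-1) ^ (m + q)) / 2 * w q m)"
      by (rule sum.mono_neutral_right) (auto dest!: odd_pow)
    also have "\<dots> = (\<Sum>(n, m)\<in>B N. u n m)"
    proof (rule sum.reindex_bij_witness[of _ "\<lambda>(n, m). (2 * m - n, n)" "\<lambda>(m, q). (q, (m + q) div 2)"])
      fix t assume "t \<in> {(m, q). (m, q) \<in> (SIGMA m:{1..N}. {1..<m}) \<and> even (m + q)}"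
      then obtain m q where t: "t = (m, q)" "m \<le> N" "1 \<le> q" "q < m" "even (m + q)" by auto
      obtain k where k: "m + q = 2 * k" using t(5) by (elim evenE)
      have k': "(m + q) div 2 = k" "q < k" "k \<le> m" using k t(4) by auto
      have "2 * k - q = m" using k by simp
      then show "(case case t of (m, q) \<Rightarrow> (q, (m + q) div 2) of (n, m) \<Rightarrow> (2 * m - n, n)) = t" unfolding t(1) prod.case k'(1) by simp
      have "2 * k \<le> N + q" using k t(2) by linarith
      then show "(case t of (m, q) \<Rightarrow> (q, (m + q) div 2)) \<in> B N" unfolding t(1) prod.case k'(1) B_def using k'(2) t(3) by simp
      show "(case case t of (m, q) \<Rightarrow> (q, (m + q) div 2) of (n, m) \<Rightarrow> u n m) = (case t of (m, q) \<Rightarrow> (1 + (-1) ^ (m + q)) / 2 * w q m)"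
        using t w[of m q] by simp
    next
      fix t assume "t \<in> B N"
      then obtain n m where t: "t = (n, m)" "0 < n" "n < m" "2 * m \<le> N + n" by (auto simp: B_def)
      have "2 * m - n + n = 2 * m" using t by simp
      then have "even (2 * m - n + n)" by simp
      then show "(case t of (n, m) \<Rightarrow> (2 * m - n, n)) \<in> {(m, q). (m, q) \<in> (SIGMA m:{1..N}. {1..<m}) \<and> even (m + q)}"
        using t by (auto simp del: even_add)
      show "(case case t of (n, m) \<Rightarrow> (2 * m - n, n) of (m, q) \<Rightarrow> (q, (m + q) div 2)) = t" using t by simp
    qed
    finally show ?thesis ..
  qed
  ultimately show ?thesis by simp
qed

text \<open>In each difference both terms are the same formal double series under different
  cut-offs: for m + q = 2l the factor rcp Z (m + q) in \<open>v2\<close> is half of rcp (Z/2) l. The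
  single series diverge, but the signed sum of the four has terms O(1/(n^2 m^2)), so the cut-off
  does not matter.\<close>

lemma mu_tendsto:
  assumes "0 < x" "x \<le> 1/4" "0 < y" "y \<le> 1/4"
  shows "(\<lambda>N. (zs 1 1 x ((y + x) / 2) N / 2 - v2 (y + x) x N) - (zs 1 1 (- x) ((y - x) / 2) N / 2 - v2 (y - x) (- x) N)
     - (zs 1 1 x ((x - y) / 2) N / 2 - v2 (x - y) x N) + (zs 1 1 (- x) ((- y - x) / 2) N / 2 - v2 (- y - x) (- x) N)) \<longlonglongrightarrow> 0"
proof -
  define w where "w q l = rcp (y + x) l * rcp x q - rcp (y - x) l * rcp (- x) q - rcp (x - y) l * rcp x q + rcp (- y - x) l * rcp (- x) q" for q l
  define u where "u n m = w n (2 * m)" for n m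
  have ub: "\<bar>u n m\<bar> \<le> 10 * ((1 / (real n)\<^sup>2) * (1 / (real m)\<^sup>2))" if nm: "0 < n" "n < m" for n m
  proof -
    define M where "M = real (2 * m)"
    have n1: "real n \<ge> 1" and m1: "real m \<ge> 1" and nm': "real n \<le> real m" using nm by auto
    have M: "M = 2 * real m" by (simp add: M_def)
    define P where "P = x + y" define Q where "Q = x - y"
    have PQ: "\<bar>P\<bar> \<le> 1/2" "\<bar>Q\<bar> \<le> 1/2" using assms unfolding P_def Q_def by linarith+
    have nz: "M - P \<ge> real m" "M + P \<ge> real m" "M - Q \<ge> real m" "M + Q \<ge> real m" "M - P > 0" "M + P > 0" "M - Q > 0" "M + Q > 0"
      using PQ m1 by (auto simp: M abs_le_iff)
    have X: "\<bar>x\<bar> \<le> 1/2" "\<bar>- x\<bar> \<le> 1/2" using assms by auto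
    \<comment> \<open>Arranged to exhibit the cancellation: the first product is O(1/n^2) times
      O(1/m^2), the second O(1/n) times O(1/m^3), where n < m trades one 1/m for 1/n. The two bounds
      2 and 8 make up the constant 10.\<close>
    have u: "u n m = (rcp x n - rcp (- x) n) * (1 / (M - P) - 1 / (M - Q)) + rcp (- x) n * ((1 / (M - P) + 1 / (M + P)) - (1 / (M - Q) + 1 / (M + Q)))"
      unfolding u_def w_def rcp_def M_def[symmetric] P_def Q_def by (simp add: algebra_simps)
    have a: "\<bar>rcp x n - rcp (- x) n\<bar> \<le> 2 / (real n)\<^sup>2"
      using rcp_diff_0[OF X(1), of n] rcp_diff_0[OF X(2), of n] nm by auto
    have m2: "(real m)\<^sup>2 > 0" using m1 by simp
    have bq: "\<bar>1 / (M - P) - 1 / (M - Q)\<bar> \<le> 1 / (real m)\<^sup>2"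
    proof -
      have "1 / (M - P) - 1 / (M - Q) = (P - Q) / ((M - P) * (M - Q))" using nz by (simp add: field_simps)
      also have "\<bar>\<dots>\<bar> = \<bar>P - Q\<bar> / ((M - P) * (M - Q))" using nz by (simp add: abs_mult)
      also have "\<dots> \<le> 1 / (real m * real m)"
        using nz PQ m1 by (intro frac_le mult_mono) (auto simp: abs_le_iff)
      finally show ?thesis by (simp add: power2_eq_square)
    qed
    have sq: "\<bar>1 / (M - P) + 1 / (M + P) - (1 / (M - Q) + 1 / (M + Q))\<bar> \<le> 4 / real m ^ 3"
    proof -
      have "1 / (M - P) + 1 / (M + P) - (1 / (M - Q) + 1 / (M + Q)) = 2 * M * (P\<^sup>2 - Q\<^sup>2) / ((M - P) * (M + P) * ((M - Q) * (M + Q)))"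
        using nz by (simp add: divide_simps) (simp add: power2_eq_square algebra_simps)
      also have "\<bar>\<dots>\<bar> = 2 * M * \<bar>P\<^sup>2 - Q\<^sup>2\<bar> / ((M - P) * (M + P) * ((M - Q) * (M + Q)))"
        using nz M m1 by (simp add: abs_mult)
      also have "\<dots> \<le> (2 * M * 1) / (real m * real m * (real m * real m))"
      proof (intro frac_le mult_left_mono mult_mono)
        have "\<bar>P\<bar>\<^sup>2 \<le> 1\<^sup>2" "\<bar>Q\<bar>\<^sup>2 \<le> 1\<^sup>2" using PQ by (intro power_mono; auto)+
        then have "P\<^sup>2 \<le> 1" "Q\<^sup>2 \<le> 1" "P\<^sup>2 \<ge> 0" "Q\<^sup>2 \<ge> 0" by simp_all
        then show "\<bar>P\<^sup>2 - Q\<^sup>2\<bar> \<le> 1" by linarith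
      qed (use nz m1 M in auto)
      also have "\<dots> = 4 / real m ^ 3" using m1 by (simp add: M power3_eq_cube field_simps)
      finally show ?thesis .
    qed
    have "\<bar>u n m\<bar> \<le> 2 / (real n)\<^sup>2 * (1 / (real m)\<^sup>2) + 2 / real n * (4 / real m ^ 3)"
      unfolding u
      by (rule order_trans[OF abs_triangle_ineq], unfold abs_mult, intro add_mono mult_mono)
        (use a bq sq rcp_bound(3)[OF X(2), of n] nm in auto)
    also have "2 / real n * (4 / real m ^ 3) = 8 / (real n * real m * (real m)\<^sup>2)" by (simp add: power3_eq_cube power2_eq_square)
    also have "\<dots> \<le> 8 / (real n * real n * (real m)\<^sup>2)"
      using n1 m1 nm' by (intro divide_left_mono mult_right_mono mult_left_mono mult_pos_pos) auto
    finally show ?thesis by (simp add: power2_eq_square ac_simps)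
  qed
  obtain S where S: "((\<lambda>(n, m). u n m) has_sum S) less_pairs" using has_sum_less_pairs[OF ub] by blast
  have 1: "(\<lambda>N. \<Sum>m=1..N. \<Sum>n=1..<m. u n m) \<longlonglongrightarrow> S" by (rule less_pairs_triangle[OF S])
  have 2: "(\<lambda>N. \<Sum>m=1..N. \<Sum>q=1..<m. (1 + (-1) ^ (m + q)) / 2 * w q (m + q)) \<longlonglongrightarrow> S"
    by (rule parity_pairs_limit[OF S]) (auto simp: u_def)
  have e1: "(\<Sum>m=1..N. \<Sum>n=1..<m. u n m) = zs 1 1 x ((y + x) / 2) N / 2 - zs 1 1 (- x) ((y - x) / 2) N / 2 - zs 1 1 x ((x - y) / 2) N / 2 + zs 1 1 (- x) ((- y - x) / 2) N / 2" for N
    unfolding zs_def sum_divide_distrib sum_subtractf[symmetric] sum.distrib[symmetric]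
    by (intro sum.cong refl) (simp only: u_def w_def rcp_half, simp add: mult.commute)
  have e2: "(\<Sum>m=1..N. \<Sum>q=1..<m. (1 + (-1) ^ (m + q)) / 2 * w q (m + q)) = v2 (y + x) x N - v2 (y - x) (- x) N - v2 (x - y) x N + v2 (- y - x) (- x) N" for N
    unfolding v2_def sum_subtractf[symmetric] sum.distrib[symmetric]
    by (intro sum.cong refl) (simp add: w_def algebra_simps)
  have "(\<lambda>N. (zs 1 1 x ((y + x) / 2) N / 2 - zs 1 1 (- x) ((y - x) / 2) N / 2 - zs 1 1 x ((x - y) / 2) N / 2 + zs 1 1 (- x) ((- y - x) / 2) N / 2)
     - (v2 (y + x) x N - v2 (y - x) (- x) N - v2 (x - y) x N + v2 (- y - x) (- x) N)) \<longlonglongrightarrow> S - S"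
    using tendsto_diff[OF 1 2] unfolding e1 e2 .
  then show ?thesis by (simp add: algebra_simps)
qed

text \<open>The share of one choice X = \<plusminus>y, D = \<plusminus>x in the alternating part.
  The halved argument (X + D)/2 is the origin of the powers of 1/2 in the third sum of
  \<open>T1\<close>.\<close>

definition tA :: "real \<Rightarrow> real \<Rightarrow> nat \<Rightarrow> real" where
  "tA X D N = - (zs 1 (-1) X (X + D) N + dg (-1) X (X + D) N / 2) + dzeta_upto D X N - dzeta_upto ((X + D) / 2) X N / 2 - dzeta_upto D ((X + D) / 2) N / 2"

text \<open>The double sums left in the last line are even in D or depend on only one of X and D, so
  they vanish in the signed sum over X = \<plusminus>y and D = \<plusminus>x. The difference
  involving \<open>v2\<close> is the subject of \<open>mu_tendsto\<close>.\<close>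

lemma tA_eq:
  assumes "\<bar>X\<bar> \<le> 1/4" "\<bar>D\<bar> \<le> 1/4"
  shows "tA X D N = - hs 1 X N * hs (-1) (X + D) N + hs 1 (- D) N * hs (-1) (X + D) N / 2 - hs 1 (X + D) N * hs 1 (- D) N / 2
    + hs 1 ((X + D) / 2) N * hs 1 0 N / 2 - kp (-1) (- D) (X + D) N / 2 + kp 1 (X + D) (- D) N / 2
    - dg 1 (X + D) X N / 2 - dg 1 ((X + D) / 2) 0 N / 2 - (zs 1 1 D ((X + D) / 2) N / 2 - v2 (X + D) D N)
    + (zs 1 1 D X N + zs 1 1 (- D) X N - zs (-1) (-1) (- D) X N - zs (-1) (-1) D X N - zs 1 1 0 X N - zs 1 1 D 0 N) / 2"
proof -
  have b: "\<bar>X\<bar> \<le> 1/2" "\<bar>D\<bar> \<le> 1/2" "\<bar>- D\<bar> \<le> 1/2" "\<bar>X + D\<bar> \<le> 1/2" using assms by linarith+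
  have z1: "zs 1 (-1) X (X + D) N + zs (-1) 1 (X + D) X N + dg (-1) X (X + D) N = hs 1 X N * hs (-1) (X + D) N"
    using stuffle[of 1 "-1" X "X + D" N] by simp
  have z2: "sh 1 (-1) (- D) (X + D) N = zs (-1) (-1) (- D) X N + zs (-1) 1 (X + D) X N"
    using shuffle[of "- D" "X + D" 1 "-1" N] b by simp
  have z3: "sh 1 1 (X + D) (- D) N = zs 1 1 (X + D) X N + zs 1 1 (- D) X N"
    using shuffle[of "X + D" "- D" 1 1 N] b by simp
  note z4 = zs_half[of "X + D" X N]
  note z5 = v1_v2[OF assms, of N]
  have z6: "zs 1 1 ((X + D) / 2) 0 N + zs 1 1 0 ((X + D) / 2) N + dg 1 ((X + D) / 2) 0 N = hs 1 ((X + D) / 2) N * hs 1 0 N"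
    using stuffle[of 1 1 "(X + D) / 2" 0 N] by simp
  have k: "kp (-1) (- D) (X + D) N = hs 1 (- D) N * hs (-1) (X + D) N - sh 1 (-1) (- D) (X + D) N"
    "kp 1 (X + D) (- D) N = hs 1 (X + D) N * hs 1 (- D) N - sh 1 1 (X + D) (- D) N" by (simp_all add: kp_def)
  have d: "dg (-1) (X + D) X N = dg (-1) X (X + D) N" by (rule dg_commute)
  show ?thesis unfolding tA_def dzeta_upto_def using z1 z2 z3 z4 z5 z6 k d by (simp add: field_simps)
qed

text \<open>Adds the limits of \<open>tB_tendsto\<close> for D = x and D = -x, which leaves
  expressions even in x; the 10 is twice the 5 found there.\<close>

lemma main_B:
  assumes x: "0 < x" "x \<le> 1/4" and y: "0 < y" "y \<le> 1/4" and xy: "x \<noteq> y"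
  defines "P \<equiv> x + y" and "M \<equiv> x - y"
  shows "x\<^sup>2 * ((\<Sum>k. bser x y (Suc k)) + (\<Sum>k. bser x (- y) (Suc k)))
     + (dzeta y x + dzeta y (- x) + dzeta (- y) x + dzeta (- y) (- x)) =
     4 * esr 1 x * esr 1 y + 2 * esr 1 y * (esr 1 P + esr 1 M) - 2 * esr 1 x * (esr 1 P + esr 1 M) - 4 * (esr 1 y)\<^sup>2 + 2 * (esr 1 x)\<^sup>2
     + (osr 1 P + osr 1 M) / x + 2 * (osr 1 P - osr 1 M) / y - (d2 x + d2 (- x)) + 4 * osr 1 y / y + (d2 y + d2 (- y))
     - 2 * osr 1 y * (osr 1 P - osr 1 M) - 2 * osr 1 x * (osr 1 P + osr 1 M) - 4 * (osr 1 y)\<^sup>2 + 2 * (osr 1 x)\<^sup>2 - 10 * (pi\<^sup>2 / 6)"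
proof -
  have b: "\<bar>x\<bar> \<le> 1/2" "\<bar>y\<bar> \<le> 1/2" "\<bar>P\<bar> \<le> 1/2" "\<bar>M\<bar> \<le> 1/2" "\<bar>- x\<bar> \<le> 1/2" "\<bar>- y\<bar> \<le> 1/2"
    using x y unfolding P_def M_def by linarith+
  have lim: "(\<lambda>N. (x\<^sup>2 * (\<Sum>k=1..N. bser x y k) + x\<^sup>2 * (\<Sum>k=1..N. bser x (- y) k)) + (dzeta_upto y x N + dzeta_upto y (- x) N + dzeta_upto (- y) x N + dzeta_upto (- y) (- x) N)) \<longlonglongrightarrow>
     (x\<^sup>2 * (\<Sum>k. bser x y (Suc k)) + x\<^sup>2 * (\<Sum>k. bser x (- y) (Suc k))) + (dzeta y x + dzeta y (- x) + dzeta (- y) x + dzeta (- y) (- x))"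
    using x y by (intro tendsto_intros sum_from_1_tendsto sum_shift_limit(2) dzeta_upto_tendsto) auto
  have e: "(x\<^sup>2 * (\<Sum>k=1..N. bser x y k) + x\<^sup>2 * (\<Sum>k=1..N. bser x (- y) k)) + (dzeta_upto y x N + dzeta_upto y (- x) N + dzeta_upto (- y) x N + dzeta_upto (- y) (- x) N)
     = (tB y x N + tB (- y) x N) + (tB y (- x) N + tB (- y) (- x) N)" for N
    using sum_bser[of x y N] sum_bser[of x "- y" N] x y by (simp add: tB_def)
  have "\<bar>x\<bar> \<le> 1/4" "\<bar>- x\<bar> \<le> 1/4" "x \<noteq> 0" "- x \<noteq> 0" "\<bar>x\<bar> \<noteq> y" "\<bar>- x\<bar> \<noteq> y" using x xy by auto
  note l = tendsto_add[OF tB_tendsto[OF y this(1,3,5)] tB_tendsto[OF y this(2,4,6)], folded e]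
  have a: "y + x = P" "x - y = M" "y + - x = - M" "- x - y = - P" by (simp_all add: P_def M_def)
  have p: "psr 1 x = esr 1 x + osr 1 x" "psr 1 y = esr 1 y + osr 1 y" "psr 1 (- x) = esr 1 x - osr 1 x" "psr 1 (- y) = esr 1 y - osr 1 y"
    "psr 1 P = esr 1 P + osr 1 P" "psr 1 M = esr 1 M + osr 1 M" "psr 1 (- P) = esr 1 P - osr 1 P" "psr 1 (- M) = esr 1 M - osr 1 M"
    using b by (simp_all add: psr_def osr_minus)
  show ?thesis
    unfolding distrib_left using LIMSEQ_unique[OF lim l] unfolding a p minus_minus
    by (simp add: power2_eq_square algebra_simps add_divide_distrib diff_divide_distrib)
qed

text \<open>L and L' stand for \<open>hs 1 0 N\<close> and \<open>hs (-1) 0 N\<close>, the letters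
  e, o for even and odd parts, m, n for their alternating versions, h, g for halved shifts.
  Everything quadratic in L and L' cancels, and L survives with a factor that tends to 0 by
  \<open>esr_half\<close>.\<close>

lemma quad_sum_A:
  fixes L :: real
  shows "(- (L + ey + oy) * (L' + mP + nP) + (L + ex - ox) * (L' + mP + nP) / 2 - (L + eP + oP) * (L + ex - ox) / 2 + (L + hP + gP) * L / 2)
    - (- (L + ey + oy) * (L' + mM - nM) + (L + ex + ox) * (L' + mM - nM) / 2 - (L + eM - oM) * (L + ex + ox) / 2 + (L + hM - gM) * L / 2)
    - (- (L + ey - oy) * (L' + mM + nM) + (L + ex - ox) * (L' + mM + nM) / 2 - (L + eM + oM) * (L + ex - ox) / 2 + (L + hM + gM) * L / 2)
    + (- (L + ey - oy) * (L' + mP - nP) + (L + ex + ox) * (L' + mP - nP) / 2 - (L + eP - oP) * (L + ex + ox) / 2 + (L + hP - gP) * L / 2)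
    = - 2 * ey * (mP - mM) - 2 * oy * (nP + nM) + ex * ((mP - eP) - (mM - eM)) - ox * ((nP - oP) - (nM - oM))
      + L * ((hP - eP - mP) - (hM - eM - mM))"
  by (simp add: algebra_simps add_divide_distrib diff_divide_distrib)

text \<open>The signed sum of the four \<open>tA\<close> consists of a convergent part
  \<open>FA\<close>, the corners \<open>KK\<close>, the logarithmic remainder \<open>lg\<close> and
  the difference \<open>mu\<close> of two cut-offs; only the first survives.\<close>

lemma main_A:
  assumes x: "0 < x" "x \<le> 1/4" and y: "0 < y" "y \<le> 1/4" and xy: "x \<noteq> y"
  defines "P \<equiv> x + y" and "M \<equiv> x - y"
  shows "x * ((\<Sum>k. aser x (- y) (Suc k)) - (\<Sum>k. aser x y (Suc k)))
     + (dzeta x y - dzeta (- x) y - dzeta x (- y) + dzeta (- x) (- y))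
     - (dzeta (P / 2) y - dzeta (- M / 2) y - dzeta (M / 2) (- y) + dzeta (- P / 2) (- y)) / 2
     - (dzeta x (P / 2) - dzeta (- x) (- M / 2) - dzeta x (M / 2) + dzeta (- x) (- P / 2)) / 2 =
     - 2 * esr 1 y * (esr (-1) P - esr (-1) M) - 2 * osr 1 y * (osr (-1) P + osr (-1) M)
     + esr 1 x * ((esr (-1) P - esr 1 P) - (esr (-1) M - esr 1 M)) - osr 1 x * ((osr (-1) P - osr 1 P) - (osr (-1) M - osr 1 M))
     - (osr 1 P - osr 1 M - 2 * osr 1 y) / x - 2 * (osr 1 (P / 2) / P - osr 1 (M / 2) / M)"
proof -
  have "\<bar>P\<bar> \<le> 1/2" "\<bar>M\<bar> \<le> 1/2" using x y unfolding P_def M_def by linarith+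
  then have b: "\<bar>x\<bar> \<le> 1/2" "\<bar>y\<bar> \<le> 1/2" "\<bar>P\<bar> \<le> 1/2" "\<bar>M\<bar> \<le> 1/2" "\<bar>- x\<bar> \<le> 1/2" "\<bar>- y\<bar> \<le> 1/2" "\<bar>- P\<bar> \<le> 1/2" "\<bar>- M\<bar> \<le> 1/2"
    "\<bar>P / 2\<bar> \<le> 1/2" "\<bar>M / 2\<bar> \<le> 1/2" "\<bar>- P / 2\<bar> \<le> 1/2" "\<bar>- M / 2\<bar> \<le> 1/2" "\<bar>0::real\<bar> \<le> 1/2"
    using x y by simp_all
  have ne: "P \<noteq> 0" "M \<noteq> 0" "- P \<noteq> 0" "- M \<noteq> 0" "P / 2 \<noteq> 0" "M / 2 \<noteq> 0" "- P / 2 \<noteq> 0" "- M / 2 \<noteq> 0" using x y xy by (auto simp: P_def M_def)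
  have lim: "(\<lambda>N. (x * (\<Sum>k=1..N. aser x (- y) k) - x * (\<Sum>k=1..N. aser x y k))
     + (dzeta_upto x y N - dzeta_upto (- x) y N - dzeta_upto x (- y) N + dzeta_upto (- x) (- y) N)
     - (dzeta_upto (P / 2) y N - dzeta_upto (- M / 2) y N - dzeta_upto (M / 2) (- y) N + dzeta_upto (- P / 2) (- y) N) / 2
     - (dzeta_upto x (P / 2) N - dzeta_upto (- x) (- M / 2) N - dzeta_upto x (M / 2) N + dzeta_upto (- x) (- P / 2) N) / 2) \<longlonglongrightarrow>
     (x * (\<Sum>k. aser x (- y) (Suc k)) - x * (\<Sum>k. aser x y (Suc k)))
     + (dzeta x y - dzeta (- x) y - dzeta x (- y) + dzeta (- x) (- y))
     - (dzeta (P / 2) y - dzeta (- M / 2) y - dzeta (M / 2) (- y) + dzeta (- P / 2) (- y)) / 2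
     - (dzeta x (P / 2) - dzeta (- x) (- M / 2) - dzeta x (M / 2) + dzeta (- x) (- P / 2)) / 2"
    using x y b by (intro tendsto_intros sum_from_1_tendsto sum_shift_limit(1) dzeta_upto_tendsto) auto
  have a: "y + x = P" "x - y = M" "y - x = - M" "y + - x = - M" "- y + x = M" "- x - y = - P" "- y - x = - P" "- y + - x = - P"
    by (simp_all add: P_def M_def)
  have e: "(x * (\<Sum>k=1..N. aser x (- y) k) - x * (\<Sum>k=1..N. aser x y k))
     + (dzeta_upto x y N - dzeta_upto (- x) y N - dzeta_upto x (- y) N + dzeta_upto (- x) (- y) N)
     - (dzeta_upto (P / 2) y N - dzeta_upto (- M / 2) y N - dzeta_upto (M / 2) (- y) N + dzeta_upto (- P / 2) (- y) N) / 2
     - (dzeta_upto x (P / 2) N - dzeta_upto (- x) (- M / 2) N - dzeta_upto x (M / 2) N + dzeta_upto (- x) (- P / 2) N) / 2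
     = tA y x N - tA y (- x) N - tA (- y) x N + tA (- y) (- x) N" for N
    using sum_aser[of x y N] sum_aser[of x "- y" N] x y
    unfolding tA_def a add_divide_distrib diff_divide_distrib by linarith
  define mu where "mu N = (zs 1 1 x (P / 2) N / 2 - v2 P x N) - (zs 1 1 (- x) (- M / 2) N / 2 - v2 (- M) (- x) N)
     - (zs 1 1 x (M / 2) N / 2 - v2 M x N) + (zs 1 1 (- x) (- P / 2) N / 2 - v2 (- P) (- x) N)" for N
  have mu: "mu \<longlonglongrightarrow> 0" using mu_tendsto[OF x y] unfolding mu_def a .
  \<comment> \<open>The limits subtracted here cancel by \<open>esr_half\<close>, so
    \<open>lg\<close> is exactly the surviving multiple of \<open>hs 1 0 N\<close>, written as six
    products to which \<open>eps_log_tendsto\<close> applies.\<close>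
  define lg where "lg N = (hs 1 0 N * (eps 1 (P / 2) N - esr 1 (P / 2)) - hs 1 0 N * (eps 1 P N - esr 1 P) - hs 1 0 N * (eps (-1) P N - esr (-1) P))
     - (hs 1 0 N * (eps 1 (M / 2) N - esr 1 (M / 2)) - hs 1 0 N * (eps 1 M N - esr 1 M) - hs 1 0 N * (eps (-1) M N - esr (-1) M))" for N
  have lg: "lg \<longlonglongrightarrow> (0 - 0 - 0) - (0 - 0 - 0)"
    unfolding lg_def using b by (intro tendsto_diff eps_log_tendsto) auto
  have lg_eq: "lg N = hs 1 0 N * ((eps 1 (P / 2) N - eps 1 P N - eps (-1) P N) - (eps 1 (M / 2) N - eps 1 M N - eps (-1) M N))" for N
    unfolding lg_def esr_half[OF b(3), symmetric] esr_half[OF b(4), symmetric] by (simp add: algebra_simps)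
  \<comment> \<open>The unsigned corners occur twice with either sign, so the pi^2/6 cancel here,
    unlike in the nonalternating part.\<close>
  define KK where "KK N = (- kp (-1) (- x) P N + kp (-1) x (- M) N + kp (-1) (- x) M N - kp (-1) x (- P) N
     + kp 1 P (- x) N - kp 1 (- M) x N - kp 1 M (- x) N + kp 1 (- P) x N) / 2" for N
  have KK: "KK \<longlonglongrightarrow> (- 0 + 0 + 0 - 0 + pi\<^sup>2 / 6 - pi\<^sup>2 / 6 - pi\<^sup>2 / 6 + pi\<^sup>2 / 6) / 2"
    unfolding KK_def by (intro tendsto_divide tendsto_add tendsto_diff tendsto_minus tendsto_const kp_tendsto b) simp
  define FA where "FA N = - 2 * eps 1 y N * (eps (-1) P N - eps (-1) M N) - 2 * ops 1 y N * (ops (-1) P N + ops (-1) M N)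
     + eps 1 x N * ((eps (-1) P N - eps 1 P N) - (eps (-1) M N - eps 1 M N)) - ops 1 x N * ((ops (-1) P N - ops 1 P N) - (ops (-1) M N - ops 1 M N))
     - (ops 1 P N - ops 1 M N - 2 * ops 1 y N) / x - 2 * (ops 1 (P / 2) N / P - ops 1 (M / 2) N / M)" for N
  have FA: "FA \<longlonglongrightarrow> - 2 * esr 1 y * (esr (-1) P - esr (-1) M) - 2 * osr 1 y * (osr (-1) P + osr (-1) M)
     + esr 1 x * ((esr (-1) P - esr 1 P) - (esr (-1) M - esr 1 M)) - osr 1 x * ((osr (-1) P - osr 1 P) - (osr (-1) M - osr 1 M))
     - (osr 1 P - osr 1 M - 2 * osr 1 y) / x - 2 * (osr 1 (P / 2) / P - osr 1 (M / 2) / M)"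
    unfolding FA_def by (intro tendsto_add tendsto_diff tendsto_mult tendsto_divide tendsto_const eps_tendsto ops_tendsto b ne) (use x in auto)
  have eq: "tA y x N - tA y (- x) N - tA (- y) x N + tA (- y) (- x) N = FA N + KK N + lg N - mu N" for N
  proof -
    have h: "hs s x N = hs s 0 N + eps s x N + ops s x N" "hs s (- x) N = hs s 0 N + eps s x N - ops s x N"
      "hs s y N = hs s 0 N + eps s y N + ops s y N" "hs s (- y) N = hs s 0 N + eps s y N - ops s y N"
      "hs s P N = hs s 0 N + eps s P N + ops s P N" "hs s (- P) N = hs s 0 N + eps s P N - ops s P N"
      "hs s M N = hs s 0 N + eps s M N + ops s M N" "hs s (- M) N = hs s 0 N + eps s M N - ops s M N"
      "hs s (P / 2) N = hs s 0 N + eps s (P / 2) N + ops s (P / 2) N" "hs s (- P / 2) N = hs s 0 N + eps s (P / 2) N - ops s (P / 2) N"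
      "hs s (M / 2) N = hs s 0 N + eps s (M / 2) N + ops s (M / 2) N" "hs s (- M / 2) N = hs s 0 N + eps s (M / 2) N - ops s (M / 2) N" for s
      using b(1-12)[THEN hs_decomp, of s N] by simp_all
    have yP: "y - P = - x" "y - - M = x" "- y - M = - x" "- y - - P = x" by (simp_all add: P_def M_def)
    have ne': "P \<noteq> y" "- M \<noteq> y" "M \<noteq> - y" "- P \<noteq> - y" using x by (auto simp: P_def M_def)
    have d1: "dg 1 P y N = (hs 1 P N - hs 1 y N) / x" "dg 1 (- M) y N = (hs 1 y N - hs 1 (- M) N) / x"
      "dg 1 M (- y) N = (hs 1 M N - hs 1 (- y) N) / x" "dg 1 (- P) (- y) N = (hs 1 (- y) N - hs 1 (- P) N) / x"
      using dg_eq[OF b(3) b(2) ne'(1), of 1 N] dg_eq[OF b(8) b(2) ne'(2), of 1 N] dg_eq[OF b(4) b(6) ne'(3), of 1 N] dg_eq[OF b(7) b(6) ne'(4), of 1 N]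
      unfolding yP by (simp_all add: diff_divide_distrib)
    have d2: "dg 1 (P / 2) 0 N = 2 * (hs 1 (P / 2) N - hs 1 0 N) / P" "dg 1 (- P / 2) 0 N = - (2 * (hs 1 (- P / 2) N - hs 1 0 N) / P)"
      "dg 1 (M / 2) 0 N = 2 * (hs 1 (M / 2) N - hs 1 0 N) / M" "dg 1 (- M / 2) 0 N = - (2 * (hs 1 (- M / 2) N - hs 1 0 N) / M)"
      using dg_eq[OF b(9) b(13) ne(5), of 1 N] dg_eq[OF b(11) b(13) ne(7), of 1 N] dg_eq[OF b(10) b(13) ne(6), of 1 N] dg_eq[OF b(12) b(13) ne(8), of 1 N]
        ne(1,2) by (simp_all add: field_simps)
    have xy': "\<bar>x\<bar> \<le> 1/4" "\<bar>- x\<bar> \<le> 1/4" "\<bar>y\<bar> \<le> 1/4" "\<bar>- y\<bar> \<le> 1/4" using x y by auto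
    have nl: "(- hs 1 y N * hs (-1) P N + hs 1 (- x) N * hs (-1) P N / 2 - hs 1 P N * hs 1 (- x) N / 2 + hs 1 (P / 2) N * hs 1 0 N / 2)
      - (- hs 1 y N * hs (-1) (- M) N + hs 1 x N * hs (-1) (- M) N / 2 - hs 1 (- M) N * hs 1 x N / 2 + hs 1 (- M / 2) N * hs 1 0 N / 2)
      - (- hs 1 (- y) N * hs (-1) M N + hs 1 (- x) N * hs (-1) M N / 2 - hs 1 M N * hs 1 (- x) N / 2 + hs 1 (M / 2) N * hs 1 0 N / 2)
      + (- hs 1 (- y) N * hs (-1) (- P) N + hs 1 x N * hs (-1) (- P) N / 2 - hs 1 (- P) N * hs 1 x N / 2 + hs 1 (- P / 2) N * hs 1 0 N / 2)
      = - 2 * eps 1 y N * (eps (-1) P N - eps (-1) M N) - 2 * ops 1 y N * (ops (-1) P N + ops (-1) M N)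
     + eps 1 x N * ((eps (-1) P N - eps 1 P N) - (eps (-1) M N - eps 1 M N)) - ops 1 x N * ((ops (-1) P N - ops 1 P N) - (ops (-1) M N - ops 1 M N))
     + lg N"
      unfolding h lg_eq by (rule quad_sum_A)
    have dl: "(dg 1 P y N / 2 + dg 1 (P / 2) 0 N / 2) - (dg 1 (- M) y N / 2 + dg 1 (- M / 2) 0 N / 2)
      - (dg 1 M (- y) N / 2 + dg 1 (M / 2) 0 N / 2) + (dg 1 (- P) (- y) N / 2 + dg 1 (- P / 2) 0 N / 2)
      = (ops 1 P N - ops 1 M N - 2 * ops 1 y N) / x + 2 * (ops 1 (P / 2) N / P - ops 1 (M / 2) N / M)"
      unfolding d1 d2 h by (simp add: add_divide_distrib diff_divide_distrib)
    note t = tA_eq[OF xy'(3) xy'(1), of N] tA_eq[OF xy'(3) xy'(2), of N] tA_eq[OF xy'(4) xy'(1), of N] tA_eq[OF xy'(4) xy'(2), of N]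
    show ?thesis
      using t[unfolded a minus_minus] nl dl unfolding FA_def KK_def mu_def add_divide_distrib diff_divide_distrib minus_divide_left[symmetric]
      by linarith
  qed
  have "(\<lambda>N. FA N + KK N + lg N - mu N) \<longlonglongrightarrow> (- 2 * esr 1 y * (esr (-1) P - esr (-1) M) - 2 * osr 1 y * (osr (-1) P + osr (-1) M)
     + esr 1 x * ((esr (-1) P - esr 1 P) - (esr (-1) M - esr 1 M)) - osr 1 x * ((osr (-1) P - osr 1 P) - (osr (-1) M - osr 1 M))
     - (osr 1 P - osr 1 M - 2 * osr 1 y) / x - 2 * (osr 1 (P / 2) / P - osr 1 (M / 2) / M)) +
     (- 0 + 0 + 0 - 0 + pi\<^sup>2 / 6 - pi\<^sup>2 / 6 - pi\<^sup>2 / 6 + pi\<^sup>2 / 6) / 2 + ((0 - 0 - 0) - (0 - 0 - 0)) - 0"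
    by (intro tendsto_add tendsto_diff FA KK lg mu)
  from LIMSEQ_unique[OF lim[unfolded e eq] this] show ?thesis by (simp add: right_diff_distrib)
qed

subsection \<open>Cotangent series\<close>

lemma Gamma_reflection_real:
  assumes "0 < x" "x < 1"
  shows "Gamma x * Gamma (1 - x) = pi / sin (pi * (x::real))"
proof -
  have "complex_of_real (Gamma x * Gamma (1 - x)) = of_real (pi / sin (pi * x))"
    using Gamma_reflection_complex[of "of_real x"]
    by (simp flip: Gamma_complex_of_real sin_of_real)
  then show ?thesis by (simp only: of_real_eq_iff)
qed

lemma not_nonpos_Int: "0 < x \<Longrightarrow> (x::real) \<notin> \<int>\<^sub>\<le>\<^sub>0"
  by (auto elim!: nonpos_Ints_cases)

text \<open>Logarithmic derivative of the reflection formula for Gamma; a further derivative gives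
  \<open>Polygamma1_reflection_real\<close>.\<close>

lemma Digamma_reflection_real:
  assumes x: "0 < x" "x < 1"
  shows "Digamma (1 - x) - Digamma x = pi * cot (pi * (x::real))"
proof -
  have s: "sin (pi * x) > 0" using x by (intro sin_gt_zero) auto
  have "((\<lambda>x. Gamma x * Gamma (1 - x)) has_field_derivative
      Gamma x * Gamma (1 - x) * (Digamma x - Digamma (1 - x))) (at x)"
  proof -
    have "(Gamma has_field_derivative Gamma x * Digamma x) (at x)"
      using x by (intro has_field_derivative_Gamma not_nonpos_Int) auto
    moreover have "((\<lambda>x. Gamma (1 - x)) has_field_derivative Gamma (1 - x) * Digamma (1 - x) * (0 - 1)) (at x)"
      using x by (intro DERIV_chain2[where f = Gamma] has_field_derivative_Gamma not_nonpos_Int DERIV_diff DERIV_const DERIV_ident) auto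
    ultimately have "((\<lambda>x. Gamma x * Gamma (1 - x)) has_field_derivative
        Gamma x * Digamma x * Gamma (1 - x) + Gamma (1 - x) * Digamma (1 - x) * (0 - 1) * Gamma x) (at x)"
      by (rule DERIV_mult)
    then show ?thesis by (simp add: algebra_simps)
  qed
  moreover have "((\<lambda>x. pi / sin (pi * x)) has_field_derivative (pi / sin (pi * x)) * (- (pi * cot (pi * x)))) (at x)"
  proof -
    have "((\<lambda>x. sin (pi * x)) has_field_derivative cos (pi * x) * (pi * 1)) (at x)"
      by (intro DERIV_chain2[where f = sin] DERIV_sin DERIV_cmult DERIV_ident)
    from DERIV_divide[OF DERIV_const[of pi] this] show ?thesis using s
      by (simp add: cot_def power2_eq_square ac_simps)
  qed
  then have "((\<lambda>x. Gamma x * Gamma (1 - x)) has_field_derivative (pi / sin (pi * x)) * (- (pi * cot (pi * x)))) (at x)"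
    by (rule has_field_derivative_transform_within_open[of _ _ _ "{0<..<1}"]) (use x in \<open>auto simp: Gamma_reflection_real\<close>)
  ultimately have "Gamma x * Gamma (1 - x) * (Digamma x - Digamma (1 - x)) = (pi / sin (pi * x)) * (- (pi * cot (pi * x)))"
    by (rule DERIV_unique)
  then have "Digamma x - Digamma (1 - x) = - (pi * cot (pi * x))"
    unfolding Gamma_reflection_real[OF x] using s by (subst (asm) mult_left_cancel) auto
  then show ?thesis by linarith
qed

lemma Polygamma1_reflection_real:
  assumes x: "0 < x" "x < 1"
  shows "Polygamma 1 (1 - x) + Polygamma 1 x = pi\<^sup>2 / (sin (pi * (x::real)))\<^sup>2"
proof -
  have s: "sin (pi * x) > 0" using x by (intro sin_gt_zero) auto
  have "((\<lambda>x. Digamma (1 - x) - Digamma x) has_field_derivative - Polygamma 1 (1 - x) - Polygamma 1 x) (at x)"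
  proof -
    have "(Digamma has_field_derivative Polygamma 1 x) (at x)"
      using has_field_derivative_Polygamma[OF not_nonpos_Int, of x 0] x by simp
    moreover have "((\<lambda>x. Digamma (1 - x)) has_field_derivative Polygamma 1 (1 - x) * (0 - 1)) (at x)"
      using has_field_derivative_Polygamma[OF not_nonpos_Int, of "1 - x" 0] x
      by (intro DERIV_chain2[where f = Digamma] DERIV_diff DERIV_const DERIV_ident) auto
    ultimately show ?thesis using DERIV_diff[of "\<lambda>x. Digamma (1 - x)" _ x UNIV Digamma] by simp
  qed
  moreover have "((\<lambda>x. pi * cot (pi * x)) has_field_derivative - (pi\<^sup>2 / (sin (pi * x))\<^sup>2)) (at x)"
    using DERIV_cmult[OF DERIV_chain2[OF DERIV_cot[of "pi * x"] DERIV_cmult[OF DERIV_ident, of pi]], of pi] s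
    by (simp add: field_simps power2_eq_square)
  then have "((\<lambda>x. Digamma (1 - x) - Digamma x) has_field_derivative - (pi\<^sup>2 / (sin (pi * x))\<^sup>2)) (at x)"
    by (rule has_field_derivative_transform_within_open[of _ _ _ "{0<..<1}"]) (use x in \<open>auto simp: Digamma_reflection_real\<close>)
  ultimately have "- Polygamma 1 (1 - x) - Polygamma 1 x = - (pi\<^sup>2 / (sin (pi * x))\<^sup>2)" by (rule DERIV_unique)
  then show ?thesis by simp
qed

text \<open>The partial fraction series of the cotangent. In the difference of the limit formulas
  for Digamma at x and 1 - x the logarithms cancel.\<close>

lemma osr_cot:
  assumes x: "0 < x" "x \<le> 1/2"
  shows "osr 1 x = (1 / x - pi * cot (pi * x)) / 2"
proof -
  have "(\<lambda>m. (of_real (ln (real m)) - (\<Sum>n<m. inverse (x + of_nat n))) - (of_real (ln (real m)) - (\<Sum>n<m. inverse (1 - x + of_nat n))))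
     \<longlonglongrightarrow> Digamma x - Digamma (1 - x)"
    using x by (intro tendsto_diff Digamma_LIMSEQ) auto
  also have "(\<lambda>m. (of_real (ln (real m)) - (\<Sum>n<m. inverse (x + of_nat n))) - (of_real (ln (real m)) - (\<Sum>n<m. inverse (1 - x + of_nat n))))
     = (\<lambda>m. 2 * ops 1 x m - 1 / x + 1 / (real m + x))"
  proof
    fix m
    \<comment> \<open>The denominators are 1 - x, ..., m - x and x, ..., x + m - 1; pairing k - x
      with k + x leaves 1/x over and lacks 1/(m + x).\<close>
    have "(\<Sum>n<m. inverse (1 - x + of_nat n)) - (\<Sum>n<m. inverse (x + of_nat n)) = 2 * ops 1 x m - 1 / x + 1 / (real m + x)"
    proof (induction m)
      case (Suc m)
      define k where "k = real (Suc m)"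
      have k: "k - x > 0" "k + x > 0" "real m = k - 1" "real m + x > 0" using x unfolding k_def by auto
      have "2 * (x / (k\<^sup>2 - x\<^sup>2)) = 1 / (k - x) - 1 / (k + x)"
      proof -
        have e: "k\<^sup>2 - x\<^sup>2 = (k - x) * (k + x)" by (simp add: power2_eq_square algebra_simps)
        show ?thesis unfolding e using k by (simp add: divide_simps)
      qed
      then have o: "2 * ops 1 x (Suc m) = 2 * ops 1 x m + (1 / (k - x) - 1 / (k + x))"
        by (simp add: ops_def k_def distrib_left)
      have i: "inverse (1 - x + real m) = 1 / (k - x)" "inverse (x + real m) = 1 / (real m + x)" by (simp_all add: k_def inverse_eq_divide add_ac)
      have kk: "real (Suc m) + x = k + x" by (simp add: k_def)
      show ?case unfolding o kk sum.lessThan_Suc i using Suc.IH by linarith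
    qed (use x in \<open>simp add: ops_def\<close>)
    then show "(of_real (ln (real m)) - (\<Sum>n<m. inverse (x + of_nat n))) - (of_real (ln (real m)) - (\<Sum>n<m. inverse (1 - x + of_nat n))) = 2 * ops 1 x m - 1 / x + 1 / (real m + x)"
      by simp
  qed
  finally have 1: "(\<lambda>m. 2 * ops 1 x m - 1 / x + 1 / (real m + x)) \<longlonglongrightarrow> Digamma x - Digamma (1 - x)" .
  have "(\<lambda>m. 1 / (real m + x)) \<longlonglongrightarrow> 0"
    using filterlim_tendsto_add_at_top[OF tendsto_const[of x] filterlim_real_sequentially]
    by (intro tendsto_divide_0[OF tendsto_const] filterlim_at_top_imp_at_infinity) (simp add: add.commute)
  then have "(\<lambda>m. 2 * ops 1 x m - 1 / x + 1 / (real m + x)) \<longlonglongrightarrow> 2 * osr 1 x - 1 / x + 0"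
    using x by (intro tendsto_intros ops_tendsto) auto
  then have "2 * osr 1 x - 1 / x + 0 = Digamma x - Digamma (1 - x)" using 1 LIMSEQ_unique by blast
  then show ?thesis using Digamma_reflection_real[of x] x by simp
qed

text \<open>\<open>d2 x\<close> and \<open>d2 (- x)\<close> are trigamma values at 1 - x and at x,
  the latter without its first term 1/x^2.\<close>

lemma d2_sum:
  assumes x: "0 < x" "x \<le> 1/2"
  shows "d2 x + d2 (- x) = pi\<^sup>2 / (sin (pi * x))\<^sup>2 - 1 / x\<^sup>2"
proof -
  have 1: "(\<lambda>k. inverse ((1 - x + of_nat k) ^ Suc 1)) sums Polygamma 1 (1 - x)"
    using Polygamma_LIMSEQ[of "1 - x" 1] x by simp
  have "inverse ((1 - x + of_nat k) ^ Suc 1) = (rcp x (Suc k))\<^sup>2" for k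
    by (simp add: rcp_def inverse_eq_divide power2_eq_square algebra_simps)
  then have "d2 x = Polygamma 1 (1 - x)" using 1 unfolding d2_def by (simp add: sums_iff)
  moreover have 2: "(\<lambda>k. inverse ((x + of_nat k) ^ Suc 1)) sums Polygamma 1 x"
    using Polygamma_LIMSEQ[of x 1] x by simp
  have "(\<lambda>k. inverse ((x + of_nat (Suc k)) ^ Suc 1)) sums (Polygamma 1 x - inverse ((x + of_nat 0) ^ Suc 1))"
    using sums_Suc_iff[of "\<lambda>k. inverse ((x + of_nat k) ^ Suc 1)"] 2 by simp
  moreover have "inverse ((x + of_nat (Suc k)) ^ Suc 1) = (rcp (- x) (Suc k))\<^sup>2" for k
    by (simp add: rcp_def inverse_eq_divide power2_eq_square add_ac)
  ultimately have "d2 (- x) = Polygamma 1 x - 1 / x\<^sup>2" unfolding d2_def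
    by (simp add: sums_iff inverse_eq_divide power2_eq_square)
  then show ?thesis using Polygamma1_reflection_real[of x] x \<open>d2 x = _\<close> by simp
qed

subsection \<open>Generating functions of zeta values\<close>

lemma mzv_1_eq: "mzv [k] = (\<Sum>\<^sub>\<infinity>n\<in>{1..}. 1 / real n ^ k)"
  unfolding mzv_def
  by (rule infsum_reindex_bij_witness[where i = "\<lambda>n. [n]" and j = hd])
     (auto simp: length_Suc_conv Suc_le_eq)

lemma mzv_2_eq: "mzv [k, l] = (\<Sum>\<^sub>\<infinity>(n, m)\<in>less_pairs. (1 / real n ^ k) * (1 / real m ^ l))"
  unfolding mzv_def
  by (rule infsum_reindex_bij_witness[where i = "\<lambda>(n, m). [n, m]" and j = "\<lambda>ns. (ns ! 0, ns ! 1)"])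
     (auto simp: length_Suc_conv less_pairs_def numeral_2_eq_2 lessThan_Suc)

text \<open>One predicate for \<open>zeta1\<close> with s = 1 and \<open>zeta_bar\<close> with s =
  -1. The condition c 1 = 0 mirrors the subtraction of 1/n in the series \<open>psr\<close>.\<close>

definition zeta_coeffs :: "real \<Rightarrow> (nat \<Rightarrow> real) \<Rightarrow> bool" where
  "zeta_coeffs s c \<longleftrightarrow> \<bar>s\<bar> = 1 \<and> c 1 = 0 \<and> (\<forall>k\<ge>2. ((\<lambda>n. s ^ n / real n ^ k) has_sum c k) {1..})"

lemma zeta_coeffs_zeta1: "zeta_coeffs 1 zeta1"
  using summable_on_inverse_power by (auto simp: zeta_coeffs_def zeta1_def mzv_1_eq)

text \<open>The alternating sum is twice the even terms minus all terms, which explains the factor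
  2^(1-k) - 1.\<close>

lemma zeta_coeffs_zeta_bar: "zeta_coeffs (-1) zeta_bar"
proof -
  have "((\<lambda>n. (-1) ^ n / real n ^ k) has_sum zeta_bar k) {1..}" if k: "k \<ge> 2" for k
  proof -
    have z: "((\<lambda>n. 1 / real n ^ k) has_sum zeta1 k) {1..}"
      using zeta_coeffs_zeta1 k by (simp add: zeta_coeffs_def)
    have "((\<lambda>n. 2 / 2 ^ k * (1 / real n ^ k)) has_sum 2 / 2 ^ k * zeta1 k) {1..}"
      by (rule has_sum_cmult_right[OF z])
    then have "((\<lambda>n. 2 / real n ^ k) has_sum 2 / 2 ^ k * zeta1 k) {n. 1 \<le> n \<and> even n}"
      by (subst has_sum_reindex_bij_witness[where i = "\<lambda>n. 2 * n" and j = "\<lambda>n. n div 2" and T = "{1..}"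
           and h = "\<lambda>n. 2 / 2 ^ k * (1 / real n ^ k)" and s' = "2 / 2 ^ k * zeta1 k"])
         (auto elim!: evenE simp: power_mult_distrib)
    then have "((\<lambda>n. if even n then 2 / real n ^ k else 0) has_sum 2 / 2 ^ k * zeta1 k) {1..}"
      by (subst has_sum_cong_neutral[where T = "{n. 1 \<le> n \<and> even n}" and g = "\<lambda>n. 2 / real n ^ k"]) auto
    from has_sum_add[OF this has_sum_cmult_right[OF z, of "-1"]]
    have "((\<lambda>n. (if even n then 2 / real n ^ k else 0) + - 1 * (1 / real n ^ k)) has_sum (2 / 2 ^ k - 1) * zeta1 k) {1..}"
      by (simp add: algebra_simps)
    moreover have "(2 :: real) powi (1 - int k) = 2 / 2 ^ k" by (simp add: power_int_diff)
    then have "(2 / 2 ^ k - 1) * zeta1 k = zeta_bar k" by (simp add: zeta_bar_def algebra_simps)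
    moreover have "(if even n then 2 / real n ^ k else 0) + - 1 * (1 / real n ^ k) = (-1) ^ n / real n ^ k" for n
      by (simp add: diff_divide_distrib[symmetric])
    ultimately show ?thesis by simp
  qed
  then show ?thesis by (simp add: zeta_coeffs_def zeta_bar_def zeta1_def)
qed

lemma geometric_term:
  assumes "\<bar>X\<bar> \<le> 1/2" "1 \<le> n"
  shows "((\<lambda>k. X ^ (k + 1) / real n ^ (k + 2)) has_sum (rcp X n - rcp 0 n)) UNIV"
proof -
  have n: "real n \<ge> 1" using assms by simp
  have nX: "real n - X > 0" using assms n by linarith
  have q: "\<bar>X / real n\<bar> < 1" using assms n by (simp add: field_simps)
  have "(\<lambda>k. (X / real n) ^ k) sums (1 / (1 - X / real n))" using q by (intro geometric_sums) auto
  moreover have "summable (\<lambda>k. norm ((X / real n) ^ k))" using q by (simp add: norm_power summable_geometric power_abs)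
  ultimately have "((\<lambda>k. (X / real n) ^ k) has_sum (1 / (1 - X / real n))) UNIV" by (intro norm_summable_imp_has_sum)
  then have "((\<lambda>k. X / (real n)\<^sup>2 * (X / real n) ^ k) has_sum X / (real n)\<^sup>2 * (1 / (1 - X / real n))) UNIV"
    by (rule has_sum_cmult_right)
  moreover have "X / (real n)\<^sup>2 * (X / real n) ^ k = X ^ (k + 1) / real n ^ (k + 2)" for k
    by (simp add: power_divide power2_eq_square)
  moreover have "X / (real n)\<^sup>2 * (1 / (1 - X / real n)) = rcp X n - rcp 0 n"
    using n nX by (simp add: rcp_def divide_simps power2_eq_square)
  ultimately show ?thesis by simp
qed

lemma power_family_summable:
  assumes "\<bar>X\<bar> \<le> 1/2"
  shows "(\<lambda>(n, k). X ^ (k + 1) / real n ^ (k + 2)) summable_on {1..} \<times> UNIV"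
proof -
  have "((\<lambda>k. (1/2) ^ k :: real) has_sum 2) UNIV"
    using geometric_sums[of "1/2 :: real"] by (intro norm_summable_imp_has_sum) (auto simp: summable_geometric)
  with has_sum_infsum[OF summable_on_inverse_power[of 2]]
  have "(\<lambda>(n, k). 1 / real n ^ 2 * (1/2) ^ k) summable_on {1..} \<times> UNIV"
    by (intro has_sum_imp_summable[OF has_sum_Times_real]) auto
  then have "(\<lambda>t. norm (case t of (n, k) \<Rightarrow> X ^ (k + 1) / real n ^ (k + 2))) summable_on {1..} \<times> UNIV"
  proof (rule Infinite_Sum.abs_summable_on_comparison_test')
    fix t :: "nat \<times> nat" assume "t \<in> {1..} \<times> UNIV"
    then obtain n k where t: "t = (n, k)" "1 \<le> n" by auto
    have "\<bar>X\<bar> ^ (k + 1) / real n ^ (k + 2) \<le> (1/2) ^ k / real n ^ 2"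
    proof (rule frac_le)
      have "\<bar>X\<bar> ^ (k + 1) \<le> (1/2) ^ (k + 1)" using assms by (intro power_mono) auto
      also have "\<dots> \<le> (1/2) ^ k" by (intro power_decreasing) auto
      finally show "\<bar>X\<bar> ^ (k + 1) \<le> (1/2) ^ k" .
      show "real n ^ 2 \<le> real n ^ (k + 2)" using t by (intro power_increasing) auto
    qed (use t in auto)
    then show "norm (case t of (n, k) \<Rightarrow> X ^ (k + 1) / real n ^ (k + 2)) \<le> (case t of (n, k) \<Rightarrow> 1 / real n ^ 2 * (1/2) ^ k)"
      by (simp add: t abs_mult power_abs)
  qed
  then show ?thesis by (rule abs_summable_summable)
qed

text \<open>The terms s^n X^(k+1)/n^(k+2) are summed over k first, a geometric series, and then over
  n first, which gives the coefficients.\<close>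

lemma has_sum_psr_aux:
  assumes X: "\<bar>X\<bar> \<le> 1/2" and c: "zeta_coeffs s c"
  shows "((\<lambda>k. c (k + 2) * X ^ (k + 1)) has_sum psr s X) UNIV"
proof -
  have s: "\<bar>s\<bar> = 1" using c by (simp add: zeta_coeffs_def)
  define f where "f = (\<lambda>(n, k). s ^ n * (X ^ (k + 1) / real n ^ (k + 2)))"
  have "norm (f t) = norm (case t of (n, k) \<Rightarrow> X ^ (k + 1) / real n ^ (k + 2))" for t
    by (simp add: f_def case_prod_unfold abs_mult power_abs s)
  then have "(\<lambda>t. norm (f t)) summable_on {1..} \<times> UNIV"
    using summable_on_iff_abs_summable_on_real[THEN iffD1, OF power_family_summable[OF X]] by simp
  then have "f summable_on {1..} \<times> UNIV" by (rule abs_summable_summable)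
  then obtain S where S: "(f has_sum S) ({1..} \<times> UNIV)" by (auto simp: summable_on_def)
  have "((\<lambda>n. s ^ n * (rcp X n - rcp 0 n)) has_sum S) {1..}"
  proof (rule has_sum_SigmaD[OF S])
    fix n :: nat assume "n \<in> {1..}"
    then show "((\<lambda>k. f (n, k)) has_sum s ^ n * (rcp X n - rcp 0 n)) UNIV"
      unfolding f_def prod.case by (intro has_sum_cmult_right geometric_term[OF X]) simp
  qed
  then have "(\<lambda>N. \<Sum>n\<in>{1..N}. s ^ n * (rcp X n - rcp 0 n)) \<longlonglongrightarrow> S"
    by (rule has_sum_exhaust) (auto simp: mono_def)
  moreover have "(\<Sum>n\<in>{1..N}. s ^ n * (rcp X n - rcp 0 n)) = pps s X N" for N
    using hs_pps[OF X, of s N] by (simp add: hs_def right_diff_distrib sum_subtractf)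
  ultimately have "S = psr s X" using pps_tendsto[OF X s] LIMSEQ_unique by auto
  moreover have "((\<lambda>(k, n). f (n, k)) has_sum S) (UNIV \<times> {1..})"
    using S by (subst has_sum_swap) (simp add: case_prod_unfold)
  then have "((\<lambda>k. X ^ (k + 1) * c (k + 2)) has_sum S) UNIV"
  proof (rule has_sum_SigmaD)
    fix k :: nat
    have "((\<lambda>n. s ^ n / real n ^ (k + 2)) has_sum c (k + 2)) {1..}" using c unfolding zeta_coeffs_def by (meson le_add2)
    from has_sum_cmult_right[OF this, of "X ^ (k + 1)"]
    show "((\<lambda>n. case (k, n) of (k, n) \<Rightarrow> f (n, k)) has_sum X ^ (k + 1) * c (k + 2)) {1..}"
      by (simp add: f_def ac_simps)
  qed
  ultimately show ?thesis by (simp add: mult.commute)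
qed

lemma has_sum_psr:
  assumes X: "\<bar>X\<bar> \<le> 1/2" and c: "zeta_coeffs s c"
  shows "((\<lambda>k. c (k + 1) * X ^ k) has_sum psr s X) UNIV"
proof -
  have "((\<lambda>k. c (k + 1) * X ^ k) has_sum psr s X) {1..}"
    using has_sum_psr_aux[OF assms]
    by (subst has_sum_reindex_bij_witness[where i = Suc and j = "\<lambda>k. k - 1" and T = UNIV
        and h = "\<lambda>k. c (k + 2) * X ^ (k + 1)" and s' = "psr s X"]) auto
  then show ?thesis
    by (subst has_sum_cong_neutral[where T = "{1..}" and g = "\<lambda>k. c (k + 1) * X ^ k"])
       (use c in \<open>auto simp: zeta_coeffs_def not_le\<close>)
qed

text \<open>The second assumption is the absolute summability of all monomials at once: by the
  binomial theorem their norms add up to a power of |x| + |y|.\<close>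

lemma has_sum_binomial:
  fixes \<beta> :: "'i \<Rightarrow> 'a::{real_normed_field, banach}"
  assumes 1: "((\<lambda>i. \<beta> i * (x + y) ^ d i) has_sum S) I" and 2: "(\<lambda>i. norm (\<beta> i) * (norm x + norm y) ^ d i) summable_on I"
  shows "((\<lambda>(i, k). \<beta> i * of_nat (d i choose k) * x ^ k * y ^ (d i - k)) has_sum S) (SIGMA i:I. {..d i})"
proof (rule has_sum_SigmaI[OF _ 1])
  show "((\<lambda>k. case (i, k) of (i, k) \<Rightarrow> \<beta> i * of_nat (d i choose k) * x ^ k * y ^ (d i - k)) has_sum \<beta> i * (x + y) ^ d i) {..d i}" for i
    by (rule has_sum_finiteI) (simp_all add: binomial_ring sum_distrib_left mult.assoc)
  have "(\<lambda>t. norm (case t of (i, k) \<Rightarrow> \<beta> i * of_nat (d i choose k) * x ^ k * y ^ (d i - k))) summable_on (SIGMA i:I. {..d i})"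
  proof (rule summable_on_SigmaI[OF _ 2])
    fix i
    show "((\<lambda>k. norm (case (i, k) of (i, k) \<Rightarrow> \<beta> i * of_nat (d i choose k) * x ^ k * y ^ (d i - k))) has_sum norm (\<beta> i) * (norm x + norm y) ^ d i) {..d i}"
      by (rule has_sum_finiteI) (simp_all add: norm_mult norm_power binomial_ring sum_distrib_left mult.assoc)
  qed auto
  then show "(\<lambda>(i, k). \<beta> i * of_nat (d i choose k) * x ^ k * y ^ (d i - k)) summable_on (SIGMA i:I. {..d i})"
    by (rule abs_summable_summable)
qed

lemma has_sum_psr2:
  assumes xy: "\<bar>x\<bar> + \<bar>y\<bar> \<le> 1/2" and c: "zeta_coeffs s c"
  shows "((\<lambda>(k, l). c (k + l + 1) * real ((k + l) choose k) * x ^ k * y ^ l) has_sum psr s (x + y)) UNIV"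
proof -
  have "\<bar>x + y\<bar> \<le> 1/2" using xy by linarith
  note 1 = has_sum_psr[OF this c]
  have "(\<lambda>i. c (i + 1) * (\<bar>x\<bar> + \<bar>y\<bar>) ^ i) summable_on UNIV"
    using xy by (intro has_sum_imp_summable[OF has_sum_psr[OF _ c]]) auto
  then have 2: "(\<lambda>i. norm (c (i + 1)) * (norm x + norm y) ^ i) summable_on UNIV"
    using summable_on_iff_abs_summable_on_real[where f = "\<lambda>i. c (i + 1) * (\<bar>x\<bar> + \<bar>y\<bar>) ^ i"] by (simp add: abs_mult)
  show ?thesis
    using has_sum_binomial[OF 1 2]
    by (subst has_sum_reindex_bij_witness[where i = "\<lambda>(i, k). (k, i - k)" and j = "\<lambda>(k, l). (k + l, k)"
          and h = "\<lambda>(i, k). c (i + 1) * real (i choose k) * x ^ k * y ^ (i - k)" and T = "SIGMA i:UNIV. {..i}" and s' = "psr s (x + y)"])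
       auto
qed

text \<open>Averaging over the four sign changes keeps the monomials whose exponents have parities p
  and q. This is how the values at \<plusminus>x, \<plusminus>y and \<plusminus>x \<plusminus>y
  combine into series in x^(2a) y^(2b).\<close>

lemma has_sum_parity:
  fixes c :: "nat \<Rightarrow> nat \<Rightarrow> 'a::real_normed_field"
  assumes f: "\<And>s t. s \<in> {1, -1} \<Longrightarrow> t \<in> {1, -1} \<Longrightarrow> ((\<lambda>(k, l). c k l * (s * x) ^ k * (t * y) ^ l) has_sum f s t) UNIV"
    and pq: "p \<in> {0, 1}" "q \<in> {0, 1}"
  shows "((\<lambda>(a, b). c (2 * a + p) (2 * b + q) * x ^ (2 * a + p) * y ^ (2 * b + q)) has_sum
     (f 1 1 + (-1) ^ p * f (-1) 1 + (-1) ^ q * f 1 (-1) + (-1) ^ p * (-1) ^ q * f (-1) (-1)) / 4) UNIV"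
proof -
  define g where "g = (\<lambda>(k, l). c k l * x ^ k * y ^ l)"
  have e: "2 * (k div 2) + r = k" "2 * (k div 2) + Suc 0 = k \<or> r \<noteq> 1" if "even (k + r)" "r \<in> {0, 1}" for k r :: nat using that by auto
  have e': "even (2 * k + r + r)" "(2 * k + r) div 2 = k" if "r \<in> {0, 1}" for k r :: nat using that by auto
  have "((\<lambda>(k, l). (c k l * (1 * x) ^ k * (1 * y) ^ l + (-1) ^ p * (c k l * (-1 * x) ^ k * (1 * y) ^ l)
      + (-1) ^ q * (c k l * (1 * x) ^ k * (-1 * y) ^ l) + (-1) ^ p * (-1) ^ q * (c k l * (-1 * x) ^ k * (-1 * y) ^ l)) / 4)
      has_sum (f 1 1 + (-1) ^ p * f (-1) 1 + (-1) ^ q * f 1 (-1) + (-1) ^ p * (-1) ^ q * f (-1) (-1)) / 4) UNIV"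
    unfolding case_prod_unfold
    by (intro has_sum_divide_const has_sum_add has_sum_cmult_right f[unfolded case_prod_unfold]) auto
  moreover have "(c k l * (1 * x) ^ k * (1 * y) ^ l + (-1) ^ p * (c k l * (-1 * x) ^ k * (1 * y) ^ l)
      + (-1) ^ q * (c k l * (1 * x) ^ k * (-1 * y) ^ l) + (-1) ^ p * (-1) ^ q * (c k l * (-1 * x) ^ k * (-1 * y) ^ l)) / 4
    = (if even (k + p) \<and> even (l + q) then g (k, l) else 0)" for k l
    using pq by (cases "even k"; cases "even l") (auto simp: g_def)
  ultimately have "((\<lambda>(k, l). if even (k + p) \<and> even (l + q) then g (k, l) else 0) has_sum
     (f 1 1 + (-1) ^ p * f (-1) 1 + (-1) ^ q * f 1 (-1) + (-1) ^ p * (-1) ^ q * f (-1) (-1)) / 4) UNIV" (is "(_ has_sum ?S) UNIV") by simp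
  then have "(g has_sum ?S) {(k, l). even (k + p) \<and> even (l + q)}"
    by (subst (asm) has_sum_cong_neutral[where T = "{(k, l). even (k + p) \<and> even (l + q)}" and g = g]) (auto split: if_splits)
  then show ?thesis
    by (subst has_sum_reindex_bij_witness[where i = "\<lambda>(k, l). (k div 2, l div 2)" and j = "\<lambda>(a, b). (2 * a + p, 2 * b + q)"
          and h = g and T = "{(k, l). even (k + p) \<and> even (l + q)}" and s' = ?S])
       (use pq e e' in \<open>auto simp: g_def simp del: even_add\<close>)
qed

text \<open>Both geometric expansions form one absolutely summable family over four indices; summing
  it over the exponents or over the pairs n < m first gives the two sides.\<close>

lemma gf_dzeta:
  assumes X: "\<bar>X\<bar> \<le> 1/2" and Y: "\<bar>Y\<bar> \<le> 1/2"
  shows "((\<lambda>(i, j). mzv [i + 2, j + 2] * X ^ (i + 1) * Y ^ (j + 1)) has_sum dzeta X Y) UNIV"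
proof -
  define u where "u X n k = X ^ (k + 1) / real n ^ (k + 2)" for X :: real and n k :: nat
  have "((\<lambda>(s, t). (case s of (n, i) \<Rightarrow> u X n i) * (case t of (m, j) \<Rightarrow> u Y m j)) has_sum
     infsum (\<lambda>(n, i). u X n i) ({1..} \<times> UNIV) * infsum (\<lambda>(n, i). u Y n i) ({1..} \<times> UNIV)) (({1..} \<times> UNIV) \<times> ({1..} \<times> UNIV))"
    unfolding u_def by (intro has_sum_Times_real has_sum_infsum power_family_summable X Y)
  then have "(\<lambda>(s, t). (case s of (n, i) \<Rightarrow> u X n i) * (case t of (m, j) \<Rightarrow> u Y m j)) summable_on (({1..} \<times> UNIV) \<times> ({1..} \<times> UNIV))"
    by (rule has_sum_imp_summable)
  then have "(\<lambda>((n, m), (i, j)). u X n i * u Y m j) summable_on (({1..} \<times> {1..}) \<times> (UNIV \<times> UNIV))"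
    by (subst summable_on_reindex_bij_witness[where i = "\<lambda>((n, i), (m, j)). ((n, m), (i, j))" and j = "\<lambda>((n, m), (i, j)). ((n, i), (m, j))"
      and h = "\<lambda>(s, t). (case s of (n, i) \<Rightarrow> u X n i) * (case t of (m, j) \<Rightarrow> u Y m j)" and T = "(({1..} \<times> UNIV) \<times> ({1..} \<times> UNIV))"]) auto
  then have "(\<lambda>((n, m), (i, j)). u X n i * u Y m j) summable_on (less_pairs \<times> UNIV)"
    by (rule summable_on_subset_banach) (auto simp: less_pairs_def)
  define h where "h = (\<lambda>((n, m), (i, j)). u X n i * u Y m j)"
  have "h summable_on (less_pairs \<times> UNIV)" unfolding h_def by fact
  then obtain S where S: "(h has_sum S) (less_pairs \<times> UNIV)" by (auto simp: summable_on_def)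
  have "((\<lambda>(n, m). (rcp X n - rcp 0 n) * (rcp Y m - rcp 0 m)) has_sum S) less_pairs"
  proof (rule has_sum_SigmaD[OF S])
    fix t assume "t \<in> less_pairs"
    then obtain n m where t: "t = (n, m)" "1 \<le> n" "1 \<le> m" by (auto simp: less_pairs_def)
    have "((\<lambda>(i, j). u X n i * u Y m j) has_sum (rcp X n - rcp 0 n) * (rcp Y m - rcp 0 m)) (UNIV \<times> UNIV)"
      unfolding u_def using t by (intro has_sum_Times_real geometric_term X Y)
    then show "((\<lambda>ij. h (t, ij)) has_sum
       (case t of (n, m) \<Rightarrow> (rcp X n - rcp 0 n) * (rcp Y m - rcp 0 m))) UNIV" by (simp add: t h_def case_prod_unfold)
  qed
  then have "S = dzeta X Y" using has_sum_dzeta[OF X Y] has_sum_unique by blast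
  moreover have "((\<lambda>(ij, nm). h (nm, ij)) has_sum S) (UNIV \<times> less_pairs)"
    using S by (subst has_sum_swap) (simp add: case_prod_unfold)
  then have "((\<lambda>(i, j). mzv [i + 2, j + 2] * X ^ (i + 1) * Y ^ (j + 1)) has_sum S) UNIV"
  proof (rule has_sum_SigmaD)
    fix ij :: "nat \<times> nat"
    obtain i j where ij: "ij = (i, j)" by force
    have "(\<lambda>(n, m). (1 / real n ^ (i + 2)) * (1 / real m ^ (j + 2))) summable_on less_pairs"
    proof -
      have "((\<lambda>(n, m). (1 / real n ^ (i + 2)) * (1 / real m ^ (j + 2))) has_sum
          infsum (\<lambda>n. 1 / real n ^ (i + 2)) {1..} * infsum (\<lambda>n. 1 / real n ^ (j + 2)) {1..}) ({1..} \<times> {1..})"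
        by (intro has_sum_Times_real has_sum_infsum summable_on_inverse_power) auto
      then show ?thesis by (intro summable_on_subset_banach[OF has_sum_imp_summable]) (auto simp: less_pairs_def)
    qed
    then have "((\<lambda>(n, m). (1 / real n ^ (i + 2)) * (1 / real m ^ (j + 2))) has_sum mzv [i + 2, j + 2]) less_pairs"
      unfolding mzv_2_eq by (rule has_sum_infsum)
    from has_sum_cmult_right[OF this, of "X ^ (i + 1) * Y ^ (j + 1)"]
    have "((\<lambda>nm. X ^ (i + 1) * Y ^ (j + 1) * (case nm of (n, m) \<Rightarrow> (1 / real n ^ (i + 2)) * (1 / real m ^ (j + 2)))) has_sum
       X ^ (i + 1) * Y ^ (j + 1) * mzv [i + 2, j + 2]) less_pairs" .
    moreover have "X ^ (i + 1) * Y ^ (j + 1) * (case nm of (n, m) \<Rightarrow> (1 / real n ^ (i + 2)) * (1 / real m ^ (j + 2))) = h (nm, ij)" for nm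
      by (cases nm) (simp add: h_def u_def ij)
    ultimately show "((\<lambda>nm. case (ij, nm) of (ij, nm) \<Rightarrow> h (nm, ij)) has_sum
       (case ij of (i, j) \<Rightarrow> mzv [i + 2, j + 2] * X ^ (i + 1) * Y ^ (j + 1))) less_pairs"
      by (simp only: ij prod.case) (simp only: ac_simps)
  qed
  ultimately show ?thesis by simp
qed

text \<open>\<open>\<phi>\<close> sends an index to the exponent pair to which it contributes,
  together with the remaining data. The finite fibre \<open>T a b\<close> will be the index set of a
  sum in the coefficient.\<close>

lemma has_sum_regroup:
  fixes h :: "'i \<Rightarrow> 'b::banach"
  assumes h: "(h has_sum S) A"
    and fin: "\<And>a b. finite (T a b)"
    and \<phi>: "\<And>z. z \<in> A \<Longrightarrow> snd (\<phi> z) \<in> T (fst (fst (\<phi> z))) (snd (fst (\<phi> z)))" "\<And>z. z \<in> A \<Longrightarrow> \<psi> (\<phi> z) = z"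
    and \<psi>: "\<And>a b t. t \<in> T a b \<Longrightarrow> \<phi> (\<psi> ((a, b), t)) = ((a, b), t)" "\<And>a b t. t \<in> T a b \<Longrightarrow> \<psi> ((a, b), t) \<in> A"
    and k: "\<And>a b t. t \<in> T a b \<Longrightarrow> h (\<psi> ((a, b), t)) = k a b t"
  shows "((\<lambda>(a, b). \<Sum>t\<in>T a b. k a b t) has_sum S) UNIV"
proof -
  have \<phi>': "\<phi> z \<in> Sigma UNIV (\<lambda>(a, b). T a b)" if "z \<in> A" for z using \<phi>(1)[OF that] by (cases "\<phi> z") auto
  have "((\<lambda>((a, b), t). k a b t) has_sum S) (Sigma UNIV (\<lambda>(a, b). T a b))"
    using h
    by (subst has_sum_reindex_bij_witness[where i = \<phi> and j = \<psi> and T = A and h = h and s' = S])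
       (use \<phi>(2) \<phi>' \<psi> k in auto)
  then show ?thesis
    by (rule has_sum_SigmaD) (auto intro!: has_sum_finiteI fin)
qed

lemma gf_regroup:
  fixes h :: "'i \<Rightarrow> complex"
  assumes h: "(h has_sum S) UNIV"
    and fin: "\<And>a b. finite (T a b)"
    and \<phi>: "\<And>z. snd (\<phi> z) \<in> T (fst (fst (\<phi> z))) (snd (fst (\<phi> z)))" "\<And>z. \<psi> (\<phi> z) = z"
    and \<psi>: "\<And>a b t. t \<in> T a b \<Longrightarrow> \<phi> (\<psi> ((a, b), t)) = ((a, b), t)"
    and k: "\<And>a b t. t \<in> T a b \<Longrightarrow> h (\<psi> ((a, b), t)) = k a b t * X ^ (2 * a) * Y ^ (2 * b)"
  shows "((\<lambda>(a, b). (\<Sum>t\<in>T a b. k a b t) * X ^ (2 * a) * Y ^ (2 * b)) has_sum S) UNIV"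
  using has_sum_regroup[where T = T and \<phi> = \<phi> and \<psi> = \<psi>
      and k = "\<lambda>a b t. k a b t * X ^ (2 * a) * Y ^ (2 * b)", OF h fin \<phi> \<psi> UNIV_I k]
  by (simp add: sum_distrib_right)

lemma has_sum_parity1:
  fixes c :: "nat \<Rightarrow> 'a::real_normed_field"
  assumes f: "((\<lambda>k. c k * x ^ k) has_sum f) UNIV" and f': "((\<lambda>k. c k * (- x) ^ k) has_sum f') UNIV" and p: "p \<in> {0, 1}"
  shows "((\<lambda>a. c (2 * a + p) * x ^ (2 * a + p)) has_sum (f + (-1) ^ p * f') / 2) UNIV"
proof -
  define g where "g k = c k * x ^ k" for k
  have "((\<lambda>k. (c k * x ^ k + (-1) ^ p * (c k * (- x) ^ k)) / 2) has_sum (f + (-1) ^ p * f') / 2) UNIV"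
    by (intro has_sum_divide_const has_sum_add has_sum_cmult_right f f')
  moreover have "(c k * x ^ k + (-1) ^ p * (c k * (- x) ^ k)) / 2 = (if even (k + p) then g k else 0)" for k
    using p by (cases "even k") (auto simp: g_def)
  ultimately have "((\<lambda>k. if even (k + p) then g k else 0) has_sum (f + (-1) ^ p * f') / 2) UNIV" by simp
  then have "(g has_sum (f + (-1) ^ p * f') / 2) {k. even (k + p)}"
    by (subst (asm) has_sum_cong_neutral[where T = "{k. even (k + p)}" and g = g]) (auto split: if_splits)
  moreover have e: "2 * (k div 2) + p = k" if "even (k + p)" for k using that p by auto
  have e': "even (2 * k + p + p)" "(2 * k + p) div 2 = k" for k using p by auto
  ultimately show ?thesis
    by (subst has_sum_reindex_bij_witness[where i = "\<lambda>k. k div 2" and j = "\<lambda>a. 2 * a + p"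
          and h = g and T = "{k. even (k + p)}" and s' = "(f + (-1) ^ p * f') / 2"])
       (use e e' in \<open>auto simp: g_def simp del: even_add\<close>)
qed

lemma gf_esr:
  assumes "\<bar>x\<bar> \<le> 1/2" "zeta_coeffs s c"
  shows "((\<lambda>a. c (2 * a + 1) * x ^ (2 * a)) has_sum esr s x) UNIV"
proof -
  have s: "\<bar>s\<bar> = 1" using assms(2) by (simp add: zeta_coeffs_def)
  have "((\<lambda>a. c (2 * a + 0 + 1) * x ^ (2 * a + 0)) has_sum (psr s x + (-1) ^ 0 * psr s (- x)) / 2) UNIV"
    by (rule has_sum_parity1[where c = "\<lambda>k. c (k + 1)"]) (use assms has_sum_psr[OF assms] has_sum_psr[of "- x" s c] in simp_all)
  then show ?thesis using assms(1) s by (simp add: psr_def osr_minus)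
qed

lemma gf_osr:
  assumes "\<bar>x\<bar> \<le> 1/2" "zeta_coeffs s c"
  shows "((\<lambda>a. c (2 * a + 2) * x ^ (2 * a + 1)) has_sum osr s x) UNIV"
proof -
  have s: "\<bar>s\<bar> = 1" using assms(2) by (simp add: zeta_coeffs_def)
  have "((\<lambda>a. c (2 * a + 1 + 1) * x ^ (2 * a + 1)) has_sum (psr s x + (-1) ^ 1 * psr s (- x)) / 2) UNIV"
    by (rule has_sum_parity1[where c = "\<lambda>k. c (k + 1)"]) (use assms has_sum_psr[OF assms] has_sum_psr[of "- x" s c] in simp_all)
  then show ?thesis using assms(1) s by (simp add: psr_def osr_minus)
qed

text \<open>The four parity classes of the expansion of \<open>psr s\<close> at x + y. As
  \<open>esr\<close> is even and \<open>osr\<close> odd, exponents of equal parity lead to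
  \<open>esr\<close>, of different parity to \<open>osr\<close>.\<close>

lemma gf_psr2:
  assumes xy: "0 < x" "x \<le> 1/4" "0 < y" "y \<le> 1/4" and c: "zeta_coeffs s c"
  defines "P \<equiv> x + y" and "M \<equiv> x - y"
  shows "((\<lambda>(a, b). c (2 * a + 2 * b + 1) * real ((2 * a + 2 * b) choose (2 * a)) * x ^ (2 * a) * y ^ (2 * b)) has_sum (esr s P + esr s M) / 2) UNIV"
    "((\<lambda>(a, b). c (2 * a + 2 * b + 3) * real ((2 * a + 2 * b + 2) choose (2 * a + 1)) * x ^ (2 * a + 1) * y ^ (2 * b + 1)) has_sum (esr s P - esr s M) / 2) UNIV"
    "((\<lambda>(a, b). c (2 * a + 2 * b + 2) * real ((2 * a + 2 * b + 1) choose (2 * a + 1)) * x ^ (2 * a + 1) * y ^ (2 * b)) has_sum (osr s P + osr s M) / 2) UNIV"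
    "((\<lambda>(a, b). c (2 * a + 2 * b + 2) * real ((2 * a + 2 * b + 1) choose (2 * a)) * x ^ (2 * a) * y ^ (2 * b + 1)) has_sum (osr s P - osr s M) / 2) UNIV"
proof -
  have s: "\<bar>s\<bar> = 1" using c by (simp add: zeta_coeffs_def)
  have b: "\<bar>P\<bar> \<le> 1/2" "\<bar>M\<bar> \<le> 1/2" using xy unfolding P_def M_def by linarith+
  define cc where "cc k l = c (k + l + 1) * real ((k + l) choose k)" for k l
  define SS where "SS p q = (psr s (1 * x + 1 * y) + (-1) ^ p * psr s (-1 * x + 1 * y) + (-1) ^ q * psr s (1 * x + -1 * y) + (-1) ^ p * (-1) ^ q * psr s (-1 * x + -1 * y)) / 4" for p q :: nat
  have A: "((\<lambda>(a, b). cc (2 * a + p) (2 * b + q) * x ^ (2 * a + p) * y ^ (2 * b + q)) has_sum SS p q) UNIV"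
    if "p \<in> {0, 1}" "q \<in> {0, 1}" for p q unfolding SS_def
  proof (rule has_sum_parity[where f = "\<lambda>u v. psr s (u * x + v * y)", OF _ that])
    fix u v :: real assume "u \<in> {1, -1}" "v \<in> {1, -1}"
    then have "\<bar>u * x\<bar> + \<bar>v * y\<bar> \<le> 1/2" using xy by (auto simp: abs_mult)
    from has_sum_psr2[OF this c] show "((\<lambda>(k, l). cc k l * (u * x) ^ k * (v * y) ^ l) has_sum psr s (u * x + v * y)) UNIV"
      by (simp add: cc_def)
  qed
  have p: "psr s (1 * x + 1 * y) = esr s P + osr s P" "psr s (-1 * x + 1 * y) = esr s M - osr s M"
    "psr s (1 * x + -1 * y) = esr s M + osr s M" "psr s (-1 * x + -1 * y) = esr s P - osr s P"
  proof -
    have "1 * x + 1 * y = P" "-1 * x + 1 * y = - M" "1 * x + -1 * y = M" "-1 * x + -1 * y = - P" by (simp_all add: P_def M_def)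
    then show "psr s (1 * x + 1 * y) = esr s P + osr s P" "psr s (-1 * x + 1 * y) = esr s M - osr s M"
      "psr s (1 * x + -1 * y) = esr s M + osr s M" "psr s (-1 * x + -1 * y) = esr s P - osr s P"
      using b s by (simp_all only: psr_def osr_minus esr_minus diff_conv_add_uminus)
  qed
  have SS: "SS 0 0 = (esr s P + esr s M) / 2" "SS 1 1 = (esr s P - esr s M) / 2" "SS 1 0 = (osr s P + osr s M) / 2" "SS 0 1 = (osr s P - osr s M) / 2"
    unfolding SS_def p by (simp_all add: field_simps)
  show "((\<lambda>(a, b). c (2 * a + 2 * b + 1) * real ((2 * a + 2 * b) choose (2 * a)) * x ^ (2 * a) * y ^ (2 * b)) has_sum (esr s P + esr s M) / 2) UNIV"
    using A[of 0 0] unfolding SS cc_def by simp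
  show "((\<lambda>(a, b). c (2 * a + 2 * b + 3) * real ((2 * a + 2 * b + 2) choose (2 * a + 1)) * x ^ (2 * a + 1) * y ^ (2 * b + 1)) has_sum (esr s P - esr s M) / 2) UNIV"
    using A[of 1 1] unfolding SS cc_def by (simp add: numeral_3_eq_3)
  show "((\<lambda>(a, b). c (2 * a + 2 * b + 2) * real ((2 * a + 2 * b + 1) choose (2 * a + 1)) * x ^ (2 * a + 1) * y ^ (2 * b)) has_sum (osr s P + osr s M) / 2) UNIV"
    using A[of 1 0] unfolding SS cc_def by simp
  show "((\<lambda>(a, b). c (2 * a + 2 * b + 2) * real ((2 * a + 2 * b + 1) choose (2 * a)) * x ^ (2 * a) * y ^ (2 * b + 1)) has_sum (osr s P - osr s M) / 2) UNIV"
    using A[of 0 1] unfolding SS cc_def by simp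
qed

text \<open>The function expanded in Z = x + y is psr s (Z/2) / (Z/2). Because of the division by Z
  the odd-odd class picks up \<open>osr\<close> instead of \<open>esr\<close>.\<close>

lemma gf_zeta_half:
  assumes xy: "0 < x" "x \<le> 1/4" "0 < y" "y \<le> 1/4" "x \<noteq> y" and c: "zeta_coeffs s c"
  defines "P \<equiv> x + y" and "M \<equiv> x - y"
  shows "((\<lambda>(a, b). c (2 * a + 2 * b + 4) * real ((2 * a + 2 * b + 2) choose (2 * a + 1)) / 2 ^ (2 * a + 2 * b + 2) * x ^ (2 * a + 1) * y ^ (2 * b + 1)) has_sum
     (osr s (P / 2) / P - osr s (M / 2) / M)) UNIV"
proof -
  have s: "\<bar>s\<bar> = 1" using c by (simp add: zeta_coeffs_def)
  define cc where "cc k l = c (k + l + 2) * real ((k + l) choose k) / 2 ^ (k + l)" for k l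
  have Z: "((\<lambda>k. c (k + 2) / 2 ^ k * Z ^ k) has_sum psr s (Z / 2) / (Z / 2)) UNIV" if "\<bar>Z\<bar> \<le> 1/2" "Z \<noteq> 0" for Z
  proof -
    have "\<bar>Z / 2\<bar> \<le> 1/2" using that by simp
    from has_sum_divide_const[OF has_sum_psr_aux[OF this c], of "Z / 2"] show ?thesis
      using that by (simp add: power_divide)
  qed
  have A: "((\<lambda>(a, b). cc (2 * a + 1) (2 * b + 1) * x ^ (2 * a + 1) * y ^ (2 * b + 1)) has_sum
     (psr s ((1 * x + 1 * y) / 2) / ((1 * x + 1 * y) / 2) + (-1) ^ 1 * (psr s ((-1 * x + 1 * y) / 2) / ((-1 * x + 1 * y) / 2)) + (-1) ^ 1 * (psr s ((1 * x + -1 * y) / 2) / ((1 * x + -1 * y) / 2)) + (-1) ^ 1 * (-1) ^ 1 * (psr s ((-1 * x + -1 * y) / 2) / ((-1 * x + -1 * y) / 2))) / 4) UNIV"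
  proof (rule has_sum_parity[where f = "\<lambda>u v. psr s ((u * x + v * y) / 2) / ((u * x + v * y) / 2)"])
    fix u v :: real assume uv: "u \<in> {1, -1}" "v \<in> {1, -1}"
    have n: "norm (u * x) + norm (v * y) = x + y" using uv xy by (auto simp: abs_mult)
    have "\<bar>u * x + v * y\<bar> \<le> 1/2" using n abs_triangle_ineq[of "u * x" "v * y"] xy unfolding real_norm_def by linarith
    moreover have "u * x + v * y \<noteq> 0" using uv xy by auto
    ultimately have "\<bar>u * x + v * y\<bar> \<le> 1/2" "u * x + v * y \<noteq> 0" by blast+
    note 1 = Z[OF this]
    have "(\<lambda>k. c (k + 2) / 2 ^ k * (x + y) ^ k) summable_on UNIV"
      using xy by (intro has_sum_imp_summable[OF Z]) auto
    then have 2: "(\<lambda>k. norm (c (k + 2) / 2 ^ k) * (norm (u * x) + norm (v * y)) ^ k) summable_on UNIV"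
      unfolding n using xy summable_on_iff_abs_summable_on_real[where f = "\<lambda>k. c (k + 2) / 2 ^ k * (x + y) ^ k"] by (simp add: abs_mult)
    show "((\<lambda>(k, l). cc k l * (u * x) ^ k * (v * y) ^ l) has_sum psr s ((u * x + v * y) / 2) / ((u * x + v * y) / 2)) UNIV"
      using has_sum_binomial[OF 1 2]
      by (subst has_sum_reindex_bij_witness[where i = "\<lambda>(i, k). (k, i - k)" and j = "\<lambda>(k, l). (k + l, k)"
          and h = "\<lambda>(i, k). c (i + 2) / 2 ^ i * of_nat (i choose k) * (u * x) ^ k * (v * y) ^ (i - k)" and T = "SIGMA i:UNIV. {..i}" and s' = "psr s ((u * x + v * y) / 2) / ((u * x + v * y) / 2)"])
         (auto simp: cc_def)
  qed auto
  have b: "\<bar>P / 2\<bar> \<le> 1/2" "\<bar>M / 2\<bar> \<le> 1/2" "P \<noteq> 0" "M \<noteq> 0" using xy unfolding P_def M_def by auto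
  have e: "1 * x + 1 * y = P" "-1 * x + 1 * y = - M" "1 * x + -1 * y = M" "-1 * x + -1 * y = - P" by (simp_all add: P_def M_def)
  have p: "psr s (P / 2) = esr s (P / 2) + osr s (P / 2)" "psr s (- M / 2) = esr s (M / 2) - osr s (M / 2)"
    "psr s (M / 2) = esr s (M / 2) + osr s (M / 2)" "psr s (- P / 2) = esr s (P / 2) - osr s (P / 2)"
    unfolding psr_def minus_divide_left[symmetric] using b s by (simp_all add: osr_minus)
  have eq: "(psr s (P / 2) / (P / 2) + (-1) ^ 1 * (psr s (- M / 2) / (- M / 2)) + (-1) ^ 1 * (psr s (M / 2) / (M / 2)) + (-1) ^ 1 * (-1) ^ 1 * (psr s (- P / 2) / (- P / 2))) / 4
     = osr s (P / 2) / P - osr s (M / 2) / M"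
    unfolding p using b by (simp add: field_simps)
  show ?thesis using A unfolding e eq cc_def by (simp add: numeral_eq_Suc)
qed

text \<open>The sum of x^(2k) y^(2(n-k)) over k \<le> n is (x^(2n+2) - y^(2n+2))/(x^2 - y^2), so
  coefficients depending on a + b alone lead to a divided difference.\<close>

lemma gf_geometric2:
  fixes \<beta> :: "nat \<Rightarrow> real"
  assumes xy: "0 < x" "0 < y" "x \<noteq> y"
    and fx: "((\<lambda>n. \<beta> n * x ^ (2 * n + 2)) has_sum fx) UNIV" and fy: "((\<lambda>n. \<beta> n * y ^ (2 * n + 2)) has_sum fy) UNIV"
  shows "((\<lambda>(a, b). \<beta> (a + b) * x ^ (2 * a) * y ^ (2 * b)) has_sum (fx - fy) / (x\<^sup>2 - y\<^sup>2)) UNIV"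
proof -
  have ne: "x\<^sup>2 - y\<^sup>2 \<noteq> 0" using xy by (simp add: power2_eq_iff)
  have inner: "(\<Sum>k\<le>n. u * x ^ (2 * k) * y ^ (2 * (n - k))) = u * (x ^ (2 * n + 2) - y ^ (2 * n + 2)) / (x\<^sup>2 - y\<^sup>2)" for n and u :: real
  proof -
    have "(x\<^sup>2) ^ Suc n - (y\<^sup>2) ^ Suc n = (x\<^sup>2 - y\<^sup>2) * (\<Sum>k<Suc n. (x\<^sup>2) ^ k * (y\<^sup>2) ^ (n - k))"
      using power_diff_sumr2[of "x\<^sup>2" "Suc n" "y\<^sup>2"] by (simp add: mult.commute)
    then have "(\<Sum>k\<le>n. (x\<^sup>2) ^ k * (y\<^sup>2) ^ (n - k)) = ((x\<^sup>2) ^ Suc n - (y\<^sup>2) ^ Suc n) / (x\<^sup>2 - y\<^sup>2)"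
      using ne by (simp add: lessThan_Suc_atMost)
    then show ?thesis by (simp add: power_mult power_add power2_eq_square mult.assoc flip: sum_distrib_left)
  qed
  have 1: "((\<lambda>n. \<beta> n * (x ^ (2 * n + 2) - y ^ (2 * n + 2)) / (x\<^sup>2 - y\<^sup>2)) has_sum (fx - fy) / (x\<^sup>2 - y\<^sup>2)) UNIV"
    using has_sum_divide_const[OF has_sum_add[OF fx has_sum_uminusI[OF fy]], of "x\<^sup>2 - y\<^sup>2"] by (simp add: right_diff_distrib)
  have ab: "(\<lambda>n. \<bar>\<beta> n\<bar> * z ^ (2 * n + 2)) summable_on UNIV" if "((\<lambda>n. \<beta> n * z ^ (2 * n + 2)) has_sum f) UNIV" "0 < z" for z f
    using summable_on_iff_abs_summable_on_real[THEN iffD1, OF has_sum_imp_summable[OF that(1)]] that(2) by (simp add: abs_mult)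
  have 2: "(\<lambda>n. \<bar>\<beta> n\<bar> * (x ^ (2 * n + 2) - y ^ (2 * n + 2)) / (x\<^sup>2 - y\<^sup>2)) summable_on UNIV"
  proof -
    obtain u v where "((\<lambda>n. \<bar>\<beta> n\<bar> * x ^ (2 * n + 2)) has_sum u) UNIV" "((\<lambda>n. \<bar>\<beta> n\<bar> * y ^ (2 * n + 2)) has_sum v) UNIV"
      using ab[OF fx xy(1)] ab[OF fy xy(2)] by (auto simp: summable_on_def)
    from has_sum_divide_const[OF has_sum_add[OF this(1) has_sum_uminusI[OF this(2)]], of "x\<^sup>2 - y\<^sup>2"]
    show ?thesis by (intro has_sum_imp_summable) (simp add: right_diff_distrib)
  qed
  have "((\<lambda>(n, k). \<beta> n * x ^ (2 * k) * y ^ (2 * (n - k))) has_sum (fx - fy) / (x\<^sup>2 - y\<^sup>2)) (SIGMA n:UNIV. {..n})"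
  proof (rule has_sum_SigmaI[OF _ 1])
    show "((\<lambda>k. case (n, k) of (n, k) \<Rightarrow> \<beta> n * x ^ (2 * k) * y ^ (2 * (n - k))) has_sum \<beta> n * (x ^ (2 * n + 2) - y ^ (2 * n + 2)) / (x\<^sup>2 - y\<^sup>2)) {..n}" for n
      by (rule has_sum_finiteI) (simp_all only: inner prod.case finite_atMost)
    have "(\<lambda>t. norm (case t of (n, k) \<Rightarrow> \<beta> n * x ^ (2 * k) * y ^ (2 * (n - k)))) summable_on (SIGMA n:UNIV. {..n})"
    proof (rule summable_on_SigmaI[OF _ 2])
      fix n
      have "norm (case (n, k) of (n, k) \<Rightarrow> \<beta> n * x ^ (2 * k) * y ^ (2 * (n - k))) = \<bar>\<beta> n\<bar> * x ^ (2 * k) * y ^ (2 * (n - k))" for k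
        using xy by (simp add: abs_mult)
      then show "((\<lambda>k. norm (case (n, k) of (n, k) \<Rightarrow> \<beta> n * x ^ (2 * k) * y ^ (2 * (n - k)))) has_sum \<bar>\<beta> n\<bar> * (x ^ (2 * n + 2) - y ^ (2 * n + 2)) / (x\<^sup>2 - y\<^sup>2)) {..n}"
        by (intro has_sum_finiteI) (simp_all only: inner finite_atMost)
    qed auto
    then show "(\<lambda>(n, k). \<beta> n * x ^ (2 * k) * y ^ (2 * (n - k))) summable_on (SIGMA n:UNIV. {..n})" by (rule abs_summable_summable)
  qed
  then show ?thesis
    by (subst has_sum_reindex_bij_witness[where i = "\<lambda>(n, k). (k, n - k)" and j = "\<lambda>(k, l). (k + l, k)"
          and h = "\<lambda>(n, k). \<beta> n * x ^ (2 * k) * y ^ (2 * (n - k))" and T = "SIGMA n:UNIV. {..n}" and s' = "(fx - fy) / (x\<^sup>2 - y\<^sup>2)"]) auto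
qed

text \<open>\<open>sinc 0\<close> evaluates to 0, since division by zero gives 0; the limit value 1
  at the origin therefore needs its own case.\<close>

lemma gf_sinc_real:
  "((\<lambda>q. (- (pi\<^sup>2)) ^ q / fact (2 * q + 1) * x ^ (2 * q)) has_sum (if x = 0 then 1 else sinc x)) UNIV"
proof (cases "x = 0")
  case True
  have "((\<lambda>q. (- (pi\<^sup>2)) ^ q / fact (2 * q + 1) * x ^ (2 * q)) has_sum 1) {0}"
    by (rule has_sum_finiteI) (simp_all add: True)
  then show ?thesis using True
    by (subst has_sum_cong_neutral[where T = "{0}" and g = "\<lambda>q. (- (pi\<^sup>2)) ^ q / fact (2 * q + 1) * x ^ (2 * q)"]) auto
next
  case False
  define g where "g n = sin_coeff n * (pi * x) ^ n" for n
  have "(g has_sum sin (pi * x)) UNIV"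
    using summable_norm_sin[of "pi * x"] sin_converges[of "pi * x"] unfolding g_def
    by (intro norm_summable_imp_has_sum) simp_all
  then have "(g has_sum sin (pi * x)) {n. odd n}"
    by (subst (asm) has_sum_cong_neutral[where T = "{n. odd n}" and g = g]) (auto simp: g_def sin_coeff_def)
  then have "((\<lambda>q. g (2 * q + 1)) has_sum sin (pi * x)) UNIV"
    by (subst has_sum_reindex_bij_witness[where i = "\<lambda>n. n div 2" and j = "\<lambda>q. 2 * q + 1" and h = g and T = "{n. odd n}" and s' = "sin (pi * x)"]) auto
  then have "((\<lambda>q. g (2 * q + 1) / (pi * x)) has_sum sin (pi * x) / (pi * x)) UNIV" by (rule has_sum_divide_const)
  moreover have "g (2 * q + 1) / (pi * x) = (- (pi\<^sup>2)) ^ q / fact (2 * q + 1) * x ^ (2 * q)" for q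
    using False by (simp add: g_def sin_coeff_def power_mult_distrib power_mult power_minus[of "pi\<^sup>2"] power_add)
  ultimately show ?thesis using False by (simp add: sinc_def)
qed

lemma i_pi_power: "(\<i> * complex_of_real pi) ^ (2 * q) = of_real ((- (pi\<^sup>2)) ^ q)"
  by (simp add: power_mult power_mult_distrib)

lemma gf_sinc:
  "((\<lambda>q. (\<i> * complex_of_real pi) ^ (2 * q) / fact (2 * q + 1) * complex_of_real x ^ (2 * q)) has_sum of_real (if x = 0 then 1 else sinc x)) UNIV"
  using has_sum_of_real[OF gf_sinc_real[of x], where 'a = complex] by (simp add: i_pi_power)

text \<open>Extended by 0 to the axes, so that \<open>has_sum_parity\<close> sees a full grid of
  exponents.\<close>

definition mz :: "nat \<Rightarrow> nat \<Rightarrow> real" where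
  "mz k l = (if k = 0 \<or> l = 0 then 0 else mzv [k + 1, l + 1])"

lemma has_sum_mz:
  assumes "\<bar>X\<bar> \<le> 1/2" "\<bar>Y\<bar> \<le> 1/2"
  shows "((\<lambda>(k, l). mz k l * X ^ k * Y ^ l) has_sum dzeta X Y) UNIV"
proof -
  have "((\<lambda>(k, l). mz k l * X ^ k * Y ^ l) has_sum dzeta X Y) ({1..} \<times> {1..})"
    using gf_dzeta[OF assms]
    by (subst has_sum_reindex_bij_witness[where i = "\<lambda>(i, j). (i + 1, j + 1)" and j = "\<lambda>(k, l). (k - 1, l - 1)"
        and h = "\<lambda>(i, j). mzv [i + 2, j + 2] * X ^ (i + 1) * Y ^ (j + 1)" and T = UNIV and s' = "dzeta X Y"])
       (auto simp: mz_def Suc_le_eq gr0_conv_Suc)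
  then show ?thesis
    by (subst has_sum_cong_neutral[where T = "{1..} \<times> {1..}" and g = "\<lambda>(k, l). mz k l * X ^ k * Y ^ l"])
       (auto simp: mz_def Suc_le_eq split: if_splits)
qed

section \<open>Double zeta values by the parity of their exponents\<close>

lemma gf_mzv_odd_odd:
  assumes xy: "0 < x" "x \<le> 1/4" "0 < y" "y \<le> 1/4"
  shows "((\<lambda>(a, b). mzv [2 * a + 2, 2 * b + 2] * x ^ (2 * a + 1) * y ^ (2 * b + 1)) has_sum
      (dzeta x y - dzeta (- x) y - dzeta x (- y) + dzeta (- x) (- y)) / 4) UNIV"
proof -
  have "((\<lambda>(a, b). mz (2 * a + 1) (2 * b + 1) * x ^ (2 * a + 1) * y ^ (2 * b + 1)) has_sum
      (dzeta (1 * x) (1 * y) + (-1) ^ 1 * dzeta (-1 * x) (1 * y) + (-1) ^ 1 * dzeta (1 * x) (-1 * y) + (-1) ^ 1 * (-1) ^ 1 * dzeta (-1 * x) (-1 * y)) / 4) UNIV"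
    by (rule has_sum_parity[where f = "\<lambda>s t. dzeta (s * x) (t * y)"]) (use xy in \<open>auto intro!: has_sum_mz simp: abs_mult\<close>)
  then show ?thesis by (simp add: mz_def numeral_eq_Suc)
qed

lemma gf_mzv_even_even:
  assumes xy: "0 < x" "x \<le> 1/4" "0 < y" "y \<le> 1/4"
  shows "((\<lambda>(a, b). mzv [2 * a + 3, 2 * b + 3] * x ^ (2 * a + 2) * y ^ (2 * b + 2)) has_sum
      (dzeta x y + dzeta (- x) y + dzeta x (- y) + dzeta (- x) (- y)) / 4) UNIV"
proof -
  define S where "S = (dzeta (1 * x) (1 * y) + (-1) ^ 0 * dzeta (-1 * x) (1 * y) + (-1) ^ 0 * dzeta (1 * x) (-1 * y) + (-1) ^ 0 * (-1) ^ 0 * dzeta (-1 * x) (-1 * y)) / 4"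
  have "((\<lambda>(a, b). mz (2 * a + 0) (2 * b + 0) * x ^ (2 * a + 0) * y ^ (2 * b + 0)) has_sum S) UNIV"
    unfolding S_def
    by (rule has_sum_parity[where f = "\<lambda>s t. dzeta (s * x) (t * y)"]) (use xy in \<open>auto intro!: has_sum_mz simp: abs_mult\<close>)
  then have "((\<lambda>(a, b). mz (2 * a) (2 * b) * x ^ (2 * a) * y ^ (2 * b)) has_sum S) UNIV" by simp
  then have "((\<lambda>(a, b). mz (2 * a) (2 * b) * x ^ (2 * a) * y ^ (2 * b)) has_sum S) ({1..} \<times> {1..})"
    by (subst (asm) has_sum_cong_neutral[where T = "{1..} \<times> {1..}" and g = "\<lambda>(a, b). mz (2 * a) (2 * b) * x ^ (2 * a) * y ^ (2 * b)"])
       (auto simp: mz_def Suc_le_eq split: if_splits)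
  then have "((\<lambda>(a, b). mzv [2 * a + 3, 2 * b + 3] * x ^ (2 * a + 2) * y ^ (2 * b + 2)) has_sum S) UNIV"
    by (subst has_sum_reindex_bij_witness[where i = "\<lambda>(i, j). (i - 1, j - 1)" and j = "\<lambda>(k, l). (k + 1, l + 1)"
        and h = "\<lambda>(a, b). mz (2 * a) (2 * b) * x ^ (2 * a) * y ^ (2 * b)" and T = "{1..} \<times> {1..}" and s' = S])
       (auto simp: mz_def numeral_eq_Suc)
  then show ?thesis by (simp add: S_def)
qed

lemma summable_abs_mzv:
  assumes "0 \<le> X" "X \<le> 1/2" "0 \<le> Y" "Y \<le> 1/2"
  shows "(\<lambda>(i, j). \<bar>mzv [i + 2, j + 2]\<bar> * X ^ (i + 1) * Y ^ (j + 1)) summable_on UNIV"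
  using summable_on_iff_abs_summable_on_real[THEN iffD1, OF has_sum_imp_summable[OF gf_dzeta[of X Y]]] assms
  by (simp add: case_prod_unfold abs_mult)

text \<open>Expanding (x + y)^(i+1) y^(j+1), a monomial x^k y^l collects all (i, j) with i + j + 2 =
  k + l, where x^k comes from the first power alone and so k \<le> i + 1.\<close>

lemma has_sum_mzv_half_left:
  assumes xy: "\<bar>x\<bar> + \<bar>y\<bar> \<le> 1/2"
  shows "((\<lambda>(k, l). (\<Sum>(i, j)\<in>{(i, j). i + j + 2 = k + l \<and> k \<le> i + 1}. mzv [i + 2, j + 2] / 2 ^ (i + 1) * real ((i + 1) choose k)) * x ^ k * y ^ l)
     has_sum dzeta ((x + y) / 2) y) UNIV"
proof -
  define \<beta> where "\<beta> = (\<lambda>(i, j). mzv [i + 2, j + 2] / 2 ^ (i + 1) * y ^ (j + 1))"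
  have b: "\<bar>(x + y) / 2\<bar> \<le> 1/2" "\<bar>y\<bar> \<le> 1/2" using xy by auto
  have 1: "((\<lambda>z. \<beta> z * (x + y) ^ (fst z + 1)) has_sum dzeta ((x + y) / 2) y) UNIV"
    using gf_dzeta[OF b] by (simp add: \<beta>_def case_prod_unfold power_divide ac_simps)
  have 2: "(\<lambda>z. norm (\<beta> z) * (norm x + norm y) ^ (fst z + 1)) summable_on UNIV"
    using summable_abs_mzv[of "(\<bar>x\<bar> + \<bar>y\<bar>) / 2" "\<bar>y\<bar>"] xy
    by (simp add: \<beta>_def case_prod_unfold abs_mult power_abs power_divide ac_simps)
  define h where "h = (\<lambda>(z, k). \<beta> z * of_nat (fst z + 1 choose k) * x ^ k * y ^ (fst z + 1 - k))"
  define \<psi> :: "(nat \<times> nat) \<times> (nat \<times> nat) \<Rightarrow> (nat \<times> nat) \<times> nat" where "\<psi> = (\<lambda>((k, l), (i, j)). ((i, j), k))"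
  have h: "(h has_sum dzeta ((x + y) / 2) y) (SIGMA z:UNIV. {..fst z + 1})" unfolding h_def by (rule has_sum_binomial[OF 1 2])
  have "((\<lambda>(k, l). \<Sum>t\<in>{(i, j). i + j + 2 = k + l \<and> k \<le> i + 1}. (case t of (i, j) \<Rightarrow> mzv [i + 2, j + 2] / 2 ^ (i + 1) * real ((i + 1) choose k)) * (x ^ k * y ^ l))
     has_sum dzeta ((x + y) / 2) y) UNIV"
  proof (rule has_sum_regroup[where h = h and \<phi> = "\<lambda>((i, j), k). ((k, i + 1 - k + j + 1), (i, j))" and \<psi> = \<psi>, OF h])
    show "finite {(i, j). i + j + 2 = k + l \<and> k \<le> i + 1}" for k l :: nat
      by (rule finite_subset[of _ "{..k + l} \<times> {..k + l}"]) auto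
  next
    fix k l :: nat and t assume "t \<in> {(i, j). i + j + 2 = k + l \<and> k \<le> i + 1}"
    then obtain i j where t: "t = (i, j)" "i + j + 2 = k + l" "k \<le> i + 1" by auto
    then have l: "l = (i + 1 - k) + (j + 1)" by simp
    show "h (\<psi> ((k, l), t)) =
       (case t of (i, j) \<Rightarrow> mzv [i + 2, j + 2] / 2 ^ (i + 1) * real ((i + 1) choose k)) * (x ^ k * y ^ l)"
      unfolding l t(1) by (simp add: \<beta>_def h_def \<psi>_def power_add)
  qed (auto simp: \<psi>_def)
  then show ?thesis by (simp only: sum_distrib_right[symmetric] mult.assoc)
qed

lemma has_sum_mzv_half_right:
  assumes xy: "\<bar>x\<bar> + \<bar>y\<bar> \<le> 1/2"
  shows "((\<lambda>(k, l). (\<Sum>(i, j)\<in>{(i, j). i + j + 2 = k + l \<and> l \<le> j + 1}. mzv [i + 2, j + 2] / 2 ^ (j + 1) * real ((j + 1) choose l)) * x ^ k * y ^ l)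
     has_sum dzeta x ((x + y) / 2)) UNIV"
proof -
  define \<beta> where "\<beta> = (\<lambda>(i, j). mzv [i + 2, j + 2] / 2 ^ (j + 1) * x ^ (i + 1))"
  have b: "\<bar>x\<bar> \<le> 1/2" "\<bar>(x + y) / 2\<bar> \<le> 1/2" using xy by auto
  have 1: "((\<lambda>z. \<beta> z * (y + x) ^ (snd z + 1)) has_sum dzeta x ((x + y) / 2)) UNIV"
    using gf_dzeta[OF b] by (simp add: \<beta>_def case_prod_unfold power_divide ac_simps)
  have 2: "(\<lambda>z. norm (\<beta> z) * (norm y + norm x) ^ (snd z + 1)) summable_on UNIV"
    using summable_abs_mzv[of "\<bar>x\<bar>" "(\<bar>x\<bar> + \<bar>y\<bar>) / 2"] xy
    by (simp add: \<beta>_def case_prod_unfold abs_mult power_abs power_divide ac_simps)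
  define h where "h = (\<lambda>(z, k). \<beta> z * of_nat (snd z + 1 choose k) * y ^ k * x ^ (snd z + 1 - k))"
  define \<psi> :: "(nat \<times> nat) \<times> (nat \<times> nat) \<Rightarrow> (nat \<times> nat) \<times> nat" where "\<psi> = (\<lambda>((k, l), (i, j)). ((i, j), l))"
  have h: "(h has_sum dzeta x ((x + y) / 2)) (SIGMA z:UNIV. {..snd z + 1})" unfolding h_def by (rule has_sum_binomial[OF 1 2])
  have "((\<lambda>(k, l). \<Sum>t\<in>{(i, j). i + j + 2 = k + l \<and> l \<le> j + 1}. (case t of (i, j) \<Rightarrow> mzv [i + 2, j + 2] / 2 ^ (j + 1) * real ((j + 1) choose l)) * (x ^ k * y ^ l))
     has_sum dzeta x ((x + y) / 2)) UNIV"
  proof (rule has_sum_regroup[where h = h and \<phi> = "\<lambda>((i, j), l). ((j + 1 - l + i + 1, l), (i, j))" and \<psi> = \<psi>, OF h])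
    show "finite {(i, j). i + j + 2 = k + l \<and> l \<le> j + 1}" for k l :: nat
      by (rule finite_subset[of _ "{..k + l} \<times> {..k + l}"]) auto
  next
    fix k l :: nat and t assume "t \<in> {(i, j). i + j + 2 = k + l \<and> l \<le> j + 1}"
    then obtain i j where t: "t = (i, j)" "i + j + 2 = k + l" "l \<le> j + 1" by auto
    then have k: "k = (j + 1 - l) + (i + 1)" by simp
    show "h (\<psi> ((k, l), t)) =
       (case t of (i, j) \<Rightarrow> mzv [i + 2, j + 2] / 2 ^ (j + 1) * real ((j + 1) choose l)) * (x ^ k * y ^ l)"
      unfolding k t(1) by (simp add: \<beta>_def h_def \<psi>_def power_add)
  qed (auto simp: \<psi>_def)
  then show ?thesis by (simp only: sum_distrib_right[symmetric] mult.assoc)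
qed

lemma gf_mzv_half_left:
  assumes xy: "0 < x" "x \<le> 1/4" "0 < y" "y \<le> 1/4"
  defines "P \<equiv> x + y" and "M \<equiv> x - y"
  shows "((\<lambda>(a, b). (\<Sum>(i, j)\<in>{(i, j). i + j = 2 * a + 2 * b}. mzv [i + 2, j + 2] / 2 ^ i * real ((i + 1) choose (2 * a + 1))) * x ^ (2 * a + 1) * y ^ (2 * b + 1))
     has_sum (dzeta (P / 2) y - dzeta (- M / 2) y - dzeta (M / 2) (- y) + dzeta (- P / 2) (- y)) / 2) UNIV"
proof -
  define c where "c k l = (\<Sum>(i, j)\<in>{(i, j). i + j + 2 = k + l \<and> k \<le> i + 1}. mzv [i + 2, j + 2] / 2 ^ (i + 1) * real ((i + 1) choose k))" for k l
  have "((\<lambda>(a, b). c (2 * a + 1) (2 * b + 1) * x ^ (2 * a + 1) * y ^ (2 * b + 1)) has_sum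
      (dzeta ((1 * x + 1 * y) / 2) (1 * y) + (-1) ^ 1 * dzeta ((-1 * x + 1 * y) / 2) (1 * y) + (-1) ^ 1 * dzeta ((1 * x + -1 * y) / 2) (-1 * y) + (-1) ^ 1 * (-1) ^ 1 * dzeta ((-1 * x + -1 * y) / 2) (-1 * y)) / 4) UNIV"
  proof (rule has_sum_parity[where f = "\<lambda>s t. dzeta ((s * x + t * y) / 2) (t * y)"])
    fix s t :: real assume "s \<in> {1, -1}" "t \<in> {1, -1}"
    then have "\<bar>s * x\<bar> + \<bar>t * y\<bar> \<le> 1/2" using xy by (auto simp: abs_mult)
    then show "((\<lambda>(k, l). c k l * (s * x) ^ k * (t * y) ^ l) has_sum dzeta ((s * x + t * y) / 2) (t * y)) UNIV"
      unfolding c_def by (rule has_sum_mzv_half_left)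
  qed auto
  note A = this
  have e: "1 * x + 1 * y = P" "-1 * x + 1 * y = - M" "1 * x + -1 * y = M" "-1 * x + -1 * y = - P" by (simp_all add: P_def M_def)
  have B: "((\<lambda>(a, b). c (2 * a + 1) (2 * b + 1) * x ^ (2 * a + 1) * y ^ (2 * b + 1)) has_sum
      (dzeta (P / 2) y - dzeta (- M / 2) y - dzeta (M / 2) (- y) + dzeta (- P / 2) (- y)) / 4) UNIV" using A unfolding e by simp
  \<comment> \<open>The series is doubled to turn 1/2^(i+1) into the 1/2^i of the claim.\<close>
  have q: "2 * (S / 4) = S / 2" for S :: real by simp
  have 1: "((\<lambda>t. 2 * (case t of (a, b) \<Rightarrow> c (2 * a + 1) (2 * b + 1) * x ^ (2 * a + 1) * y ^ (2 * b + 1))) has_sum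
      (dzeta (P / 2) y - dzeta (- M / 2) y - dzeta (M / 2) (- y) + dzeta (- P / 2) (- y)) / 2) UNIV" using has_sum_cmult_right[OF B, of 2] unfolding q .
  have "2 * c (2 * a + 1) (2 * b + 1) = (\<Sum>(i, j)\<in>{(i, j). i + j = 2 * a + 2 * b}. mzv [i + 2, j + 2] / 2 ^ i * real ((i + 1) choose (2 * a + 1)))" for a b
  proof -
    have fin: "finite {(i, j). i + j = 2 * a + 2 * b}" by (rule finite_subset[of _ "{..2 * a + 2 * b} \<times> {..2 * a + 2 * b}"]) auto
    have "2 * c (2 * a + 1) (2 * b + 1) = (\<Sum>(i, j)\<in>{(i, j). i + j = 2 * a + 2 * b \<and> 2 * a \<le> i}. mzv [i + 2, j + 2] / 2 ^ i * real ((i + 1) choose (2 * a + 1)))"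
      unfolding c_def sum_distrib_left by (rule sum.cong) auto
    also have "\<dots> = (\<Sum>(i, j)\<in>{(i, j). i + j = 2 * a + 2 * b}. mzv [i + 2, j + 2] / 2 ^ i * real ((i + 1) choose (2 * a + 1)))"
    proof (rule sum.mono_neutral_left[OF fin])
      have "(i + 1) choose (2 * a + 1) = 0" if "\<not> 2 * a \<le> i" for i using that by (intro binomial_eq_0) simp
      then show "\<forall>t\<in>{(i, j). i + j = 2 * a + 2 * b} - {(i, j). i + j = 2 * a + 2 * b \<and> 2 * a \<le> i}.
          (case t of (i, j) \<Rightarrow> mzv [i + 2, j + 2] / 2 ^ i * real ((i + 1) choose (2 * a + 1))) = 0" by (auto simp del: binomial_Suc_Suc)
    qed auto
    finally show ?thesis .
  qed
  then show ?thesis using 1 by (simp add: case_prod_unfold mult.assoc[symmetric])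
qed

lemma gf_mzv_half_right:
  assumes xy: "0 < x" "x \<le> 1/4" "0 < y" "y \<le> 1/4"
  defines "P \<equiv> x + y" and "M \<equiv> x - y"
  shows "((\<lambda>(a, b). (\<Sum>(i, j)\<in>{(i, j). i + j = 2 * a + 2 * b}. mzv [i + 2, j + 2] / 2 ^ j * real ((j + 1) choose (2 * b + 1))) * x ^ (2 * a + 1) * y ^ (2 * b + 1))
     has_sum (dzeta x (P / 2) - dzeta (- x) (- M / 2) - dzeta x (M / 2) + dzeta (- x) (- P / 2)) / 2) UNIV"
proof -
  define c where "c k l = (\<Sum>(i, j)\<in>{(i, j). i + j + 2 = k + l \<and> l \<le> j + 1}. mzv [i + 2, j + 2] / 2 ^ (j + 1) * real ((j + 1) choose l))" for k l
  have "((\<lambda>(a, b). c (2 * a + 1) (2 * b + 1) * x ^ (2 * a + 1) * y ^ (2 * b + 1)) has_sum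
      (dzeta (1 * x) ((1 * x + 1 * y) / 2) + (-1) ^ 1 * dzeta (-1 * x) ((-1 * x + 1 * y) / 2) + (-1) ^ 1 * dzeta (1 * x) ((1 * x + -1 * y) / 2) + (-1) ^ 1 * (-1) ^ 1 * dzeta (-1 * x) ((-1 * x + -1 * y) / 2)) / 4) UNIV"
  proof (rule has_sum_parity[where f = "\<lambda>s t. dzeta (s * x) ((s * x + t * y) / 2)"])
    fix s t :: real assume "s \<in> {1, -1}" "t \<in> {1, -1}"
    then have "\<bar>s * x\<bar> + \<bar>t * y\<bar> \<le> 1/2" using xy by (auto simp: abs_mult)
    then show "((\<lambda>(k, l). c k l * (s * x) ^ k * (t * y) ^ l) has_sum dzeta (s * x) ((s * x + t * y) / 2)) UNIV"
      unfolding c_def by (rule has_sum_mzv_half_right)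
  qed auto
  note A = this
  have e: "1 * x + 1 * y = P" "-1 * x + 1 * y = - M" "1 * x + -1 * y = M" "-1 * x + -1 * y = - P" by (simp_all add: P_def M_def)
  have B: "((\<lambda>(a, b). c (2 * a + 1) (2 * b + 1) * x ^ (2 * a + 1) * y ^ (2 * b + 1)) has_sum
      (dzeta x (P / 2) - dzeta (- x) (- M / 2) - dzeta x (M / 2) + dzeta (- x) (- P / 2)) / 4) UNIV" using A unfolding e by simp
  have q: "2 * (S / 4) = S / 2" for S :: real by simp
  have 1: "((\<lambda>t. 2 * (case t of (a, b) \<Rightarrow> c (2 * a + 1) (2 * b + 1) * x ^ (2 * a + 1) * y ^ (2 * b + 1))) has_sum
      (dzeta x (P / 2) - dzeta (- x) (- M / 2) - dzeta x (M / 2) + dzeta (- x) (- P / 2)) / 2) UNIV" using has_sum_cmult_right[OF B, of 2] unfolding q .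
  have "2 * c (2 * a + 1) (2 * b + 1) = (\<Sum>(i, j)\<in>{(i, j). i + j = 2 * a + 2 * b}. mzv [i + 2, j + 2] / 2 ^ j * real ((j + 1) choose (2 * b + 1)))" for a b
  proof -
    have fin: "finite {(i, j). i + j = 2 * a + 2 * b}" by (rule finite_subset[of _ "{..2 * a + 2 * b} \<times> {..2 * a + 2 * b}"]) auto
    have "2 * c (2 * a + 1) (2 * b + 1) = (\<Sum>(i, j)\<in>{(i, j). i + j = 2 * a + 2 * b \<and> 2 * b \<le> j}. mzv [i + 2, j + 2] / 2 ^ j * real ((j + 1) choose (2 * b + 1)))"
      unfolding c_def sum_distrib_left by (rule sum.cong) auto
    also have "\<dots> = (\<Sum>(i, j)\<in>{(i, j). i + j = 2 * a + 2 * b}. mzv [i + 2, j + 2] / 2 ^ j * real ((j + 1) choose (2 * b + 1)))"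
    proof (rule sum.mono_neutral_left[OF fin])
      have "(j + 1) choose (2 * b + 1) = 0" if "\<not> 2 * b \<le> j" for j using that by (intro binomial_eq_0) simp
      then show "\<forall>t\<in>{(i, j). i + j = 2 * a + 2 * b} - {(i, j). i + j = 2 * a + 2 * b \<and> 2 * b \<le> j}.
          (case t of (i, j) \<Rightarrow> mzv [i + 2, j + 2] / 2 ^ j * real ((j + 1) choose (2 * b + 1))) = 0" by (auto simp del: binomial_Suc_Suc)
    qed auto
    finally show ?thesis .
  qed
  then show ?thesis using 1 by (simp add: case_prod_unfold mult.assoc[symmetric])
qed

lemma has_sum_shift:
  fixes f :: "nat \<Rightarrow> 'a::{topological_ab_group_add}"
  assumes "(f has_sum S) UNIV"
  shows "((\<lambda>a. f (a + 1)) has_sum (S - f 0)) UNIV"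
proof -
  have "(f has_sum (S - f 0)) (UNIV - {0})"
    by (rule has_sum_Diff[OF assms]) (auto intro!: has_sum_finiteI)
  then show ?thesis
    by (subst has_sum_reindex_bij_witness[where i = "\<lambda>n. n - 1" and j = "\<lambda>n. n + 1" and h = f and T = "UNIV - {0}" and s' = "S - f 0"]) auto
qed

text \<open>For coefficients belonging to row a + 1 of a known series: the row a = 0 is
  subtracted.\<close>

lemma has_sum_shift_fst:
  fixes f :: "nat \<Rightarrow> nat \<Rightarrow> 'a::{topological_ab_group_add}"
  assumes "((\<lambda>(a, b). f a b) has_sum S) UNIV" and "(f 0 has_sum s) UNIV"
  shows "((\<lambda>(a, b). f (a + 1) b) has_sum (S - s)) UNIV"
proof -
  have "((\<lambda>(a, b). f a b) has_sum s) ({0} \<times> UNIV)"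
    using assms(2)
    by (subst has_sum_reindex_bij_witness[where i = "\<lambda>b. (0, b)" and j = snd and h = "f 0" and T = UNIV and s' = s]) auto
  then have "((\<lambda>(a, b). f a b) has_sum (S - s)) (UNIV - {0} \<times> UNIV)"
    by (intro has_sum_Diff[OF assms(1)]) auto
  then show ?thesis
    by (subst has_sum_reindex_bij_witness[where i = "\<lambda>(a, b). (a - 1, b)" and j = "\<lambda>(a, b). (a + 1, b)"
       and h = "\<lambda>(a, b). f a b" and T = "UNIV - {0} \<times> UNIV" and s' = "S - s"]) auto
qed

subsection \<open>The three groups of terms\<close>

definition ipi_coeff :: "nat \<Rightarrow> complex" where "ipi_coeff q = (\<i> * complex_of_real pi) ^ (2 * q) / fact (2 * q + 1)"

lemma has_sum_product:
  fixes f :: "'i \<Rightarrow> complex" and g :: "'j \<Rightarrow> complex"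
  assumes "(f has_sum a) UNIV" "(g has_sum b) UNIV"
  shows "((\<lambda>z. f (fst z) * g (snd z)) has_sum a * b) UNIV"
  using has_sum_Times_complex[OF assms] by (simp add: case_prod_unfold)

lemma has_sum_of_real_pair:
  assumes "((\<lambda>(a, b). f a b :: real) has_sum S) UNIV"
  shows "((\<lambda>z. complex_of_real (f (fst z) (snd z))) has_sum of_real S) UNIV"
  using has_sum_of_real[OF assms, where 'a = complex] by (simp add: case_prod_unfold)

lemma finite_sum_eq_pair: "finite {(p::nat, q). p + q = a}" by (rule finite_subset[of _ "{..a} \<times> {..a}"]) auto
lemma finite_sum_less_pair: "finite {(p::nat, q). p + q + 1 = a}" by (rule finite_subset[of _ "{..a} \<times> {..a}"]) auto
lemma finite_sum_less_triple: "finite {(u::nat, v, w). u + v + w + 1 = a}" by (rule finite_subset[of _ "{..a} \<times> {..a} \<times> {..a}"]) auto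
lemma finite_sum_eq_quadruple: "finite {(p::nat, q, r::nat, s). p + q = a \<and> r + s = b}"
  by (rule finite_subset[of _ "{..a} \<times> {..a} \<times> {..b} \<times> {..b}"]) auto

lemma gf_ipi: "x \<noteq> 0 \<Longrightarrow> ((\<lambda>q. ipi_coeff q * complex_of_real x ^ (2 * q)) has_sum of_real (sinc x)) UNIV"
  using gf_sinc[of x] by (simp add: ipi_coeff_def)

lemma gf_zeta_odd:
  assumes "\<bar>x\<bar> \<le> 1/2"
  shows "((\<lambda>v. complex_of_real (zeta1 (2 * v + 3)) * of_real x ^ (2 * v + 2)) has_sum of_real (esr 1 x)) UNIV"
proof -
  have "((\<lambda>a. zeta1 (2 * (a + 1) + 1) * x ^ (2 * (a + 1))) has_sum (esr 1 x - zeta1 (2 * 0 + 1) * x ^ (2 * 0))) UNIV"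
    by (rule has_sum_shift[OF gf_esr[OF assms zeta_coeffs_zeta1]])
  then show ?thesis
    using has_sum_of_real[where 'a = complex, of "\<lambda>a. zeta1 (2 * (a + 1) + 1) * x ^ (2 * (a + 1))"]
    by (simp add: zeta1_def numeral_3_eq_3)
qed

lemma gf_zeta_even:
  assumes "\<bar>x\<bar> \<le> 1/2" "x \<noteq> 0"
  shows "((\<lambda>l. complex_of_real (zeta1 (2 * l + 2)) * of_real x ^ (2 * l)) has_sum of_real (osr 1 x / x)) UNIV"
proof -
  have "((\<lambda>a. zeta1 (2 * a + 2) * x ^ (2 * a + 1) / x) has_sum osr 1 x / x) UNIV"
    by (rule has_sum_divide_const[OF gf_osr[OF assms(1) zeta_coeffs_zeta1]])
  then have "((\<lambda>a. zeta1 (2 * a + 2) * x ^ (2 * a)) has_sum osr 1 x / x) UNIV" using assms by simp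
  from has_sum_of_real[OF this, where 'a = complex] show ?thesis by simp
qed

text \<open>The bound 1/4 keeps \<plusminus>x \<plusminus>y within 1/2, where the expansions above
  hold.\<close>

locale small_point =
  fixes x y :: real
  assumes x: "0 < x" "x \<le> 1/4" and y: "0 < y" "y \<le> 1/4" and ne: "x \<noteq> y"
begin

abbreviation "X \<equiv> complex_of_real x"
abbreviation "Y \<equiv> complex_of_real y"
definition "P = x + y"
definition "M = x - y"

lemma nz: "X \<noteq> 0" "Y \<noteq> 0" using x y by auto
lemma xy_bounds: "\<bar>x\<bar> \<le> 1/2" "x \<noteq> 0" "\<bar>y\<bar> \<le> 1/2" "y \<noteq> 0" using x y by auto

lemmas monomial_simps = power_add power2_eq_square field_simps nz

section \<open>Generating functions of the sums in \<open>T1\<close>\<close>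

lemma gf_T1_sum1: "((\<lambda>(a, b). (\<Sum>(p, q)\<in>{(p, q). p + q = a}. 4 * of_real (mzv [2 * p + 2, 2 * b + 2]) * ipi_coeff q) * X ^ (2 * a) * Y ^ (2 * b)) has_sum
   4 / (X * Y) * (of_real (sinc x) * of_real ((dzeta x y - dzeta (- x) y - dzeta x (- y) + dzeta (- x) (- y)) / 4))) UNIV"
proof (rule gf_regroup[where \<phi> = "\<lambda>(q, (p, b)). ((p + q, b), (p, q))" and \<psi> = "\<lambda>((a, b), (p, q)). (q, (p, b))",
    OF has_sum_cmult_right[OF has_sum_product[OF gf_ipi has_sum_of_real_pair[OF gf_mzv_odd_odd[OF x y]]]]])
  show "finite {(p, q). p + q = a}" for a b :: nat by (rule finite_sum_eq_pair)
qed (auto simp: monomial_simps xy_bounds)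

lemma gf_T1_sum2: "((\<lambda>(a, b). (\<Sum>(r, s)\<in>{(r, s). r + s + 1 = b}. 4 * of_real (mzv [2 * r + 3, 2 * a + 3]) * ipi_coeff s) * X ^ (2 * a) * Y ^ (2 * b)) has_sum
   4 / X\<^sup>2 * (of_real (sinc y) * of_real ((dzeta y x + dzeta (- y) x + dzeta y (- x) + dzeta (- y) (- x)) / 4))) UNIV"
proof (rule gf_regroup[where \<phi> = "\<lambda>(s, (r, a)). ((a, r + s + 1), (r, s))" and \<psi> = "\<lambda>((a, b), (r, s)). (s, (r, a))",
    OF has_sum_cmult_right[OF has_sum_product[OF gf_ipi has_sum_of_real_pair[OF gf_mzv_even_even[OF y x]]]]])
  show "finite {(r, s). r + s + 1 = b}" for a b :: nat by (rule finite_sum_less_pair)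
qed (auto simp: monomial_simps xy_bounds)

text \<open>The factor \<open>ipi_coeff u\<close> splits off as sinc x once a - u replaces a, which
  requires the terms with u > a to vanish. In one application the lower index of
  \<open>binom\<close> is negative there, in the other j + 1 < 2b + 1.\<close>

lemma gf_T1_sum3_aux:
  assumes c: "((\<lambda>(a, b). (\<Sum>(i, j)\<in>{(i, j). i + j = 2 * a + 2 * b}. f i j a b) * x ^ (2 * a + 1) * y ^ (2 * b + 1)) has_sum V) UNIV"
    and g0: "\<And>a b u i j. 2 * u + i + j = 2 * a + 2 * b \<Longrightarrow> a < u \<Longrightarrow> g a b u i j = 0"
    and g: "\<And>a b u i j. u \<le> a \<Longrightarrow> g a b u i j = of_real (f i j (a - u) b)"
  shows "((\<lambda>(a, b). (\<Sum>(u, i, j)\<in>{(u, i, j). 2 * u + i + j = 2 * a + 2 * b}. g a b u i j * ipi_coeff u) * X ^ (2 * a) * Y ^ (2 * b)) has_sum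
   1 / (X * Y) * (of_real (sinc x) * of_real V)) UNIV"
proof -
  define c where "c a b = (\<Sum>(i, j)\<in>{(i, j). i + j = 2 * a + 2 * b}. f i j a b)" for a b
  have c': "((\<lambda>(a, b). c a b * x ^ (2 * a + 1) * y ^ (2 * b + 1)) has_sum V) UNIV"
    using c by (simp add: c_def)
  define \<psi> :: "(nat \<times> nat) \<times> nat \<Rightarrow> nat \<times> nat \<times> nat" where "\<psi> = (\<lambda>((a, b), u). (u, (a - u, b)))"
  have "((\<lambda>(a, b). (\<Sum>u\<in>{..a}. of_real (c (a - u) b) * ipi_coeff u) * X ^ (2 * a) * Y ^ (2 * b)) has_sum
   1 / (X * Y) * (of_real (sinc x) * of_real V)) UNIV"
  proof (rule gf_regroup[where \<phi> = "\<lambda>(u, (a, b)). ((a + u, b), u)" and \<psi> = \<psi>,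
      OF has_sum_cmult_right[OF has_sum_product[OF gf_ipi has_sum_of_real_pair[OF c']]]])
    fix a b t :: nat assume "t \<in> {..a}"
    then obtain d where "a = d + t" by (metis atMost_iff le_add_diff_inverse2)
    then show "1 / (X * Y) * (ipi_coeff (fst (\<psi> ((a, b), t))) * X ^ (2 * fst (\<psi> ((a, b), t))) *
      complex_of_real (c (fst (snd (\<psi> ((a, b), t)))) (snd (snd (\<psi> ((a, b), t)))) * x ^ (2 * fst (snd (\<psi> ((a, b), t))) + 1) * y ^ (2 * snd (snd (\<psi> ((a, b), t))) + 1))) =
      complex_of_real (c (a - t) b) * ipi_coeff t * X ^ (2 * a) * Y ^ (2 * b)" by (simp add: \<psi>_def monomial_simps xy_bounds)
  qed (auto simp: xy_bounds \<psi>_def)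
  moreover have "(\<Sum>u\<in>{..a}. of_real (c (a - u) b) * ipi_coeff u) = (\<Sum>(u, i, j)\<in>{(u, i, j). 2 * u + i + j = 2 * a + 2 * b}. g a b u i j * ipi_coeff u)" for a b
  proof -
    have le: "u \<le> a" if "2 * u + i + j = 2 * a + 2 * b" "g a b u i j \<noteq> 0" for u i j
      using g0 that by (metis not_le)
    have le': "i + j = 2 * (a - u) + 2 * b" if "2 * u + i + j = 2 * a + 2 * b" "g a b u i j \<noteq> 0" for u i j
      using le[OF that] that(1) by linarith
    have "(\<Sum>(u, i, j)\<in>{(u, i, j). 2 * u + i + j = 2 * a + 2 * b}. g a b u i j * ipi_coeff u)
       = (\<Sum>(u, i, j)\<in>(SIGMA u:{..a}. {(i, j). i + j = 2 * (a - u) + 2 * b}). g a b u i j * ipi_coeff u)"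
      by (rule sum.mono_neutral_right)
         (auto intro: le le' intro!: finite_subset[of "{(u, i, j). 2 * u + i + j = 2 * a + 2 * b}" "{..a + b} \<times> {..2 * a + 2 * b} \<times> {..2 * a + 2 * b}"])
    also have "\<dots> = (\<Sum>u\<in>{..a}. \<Sum>(i, j)\<in>{(i, j). i + j = 2 * (a - u) + 2 * b}. g a b u i j * ipi_coeff u)"
      by (subst sum.Sigma) (use finite_sum_eq_pair[of "2 * (a - _) + 2 * b"] in \<open>auto simp: case_prod_unfold\<close>)
    also have "\<dots> = (\<Sum>u\<in>{..a}. of_real (c (a - u) b) * ipi_coeff u)"
      unfolding c_def sum_distrib_right of_real_sum by (intro sum.cong) (auto simp: g)
    finally show ?thesis ..
  qed
  ultimately show ?thesis by simp
qed

lemma gf_T1_sum3_left: "((\<lambda>(a, b). (\<Sum>(u, i, j)\<in>{(u, i, j). 2 * u + i + j = 2 * a + 2 * b}.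
      1 / 2 ^ i * of_nat (binom (i + 1) (2 * int a - 2 * int u + 1)) * of_real (mzv [i + 2, j + 2]) * ipi_coeff u) * X ^ (2 * a) * Y ^ (2 * b)) has_sum
   1 / (X * Y) * (of_real (sinc x) * of_real ((dzeta (P / 2) y - dzeta (- M / 2) y - dzeta (M / 2) (- y) + dzeta (- P / 2) (- y)) / 2))) UNIV"
proof (rule gf_T1_sum3_aux)
  show "((\<lambda>(a, b). (\<Sum>(i, j)\<in>{(i, j). i + j = 2 * a + 2 * b}. mzv [i + 2, j + 2] / 2 ^ i * real ((i + 1) choose (2 * a + 1))) * x ^ (2 * a + 1) * y ^ (2 * b + 1))
     has_sum (dzeta (P / 2) y - dzeta (- M / 2) y - dzeta (M / 2) (- y) + dzeta (- P / 2) (- y)) / 2) UNIV"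
    using gf_mzv_half_left[OF x y] by (simp add: P_def M_def)
  fix a b u i j :: nat assume "u \<le> a"
  then have "nat (2 * int a - 2 * int u + 1) = 2 * (a - u) + 1" "\<not> 2 * int a - 2 * int u + 1 < 0" by auto
  then show "1 / 2 ^ i * of_nat (binom (i + 1) (2 * int a - 2 * int u + 1)) * of_real (mzv [i + 2, j + 2])
      = complex_of_real (mzv [i + 2, j + 2] / 2 ^ i * real ((i + 1) choose (2 * (a - u) + 1)))"
    by (simp add: binom_def)
qed (simp add: binom_def)

lemma gf_T1_sum3_right: "((\<lambda>(a, b). (\<Sum>(u, i, j)\<in>{(u, i, j). 2 * u + i + j = 2 * a + 2 * b}.
      1 / 2 ^ j * of_nat ((j + 1) choose (2 * b + 1)) * of_real (mzv [i + 2, j + 2]) * ipi_coeff u) * X ^ (2 * a) * Y ^ (2 * b)) has_sum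
   1 / (X * Y) * (of_real (sinc x) * of_real ((dzeta x (P / 2) - dzeta (- x) (- M / 2) - dzeta x (M / 2) + dzeta (- x) (- P / 2)) / 2))) UNIV"
proof (rule gf_T1_sum3_aux)
  show "((\<lambda>(a, b). (\<Sum>(i, j)\<in>{(i, j). i + j = 2 * a + 2 * b}. mzv [i + 2, j + 2] / 2 ^ j * real ((j + 1) choose (2 * b + 1))) * x ^ (2 * a + 1) * y ^ (2 * b + 1))
     has_sum (dzeta x (P / 2) - dzeta (- x) (- M / 2) - dzeta x (M / 2) + dzeta (- x) (- P / 2)) / 2) UNIV"
    using gf_mzv_half_right[OF x y] by (simp add: P_def M_def)
qed (simp_all add: binomial_eq_0)

end

context small_point
begin

section \<open>Generating functions of the sums in \<open>T2\<close>\<close>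

lemmas gf_ipi_x = gf_ipi[OF xy_bounds(2)] and gf_ipi_y = gf_ipi[OF xy_bounds(4)] and gf_zeta_odd_x = gf_zeta_odd[OF xy_bounds(1)] and gf_zeta_odd_y = gf_zeta_odd[OF xy_bounds(3)]
  and gf_zeta_even_x = gf_zeta_even[OF xy_bounds(1,2)] and gf_zeta_even_y = gf_zeta_even[OF xy_bounds(3,4)]

lemma PM_bounds: "\<bar>P\<bar> \<le> 1/2" "\<bar>M\<bar> \<le> 1/2" unfolding P_def M_def using x y by linarith+

lemma gf_T2_sum1: "((\<lambda>(a, b). (\<Sum>(u, v, w)\<in>{(u, v, w). u + v + w + 1 = a}. 4 * of_nat ((2 * w + 2 * b + 2) choose (2 * b + 1))
          * of_real (zeta_bar (2 * b + 2 * w + 3)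
               - zeta1 (2 * b + 2 * w + 3) / 2 ^ (2 * b + 2 * w + 3))
          * of_real (zeta1 (2 * v + 3)) * ipi_coeff u) * X ^ (2 * a) * Y ^ (2 * b)) has_sum
   4 / (X * Y) * (of_real (sinc x) * (of_real (esr 1 x) * of_real (((esr (-1) P - esr (-1) M) - (esr 1 P - esr 1 M)) / 4)))) UNIV"
proof -
  have "((\<lambda>(a, b). (zeta_bar (2 * a + 2 * b + 3) * real ((2 * a + 2 * b + 2) choose (2 * a + 1)) * x ^ (2 * a + 1) * y ^ (2 * b + 1)
       + - (zeta1 (2 * a + 2 * b + 3) * real ((2 * a + 2 * b + 2) choose (2 * a + 1)) * x ^ (2 * a + 1) * y ^ (2 * b + 1))) / 2)
     has_sum ((esr (-1) P - esr (-1) M) / 2 + - ((esr 1 P - esr 1 M) / 2)) / 2) UNIV"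
    unfolding case_prod_unfold P_def M_def
    by (intro has_sum_divide_const has_sum_add has_sum_uminusI
       gf_psr2(2)[OF x y zeta_coeffs_zeta1, unfolded case_prod_unfold] gf_psr2(2)[OF x y zeta_coeffs_zeta_bar, unfolded case_prod_unfold])
  moreover have "(zeta_bar (2 * a + 2 * b + 3) * real ((2 * a + 2 * b + 2) choose (2 * a + 1)) * x ^ (2 * a + 1) * y ^ (2 * b + 1)
       + - (zeta1 (2 * a + 2 * b + 3) * real ((2 * a + 2 * b + 2) choose (2 * a + 1)) * x ^ (2 * a + 1) * y ^ (2 * b + 1))) / 2
     = real ((2 * a + 2 * b + 2) choose (2 * b + 1)) * (zeta_bar (2 * b + 2 * a + 3) - zeta1 (2 * b + 2 * a + 3) / 2 ^ (2 * b + 2 * a + 3)) * x ^ (2 * a + 1) * y ^ (2 * b + 1)" for a b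
  proof -
    \<comment> \<open>Since zeta_bar k = (2/2^k - 1) zeta1 k, taking away zeta1 k / 2^k leaves half
      the difference of the alternating and the ordinary value.\<close>
    have zh: "zeta_bar k - zeta1 k / 2 ^ k = (zeta_bar k - zeta1 k) / 2" for k
      by (simp add: zeta_bar_def power_int_diff field_simps)
    have "2 * b + 2 * a + 3 = 2 * a + 2 * b + 3" "(2 * a + 2 * b + 2) choose (2 * b + 1) = (2 * a + 2 * b + 2) choose (2 * a + 1)"
      using binomial_symmetric[of "2 * a + 1" "2 * a + 2 * b + 2"] by (simp_all del: binomial_Suc_Suc)
    then show ?thesis by (simp only: zh) (simp add: field_simps del: binomial_Suc_Suc)
  qed
  ultimately have R: "((\<lambda>(w, b). real ((2 * w + 2 * b + 2) choose (2 * b + 1)) * (zeta_bar (2 * b + 2 * w + 3) - zeta1 (2 * b + 2 * w + 3) / 2 ^ (2 * b + 2 * w + 3)) * x ^ (2 * w + 1) * y ^ (2 * b + 1))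
      has_sum ((esr (-1) P - esr (-1) M) / 2 + - ((esr 1 P - esr 1 M) / 2)) / 2) UNIV"
    by (simp only:)
  have V: "((esr (-1) P - esr (-1) M) / 2 + - ((esr 1 P - esr 1 M) / 2)) / 2 = ((esr (-1) P - esr (-1) M) - (esr 1 P - esr 1 M)) / 4"
    by (simp add: field_simps)
  show ?thesis
  proof (rule gf_regroup[where \<phi> = "\<lambda>(u, (v, (w, b))). ((u + v + w + 1, b), (u, v, w))" and \<psi> = "\<lambda>((a, b), (u, v, w)). (u, (v, (w, b)))",
      OF has_sum_cmult_right[OF has_sum_product[OF gf_ipi_x has_sum_product[OF gf_zeta_odd_x has_sum_of_real_pair[OF R[unfolded V]]]]]])
    show "finite {(u, v, w). u + v + w + 1 = a}" for a b :: nat by (rule finite_sum_less_triple)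
  qed (auto simp: monomial_simps xy_bounds simp del: binomial_Suc_Suc)
qed

lemma gf_T2_sum2: "((\<lambda>(a, b). (\<Sum>(p, q, r, s) \<in> {(p, q, r, s). p + q = a \<and> r + s = b}.
          4 * of_nat (binom (2 * p + 2 * s) (2 * int s - 1))
          * of_real (zeta1 (2 * r + 3)) * of_real (zeta_bar (2 * s + 2 * p + 1))
          * ipi_coeff q) * X ^ (2 * a) * Y ^ (2 * b)) has_sum
   4 / (X * Y) * (of_real (sinc x) * (of_real (esr 1 y) * of_real ((esr (-1) P - esr (-1) M) / 2)))) UNIV"
proof -
  have R: "((\<lambda>(p, s). zeta_bar (2 * p + 2 * s + 3) * real ((2 * p + 2 * s + 2) choose (2 * p + 1)) * x ^ (2 * p + 1) * y ^ (2 * s + 1))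
      has_sum (esr (-1) P - esr (-1) M) / 2) UNIV"
    unfolding P_def M_def by (rule gf_psr2(2)[OF x y zeta_coeffs_zeta_bar])
  define F where "F p q r s = 4 * of_nat (binom (2 * p + 2 * s) (2 * int s - 1))
          * of_real (zeta1 (2 * r + 3)) * of_real (zeta_bar (2 * s + 2 * p + 1)) * ipi_coeff q" for p q r s
  define G where "G p q r s = 4 * of_nat ((2 * p + 2 * s + 2) choose (2 * p + 1))
          * of_real (zeta1 (2 * r + 3)) * of_real (zeta_bar (2 * p + 2 * s + 3)) * ipi_coeff q" for p q r s
  \<comment> \<open>For s = 0 the lower index 2s - 1 of \<open>binom\<close> is negative, so the sum
    effectively starts at s = 1; \<open>G\<close> is \<open>F\<close> with s shifted by one.\<close>
  have F0: "1 \<le> s" if "F p q r s \<noteq> 0" for p q r s using that by (cases s) (auto simp: F_def binom_def)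
  have FG: "F p q r (Suc s) = G p q r s" for p q r s
  proof -
    have "nat (2 * int (Suc s) - 1) = 2 * s + 1" "2 * Suc s + 2 * p + 1 = 2 * p + 2 * s + 3" "2 * p + 2 * Suc s = 2 * p + 2 * s + 2"
      "\<not> 2 * int (Suc s) - 1 < 0" by auto
    moreover have "(2 * p + 2 * s + 2) choose (2 * s + 1) = (2 * p + 2 * s + 2) choose (2 * p + 1)"
      using binomial_symmetric[of "2 * s + 1" "2 * p + 2 * s + 2"] by (simp del: binomial_Suc_Suc)
    ultimately show ?thesis unfolding F_def G_def binom_def by (simp only: if_False)
  qed
  have "((\<lambda>(a, b). (\<Sum>(p, q, r, s) \<in> {(p, q, r, s). p + q = a \<and> r + s + 1 = b}. G p q r s) * X ^ (2 * a) * Y ^ (2 * b)) has_sum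
     4 / (X * Y) * (of_real (sinc x) * (of_real (esr 1 y) * of_real ((esr (-1) P - esr (-1) M) / 2)))) UNIV"
  proof (rule gf_regroup[where \<phi> = "\<lambda>(q, (r, (p, s))). ((p + q, r + s + 1), (p, q, r, s))" and \<psi> = "\<lambda>((a, b), (p, q, r, s)). (q, (r, (p, s)))",
      OF has_sum_cmult_right[OF has_sum_product[OF gf_ipi_x has_sum_product[OF gf_zeta_odd_y has_sum_of_real_pair[OF R]]]]])
    show "finite {(p, q, r, s). p + q = a \<and> r + s + 1 = b}" for a b :: nat by (rule finite_subset[OF _ finite_sum_eq_quadruple[of a "b - 1"]]) auto
  qed (auto simp: monomial_simps xy_bounds G_def simp del: binomial_Suc_Suc)
  moreover have "(\<Sum>(p, q, r, s) \<in> {(p, q, r, s). p + q = a \<and> r + s + 1 = b}. G p q r s)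
     = (\<Sum>(p, q, r, s) \<in> {(p, q, r, s). p + q = a \<and> r + s = b}. F p q r s)" for a b
  proof -
    have "(\<Sum>(p, q, r, s) \<in> {(p, q, r, s). p + q = a \<and> r + s + 1 = b}. G p q r s)
       = (\<Sum>(p, q, r, s) \<in> {(p, q, r, s). p + q = a \<and> r + s = b \<and> 1 \<le> s}. F p q r s)"
      by (rule sum.reindex_bij_witness[where i = "\<lambda>(p, q, r, s). (p, q, r, s - 1)" and j = "\<lambda>(p, q, r, s). (p, q, r, Suc s)"]) (auto simp: FG)
    also have "\<dots> = (\<Sum>(p, q, r, s) \<in> {(p, q, r, s). p + q = a \<and> r + s = b}. F p q r s)"
      by (rule sum.mono_neutral_left[OF finite_sum_eq_quadruple]) (use F0 in fastforce)+
    finally show ?thesis .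
  qed
  ultimately show ?thesis by (simp add: F_def)
qed

text \<open>The binomial coefficients belong to row a + 1 of the first series in
  \<open>gf_psr2\<close>; the missing row 0 sums to \<open>esr 1 y\<close>.\<close>

lemma gf_T2_sum3: "((\<lambda>(a, b). (\<Sum>(u, v, w) \<in> {(u, v, w). u + v + w + 1 = b}.
          4 * of_nat ((2 * a + 2 * v + 2) choose (2 * v))
          * of_real (zeta1 (2 * w + 3)) * of_real (zeta1 (2 * a + 2 * v + 3))
          * ipi_coeff u) * X ^ (2 * a) * Y ^ (2 * b)) has_sum
   4 / X\<^sup>2 * (of_real (sinc y) * (of_real (esr 1 y) * of_real ((esr 1 P + esr 1 M) / 2 - esr 1 y)))) UNIV"
proof -
  have "((\<lambda>(a, v). zeta1 (2 * (a + 1) + 2 * v + 1) * real ((2 * (a + 1) + 2 * v) choose (2 * (a + 1))) * x ^ (2 * (a + 1)) * y ^ (2 * v))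
      has_sum ((esr 1 P + esr 1 M) / 2 - esr 1 y)) UNIV"
    unfolding P_def M_def
    by (rule has_sum_shift_fst[OF gf_psr2(1)[OF x y zeta_coeffs_zeta1]]) (use gf_esr[OF xy_bounds(3) zeta_coeffs_zeta1] in simp)
  moreover have "(2 * (a + 1) + 2 * v) choose (2 * (a + 1)) = (2 * a + 2 * v + 2) choose (2 * v)" for a v
    using binomial_symmetric[of "2 * v" "2 * a + 2 * v + 2"] by (simp del: binomial_Suc_Suc)
  ultimately have R: "((\<lambda>(a, v). zeta1 (2 * a + 2 * v + 3) * real ((2 * a + 2 * v + 2) choose (2 * v)) * x ^ (2 * (a + 1)) * y ^ (2 * v))
      has_sum ((esr 1 P + esr 1 M) / 2 - esr 1 y)) UNIV"
    by (simp add: eval_nat_numeral del: binomial_Suc_Suc)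
  show ?thesis
  proof (rule gf_regroup[where \<phi> = "\<lambda>(u, (w, (a, v))). ((a, u + v + w + 1), (u, v, w))" and \<psi> = "\<lambda>((a, b), (u, v, w)). (u, (w, (a, v)))",
      OF has_sum_cmult_right[OF has_sum_product[OF gf_ipi_y has_sum_product[OF gf_zeta_odd_y has_sum_of_real_pair[OF R]]]]])
    show "finite {(u, v, w). u + v + w + 1 = b}" for a b :: nat by (rule finite_sum_less_triple)
  qed (auto simp: monomial_simps xy_bounds simp del: binomial_Suc_Suc)
qed

lemma gf_T2_sum4: "((\<lambda>(a, b). (\<Sum>(p, q, r, s) \<in> {(p, q, r, s). p + q = a \<and> r + s = b}.
          4 * of_nat ((2 * q + 2 * r) choose (2 * r))
          * of_real (zeta1 (2 * p + 3)) * of_real (zeta1 (2 * q + 2 * r + 1))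
          * ipi_coeff s) * X ^ (2 * a) * Y ^ (2 * b)) has_sum
   4 / X\<^sup>2 * (of_real (sinc y) * (of_real (esr 1 x) * of_real ((esr 1 P + esr 1 M) / 2)))) UNIV"
proof -
  define c where "c q r = (2 * q + 2 * r) choose (2 * r)" for q r :: nat
  have c: "(2 * q + 2 * r) choose (2 * q) = c q r" for q r
    unfolding c_def using binomial_symmetric[of "2 * q" "2 * q + 2 * r"] by simp
  have R: "((\<lambda>(q, r). zeta1 (2 * q + 2 * r + 1) * real ((2 * q + 2 * r) choose (2 * r)) * x ^ (2 * q) * y ^ (2 * r)) has_sum (esr 1 P + esr 1 M) / 2) UNIV"
    using gf_psr2(1)[OF x y zeta_coeffs_zeta1] unfolding c P_def M_def unfolding c_def .
  show ?thesis
  proof (rule gf_regroup[where \<phi> = "\<lambda>(s, (p, (q, r))). ((p + q, r + s), (p, q, r, s))" and \<psi> = "\<lambda>((a, b), (p, q, r, s)). (s, (p, (q, r)))",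
      OF has_sum_cmult_right[OF has_sum_product[OF gf_ipi_y has_sum_product[OF gf_zeta_odd_x has_sum_of_real_pair[OF R]]]]])
    show "finite {(p, q, r, s). p + q = a \<and> r + s = b}" for a b :: nat by (rule finite_sum_eq_quadruple)
  qed (auto simp: monomial_simps xy_bounds simp del: binomial_Suc_Suc)
qed

lemma gf_T2_sum5: "((\<lambda>(a, b). (\<Sum>(p, q) \<in> {(p, q). p + q + 1 = a}.
          2 * of_real (zeta1 (2 * p + 3)) * of_real (zeta1 (2 * q + 3)) * ipi_coeff b) * X ^ (2 * a) * Y ^ (2 * b)) has_sum
   2 / X\<^sup>2 * (of_real (sinc y) * (of_real (esr 1 x) * of_real (esr 1 x)))) UNIV"
proof (rule gf_regroup[where \<phi> = "\<lambda>(b, (p, q)). ((p + q + 1, b), (p, q))" and \<psi> = "\<lambda>((a, b), (p, q)). (b, (p, q))",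
      OF has_sum_cmult_right[OF has_sum_product[OF gf_ipi_y has_sum_product[OF gf_zeta_odd_x gf_zeta_odd_x]]]])
    show "finite {(p, q). p + q + 1 = a}" for a b :: nat by (rule finite_sum_less_pair)
qed (auto simp: monomial_simps xy_bounds)

lemma gf_T2_sum6: "((\<lambda>(a, b). (\<Sum>(r, s) \<in> {(r, s). r + s + 1 = b}.
          4 * of_real (zeta1 (2 * a + 3)) * of_real (zeta1 (2 * r + 3)) * ipi_coeff s) * X ^ (2 * a) * Y ^ (2 * b)) has_sum
   4 / X\<^sup>2 * (of_real (sinc y) * (of_real (esr 1 x) * of_real (esr 1 y)))) UNIV"
proof (rule gf_regroup[where \<phi> = "\<lambda>(s, (a, r)). ((a, r + s + 1), (r, s))" and \<psi> = "\<lambda>((a, b), (r, s)). (s, (a, r))",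
      OF has_sum_cmult_right[OF has_sum_product[OF gf_ipi_y has_sum_product[OF gf_zeta_odd_x gf_zeta_odd_y]]]])
    show "finite {(r, s). r + s + 1 = b}" for a b :: nat by (rule finite_sum_less_pair)
qed (auto simp: monomial_simps xy_bounds)

end

lemma has_real_derivative_osr:
  assumes "0 < y" "y < 1/2"
  shows "(osr 1 has_real_derivative (d2 y + d2 (- y)) / 2) (at y)"
proof -
  have s: "sin (pi * y) \<noteq> 0" using sin_gt_zero[of "pi * y"] assms by (simp add: field_simps)
  have c: "((\<lambda>y. cot (pi * y)) has_real_derivative - inverse ((sin (pi * y))\<^sup>2) * pi) (at y)"
    by (rule DERIV_chain2[where f = cot and g = "\<lambda>y. pi * y", OF DERIV_cot[OF s]]) (auto intro!: derivative_eq_intros)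
  have r: "((\<lambda>y. 1 / y) has_real_derivative - 1 / y\<^sup>2) (at y)"
    using assms by (auto intro!: derivative_eq_intros simp: power2_eq_square)
  have "(- 1 / y\<^sup>2 - pi * (- inverse ((sin (pi * y))\<^sup>2) * pi)) / 2 = (d2 y + d2 (- y)) / 2"
    using assms s d2_sum[of y] by (simp add: field_simps power2_eq_square)
  with DERIV_cdivide[OF DERIV_diff[OF r DERIV_cmult[OF c, of pi]], of 2]
  have "((\<lambda>y. (1 / y - pi * cot (pi * y)) / 2) has_real_derivative (d2 y + d2 (- y)) / 2) (at y)" by metis
  then show ?thesis
    by (rule has_field_derivative_transform_within_open[where S = "{0<..<1/2}"]) (use assms in \<open>auto simp: osr_cot\<close>)
qed

text \<open>The row a = 0 of the third series in \<open>gf_psr2\<close> is x times this sum and has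
  to be removed in \<open>gf_T3_sum8\<close>. It is the derivative of \<open>osr 1\<close>, obtained
  once term by term and once from the cotangent.\<close>

lemma gf_osr_deriv:
  assumes y: "0 < y" "y < 1/2"
  shows "((\<lambda>b. zeta1 (2 * b + 2) * real (2 * b + 1) * y ^ (2 * b)) has_sum (d2 y + d2 (- y)) / 2) UNIV"
proof -
  define c where "c k = zeta1 (k + 1)" for k
  have s: "summable (\<lambda>n. c n * (1/2) ^ n)"
    using has_sum_imp_sums[OF has_sum_psr[OF _ zeta_coeffs_zeta1, of "1/2"]] by (simp add: c_def sums_iff)
  have p: "(\<Sum>n. c n * z ^ n) = psr 1 z" if "\<bar>z\<bar> \<le> 1/2" for z
    using has_sum_imp_sums[OF has_sum_psr[OF that zeta_coeffs_zeta1]] by (simp add: c_def sums_iff)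
  define D where "D z = (\<Sum>n. diffs c n * z ^ n)" for z
  have D: "(psr 1 has_real_derivative D z) (at z)" "summable (\<lambda>n. norm (diffs c n * z ^ n))" if "\<bar>z\<bar> < 1/2" for z
  proof -
    have "((\<lambda>z. \<Sum>n. c n * z ^ n) has_real_derivative D z) (at z)"
      unfolding D_def by (rule termdiffs_strong[OF s]) (use that in simp)
    then show "(psr 1 has_real_derivative D z) (at z)"
      by (rule has_field_derivative_transform_within_open[where S = "{-(1/2)<..<1/2}"]) (use that in \<open>auto simp: p\<close>)
    from dense[OF that] obtain K where K: "\<bar>z\<bar> < K" "K < 1/2" by blast
    have "summable (\<lambda>n. diffs c n * K ^ n)"
      by (rule termdiff_converges[of _ "1/2"]) (use K in \<open>auto intro: powser_inside[OF s]\<close>)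
    then show "summable (\<lambda>n. norm (diffs c n * z ^ n))" by (rule powser_insidea) (use K in auto)
  qed
  have h: "((\<lambda>n. diffs c n * z ^ n) has_sum D z) UNIV" if "\<bar>z\<bar> < 1/2" for z
    unfolding D_def by (rule norm_summable_imp_has_sum[OF D(2)[OF that] summable_sums[OF summable_norm_cancel[OF D(2)[OF that]]]])
  have "((\<lambda>a. diffs c (2 * a + 0) * y ^ (2 * a + 0)) has_sum (D y + (-1) ^ 0 * D (- y)) / 2) UNIV"
    by (rule has_sum_parity1) (use h[of y] h[of "- y"] y in auto)
  moreover have "(D y + D (- y)) / 2 = (d2 y + d2 (- y)) / 2"
  proof (rule DERIV_unique)
    have "(uminus has_real_derivative - 1) (at y)" by (auto intro!: derivative_eq_intros)
    then have "((\<lambda>z. psr 1 (- z)) has_real_derivative - D (- y)) (at y)"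
      using DERIV_chain'[of "\<lambda>z. - z" "-1" y UNIV "psr 1" "D (- y)"] D(1)[of "- y"] y by simp
    then have "((\<lambda>z. (psr 1 z - psr 1 (- z)) / 2) has_real_derivative (D y - (- D (- y))) / 2) (at y)"
      using D(1)[of y] y by (intro DERIV_cdivide DERIV_diff) auto
    then show "(osr 1 has_real_derivative (D y + D (- y)) / 2) (at y)"
      unfolding diff_minus_eq_add
      by (rule has_field_derivative_transform_within_open[where S = "{0<..<1/2}"]) (use y in \<open>auto simp: psr_def osr_minus\<close>)
  qed (rule has_real_derivative_osr[OF y])
  moreover have "diffs c (2 * a) = zeta1 (2 * a + 2) * real (2 * a + 1)" for a
    by (simp add: diffs_def c_def)
  ultimately show ?thesis by simp
qed

section \<open>Generating functions of the sums in \<open>T3\<close> without Euler numbers\<close>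

context small_point
begin

text \<open>A divided difference, as the coefficient depends on a + b only. The sine series without
  its first two terms gives (sinc z - 1)/z^2 + pi^2/6, and the constant cancels between x and
  y.\<close>

lemma gf_T3_term3: "((\<lambda>(a, b). (\<i> * complex_of_real pi) ^ (2 * a + 2 * b + 4) / fact (2 * a + 2 * b + 5) * X ^ (2 * a) * Y ^ (2 * b)) has_sum
   of_real (((sinc x - 1) / x\<^sup>2 - (sinc y - 1) / y\<^sup>2) / (x\<^sup>2 - y\<^sup>2))) UNIV"
proof -
  define \<beta> :: "nat \<Rightarrow> real" where "\<beta> n = (- (pi\<^sup>2)) ^ (n + 2) / fact (2 * n + 5)" for n
  have b: "((\<lambda>n. \<beta> n * z ^ (2 * n + 2)) has_sum (sinc z - 1) / z\<^sup>2 + pi\<^sup>2 / 6) UNIV" if "z \<noteq> 0" for z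
  proof -
    have "((\<lambda>q. (- (pi\<^sup>2)) ^ q / fact (2 * q + 1) * z ^ (2 * q)) has_sum sinc z) UNIV"
      using gf_sinc_real[of z] that by simp
    from has_sum_divide_const[OF has_sum_shift[OF has_sum_shift[OF this]], of "z\<^sup>2"]
    have "((\<lambda>n. (- (pi\<^sup>2)) ^ (n + 1 + 1) / fact (2 * (n + 1 + 1) + 1) * z ^ (2 * (n + 1 + 1)) / z\<^sup>2) has_sum
       (sinc z - (- (pi\<^sup>2)) ^ 0 / fact (2 * 0 + 1) * z ^ (2 * 0) - (- (pi\<^sup>2)) ^ (0 + 1) / fact (2 * (0 + 1) + 1) * z ^ (2 * (0 + 1))) / z\<^sup>2) UNIV" .
    moreover have "sinc z - (- (pi\<^sup>2)) ^ 0 / fact (2 * 0 + 1) * z ^ (2 * 0) - (- (pi\<^sup>2)) ^ (0 + 1) / fact (2 * (0 + 1) + 1) * z ^ (2 * (0 + 1))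
      = sinc z - 1 + pi\<^sup>2 / 6 * z\<^sup>2" by (simp add: fact_numeral numeral_3_eq_3 power2_eq_square)
    moreover have "(sinc z - 1 + pi\<^sup>2 / 6 * z\<^sup>2) / z\<^sup>2 = (sinc z - 1) / z\<^sup>2 + pi\<^sup>2 / 6" using that by (simp add: add_divide_distrib)
    moreover have "(- (pi\<^sup>2)) ^ (n + 1 + 1) / fact (2 * (n + 1 + 1) + 1) * z ^ (2 * (n + 1 + 1)) / z\<^sup>2 = \<beta> n * z ^ (2 * n + 2)" for n
    proof -
      have e: "n + 1 + 1 = n + 2" "2 * (n + 2) + 1 = 2 * n + 5" "z ^ (2 * (n + 2)) = z ^ (2 * n + 2) * z\<^sup>2"
        by (simp_all add: power_add power2_eq_square)
      have k: "p * (w * t) / t = p * w" if "t \<noteq> 0" for p w t :: real using that by simp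
      show ?thesis unfolding \<beta>_def e by (rule k) (use that in simp)
    qed
    ultimately show ?thesis by (simp only:)
  qed
  have "((\<lambda>(a, b). \<beta> (a + b) * x ^ (2 * a) * y ^ (2 * b)) has_sum ((sinc x - 1) / x\<^sup>2 + pi\<^sup>2 / 6 - ((sinc y - 1) / y\<^sup>2 + pi\<^sup>2 / 6)) / (x\<^sup>2 - y\<^sup>2)) UNIV"
    by (rule gf_geometric2[OF x(1) y(1) ne b b]) (use xy_bounds in auto)
  then have "((\<lambda>(a, b). \<beta> (a + b) * x ^ (2 * a) * y ^ (2 * b)) has_sum ((sinc x - 1) / x\<^sup>2 - (sinc y - 1) / y\<^sup>2) / (x\<^sup>2 - y\<^sup>2)) UNIV"
    by (simp add: algebra_simps)
  from has_sum_of_real[OF this, where 'a = complex] have "((\<lambda>z. complex_of_real (\<beta> (fst z + snd z)) * X ^ (2 * fst z) * Y ^ (2 * snd z)) has_sum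
     of_real (((sinc x - 1) / x\<^sup>2 - (sinc y - 1) / y\<^sup>2) / (x\<^sup>2 - y\<^sup>2))) UNIV" by (simp add: case_prod_unfold)
  moreover have "complex_of_real (\<beta> (a + b)) = (\<i> * complex_of_real pi) ^ (2 * a + 2 * b + 4) / fact (2 * a + 2 * b + 5)" for a b
  proof -
    have e: "2 * (a + b) + 5 = 2 * a + 2 * b + 5" "2 * (a + b + 2) = 2 * a + 2 * b + 4" by auto
    show ?thesis using i_pi_power[of "a + b + 2", unfolded e] unfolding \<beta>_def e by (simp only: of_real_divide of_real_fact)
  qed
  ultimately show ?thesis by (simp add: case_prod_unfold)
qed

lemma gf_ipi_shift: "((\<lambda>a. ipi_coeff (a + 1) * X ^ (2 * (a + 1))) has_sum of_real (sinc x - 1)) UNIV"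
  using has_sum_shift[OF gf_ipi[OF xy_bounds(2)]] by (simp add: ipi_coeff_def)

lemma gf_T3_term4: "((\<lambda>(a, b). 2 * of_real (zeta1 (2 * b + 2)) * ipi_coeff (a + 1) * X ^ (2 * a) * Y ^ (2 * b)) has_sum
   2 / X\<^sup>2 * (of_real (sinc x - 1) * of_real (osr 1 y / y))) UNIV"
proof -
  have "2 / X\<^sup>2 * (ipi_coeff (fst z + 1) * X ^ (2 * (fst z + 1)) * (of_real (zeta1 (2 * snd z + 2)) * Y ^ (2 * snd z)))
     = 2 * of_real (zeta1 (2 * snd z + 2)) * ipi_coeff (fst z + 1) * X ^ (2 * fst z) * Y ^ (2 * snd z)" for z
    using xy_bounds by (simp add: monomial_simps)
  then show ?thesis
    using has_sum_cmult_right[OF has_sum_product[OF gf_ipi_shift gf_zeta_even[OF xy_bounds(3,4)]], of "2 / X\<^sup>2"] by (simp only: case_prod_unfold)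
qed

lemma gf_zeta_even_shift:
  assumes "\<bar>t\<bar> \<le> 1/2" "t \<noteq> 0"
  shows "((\<lambda>a. complex_of_real (zeta1 (2 * a + 4)) * of_real t ^ (2 * (a + 1))) has_sum of_real (osr 1 t / t - zeta1 2)) UNIV"
  using has_sum_shift[OF gf_zeta_even[OF assms]] by (simp add: eval_nat_numeral)

lemma gf_T3_sum5: "((\<lambda>(a, b). 4 * of_real (zeta1 (2 * a + 4)) * ipi_coeff b * X ^ (2 * a) * Y ^ (2 * b)) has_sum
   4 / X\<^sup>2 * (of_real (osr 1 x / x - zeta1 2) * of_real (sinc y))) UNIV"
proof -
  have "4 / X\<^sup>2 * (of_real (zeta1 (2 * fst z + 4)) * X ^ (2 * (fst z + 1)) * (ipi_coeff (snd z) * Y ^ (2 * snd z)))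
     = 4 * of_real (zeta1 (2 * fst z + 4)) * ipi_coeff (snd z) * X ^ (2 * fst z) * Y ^ (2 * snd z)" for z
    using xy_bounds by (simp add: monomial_simps)
  then show ?thesis
    using has_sum_cmult_right[OF has_sum_product[OF gf_zeta_even_shift[OF xy_bounds(1,2)] gf_ipi[OF xy_bounds(4)]], of "4 / X\<^sup>2"] by (simp only: case_prod_unfold)
qed

lemma gf_T3_sum6: "((\<lambda>(a, b). (\<Sum>(p, q) \<in> {(p, q). p + q = a + 1}.
          1 / 2 powi (2 * int p + 2 * int b - 1) * of_nat ((2 * p + 2 * b) choose (2 * b + 1))
          * of_real (zeta1 (2 * p + 2 * b + 2)) * ipi_coeff q) * X ^ (2 * a) * Y ^ (2 * b)) has_sum
   2 / (X * Y) * (of_real (sinc x) * of_real (osr 1 (P / 2) / P - osr 1 (M / 2) / M))) UNIV"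
proof -
  define c where "c p b = (2 * p + 2 * b + 2) choose (2 * b + 1)" for p b :: nat
  have c: "(2 * p + 2 * b + 2) choose (2 * p + 1) = c p b" for p b :: nat
    unfolding c_def using binomial_symmetric[of "2 * p + 1" "2 * p + 2 * b + 2"] by (simp del: binomial_Suc_Suc)
  have R: "((\<lambda>(p, b). zeta1 (2 * p + 2 * b + 4) * real (c p b) / 2 ^ (2 * p + 2 * b + 2) * x ^ (2 * p + 1) * y ^ (2 * b + 1)) has_sum
     (osr 1 (P / 2) / P - osr 1 (M / 2) / M)) UNIV"
    using gf_zeta_half[OF x y ne zeta_coeffs_zeta1] unfolding P_def M_def c .
  define F where "F b p q = 1 / 2 powi (2 * int p + 2 * int b - 1) * of_nat ((2 * p + 2 * b) choose (2 * b + 1))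
          * of_real (zeta1 (2 * p + 2 * b + 2)) * ipi_coeff q" for b p q
  define G where "G b p q = 1 / 2 ^ (2 * p + 2 * b + 1) * of_nat (c p b) * of_real (zeta1 (2 * p + 2 * b + 4)) * ipi_coeff q" for b p q
  \<comment> \<open>For p = 0 the binomial coefficient of 2b over 2b + 1 is 0; shifting p by one
    turns p + q = a + 1 into p + q = a.\<close>
  have F0: "1 \<le> p" if "F b p q \<noteq> 0" for b p q using that by (cases p) (auto simp: F_def)
  have FG: "F b (Suc p) q = G b p q" for b p q
  proof -
    have "2 * int (Suc p) + 2 * int b - 1 = int (2 * p + 2 * b + 1)" "2 * Suc p + 2 * b = 2 * p + 2 * b + 2" "2 * p + 2 * b + 2 + 2 = 2 * p + 2 * b + 4" by auto
    then show ?thesis unfolding F_def G_def c_def by (simp only: power_int_of_nat)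
  qed
  have "((\<lambda>(a, b). (\<Sum>(p, q) \<in> {(p, q). p + q = a}. G b p q) * X ^ (2 * a) * Y ^ (2 * b)) has_sum
   2 / (X * Y) * (of_real (sinc x) * of_real (osr 1 (P / 2) / P - osr 1 (M / 2) / M))) UNIV"
  proof (rule gf_regroup[where \<phi> = "\<lambda>(q, (p, b)). ((p + q, b), (p, q))" and \<psi> = "\<lambda>((a, b), (p, q)). (q, (p, b))",
      OF has_sum_cmult_right[OF has_sum_product[OF gf_ipi_x has_sum_of_real_pair[OF R]]]])
    show "finite {(p, q). p + q = a}" for a b :: nat by (rule finite_sum_eq_pair)
  qed (auto simp: monomial_simps xy_bounds G_def)
  moreover have "(\<Sum>(p, q) \<in> {(p, q). p + q = a}. G b p q) = (\<Sum>(p, q) \<in> {(p, q). p + q = a + 1}. F b p q)" for a b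
  proof -
    have "(\<Sum>(p, q) \<in> {(p, q). p + q = a}. G b p q) = (\<Sum>(p, q) \<in> {(p, q). p + q = a + 1 \<and> 1 \<le> p}. F b p q)"
      by (rule sum.reindex_bij_witness[where i = "\<lambda>(p, q). (p - 1, q)" and j = "\<lambda>(p, q). (Suc p, q)"]) (auto simp: FG)
    also have "\<dots> = (\<Sum>(p, q) \<in> {(p, q). p + q = a + 1}. F b p q)"
      by (rule sum.mono_neutral_left[OF finite_sum_eq_pair]) (use F0 in fastforce)+
    finally show ?thesis .
  qed
  ultimately show ?thesis by (simp add: F_def)
qed

lemma gf_T3_sum7: "((\<lambda>(a, b). (\<Sum>(p, q, r, s) \<in> {(p, q, r, s). p + q = a \<and> r + s = b}.
          4 * of_nat ((2 * p + 2 * r + 1) choose (2 * p + 1))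
          * of_real (zeta_bar (2 * p + 2 * r + 2)) * of_real (zeta1 (2 * s + 2)) * ipi_coeff q) * X ^ (2 * a) * Y ^ (2 * b)) has_sum
   4 / X * (of_real (sinc x) * (of_real (osr 1 y / y) * of_real ((osr (-1) P + osr (-1) M) / 2)))) UNIV"
proof -
  have R: "((\<lambda>(p, r). zeta_bar (2 * p + 2 * r + 2) * real ((2 * p + 2 * r + 1) choose (2 * p + 1)) * x ^ (2 * p + 1) * y ^ (2 * r)) has_sum (osr (-1) P + osr (-1) M) / 2) UNIV"
    unfolding P_def M_def by (rule gf_psr2(3)[OF x y zeta_coeffs_zeta_bar])
  show ?thesis
  proof (rule gf_regroup[where \<phi> = "\<lambda>(q, (s, (p, r))). ((p + q, r + s), (p, q, r, s))" and \<psi> = "\<lambda>((a, b), (p, q, r, s)). (q, (s, (p, r)))",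
      OF has_sum_cmult_right[OF has_sum_product[OF gf_ipi_x has_sum_product[OF gf_zeta_even_y has_sum_of_real_pair[OF R]]]]])
    show "finite {(p, q, r, s). p + q = a \<and> r + s = b}" for a b :: nat by (rule finite_sum_eq_quadruple)
  qed (auto simp: monomial_simps xy_bounds simp del: binomial_Suc_Suc)
qed

text \<open>Both binomial coefficients come from series of \<open>gf_psr2\<close> without the row a
  = 0. That row is x times the sum of \<open>gf_osr_deriv\<close> in one case and
  \<open>osr 1 y\<close> in the other; division by x^3 and by x^2 y makes the monomials
  agree.\<close>

lemma gf_T3_sum8: "((\<lambda>(a, b). (\<Sum>(r, s) \<in> {(r, s). r + s = b}.
          2 * of_real (zeta1 (2 * a + 2 * r + 4))
          * (of_nat ((2 * a + 2 * r + 3) choose (2 * a + 3))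
               - of_nat ((2 * a + 2 * r + 3) choose (2 * r + 1))) * ipi_coeff s) * X ^ (2 * a) * Y ^ (2 * b)) has_sum
   2 * (of_real (sinc y) * of_real (((osr 1 P + osr 1 M) / 2 - x * ((d2 y + d2 (- y)) / 2)) / x ^ 3
      - ((osr 1 P - osr 1 M) / 2 - osr 1 y) / (x\<^sup>2 * y)))) UNIV"
proof -
  have y': "0 < y" "y < 1/2" using y by auto
  have "((\<lambda>(a, v). zeta1 (2 * (a + 1) + 2 * v + 2) * real ((2 * (a + 1) + 2 * v + 1) choose (2 * (a + 1) + 1)) * x ^ (2 * (a + 1) + 1) * y ^ (2 * v))
      has_sum ((osr 1 P + osr 1 M) / 2 - x * ((d2 y + d2 (- y)) / 2))) UNIV"
    unfolding P_def M_def
    by (rule has_sum_shift_fst[OF gf_psr2(3)[OF x y zeta_coeffs_zeta1]])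
       (use has_sum_cmult_right[OF gf_osr_deriv[OF y'], of x] in \<open>simp add: ac_simps\<close>)
  then have 1: "((\<lambda>z. zeta1 (2 * fst z + 2 * snd z + 4) * real ((2 * fst z + 2 * snd z + 3) choose (2 * fst z + 3)) * x ^ (2 * fst z + 3) * y ^ (2 * snd z))
      has_sum ((osr 1 P + osr 1 M) / 2 - x * ((d2 y + d2 (- y)) / 2))) UNIV"
    by (simp add: eval_nat_numeral case_prod_unfold del: binomial_Suc_Suc)
  have b: "(2 * a + 2 * v + 3) choose (2 * a + 2) = (2 * a + 2 * v + 3) choose (2 * v + 1)" for a v :: nat
    using binomial_symmetric[of "2 * v + 1" "2 * a + 2 * v + 3"] by (simp add: eval_nat_numeral del: binomial_Suc_Suc)
  have "((\<lambda>(a, v). zeta1 (2 * (a + 1) + 2 * v + 2) * real ((2 * (a + 1) + 2 * v + 1) choose (2 * (a + 1))) * x ^ (2 * (a + 1)) * y ^ (2 * v + 1))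
      has_sum ((osr 1 P - osr 1 M) / 2 - osr 1 y)) UNIV"
    unfolding P_def M_def
    by (rule has_sum_shift_fst[OF gf_psr2(4)[OF x y zeta_coeffs_zeta1]])
       (use gf_osr[OF xy_bounds(3) zeta_coeffs_zeta1] in simp)
  then have 2: "((\<lambda>z. zeta1 (2 * fst z + 2 * snd z + 4) * real ((2 * fst z + 2 * snd z + 3) choose (2 * fst z + 2)) * x ^ (2 * fst z + 2) * y ^ (2 * snd z + 1))
      has_sum ((osr 1 P - osr 1 M) / 2 - osr 1 y)) UNIV"
    by (simp add: eval_nat_numeral case_prod_unfold del: binomial_Suc_Suc)
  have "((\<lambda>z. zeta1 (2 * fst z + 2 * snd z + 4) * real ((2 * fst z + 2 * snd z + 3) choose (2 * fst z + 3)) * x ^ (2 * fst z + 3) * y ^ (2 * snd z) / x ^ 3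
      + - (zeta1 (2 * fst z + 2 * snd z + 4) * real ((2 * fst z + 2 * snd z + 3) choose (2 * fst z + 2)) * x ^ (2 * fst z + 2) * y ^ (2 * snd z + 1) / (x\<^sup>2 * y)))
     has_sum ((osr 1 P + osr 1 M) / 2 - x * ((d2 y + d2 (- y)) / 2)) / x ^ 3
      + - (((osr 1 P - osr 1 M) / 2 - osr 1 y) / (x\<^sup>2 * y))) UNIV"
    by (intro has_sum_add has_sum_uminusI has_sum_divide_const 1 2)
  moreover have "z * c * x ^ (2 * a + 3) * y ^ (2 * r) / x ^ 3 + - (z * d * x ^ (2 * a + 2) * y ^ (2 * r + 1) / (x\<^sup>2 * y))
     = z * (c - d) * x ^ (2 * a) * y ^ (2 * r)" for z c d :: real and a r
    using xy_bounds by (simp add: power_add right_diff_distrib left_diff_distrib power2_eq_square)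
  ultimately have R: "((\<lambda>(a, r). zeta1 (2 * a + 2 * r + 4) * (real ((2 * a + 2 * r + 3) choose (2 * a + 3)) - real ((2 * a + 2 * r + 3) choose (2 * r + 1))) * x ^ (2 * a) * y ^ (2 * r))
     has_sum ((osr 1 P + osr 1 M) / 2 - x * ((d2 y + d2 (- y)) / 2)) / x ^ 3
      + - (((osr 1 P - osr 1 M) / 2 - osr 1 y) / (x\<^sup>2 * y))) UNIV"
    by (simp only: b case_prod_unfold)
  show ?thesis
  proof (rule gf_regroup[where \<phi> = "\<lambda>(s, (a, r)). ((a, r + s), (r, s))" and \<psi> = "\<lambda>((a, b), (r, s)). (s, (a, r))",
      OF has_sum_cmult_right[OF has_sum_product[OF gf_ipi_y has_sum_of_real_pair[OF R[folded diff_conv_add_uminus]]]]])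
    show "finite {(r, s). r + s = b}" for a b :: nat by (rule finite_sum_eq_pair)
  qed (auto simp: monomial_simps xy_bounds simp del: binomial_Suc_Suc)
qed

lemma gf_T3_sum9: "((\<lambda>(a, b). (\<Sum>(r, s) \<in> {(r, s). r + s = b}.
          2 * of_real (zeta1 (2 * a + 2 * r + 4)) * ipi_coeff s) * X ^ (2 * a) * Y ^ (2 * b)) has_sum
   2 * (of_real (sinc y) * of_real ((osr 1 x / x - osr 1 y / y) / (x\<^sup>2 - y\<^sup>2)))) UNIV"
proof -
  have b: "((\<lambda>n. zeta1 (2 * n + 4) * z ^ (2 * n + 2)) has_sum osr 1 z / z - zeta1 2) UNIV" if "\<bar>z\<bar> \<le> 1/2" "z \<noteq> 0" for z
    using has_sum_Re[OF gf_zeta_even_shift[OF that]] by (simp flip: of_real_power of_real_mult)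
  have "((\<lambda>(a, b). zeta1 (2 * (a + b) + 4) * x ^ (2 * a) * y ^ (2 * b)) has_sum (osr 1 x / x - zeta1 2 - (osr 1 y / y - zeta1 2)) / (x\<^sup>2 - y\<^sup>2)) UNIV"
    by (rule gf_geometric2[OF x(1) y(1) ne b b]) (use xy_bounds in auto)
  then have R: "((\<lambda>(a, b). zeta1 (2 * a + 2 * b + 4) * x ^ (2 * a) * y ^ (2 * b)) has_sum (osr 1 x / x - osr 1 y / y) / (x\<^sup>2 - y\<^sup>2)) UNIV"
    by (simp add: algebra_simps)
  show ?thesis
  proof (rule gf_regroup[where \<phi> = "\<lambda>(s, (a, r)). ((a, r + s), (r, s))" and \<psi> = "\<lambda>((a, b), (r, s)). (s, (a, r))",
      OF has_sum_cmult_right[OF has_sum_product[OF gf_ipi_y has_sum_of_real_pair[OF R]]]])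
    show "finite {(r, s). r + s = b}" for a b :: nat by (rule finite_sum_eq_pair)
  qed (auto simp: monomial_simps xy_bounds)
qed

lemma gf_T3_sum10: "((\<lambda>(a, b). (\<Sum>(p, q) \<in> {(p, q). p + q = a}.
          2 * of_real (zeta1 (2 * p + 2)) * of_real (zeta1 (2 * q + 2)) * ipi_coeff b) * X ^ (2 * a) * Y ^ (2 * b)) has_sum
   2 * (of_real (sinc y) * (of_real (osr 1 x / x) * of_real (osr 1 x / x)))) UNIV"
proof (rule gf_regroup[where \<phi> = "\<lambda>(b, (p, q)). ((p + q, b), (p, q))" and \<psi> = "\<lambda>((a, b), (p, q)). (b, (p, q))",
      OF has_sum_cmult_right[OF has_sum_product[OF gf_ipi_y has_sum_product[OF gf_zeta_even_x gf_zeta_even_x]]]])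
    show "finite {(p, q). p + q = a}" for a b :: nat by (rule finite_sum_eq_pair)
qed (auto simp: monomial_simps xy_bounds)

end

subsection \<open>Euler numbers\<close>

text \<open>The coefficients of cosh are real, so the real inverse series, read over the complex
  numbers, satisfies the equation that determines the complex inverse.\<close>

lemma cosh_has_fps_expansion_complex:
  "(\<lambda>z::complex. inverse (cosh z)) has_fps_expansion Abs_fps (\<lambda>n. of_real (euler_number n / fact n))"
proof -
  define g :: "real fps" where "g = fps_const (1 / 2) * (fps_exp 1 + fps_exp (- 1))"
  define G :: "complex fps" where "G = fps_const (1 / 2) * (fps_exp 1 + fps_exp (- 1))"
  have "(\<lambda>t::complex. 1 / 2 * (exp (1 * t) + exp (- 1 * t))) has_fps_expansion G"
    unfolding G_def by (intro has_fps_expansion_cmult_left has_fps_expansion_add has_fps_expansion_exp)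
  also have "(\<lambda>t::complex. 1 / 2 * (exp (1 * t) + exp (- 1 * t))) = cosh"
    by (simp add: fun_eq_iff cosh_field_def)
  finally have 1: "(\<lambda>t::complex. inverse (cosh t)) has_fps_expansion inverse G"
    by (rule has_fps_expansion_inverse) (simp add: G_def)
  have "inverse g * g = 1" by (intro inverse_mult_eq_1) (simp add: g_def)
  then have m: "g * inverse g = 1" by (simp add: mult.commute)
  have nth: "fps_nth G n = of_real (fps_nth g n)" for n by (simp add: G_def g_def)
  have "G * Abs_fps (\<lambda>n. of_real (fps_nth (inverse g) n)) = 1"
  proof (rule fps_ext)
    fix n
    have "fps_nth (G * Abs_fps (\<lambda>n. of_real (fps_nth (inverse g) n))) n = complex_of_real (fps_nth (g * inverse g) n)"
      by (simp add: fps_mult_nth nth)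
    then show "fps_nth (G * Abs_fps (\<lambda>n. of_real (fps_nth (inverse g) n))) n = fps_nth 1 n" by (simp add: m)
  qed
  then have "inverse G = Abs_fps (\<lambda>n. of_real (fps_nth (inverse g) n))" by (rule fps_inverse_unique)
  also have "\<dots> = Abs_fps (\<lambda>n. of_real (euler_number n / fact n))"
    unfolding euler_number_def g_def by simp
  finally show ?thesis using 1 by simp
qed

text \<open>The radius stays implicit: for the comparison of coefficients some neighbourhood of 0 is
  enough.\<close>

lemma sech_series:
  obtains \<rho> :: real where "0 < \<rho>"
    "\<And>z::complex. norm z < \<rho> \<Longrightarrow> summable (\<lambda>n. norm (of_real (euler_number n / fact n) * z ^ n))"
    "\<And>z::complex. norm z < \<rho> \<Longrightarrow> ((\<lambda>n. of_real (euler_number n / fact n) * z ^ n) has_sum inverse (cosh z)) UNIV"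
proof -
  define F :: "complex fps" where "F = Abs_fps (\<lambda>n. of_real (euler_number n / fact n))"
  have F: "0 < fps_conv_radius F" "eventually (\<lambda>z. eval_fps F z = inverse (cosh z)) (nhds 0)"
    using cosh_has_fps_expansion_complex by (simp_all add: has_fps_expansion_def F_def)
  obtain r where r: "0 < r" "ereal r < fps_conv_radius F"
    using ereal_dense2[OF F(1)] by (auto simp: zero_ereal_def)
  obtain d where d: "0 < d" "\<And>z. dist z 0 < d \<Longrightarrow> eval_fps F z = inverse (cosh z)"
    using F(2) unfolding eventually_nhds_metric by blast
  have s: "summable (\<lambda>n. norm (of_real (euler_number n / fact n) * z ^ n))" if "norm z < min r d" for z :: complex
  proof -
    have "ereal (norm z) < fps_conv_radius F" using that r(2) by (meson less_trans ereal_less_eq(3) min_less_iff_conj ereal_less(2) less_ereal.simps(1))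
    from norm_summable_fps[OF this] show ?thesis by (simp add: F_def)
  qed
  have "((\<lambda>n. of_real (euler_number n / fact n) * z ^ n) has_sum inverse (cosh z)) UNIV" if z: "norm z < min r d" for z :: complex
  proof (rule norm_summable_imp_has_sum[OF s[OF z]])
    have "(\<lambda>n. of_real (euler_number n / fact n) * z ^ n) sums eval_fps F z"
      unfolding eval_fps_def F_def using summable_sums[OF summable_norm_cancel[OF s[OF z]]] by simp
    then show "(\<lambda>n. of_real (euler_number n / fact n) * z ^ n) sums inverse (cosh z)" using d(2)[of z] z by simp
  qed
  with s show ?thesis using that[of "min r d"] r(1) d(1) by simp
qed

definition half_ipi :: complex where "half_ipi = \<i> * of_real pi / 2"

text \<open>At the argument \<open>half_ipi * (x + y)\<close> the hyperbolic secant is 1/cos (pi (x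
  + y)/2). The factorials stem from the binomial coefficient divided by (k + l)!, and half of the
  previous radius is taken because |half_ipi| \<le> 2.\<close>

lemma gf_sech:
  obtains \<rho> :: real where "0 < \<rho>"
    "\<And>x y :: real. \<bar>x\<bar> + \<bar>y\<bar> < \<rho> \<Longrightarrow>
      ((\<lambda>(k, l). of_real (euler_number (k + l)) / (fact k * fact l) * half_ipi ^ (k + l) * of_real x ^ k * of_real y ^ l) has_sum
        of_real (1 / cos (pi * (x + y) / 2))) UNIV"
proof -
  obtain \<rho> where \<rho>: "0 < \<rho>"
    "\<And>z::complex. norm z < \<rho> \<Longrightarrow> summable (\<lambda>n. norm (of_real (euler_number n / fact n) * z ^ n))"
    "\<And>z::complex. norm z < \<rho> \<Longrightarrow> ((\<lambda>n. of_real (euler_number n / fact n) * z ^ n) has_sum inverse (cosh z)) UNIV"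
    by (rule sech_series) blast
  have "((\<lambda>(k, l). of_real (euler_number (k + l)) / (fact k * fact l) * half_ipi ^ (k + l) * of_real x ^ k * of_real y ^ l) has_sum
        of_real (1 / cos (pi * (x + y) / 2))) UNIV" if xy: "\<bar>x\<bar> + \<bar>y\<bar> < \<rho> / 2" for x y :: real
  proof -
    define e :: "nat \<Rightarrow> complex" where "e n = of_real (euler_number n / fact n) * half_ipi ^ n" for n
    have half_ipi: "norm half_ipi \<le> 2" using pi_less_4 by (simp add: half_ipi_def norm_mult norm_divide)
    have n: "norm (half_ipi * of_real z) < \<rho>" if "\<bar>z\<bar> < \<rho> / 2" for z
    proof -
      have "norm (half_ipi * of_real z) \<le> 2 * \<bar>z\<bar>" using half_ipi by (simp add: norm_mult mult_right_mono)
      then show ?thesis using that by linarith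
    qed
    have "((\<lambda>n. of_real (euler_number n / fact n) * (half_ipi * of_real (x + y)) ^ n) has_sum inverse (cosh (half_ipi * of_real (x + y)))) UNIV"
      by (rule \<rho>(3)[OF n]) (use xy in linarith)
    moreover have "half_ipi * of_real (x + y) = \<i> * of_real (pi * (x + y) / 2)" by (simp add: half_ipi_def)
    then have "inverse (cosh (half_ipi * of_real (x + y))) = of_real (1 / cos (pi * (x + y) / 2))"
      by (simp only: cos_conv_cosh[symmetric] cos_of_real) (simp add: inverse_eq_divide)
    ultimately have 1: "((\<lambda>n. e n * (of_real x + of_real y) ^ n) has_sum of_real (1 / cos (pi * (x + y) / 2))) UNIV"
      by (simp add: e_def power_mult_distrib mult.assoc)
    have "summable (\<lambda>n. norm (of_real (euler_number n / fact n) * (half_ipi * of_real (\<bar>x\<bar> + \<bar>y\<bar>)) ^ n))"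
      by (rule \<rho>(2)[OF n]) (use xy in linarith)
    moreover have "norm (of_real (euler_number n / fact n) * (half_ipi * of_real (\<bar>x\<bar> + \<bar>y\<bar>)) ^ n)
       = norm (norm (e n) * (norm (complex_of_real x) + norm (complex_of_real y)) ^ n)" for n
    proof -
      have "norm (complex_of_real (\<bar>x\<bar> + \<bar>y\<bar>)) = \<bar>x\<bar> + \<bar>y\<bar>" by (simp only: norm_of_real)
      then show ?thesis by (simp add: e_def norm_mult norm_power norm_divide power_mult_distrib abs_mult del: of_real_add)
    qed
    ultimately have "summable (\<lambda>n. norm (norm (e n) * (norm (complex_of_real x) + norm (complex_of_real y)) ^ n))" by simp
    then have 2: "(\<lambda>n. norm (e n) * (norm (complex_of_real x) + norm (complex_of_real y)) ^ n) summable_on UNIV"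
      by (rule norm_summable_imp_summable_on)
    have b: "e (k + l) * of_nat ((k + l) choose k) = of_real (euler_number (k + l)) / (fact k * fact l) * half_ipi ^ (k + l)" for k l
    proof -
      have "of_nat ((k + l) choose k) = (fact (k + l) / (fact k * fact l) :: complex)"
        using binomial_fact[of k "k + l", where 'a = complex] by simp
      then show ?thesis by (simp add: e_def)
    qed
    show ?thesis
      using has_sum_binomial[OF 1 2]
      by (subst has_sum_reindex_bij_witness[where i = "\<lambda>(i, k). (k, i - k)" and j = "\<lambda>(k, l). (k + l, k)"
            and h = "\<lambda>(i, k). e i * of_nat (i choose k) * of_real x ^ k * of_real y ^ (i - k)" and T = "SIGMA i:UNIV. {..i}" and s' = "of_real (1 / cos (pi * (x + y) / 2))"])
         (auto simp: b)
  qed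
  then show ?thesis using that[of "\<rho> / 2"] \<rho>(1) by simp
qed

section \<open>The Euler number sums of \<open>T3\<close>\<close>

definition euler_term :: "nat \<Rightarrow> nat \<Rightarrow> nat \<times> nat \<times> nat \<times> nat \<times> nat \<times> nat \<Rightarrow> complex" where
  "euler_term A B = (\<lambda>(i, j, k, p, q, r). ((- 1) ^ p * of_real (euler_number (i + p)) * of_real (euler_number (j + q))
               / (fact i * fact j * fact p * fact q))
          * (\<i> * of_real pi / 2) ^ (A + B)
          * (2 ^ (2 * k + 2 * r) / (fact (2 * k + 1) * fact (2 * r + 1))))"

definition euler_indices :: "nat \<Rightarrow> nat \<Rightarrow> (nat \<times> nat \<times> nat \<times> nat \<times> nat \<times> nat) set" where
  "euler_indices A B = {(i, j, k, p, q, r). i + j + 2 * k = A \<and> p + q + 2 * r = B}"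

lemma finite_euler_indices: "finite (euler_indices A B)"
  by (rule finite_subset[of _ "{..A} \<times> {..A} \<times> {..A} \<times> {..B} \<times> {..B} \<times> {..B}"]) (auto simp: euler_indices_def)

text \<open>The pairs (i, p) and (j, q) of \<open>euler_term\<close> expand the secants at x - y and
  x + y, the sign (-1)^p coming from -y; k and r expand the two sine quotients. The case x = 0 is
  needed for the row a = 0.\<close>

definition euler_gf :: "real \<Rightarrow> real \<Rightarrow> real" where
  "euler_gf x y = (if x = 0 then 1 else sinc x) * (if y = 0 then 1 else sinc y) / (cos (pi * (x - y) / 2) * cos (pi * (x + y) / 2))"

lemma gf_euler:
  obtains \<rho> :: real where "0 < \<rho>"
    "\<And>x y :: real. \<bar>x\<bar> + \<bar>y\<bar> < \<rho> \<Longrightarrow> ((\<lambda>(A, B). (\<Sum>t\<in>euler_indices A B. euler_term A B t) * of_real x ^ A * of_real y ^ B) has_sum of_real (euler_gf x y)) UNIV"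
proof -
  obtain \<rho> where \<rho>: "0 < \<rho>"
    "\<And>x y :: real. \<bar>x\<bar> + \<bar>y\<bar> < \<rho> \<Longrightarrow>
      ((\<lambda>(k, l). of_real (euler_number (k + l)) / (fact k * fact l) * half_ipi ^ (k + l) * of_real x ^ k * of_real y ^ l) has_sum
        of_real (1 / cos (pi * (x + y) / 2))) UNIV"
    by (rule gf_sech) blast
  have "((\<lambda>(A, B). (\<Sum>t\<in>euler_indices A B. euler_term A B t) * of_real x ^ A * of_real y ^ B) has_sum of_real (euler_gf x y)) UNIV"
    if xy: "\<bar>x\<bar> + \<bar>y\<bar> < \<rho>" for x y :: real
  proof -
    \<comment> \<open>Writing i pi as 2 * half_ipi accounts for the factor 2^(2k + 2r) in
      \<open>euler_term\<close>.\<close>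
    have s: "((\<lambda>q. (2 * half_ipi) ^ (2 * q) / fact (2 * q + 1) * of_real z ^ (2 * q)) has_sum of_real (if z = 0 then 1 else sinc z)) UNIV" for z
      using gf_sinc[of z] by (simp add: half_ipi_def)
    have xy': "\<bar>x\<bar> + \<bar>- y\<bar> < \<rho>" using xy by simp
    define h where "h = (\<lambda>z::(nat \<times> nat) \<times> ((nat \<times> nat) \<times> (nat \<times> nat)).
      (\<lambda>(k, l). of_real (euler_number (k + l)) / (fact k * fact l) * half_ipi ^ (k + l) * of_real x ^ k * of_real (- y) ^ l) (fst z) *
      ((\<lambda>(k, l). of_real (euler_number (k + l)) / (fact k * fact l) * half_ipi ^ (k + l) * of_real x ^ k * of_real y ^ l) (fst (snd z)) *
       ((2 * half_ipi) ^ (2 * fst (snd (snd z))) / fact (2 * fst (snd (snd z)) + 1) * of_real x ^ (2 * fst (snd (snd z))) *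
        ((2 * half_ipi) ^ (2 * snd (snd (snd z))) / fact (2 * snd (snd (snd z)) + 1) * complex_of_real y ^ (2 * snd (snd (snd z)))))))"
    have h: "(h has_sum (of_real (1 / cos (pi * (x + - y) / 2)) * (of_real (1 / cos (pi * (x + y) / 2)) *
         (of_real (if x = 0 then 1 else sinc x) * of_real (if y = 0 then 1 else sinc y))))) UNIV"
      unfolding h_def by (rule has_sum_product[OF \<rho>(2)[OF xy'] has_sum_product[OF \<rho>(2)[OF xy] has_sum_product[OF s s]]])
    have v: "of_real (1 / cos (pi * (x + - y) / 2)) * (of_real (1 / cos (pi * (x + y) / 2)) *
         (of_real (if x = 0 then 1 else sinc x) * of_real (if y = 0 then 1 else sinc y))) = complex_of_real (euler_gf x y)"
      unfolding euler_gf_def of_real_mult[symmetric] by (rule arg_cong[where f = of_real]) simp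
    define \<psi> :: "(nat \<times> nat) \<times> (nat \<times> nat \<times> nat \<times> nat \<times> nat \<times> nat) \<Rightarrow> (nat \<times> nat) \<times> ((nat \<times> nat) \<times> (nat \<times> nat))"
      where "\<psi> = (\<lambda>(_, (i, j, k, p, q, r)). ((i, p), ((j, q), (k, r))))"
    have "((\<lambda>(A, B). \<Sum>t\<in>euler_indices A B. euler_term A B t * of_real x ^ A * of_real y ^ B) has_sum of_real (euler_gf x y)) UNIV"
    proof (rule has_sum_regroup[where \<phi> = "\<lambda>((i, p), ((j, q), (k, r))). ((i + j + 2 * k, p + q + 2 * r), (i, j, k, p, q, r))"
          and \<psi> = \<psi>, OF h[unfolded v] finite_euler_indices])
      fix A B t assume "t \<in> euler_indices A B"
      then obtain i j k p q r where t: "t = (i, j, k, p, q, r)" "A = i + j + 2 * k" "B = p + q + 2 * r"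
        by (auto simp: euler_indices_def)
      have m: "complex_of_real (- y) ^ p = (- 1) ^ p * of_real y ^ p" by (simp add: power_minus[of "complex_of_real y"])
      show "h (\<psi> ((A, B), t)) = euler_term A B t * of_real x ^ A * of_real y ^ B"
        unfolding h_def \<psi>_def euler_term_def t prod.case fst_conv snd_conv m half_ipi_def[symmetric]
        by (simp add: power_add power_mult_distrib ac_simps del: fact_Suc)
    qed (auto simp: euler_indices_def \<psi>_def)
    then show ?thesis by (simp add: sum_distrib_right)
  qed
  with \<rho>(1) show ?thesis by (rule that)
qed

definition euler_coeff :: "nat \<Rightarrow> nat \<Rightarrow> complex" where "euler_coeff a b = (\<Sum>t\<in>euler_indices (2 * a) (2 * b). euler_term (2 * a) (2 * b) t)"

text \<open>A sign change of x or of y merely exchanges the two cosines. The function is thus even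
  in both variables and equals its even-even part.\<close>

lemma gf_euler_even:
  obtains \<rho> :: real where "0 < \<rho>"
    "\<And>x y :: real. \<bar>x\<bar> + \<bar>y\<bar> < \<rho> \<Longrightarrow> ((\<lambda>(a, b). euler_coeff a b * of_real x ^ (2 * a) * of_real y ^ (2 * b)) has_sum of_real (euler_gf x y)) UNIV"
proof -
  obtain \<rho> where \<rho>: "0 < \<rho>"
    "\<And>x y :: real. \<bar>x\<bar> + \<bar>y\<bar> < \<rho> \<Longrightarrow> ((\<lambda>(A, B). (\<Sum>t\<in>euler_indices A B. euler_term A B t) * of_real x ^ A * of_real y ^ B) has_sum of_real (euler_gf x y)) UNIV"
    by (rule gf_euler) blast
  have "((\<lambda>(a, b). euler_coeff a b * of_real x ^ (2 * a) * of_real y ^ (2 * b)) has_sum of_real (euler_gf x y)) UNIV"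
    if xy: "\<bar>x\<bar> + \<bar>y\<bar> < \<rho>" for x y :: real
  proof -
    have e: "euler_gf (s * x) (t * y) = euler_gf x y" if "s \<in> {1, -1}" "t \<in> {1, -1}" for s t
    proof -
      have s: "(if s * x = 0 then 1 else sinc (s * x)) = (if x = 0 then 1 else sinc x)"
        "(if t * y = 0 then 1 else sinc (t * y)) = (if y = 0 then 1 else sinc y)" using that by (auto simp: sinc_minus)
      have c: "cos (pi * (- x - y) / 2) = cos (pi * (x + y) / 2)" "cos (pi * (- x + y) / 2) = cos (pi * (x - y) / 2)"
        using cos_minus[of "pi * (x + y) / 2"] cos_minus[of "pi * (x - y) / 2"] by (simp_all add: algebra_simps minus_divide_left)
      show ?thesis unfolding euler_gf_def s using that c by (auto simp: mult.commute)
    qed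
    have "((\<lambda>(a, b). (\<Sum>t\<in>euler_indices (2 * a + 0) (2 * b + 0). euler_term (2 * a + 0) (2 * b + 0) t) * complex_of_real x ^ (2 * a + 0) * of_real y ^ (2 * b + 0)) has_sum
       (of_real (euler_gf x y) + (-1) ^ 0 * of_real (euler_gf x y) + (-1) ^ 0 * of_real (euler_gf x y) + (-1) ^ 0 * (-1) ^ 0 * of_real (euler_gf x y)) / 4) UNIV"
    proof (rule has_sum_parity[where f = "\<lambda>s t. of_real (euler_gf x y)"])
      fix s t :: complex assume "s \<in> {1, -1}" "t \<in> {1, -1}"
      moreover have "\<exists>v. u = complex_of_real v \<and> v \<in> {1, -1}" if "u \<in> {1, -1}" for u
        using that by (auto intro: exI[of _ 1] exI[of _ "-1"])
      ultimately obtain s' t' where st: "s = of_real s'" "t = of_real t'" "s' \<in> {1, -1}" "t' \<in> {1, -1}" by blast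
      then have "\<bar>s' * x\<bar> + \<bar>t' * y\<bar> < \<rho>" using xy by (auto simp: abs_mult)
      from \<rho>(2)[OF this] show "((\<lambda>(A, B). (\<Sum>t\<in>euler_indices A B. euler_term A B t) * (s * of_real x) ^ A * (t * of_real y) ^ B) has_sum of_real (euler_gf x y)) UNIV"
        unfolding e[OF st(3,4)] st by simp
    qed auto
    then show ?thesis by (simp add: euler_coeff_def)
  qed
  with \<rho>(1) show ?thesis by (rule that)
qed

text \<open>Because 0^0 = 1, setting x = 0 isolates the row a = 0.\<close>

lemma gf_euler_0:
  assumes "((\<lambda>(a, b). euler_coeff a b * complex_of_real 0 ^ (2 * a) * of_real y ^ (2 * b)) has_sum S) UNIV"
  shows "((\<lambda>b. euler_coeff 0 b * of_real y ^ (2 * b)) has_sum S) UNIV"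
proof -
  define g where "g = (\<lambda>(a, b). euler_coeff a b * complex_of_real 0 ^ (2 * a) * of_real y ^ (2 * b))"
  have "(g has_sum S) ({0} \<times> UNIV)"
    using assms by (subst has_sum_cong_neutral[where T = UNIV and g = g]) (auto simp: g_def)
  then show ?thesis
    by (subst has_sum_reindex_bij_witness[where i = snd and j = "\<lambda>b. (0, b)" and h = g and T = "{0} \<times> UNIV" and s' = S]) (auto simp: g_def)
qed

context small_point
begin

text \<open>The constraint with 2a + 2 refers to row a + 1, whence the value at x = 0 is subtracted
  and the result divided by x^2.\<close>

lemma gf_T3_sum1:
  assumes xy: "((\<lambda>(a, b). euler_coeff a b * of_real x ^ (2 * a) * of_real y ^ (2 * b)) has_sum of_real (euler_gf x y)) UNIV"
    and y0: "((\<lambda>(a, b). euler_coeff a b * of_real 0 ^ (2 * a) * of_real y ^ (2 * b)) has_sum of_real (euler_gf 0 y)) UNIV"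
  shows "((\<lambda>(a, b). (\<Sum>(i, j, k, p, q, r) \<in> {(i, j, k, p, q, r). i + j + 2 * k = 2 * a + 2 \<and> p + q + 2 * r = 2 * b}.
          3 * of_real (zeta1 2)
          * ((- 1) ^ p * of_real (euler_number (i + p)) * of_real (euler_number (j + q))
               / (fact i * fact j * fact p * fact q))
          * (\<i> * of_real pi / 2) ^ (2 * a + 2 * b + 2)
          * (2 ^ (2 * k + 2 * r) / (fact (2 * k + 1) * fact (2 * r + 1)))) * X ^ (2 * a) * Y ^ (2 * b)) has_sum
     3 * of_real (zeta1 2) / X\<^sup>2 * of_real (euler_gf x y - euler_gf 0 y)) UNIV"
proof -
  have "((\<lambda>(a, b). euler_coeff (a + 1) b * of_real x ^ (2 * (a + 1)) * of_real y ^ (2 * b)) has_sum (of_real (euler_gf x y) - of_real (euler_gf 0 y))) UNIV"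
    by (rule has_sum_shift_fst[OF xy]) (use gf_euler_0[OF y0] in simp)
  from has_sum_cmult_right[OF this, of "3 * of_real (zeta1 2) / X\<^sup>2"]
  have 1: "((\<lambda>z. 3 * of_real (zeta1 2) / X\<^sup>2 * (euler_coeff (fst z + 1) (snd z) * X ^ (2 * (fst z + 1)) * Y ^ (2 * snd z))) has_sum
     3 * of_real (zeta1 2) / X\<^sup>2 * of_real (euler_gf x y - euler_gf 0 y)) UNIV" by (simp only: case_prod_unfold of_real_diff)
  have c: "(\<Sum>(i, j, k, p, q, r) \<in> {(i, j, k, p, q, r). i + j + 2 * k = 2 * a + 2 \<and> p + q + 2 * r = 2 * b}.
          3 * of_real (zeta1 2)
          * ((- 1) ^ p * of_real (euler_number (i + p)) * of_real (euler_number (j + q))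
               / (fact i * fact j * fact p * fact q))
          * (\<i> * of_real pi / 2) ^ (2 * a + 2 * b + 2)
          * (2 ^ (2 * k + 2 * r) / (fact (2 * k + 1) * fact (2 * r + 1)))) = 3 * of_real (zeta1 2) * euler_coeff (a + 1) b" for a b
  proof -
    have e: "2 * (a + 1) = 2 * a + 2" "2 * a + 2 + 2 * b = 2 * a + 2 * b + 2" by auto
    show ?thesis unfolding euler_coeff_def euler_indices_def euler_term_def e sum_distrib_left by (intro sum.cong refl) (simp add: case_prod_unfold mult.assoc)
  qed
  have "3 * of_real (zeta1 2) / X\<^sup>2 * (euler_coeff (a + 1) b * X ^ (2 * (a + 1)) * Y ^ (2 * b)) = 3 * of_real (zeta1 2) * euler_coeff (a + 1) b * X ^ (2 * a) * Y ^ (2 * b)" for a b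
    using xy_bounds by (simp add: power_add power2_eq_square)
  with 1 show ?thesis unfolding c by (simp only: case_prod_unfold)
qed

lemma gf_T3_sum2:
  assumes xy: "((\<lambda>(a, b). euler_coeff a b * of_real x ^ (2 * a) * of_real y ^ (2 * b)) has_sum of_real (euler_gf x y)) UNIV"
  shows "((\<lambda>(a, b). (\<Sum>(i, j, k, l, p, q, r) \<in> {(i, j, k, l, p, q, r). i + j + 2 * k + 2 * l = 2 * a \<and> p + q + 2 * r = 2 * b}.
          3 * of_real (zeta1 2)
          * ((- 1) ^ p * of_real (euler_number (i + p)) * of_real (euler_number (j + q))
               / (fact i * fact j * fact p * fact q))
          * (\<i> * of_real pi / 2) ^ (2 * a + 2 * b - 2 * l)
          * (2 ^ (2 * k + 2 * r) / (fact (2 * k + 1) * fact (2 * r + 1)))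
          * of_real (zeta1 (2 * l + 2))) * X ^ (2 * a) * Y ^ (2 * b)) has_sum
     3 * of_real (zeta1 2) * (of_real (osr 1 x / x) * of_real (euler_gf x y))) UNIV"
proof -
  have xy': "((\<lambda>z. euler_coeff (fst z) (snd z) * X ^ (2 * fst z) * Y ^ (2 * snd z)) has_sum of_real (euler_gf x y)) UNIV"
    using xy by (simp add: case_prod_unfold)
  define \<psi> :: "(nat \<times> nat) \<times> nat \<Rightarrow> nat \<times> nat \<times> nat" where "\<psi> = (\<lambda>((a, b), l). (l, (a - l, b)))"
  have 1: "((\<lambda>(a, b). (\<Sum>l\<in>{..a}. 3 * of_real (zeta1 2) * euler_coeff (a - l) b * of_real (zeta1 (2 * l + 2))) * X ^ (2 * a) * Y ^ (2 * b)) has_sum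
     3 * of_real (zeta1 2) * (of_real (osr 1 x / x) * of_real (euler_gf x y))) UNIV"
  proof (rule gf_regroup[where \<phi> = "\<lambda>(l, (a, b)). ((a + l, b), l)" and \<psi> = \<psi>, OF has_sum_cmult_right[OF has_sum_product[OF gf_zeta_even_x xy']]])
    fix a b l :: nat assume "l \<in> {..a}"
    then obtain d where "a = d + l" by (metis atMost_iff le_add_diff_inverse2)
    then show "3 * of_real (zeta1 2) * (of_real (zeta1 (2 * fst (\<psi> ((a, b), l)) + 2)) * X ^ (2 * fst (\<psi> ((a, b), l))) *
      (euler_coeff (fst (snd (\<psi> ((a, b), l)))) (snd (snd (\<psi> ((a, b), l)))) * X ^ (2 * fst (snd (\<psi> ((a, b), l)))) * Y ^ (2 * snd (snd (\<psi> ((a, b), l)))))) =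
      3 * of_real (zeta1 2) * euler_coeff (a - l) b * of_real (zeta1 (2 * l + 2)) * X ^ (2 * a) * Y ^ (2 * b)"
      by (simp add: \<psi>_def power_add)
  qed (auto simp: \<psi>_def)
  have "(\<Sum>l\<in>{..a}. 3 * of_real (zeta1 2) * euler_coeff (a - l) b * of_real (zeta1 (2 * l + 2)))
     = (\<Sum>(i, j, k, l, p, q, r) \<in> {(i, j, k, l, p, q, r). i + j + 2 * k + 2 * l = 2 * a \<and> p + q + 2 * r = 2 * b}.
          3 * of_real (zeta1 2)
          * ((- 1) ^ p * of_real (euler_number (i + p)) * of_real (euler_number (j + q))
               / (fact i * fact j * fact p * fact q))
          * (\<i> * of_real pi / 2) ^ (2 * a + 2 * b - 2 * l)
          * (2 ^ (2 * k + 2 * r) / (fact (2 * k + 1) * fact (2 * r + 1)))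
          * of_real (zeta1 (2 * l + 2)))" for a b
  proof -
    have "(\<Sum>l\<in>{..a}. 3 * of_real (zeta1 2) * euler_coeff (a - l) b * of_real (zeta1 (2 * l + 2)))
       = (\<Sum>l\<in>{..a}. \<Sum>t\<in>euler_indices (2 * (a - l)) (2 * b). 3 * of_real (zeta1 2) * euler_term (2 * (a - l)) (2 * b) t * of_real (zeta1 (2 * l + 2)))"
      by (simp add: euler_coeff_def sum_distrib_left sum_distrib_right)
    also have "\<dots> = (\<Sum>(l, t)\<in>(SIGMA l:{..a}. euler_indices (2 * (a - l)) (2 * b)). 3 * of_real (zeta1 2) * euler_term (2 * (a - l)) (2 * b) t * of_real (zeta1 (2 * l + 2)))"
      by (rule sum.Sigma) (auto simp: finite_euler_indices)
    also have "\<dots> = (\<Sum>(i, j, k, l, p, q, r) \<in> {(i, j, k, l, p, q, r). i + j + 2 * k + 2 * l = 2 * a \<and> p + q + 2 * r = 2 * b}.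
          3 * of_real (zeta1 2)
          * ((- 1) ^ p * of_real (euler_number (i + p)) * of_real (euler_number (j + q))
               / (fact i * fact j * fact p * fact q))
          * (\<i> * of_real pi / 2) ^ (2 * a + 2 * b - 2 * l)
          * (2 ^ (2 * k + 2 * r) / (fact (2 * k + 1) * fact (2 * r + 1)))
          * of_real (zeta1 (2 * l + 2)))"
      by (rule sum.reindex_bij_witness[where i = "\<lambda>(i, j, k, l, p, q, r). (l, (i, j, k, p, q, r))" and j = "\<lambda>(l, (i, j, k, p, q, r)). (i, j, k, l, p, q, r)"])
         (auto simp: euler_indices_def euler_term_def right_diff_distrib' simp del: fact_Suc)
    finally show ?thesis .
  qed
  with 1 show ?thesis by simp
qed

end

subsection \<open>The trigonometric identity\<close>

text \<open>The algebra behind \<open>closure\<close>: p is pi, a and b are the sines of pi x and pi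
  y, Cx and Cy the cotangents times pi, U and V sum and difference of the cotangents of pi (x + y)
  and pi (x - y), times pi. The two sides differ by a combination of \<open>r1\<close>,
  \<open>r2\<close>, \<open>r3\<close> with coefficients 1/2, b xa/2 and xa.\<close>

lemma closure_algebra:
  fixes xa ya p a b K J U V W Cx Cy :: real
  assumes xy: "xa \<noteq> 0" "ya \<noteq> 0" "xa\<^sup>2 \<noteq> ya\<^sup>2"
    and r1: "a * V + b * U = - 2 * p * K" and r2: "Cy * V + Cx * U = - 2 * p\<^sup>2"
    and r3: "b * (p\<^sup>2 + Cy\<^sup>2) = p\<^sup>2 * J + p * Cy"
    and W: "W = 1 / (xa\<^sup>2 - ya\<^sup>2)"
    and d: "ox = (1 / xa - Cx) / 2" "oy = (1 / ya - Cy) / 2" "S1 = xa * W - U / 2" "D1 = - ya * W - V / 2"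
      "Dx = p\<^sup>2 + Cx\<^sup>2 - 1 / xa\<^sup>2" "Dy = p\<^sup>2 + Cy\<^sup>2 - 1 / ya\<^sup>2"
  shows "p * xa * K * ox - a * (D1 - 2 * oy) - b * xa * (S1 / xa + 2 * D1 / ya - Dx + 4 * oy / ya + Dy - 2 * oy * D1 - 2 * ox * S1 - 4 * oy\<^sup>2 + 2 * ox\<^sup>2 - 10 * (p\<^sup>2 / 6))
    = - p * K + p\<^sup>2 * xa * J + p * xa * K * ox + (W * ya * a - xa ^ 3 * W * b / ya\<^sup>2 + p * xa / ya) + 2 * oy * (a - p * xa)
     - 4 * xa * b * (ox / xa - p\<^sup>2 / 6) + (b * S1 - b * xa * Dy - b * xa * D1 / ya + 2 * b * xa * oy / ya)
     + 2 * b * xa ^ 3 * W * (ox / xa - oy / ya) + 2 * b * xa * ox\<^sup>2" (is "?L = ?R")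
proof -
  have ne: "xa\<^sup>2 - ya\<^sup>2 \<noteq> 0" using xy by simp
  have W1: "xa * xa * W = 1 + ya * ya * W" unfolding W using ne by (simp add: field_simps power2_eq_square)
  \<comment> \<open>The reciprocals are treated as variables subject to the cancellation rules
    \<open>r\<close>, which makes the identity polynomial.\<close>
  define xb yb where "xb = 1 / xa" and "yb = 1 / ya"
  have r: "xa * xb = 1" "ya * yb = 1" "xa * (xb * z) = z" "ya * (yb * z) = z" for z using xy by (simp_all add: xb_def yb_def)
  have "?L - ?R = (a * V + b * U + 2 * p * K) / 2 + b * xa * ((Cy * V + Cx * U) / 2 + p\<^sup>2) + xa * (b * (p\<^sup>2 + Cy\<^sup>2) - p\<^sup>2 * J - p * Cy)"
  proof -
    have 1: "xa ^ 3 * W * b / ya\<^sup>2 = b * xa * W + b * xa * yb * yb"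
      using W1 xy unfolding yb_def by (simp add: field_simps power3_eq_cube power2_eq_square) algebra
    have 2: "2 * b * xa ^ 3 * W * (ox / xa - oy / ya) = b * (2 * (xa * xa * W) * ox) - b * xa * (yb * (2 * (xa * xa * W) * oy))"
      using xy unfolding yb_def by (simp add: field_simps power3_eq_cube)
    have 3: "S1 / xa = W - U * xb / 2" "D1 / ya = - W - V * yb / 2" "ox / xa = ox * xb" "oy / ya = oy * yb" "b * xa * D1 / ya = b * xa * (D1 / ya)" "2 * b * xa * oy / ya = 2 * b * xa * (oy / ya)"
       "2 * D1 / ya = 2 * (D1 / ya)" "4 * oy / ya = 4 * (oy / ya)" "p * xa / ya = p * xa * yb"
      using xy unfolding d xb_def yb_def by (simp_all add: field_simps)
    have o: "ox = (xb - Cx) / 2" "oy = (yb - Cy) / 2" "Dx = p\<^sup>2 + Cx\<^sup>2 - xb\<^sup>2" "Dy = p\<^sup>2 + Cy\<^sup>2 - yb\<^sup>2"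
      unfolding d xb_def yb_def by (simp_all add: power_divide)
    have 4: "Cx * (b * (xa * xa * W)) = Cx * (b * (1 + ya * ya * W))" "b * (xb * (xa * xa * W)) = b * (xb * (1 + ya * ya * W))"
      unfolding W1 by simp_all
    show ?thesis unfolding 1 unfolding 2 unfolding W1 unfolding 3 unfolding 3 unfolding o d(3,4)
      using 4 by (simp add: field_simps power2_eq_square r)
  qed
  moreover have "b * (p\<^sup>2 + Cy\<^sup>2) - p\<^sup>2 * J - p * Cy = 0" using r3 by simp
  ultimately have "?L - ?R = 0" unfolding r1 r2 by simp
  then show ?thesis by (rule eq_iff_diff_eq_0[THEN iffD2])
qed

text \<open>Since sin (X + Y) sin (X - Y) = (cos Y)^2 - (cos X)^2, sum and difference of the
  cotangents have a denominator in cos X and cos Y; the claims become rational identities modulo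
  sin^2 + cos^2 = 1.\<close>

lemma cot_relations:
  fixes X Y :: real
  assumes s: "sin X \<noteq> 0" "sin Y \<noteq> 0" and c: "cos X + cos Y \<noteq> 0" "cos X - cos Y \<noteq> 0" "1 + cos Y \<noteq> 0"
  defines "K \<equiv> sin X * sin Y / (cos X + cos Y)" and "J \<equiv> sin Y / (1 + cos Y)"
  shows "sin X * (cot (X + Y) - cot (X - Y)) + sin Y * (cot (X + Y) + cot (X - Y)) = - 2 * K"
    "cot Y * (cot (X + Y) - cot (X - Y)) + cot X * (cot (X + Y) + cot (X - Y)) = - 2"
    "sin Y * (1 + (cot Y)\<^sup>2) = J + cot Y"
proof -
  have q: "(sin X)\<^sup>2 = 1 - (cos X)\<^sup>2" "(sin Y)\<^sup>2 = 1 - (cos Y)\<^sup>2" by (simp_all add: sin_squared_eq)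
  have pm: "sin (X + Y) * sin (X - Y) = (cos Y - cos X) * (cos Y + cos X)"
    unfolding sin_add sin_diff using q by algebra
  then have nz: "sin (X + Y) \<noteq> 0" "sin (X - Y) \<noteq> 0" using c by auto
  have "cos (X + Y) * sin (X - Y) + cos (X - Y) * sin (X + Y) = 2 * sin X * cos X"
    "cos (X + Y) * sin (X - Y) - cos (X - Y) * sin (X + Y) = - 2 * sin Y * cos Y"
    unfolding sin_add sin_diff cos_add cos_diff using q by algebra+
  moreover have "cot (X + Y) + cot (X - Y) = (cos (X + Y) * sin (X - Y) + cos (X - Y) * sin (X + Y)) / (sin (X + Y) * sin (X - Y))"
    "cot (X + Y) - cot (X - Y) = (cos (X + Y) * sin (X - Y) - cos (X - Y) * sin (X + Y)) / (sin (X + Y) * sin (X - Y))"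
    by (simp_all add: cot_def add_frac_eq diff_frac_eq nz)
  ultimately have S: "cot (X + Y) + cot (X - Y) = 2 * sin X * cos X / ((cos Y - cos X) * (cos Y + cos X))"
    and D: "cot (X + Y) - cot (X - Y) = - 2 * sin Y * cos Y / ((cos Y - cos X) * (cos Y + cos X))"
    unfolding pm[symmetric] by simp_all
  have n: "cos Y + cos X \<noteq> 0" "cos Y - cos X \<noteq> 0" using c by auto
  have "(cos Y + cos X) * (cos Y - cos X) \<noteq> 0" using n by simp
  show "sin X * (cot (X + Y) - cot (X - Y)) + sin Y * (cot (X + Y) + cot (X - Y)) = - 2 * K"
    unfolding S D K_def using n c by (simp add: divide_simps) algebra
  show "cot Y * (cot (X + Y) - cot (X - Y)) + cot X * (cot (X + Y) + cot (X - Y)) = - 2"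
    unfolding S D unfolding cot_def using n s by (simp add: divide_simps) algebra
  show "sin Y * (1 + (cot Y)\<^sup>2) = J + cot Y"
    unfolding J_def cot_def using s c(3) q by (simp add: divide_simps) algebra
qed

text \<open>With u and v the half sum and half difference, tan u - tan v = sin (u - v)/(cos u cos v)
  and u - v = Y.\<close>

lemma tan_half_relation:
  fixes X Y :: real
  assumes "cos ((X + Y) / 2) \<noteq> 0" "cos ((X - Y) / 2) \<noteq> 0"
  shows "cos ((X + Y) / 2) * cos ((X - Y) / 2) = (cos X + cos Y) / 2"
    "sin X * (tan ((X + Y) / 2) - tan ((X - Y) / 2)) = 2 * (sin X * sin Y / (cos X + cos Y))"
proof -
  define u v where "u = (X + Y) / 2" and "v = (X - Y) / 2"
  have XY: "X = u + v" "Y = u - v" by (simp_all add: u_def v_def field_simps)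
  show 1: "cos ((X + Y) / 2) * cos ((X - Y) / 2) = (cos X + cos Y) / 2"
    unfolding u_def[symmetric] v_def[symmetric] unfolding XY cos_add cos_diff by simp
  have "tan u - tan v = sin Y / (cos u * cos v)"
    using assms unfolding u_def[symmetric] v_def[symmetric] unfolding XY tan_def sin_diff by (simp add: field_simps)
  then show "sin X * (tan ((X + Y) / 2) - tan ((X - Y) / 2)) = 2 * (sin X * sin Y / (cos X + cos Y))"
    using 1 unfolding u_def[symmetric] v_def[symmetric] by simp
qed

lemma osr_cot': "X \<noteq> 0 \<Longrightarrow> \<bar>X\<bar> \<le> 1/2 \<Longrightarrow> osr 1 X = (1 / X - pi * cot (pi * X)) / 2"
  using osr_cot[of X] osr_cot[of "- X"] osr_minus[of X 1] by (cases "0 < X") (auto simp: cot_def field_simps)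

text \<open>By \<open>osr_half\<close> the alternating sum is osr 1 (X/2) - osr 1 X; the cotangents
  combine through 2 cot 2u = cot u - tan u.\<close>

lemma osr_alternating:
  assumes "X \<noteq> 0" "\<bar>X\<bar> \<le> 1/2"
  shows "osr (-1) X - osr 1 X = - (pi / 2) * tan (pi * X / 2)"
proof -
  define u where "u = pi * X / 2"
  have X: "pi * X = 2 * u" "pi * (X / 2) = u" by (simp_all add: u_def)
  have "\<bar>pi * X\<bar> \<le> pi * (1/2)" unfolding abs_mult using assms by (intro mult_mono) auto
  then have "\<bar>u\<bar> \<le> pi / 4" by (simp add: u_def abs_mult)
  then have u: "0 < cos u" by (intro cos_gt_zero_pi) (use pi_gt_zero in linarith)+
  have "sin u \<noteq> 0"
  proof (cases "0 < u")
    case True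
    then show ?thesis using sin_gt_zero[of u] \<open>\<bar>u\<bar> \<le> pi / 4\<close> pi_gt_zero by fastforce
  next
    case False
    then have "0 < - u" using assms by (auto simp: u_def mult_less_0_iff not_less mult_le_0_iff less_le)
    then show ?thesis using sin_gt_zero[of "- u"] \<open>\<bar>u\<bar> \<le> pi / 4\<close> pi_gt_zero by fastforce
  qed
  then have c: "2 * cot (2 * u) = cot u - tan u"
    using u unfolding cot_def tan_def sin_double cos_double by (simp add: field_simps power2_eq_square)
  have "osr (-1) X = osr 1 (X / 2) - osr 1 X" using osr_half[OF assms(2)] by simp
  moreover have "osr 1 (X / 2) = (1 / (X / 2) - pi * cot u) / 2" "osr 1 X = (1 / X - pi * cot (2 * u)) / 2"
    using osr_cot'[of "X / 2"] osr_cot'[of X] assms unfolding X by simp_all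
  ultimately have "osr (-1) X - osr 1 X = (1 / (X / 2) - pi * cot u) / 2 - (1 / X - pi * cot (2 * u))"
    by (simp only:) (simp add: field_simps)
  also have "\<dots> = (pi / 2) * (2 * cot (2 * u) - cot u)" by (simp add: field_simps)
  finally show ?thesis unfolding c unfolding u_def by (simp add: algebra_simps)
qed

lemma sinc_sin: "x \<noteq> 0 \<Longrightarrow> sinc x = sin (pi * x) / (pi * x)" by (simp add: sinc_def)

context small_point
begin

text \<open>What is left after the double zeta values and all products with \<open>esr\<close> have
  been matched. By the cotangent series both sides are rational in x, y, pi and trigonometric
  functions.\<close>

lemma closure:
  defines "RB \<equiv> (osr 1 P + osr 1 M) / x + 2 * (osr 1 P - osr 1 M) / y - (d2 x + d2 (- x)) + 4 * osr 1 y / y + (d2 y + d2 (- y))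
     - 2 * osr 1 y * (osr 1 P - osr 1 M) - 2 * osr 1 x * (osr 1 P + osr 1 M) - 4 * (osr 1 y)\<^sup>2 + 2 * (osr 1 x)\<^sup>2 - 10 * (pi\<^sup>2 / 6)"
  shows "sinc x / (x * y) * (- osr 1 x * ((osr (-1) P - osr 1 P) - (osr (-1) M - osr 1 M)) - (osr 1 P - osr 1 M - 2 * osr 1 y) / x)
      - sinc y / x\<^sup>2 * RB
    = - (3 * (pi\<^sup>2 / 6) / x\<^sup>2 * (euler_gf x y - euler_gf 0 y)) + 3 * (pi\<^sup>2 / 6) * (osr 1 x / x * euler_gf x y)
      + ((sinc x - 1) / x\<^sup>2 - (sinc y - 1) / y\<^sup>2) / (x\<^sup>2 - y\<^sup>2) + 2 / x\<^sup>2 * ((sinc x - 1) * (osr 1 y / y))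
      - 4 / x\<^sup>2 * ((osr 1 x / x - pi\<^sup>2 / 6) * sinc y)
      + 2 * (sinc y * (((osr 1 P + osr 1 M) / 2 - x * ((d2 y + d2 (- y)) / 2)) / x ^ 3 - ((osr 1 P - osr 1 M) / 2 - osr 1 y) / (x\<^sup>2 * y)))
      + 2 * (sinc y * ((osr 1 x / x - osr 1 y / y) / (x\<^sup>2 - y\<^sup>2))) + 2 * (sinc y * (osr 1 x / x * (osr 1 x / x)))" (is "?L = ?R")
proof -
  define a b cx cy where "a = sin (pi * x)" and "b = sin (pi * y)" and "cx = cos (pi * x)" and "cy = cos (pi * y)"
  define K J W where "K = a * b / (cx + cy)" and "J = b / (1 + cy)" and "W = 1 / (x\<^sup>2 - y\<^sup>2)"
  define U V where "U = pi * (cot (pi * P) + cot (pi * M))" and "V = pi * (cot (pi * P) - cot (pi * M))"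
  define Cx Cy where "Cx = pi * cot (pi * x)" and "Cy = pi * cot (pi * y)"
  have pos: "0 < pi * x" "pi * x \<le> pi / 4" "0 < pi * y" "pi * y \<le> pi / 4" using x y by simp_all
  have ab: "a > 0" "b > 0" unfolding a_def b_def using pos pi_gt_zero by (auto intro!: sin_gt_zero)
  have c: "cx > 0" "cy > 0" unfolding cx_def cy_def using pos pi_gt_zero by (auto intro!: cos_gt_zero)
  have "cx \<noteq> cy" unfolding cx_def cy_def using pos pi_gt_zero ne cos_inj_pi[of "pi * x" "pi * y"] by auto
  have sq: "x\<^sup>2 \<noteq> y\<^sup>2" using x y ne by (simp add: power2_eq_iff)
  then have sq': "x\<^sup>2 - y\<^sup>2 \<noteq> 0" by simp
  have PM0: "P \<noteq> 0" "M \<noteq> 0" unfolding P_def M_def using x y ne by auto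
  have PM': "pi * P = pi * x + pi * y" "pi * M = pi * x - pi * y" unfolding P_def M_def by (simp_all add: algebra_simps)
  note rel = cot_relations[of "pi * x" "pi * y", folded PM' a_def b_def cx_def cy_def, folded K_def J_def]
  have rels: "a * (cot (pi * P) - cot (pi * M)) + b * (cot (pi * P) + cot (pi * M)) = - 2 * K"
    "cot (pi * y) * (cot (pi * P) - cot (pi * M)) + cot (pi * x) * (cot (pi * P) + cot (pi * M)) = - 2"
    "b * (1 + (cot (pi * y))\<^sup>2) = J + cot (pi * y)"
    using rel ab c \<open>cx \<noteq> cy\<close> by auto
  have r1: "a * V + b * U = - 2 * pi * K"
    using arg_cong[OF rels(1), of "\<lambda>t. pi * t"] by (simp add: U_def V_def algebra_simps)
  have r2: "Cy * V + Cx * U = - 2 * pi\<^sup>2"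
    using arg_cong[OF rels(2), of "\<lambda>t. pi * pi * t"] by (simp add: U_def V_def Cx_def Cy_def algebra_simps power2_eq_square)
  have r3: "b * (pi\<^sup>2 + Cy\<^sup>2) = pi\<^sup>2 * J + pi * Cy"
    using arg_cong[OF rels(3), of "\<lambda>t. pi * pi * t"] by (simp add: Cy_def algebra_simps power2_eq_square)
  have P1: "osr 1 P = (1 / P - pi * cot (pi * P)) / 2" "osr 1 M = (1 / M - pi * cot (pi * M)) / 2"
    using osr_cot'[OF PM0(1) PM_bounds(1)] osr_cot'[OF PM0(2) PM_bounds(2)] by auto
  have "1 / P + 1 / M = 2 * x * W" "1 / P - 1 / M = - 2 * y * W"
    unfolding W_def using PM0 sq' by (simp_all add: P_def M_def field_simps power2_eq_square)
  then have S1: "osr 1 P + osr 1 M = x * W - U / 2" and D1: "osr 1 P - osr 1 M = - y * W - V / 2"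
    unfolding P1 U_def V_def by (simp_all add: algebra_simps add_divide_distrib diff_divide_distrib)
  have d: "d2 z + d2 (- z) = pi\<^sup>2 + (pi * cot (pi * z))\<^sup>2 - 1 / z\<^sup>2" if "0 < z" "z \<le> 1/4" for z
  proof -
    have "0 < sin (pi * z)" using that by (intro sin_gt_zero) auto
    moreover have "(sin (pi * z))\<^sup>2 + (cos (pi * z))\<^sup>2 = 1" by simp
    ultimately have "pi\<^sup>2 / (sin (pi * z))\<^sup>2 = pi\<^sup>2 + (pi * cot (pi * z))\<^sup>2"
      by (simp add: cot_def field_simps power_mult_distrib flip: distrib_left)
    then show ?thesis using d2_sum[of z] that by simp
  qed
  \<comment> \<open>Here the alternating series enter: their differences from the ordinary ones are
    tangents, which yield the same quotient \<open>K\<close> as the cosines in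
    \<open>euler_gf\<close>.\<close>
  have T: "a * ((osr (-1) P - osr 1 P) - (osr (-1) M - osr 1 M)) = - pi * K"
  proof -
    have "\<bar>pi * P / 2\<bar> < pi / 2" "\<bar>pi * M / 2\<bar> < pi / 2"
      using pos pi_gt_zero unfolding PM' add_divide_distrib diff_divide_distrib by linarith+
    then have "cos (pi * P / 2) \<noteq> 0" "cos (pi * M / 2) \<noteq> 0"
      using cos_gt_zero_pi[of "pi * P / 2"] cos_gt_zero_pi[of "pi * M / 2"] by (auto simp: abs_less_iff)
    then have "a * (tan (pi * P / 2) - tan (pi * M / 2)) = 2 * K"
      using tan_half_relation(2)[of "pi * x" "pi * y"] unfolding PM' a_def b_def cx_def cy_def K_def by simp
    then have "- (pi / 2) * (a * (tan (pi * P / 2) - tan (pi * M / 2))) = - pi * K" by simp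
    then show ?thesis
      unfolding osr_alternating[OF PM0(1) PM_bounds(1)] osr_alternating[OF PM0(2) PM_bounds(2)] by (simp add: algebra_simps)
  qed
  have s: "sinc x = a / (pi * x)" "sinc y = b / (pi * y)" using xy_bounds by (simp_all add: sinc_sin a_def b_def)
  have half: "cos (pi * (u - v) / 2) * cos (pi * (u + v) / 2) = (cos (pi * u) + cos (pi * v)) / 2" for u v
    using cos_times_cos[of "pi * (u + v) / 2" "pi * (u - v) / 2"] by (simp add: mult.commute add_divide_distrib diff_divide_distrib algebra_simps)
  have v1: "euler_gf x y = 2 * K / (pi\<^sup>2 * x * y)"
    unfolding euler_gf_def half using xy_bounds c by (simp add: s K_def cx_def cy_def power2_eq_square ac_simps)
  have v0: "euler_gf 0 y = 2 * J / (pi * y)"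
    unfolding euler_gf_def half using xy_bounds c by (simp add: s J_def cx_def cy_def ac_simps)
  define ox oy S D Dx Dy where "ox = osr 1 x" and "oy = osr 1 y" and "S = osr 1 P + osr 1 M" and "D = osr 1 P - osr 1 M"
    and "Dx = d2 x + d2 (- x)" and "Dy = d2 y + d2 (- y)"
  note alg = closure_algebra[OF xy_bounds(2) xy_bounds(4) sq r1 r2 r3 W_def, of ox oy S D Dx Dy]
  have alg: "pi * x * K * ox - a * (D - 2 * oy) - b * x * RB
    = - pi * K + pi\<^sup>2 * x * J + pi * x * K * ox + (W * y * a - x ^ 3 * W * b / y\<^sup>2 + pi * x / y) + 2 * oy * (a - pi * x)
     - 4 * x * b * (ox / x - pi\<^sup>2 / 6) + (b * S - b * x * Dy - b * x * D / y + 2 * b * x * oy / y)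
     + 2 * b * x ^ 3 * W * (ox / x - oy / y) + 2 * b * x * ox\<^sup>2"
    unfolding RB_def ox_def[symmetric] oy_def[symmetric] S_def[symmetric] D_def[symmetric] Dx_def[symmetric] Dy_def[symmetric]
    by (rule alg) (use osr_cot'[of x] osr_cot'[of y] xy_bounds S1 D1 d[OF x] d[OF y] in \<open>simp_all add: ox_def oy_def S_def D_def Dx_def Dy_def Cx_def Cy_def\<close>)
  \<comment> \<open>Multiplication by this number brings both sides into the shape of
    \<open>closure_algebra\<close>.\<close>
  define N where "N = pi * x ^ 3 * y"
  have N: "N \<noteq> 0" using xy_bounds by (simp add: N_def)
  have W': "1 / (x\<^sup>2 - y\<^sup>2) = W" "z / (x\<^sup>2 - y\<^sup>2) = z * W" for z by (simp_all add: W_def)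
  have "?L * N = pi * x * K * ox - a * (D - 2 * oy) - b * x * RB"
  proof -
    define t where "t = (osr (-1) P - osr 1 P) - (osr (-1) M - osr 1 M)"
    have "?L * N = - (x * ox * (a * t)) - a * (D - 2 * oy) - b * x * RB"
      unfolding t_def[symmetric] ox_def[symmetric] oy_def[symmetric] D_def[symmetric] s N_def
      using xy_bounds by (simp add: field_simps power2_eq_square power3_eq_cube)
    then show ?thesis unfolding T[folded t_def] by simp
  qed
  also note alg
  also have "- pi * K + pi\<^sup>2 * x * J + pi * x * K * ox + (W * y * a - x ^ 3 * W * b / y\<^sup>2 + pi * x / y) + 2 * oy * (a - pi * x)
     - 4 * x * b * (ox / x - pi\<^sup>2 / 6) + (b * S - b * x * Dy - b * x * D / y + 2 * b * x * oy / y)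
     + 2 * b * x ^ 3 * W * (ox / x - oy / y) + 2 * b * x * ox\<^sup>2 = ?R * N"
  proof -
    have e1: "3 * (pi\<^sup>2 / 6) / x\<^sup>2 * (euler_gf x y - euler_gf 0 y) * N = pi * K - pi\<^sup>2 * x * J"
      unfolding v1 v0 N_def using xy_bounds by (simp add: field_simps power2_eq_square power3_eq_cube)
    have e2: "3 * (pi\<^sup>2 / 6) * (osr 1 x / x * euler_gf x y) * N = pi * x * K * ox"
      unfolding v1 N_def ox_def using xy_bounds by (simp add: field_simps power2_eq_square power3_eq_cube)
    have "(x\<^sup>2 - y\<^sup>2) * W = 1" using sq' by (simp add: W_def)
    then have w: "x * x * W = 1 + y * y * W" by (simp add: algebra_simps power2_eq_square)
    have e3: "((sinc x - 1) / x\<^sup>2 - (sinc y - 1) / y\<^sup>2) / (x\<^sup>2 - y\<^sup>2) * N = W * y * a - x ^ 3 * W * b / y\<^sup>2 + pi * x / y"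
    proof -
      have "((sinc x - 1) / x\<^sup>2 - (sinc y - 1) / y\<^sup>2) * W * N = W * y * a - x ^ 3 * W * b / y\<^sup>2 + pi * x / y * (x * x * W - y * y * W)"
        unfolding s N_def using xy_bounds by (simp add: field_simps power2_eq_square power3_eq_cube)
      then show ?thesis unfolding W' unfolding w by simp
    qed
    have e4: "2 / x\<^sup>2 * ((sinc x - 1) * (osr 1 y / y)) * N = 2 * oy * (a - pi * x)"
      unfolding s N_def oy_def using xy_bounds by (simp add: field_simps power2_eq_square power3_eq_cube)
    have e5: "4 / x\<^sup>2 * ((osr 1 x / x - pi\<^sup>2 / 6) * sinc y) * N = 4 * x * b * (ox / x - pi\<^sup>2 / 6)"
      unfolding s N_def ox_def using xy_bounds by (simp add: field_simps power2_eq_square power3_eq_cube)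
    have e6: "2 * (sinc y * (((osr 1 P + osr 1 M) / 2 - x * ((d2 y + d2 (- y)) / 2)) / x ^ 3 - ((osr 1 P - osr 1 M) / 2 - osr 1 y) / (x\<^sup>2 * y))) * N
        = b * S - b * x * Dy - b * x * D / y + 2 * b * x * oy / y"
      unfolding S_def[symmetric] D_def[symmetric] Dy_def[symmetric] oy_def[symmetric] s N_def using xy_bounds by (simp add: field_simps power2_eq_square power3_eq_cube)
    have e7: "2 * (sinc y * ((osr 1 x / x - osr 1 y / y) / (x\<^sup>2 - y\<^sup>2))) * N = 2 * b * x ^ 3 * W * (ox / x - oy / y)"
      unfolding W' s N_def ox_def oy_def using xy_bounds by (simp add: field_simps power2_eq_square power3_eq_cube)
    have e8: "2 * (sinc y * (osr 1 x / x * (osr 1 x / x))) * N = 2 * b * x * ox\<^sup>2"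
      unfolding s N_def ox_def using xy_bounds by (simp add: field_simps power2_eq_square power3_eq_cube)
    have "(- t1 + t2 + t3 + t4 - t5 + t6 + t7 + t8) * N = - (t1 * N) + t2 * N + t3 * N + t4 * N - t5 * N + t6 * N + t7 * N + t8 * N"
      for t1 t2 t3 t4 t5 t6 t7 t8 :: real by (simp add: algebra_simps)
    note lin = this[of "3 * (pi\<^sup>2 / 6) / x\<^sup>2 * (euler_gf x y - euler_gf 0 y)"]
    show ?thesis unfolding lin e1 e2 e3 e4 e5 e6 e7 e8 by simp
  qed
  finally show ?thesis using N by simp
qed

end

subsection \<open>Comparison of coefficients\<close>

text \<open>An identity theorem from small positive reals only. Once the earlier coefficients
  vanish, division by x^(2a) leaves a power series in x^2, and its limit at 0 is the next
  coefficient.\<close>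

lemma has_sum_zero_imp_coeff_zero:
  fixes d :: "nat \<Rightarrow> complex"
  assumes \<rho>: "0 < \<rho>" and d: "\<And>x :: real. 0 < x \<Longrightarrow> x < \<rho> \<Longrightarrow> ((\<lambda>a. d a * of_real x ^ (2 * a)) has_sum 0) UNIV"
  shows "d a = 0"
proof (induction a rule: less_induct)
  case (less a)
  define e where "e n = d (n + a)" for n
  have e: "((\<lambda>n. e n * of_real (x\<^sup>2) ^ n) has_sum 0) UNIV" if x: "0 < x" "x < \<rho>" for x
  proof -
    have "((\<lambda>a. d a * of_real x ^ (2 * a)) has_sum 0) {a..}"
      using d[OF x] less.IH
      by (subst (asm) has_sum_cong_neutral[where T = "{a..}" and g = "\<lambda>a. d a * of_real x ^ (2 * a)"]) (auto simp: not_le)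
    then have "((\<lambda>n. d (n + a) * of_real x ^ (2 * (n + a))) has_sum 0) UNIV"
      by (subst has_sum_reindex_bij_witness[where i = "\<lambda>n. n - a" and j = "\<lambda>n. n + a" and T = "{a..}" and h = "\<lambda>a. d a * of_real x ^ (2 * a)" and s' = 0]) auto
    from has_sum_divide_const[OF this, of "of_real x ^ (2 * a)"] show ?thesis
      using x by (simp add: e_def power_add distrib_left power_mult)
  qed
  define f where "f z = (\<Sum>n. e n * z ^ n)" for z
  define r where "r = (\<rho> / 2)\<^sup>2"
  have r: "0 < r" using \<rho> by (simp add: r_def)
  have "summable (\<lambda>n. e n * of_real r ^ n)"
    using has_sum_imp_sums[OF e[of "\<rho> / 2"]] \<rho> by (simp add: sums_iff r_def)
  then have "summable (\<lambda>n. e n * z ^ n)" if "norm z < r" for z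
    by (rule powser_inside) (use that r in simp)
  then have "(\<lambda>n. e n * z ^ n) sums f z" if "norm z < r" for z using that by (simp add: f_def summable_sums)
  then have lim: "(f \<longlongrightarrow> e 0) (at 0)" by (rule powser_limit_0[OF r])
  have "e 0 = 0"
  proof (rule ccontr)
    assume "e 0 \<noteq> 0"
    from tendsto_imp_eventually_ne[OF lim this] obtain h where h: "0 < h" "\<And>z. z \<noteq> 0 \<Longrightarrow> norm z < h \<Longrightarrow> f z \<noteq> 0"
      by (auto simp: eventually_at)
    \<comment> \<open>Chosen below \<rho>, 1 and h, so that x^2 < h.\<close>
    define x where "x = min (\<rho> / 2) (min (1/2) (h / 2))"
    have x: "0 < x" "x < \<rho>" "x < 1" "x < h" using h \<rho> by (auto simp: x_def min_def)
    have "x * x < 1 * h" by (rule mult_strict_mono) (use x in auto)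
    then have "x\<^sup>2 < h" by (simp add: power2_eq_square)
    then have "f (of_real (x\<^sup>2)) \<noteq> 0" using h(2)[of "of_real (x\<^sup>2)"] x by (simp add: norm_power)
    then show False using has_sum_imp_sums[OF e[OF x(1,2)]] by (simp add: f_def sums_iff)
  qed
  then show ?case by (simp add: e_def)
qed

text \<open>For fixed y this is an even series in x whose coefficients are series in y. Only points
  with 0 < x < y are used, so x = y never occurs.\<close>

lemma has_sum_zero_imp_coeff_zero2:
  fixes c :: "nat \<Rightarrow> nat \<Rightarrow> complex"
  assumes \<rho>: "0 < \<rho>"
    and c: "\<And>x y :: real. 0 < x \<Longrightarrow> x < \<rho> \<Longrightarrow> 0 < y \<Longrightarrow> y < \<rho> \<Longrightarrow> x \<noteq> y \<Longrightarrow>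
      ((\<lambda>(a, b). c a b * of_real x ^ (2 * a) * of_real y ^ (2 * b)) has_sum 0) UNIV"
  shows "c a b = 0"
proof (rule has_sum_zero_imp_coeff_zero[OF \<rho>, where d = "c a"])
  fix y :: real assume y: "0 < y" "y < \<rho>"
  have s: "(\<lambda>b. c a b * of_real y ^ (2 * b)) summable_on UNIV" for a
  proof -
    \<comment> \<open>One admissible point different from y shows that each row is summable.\<close>
    define x where "x = y / 2"
    have x: "0 < x" "x < \<rho>" "x \<noteq> y" using y by (auto simp: x_def)
    have "(\<lambda>(a, b). c a b * of_real x ^ (2 * a) * of_real y ^ (2 * b)) summable_on {a} \<times> UNIV"
      by (rule summable_on_subset_banach[OF has_sum_imp_summable[OF c[OF x(1,2) y x(3)]]]) simp
    then have "(\<lambda>b. c a b * of_real x ^ (2 * a) * of_real y ^ (2 * b)) summable_on UNIV"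
      by (subst summable_on_reindex_bij_witness[where i = snd and j = "\<lambda>b. (a, b)" and T = "{a} \<times> UNIV"
          and h = "\<lambda>(a, b). c a b * of_real x ^ (2 * a) * of_real y ^ (2 * b)"]) auto
    from summable_on_cmult_right[OF this, of "1 / of_real x ^ (2 * a)"] show ?thesis using x by (simp add: field_simps)
  qed
  define d where "d a = infsum (\<lambda>b. c a b * of_real y ^ (2 * b)) UNIV" for a
  have h: "((\<lambda>b. c a b * of_real y ^ (2 * b)) has_sum d a) UNIV" for a
    unfolding d_def by (rule has_sum_infsum[OF s])
  have "d a = 0"
  proof (rule has_sum_zero_imp_coeff_zero[where d = d])
    show "0 < min \<rho> y" using y \<rho> by simp
    fix x :: real assume x: "0 < x" "x < min \<rho> y"
    have "((\<lambda>(a, b). c a b * of_real x ^ (2 * a) * of_real y ^ (2 * b)) has_sum 0) (UNIV \<times> UNIV)"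
      using c[of x y] x y by simp
    then show "((\<lambda>a. d a * of_real x ^ (2 * a)) has_sum 0) UNIV"
    proof (rule has_sum_SigmaD)
      show "((\<lambda>b. case (a, b) of (a, b) \<Rightarrow> c a b * of_real x ^ (2 * a) * of_real y ^ (2 * b)) has_sum d a * of_real x ^ (2 * a)) UNIV" for a
        using has_sum_cmult_left[OF h[of a], of "of_real x ^ (2 * a)"] by (simp add: mult.commute mult.left_commute)
    qed
  qed
  then show "((\<lambda>b. c a b * of_real y ^ (2 * b)) has_sum 0) UNIV" using h[of a] by simp
qed

lemma zeta1_2: "zeta1 2 = pi\<^sup>2 / 6"
proof -
  have "((\<lambda>n. 1 / real n ^ 2) has_sum zeta1 2) {1..}"
    using zeta_coeffs_zeta1 by (auto simp: zeta_coeffs_def)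
  then have "((\<lambda>n. 1 / real (Suc n) ^ 2) has_sum zeta1 2) UNIV"
    by (subst has_sum_reindex_bij_witness[where i = "\<lambda>n. n - 1" and j = Suc and T = "{1..}" and h = "\<lambda>n. 1 / real n ^ 2" and s' = "zeta1 2"]) auto
  from has_sum_imp_sums[OF this] have "(\<lambda>n. 1 / real (Suc n) ^ 2) sums zeta1 2" .
  moreover have "(\<lambda>n. 1 / real (Suc n) ^ 2) sums (pi\<^sup>2 / 6)"
    using inverse_squares_sums by (simp add: add.commute)
  ultimately show ?thesis by (rule sums_unique2)
qed

lemma gf_add:
  assumes "((\<lambda>(a, b). f a b * X ^ (2 * a) * Y ^ (2 * b)) has_sum S) UNIV" "((\<lambda>(a, b). g a b * X ^ (2 * a) * Y ^ (2 * b)) has_sum T) UNIV"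
  shows "((\<lambda>(a, b). (f a b + g a b) * X ^ (2 * a) * Y ^ (2 * b)) has_sum (S + T :: complex)) UNIV"
  using has_sum_add[OF assms] by (simp add: case_prod_unfold distrib_right)

lemma gf_uminus:
  assumes "((\<lambda>(a, b). f a b * X ^ (2 * a) * Y ^ (2 * b)) has_sum S) UNIV"
  shows "((\<lambda>(a, b). (- f a b) * X ^ (2 * a) * Y ^ (2 * b)) has_sum (- S :: complex)) UNIV"
  using has_sum_uminusI[OF assms] by (simp add: case_prod_unfold)

lemma gf_diff:
  assumes "((\<lambda>(a, b). f a b * X ^ (2 * a) * Y ^ (2 * b)) has_sum S) UNIV" "((\<lambda>(a, b). g a b * X ^ (2 * a) * Y ^ (2 * b)) has_sum T) UNIV"
  shows "((\<lambda>(a, b). (f a b - g a b) * X ^ (2 * a) * Y ^ (2 * b)) has_sum (S - T :: complex)) UNIV"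
  using gf_add[OF assms(1) gf_uminus[OF assms(2)]] by simp

lemma has_sum_eqI: "(f has_sum S) A \<Longrightarrow> S = T \<Longrightarrow> (f has_sum T) A" by simp

section \<open>Assembly of the three groups\<close>

context small_point
begin

definition "FA1 = dzeta x y - dzeta (- x) y - dzeta x (- y) + dzeta (- x) (- y)"
definition "FA2 = dzeta (P / 2) y - dzeta (- M / 2) y - dzeta (M / 2) (- y) + dzeta (- P / 2) (- y)"
definition "FA3 = dzeta x (P / 2) - dzeta (- x) (- M / 2) - dzeta x (M / 2) + dzeta (- x) (- P / 2)"
definition "FB = dzeta y x + dzeta (- y) x + dzeta y (- x) + dzeta (- y) (- x)"

lemma gf_T1: "((\<lambda>(a, b). T1 a b * X ^ (2 * a) * Y ^ (2 * b)) has_sum of_real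
    (- (4 / (x * y) * (sinc x * (FA1 / 4))) + 4 / x\<^sup>2 * (sinc y * (FB / 4)) + (1 / (x * y) * (sinc x * (FA2 / 2)) + 1 / (x * y) * (sinc x * (FA3 / 2))))) UNIV"
proof -
  have *: "(\<Sum>(u, i, j) \<in> A. (1 / 2 ^ i * of_nat (binom (i + 1) (2 * int a - 2 * int u + 1))
             + 1 / 2 ^ j * of_nat ((j + 1) choose (2 * b + 1))) * of_real (mzv [i + 2, j + 2]) * ipi_coeff u)
     = (\<Sum>(u, i, j) \<in> A. 1 / 2 ^ i * of_nat (binom (i + 1) (2 * int a - 2 * int u + 1)) * of_real (mzv [i + 2, j + 2]) * ipi_coeff u)
     + (\<Sum>(u, i, j) \<in> A. 1 / 2 ^ j * of_nat ((j + 1) choose (2 * b + 1)) * of_real (mzv [i + 2, j + 2]) * ipi_coeff u)" for A a b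
    by (simp add: case_prod_unfold distrib_right sum.distrib)
  show ?thesis
    unfolding T1_def ipi_coeff_def[symmetric] *
    by (rule has_sum_eqI[OF gf_add[OF gf_add[OF gf_uminus[OF gf_T1_sum1] gf_T1_sum2] gf_add[OF gf_T1_sum3_left gf_T1_sum3_right]]])
       (simp add: FA1_def FA2_def FA3_def FB_def)
qed

lemma gf_T2: "((\<lambda>(a, b). T2 a b * X ^ (2 * a) * Y ^ (2 * b)) has_sum of_real
    (4 / (x * y) * (sinc x * (esr 1 x * (((esr (-1) P - esr (-1) M) - (esr 1 P - esr 1 M)) / 4)))
     - 4 / (x * y) * (sinc x * (esr 1 y * ((esr (-1) P - esr (-1) M) / 2)))
     - 4 / x\<^sup>2 * (sinc y * (esr 1 y * ((esr 1 P + esr 1 M) / 2 - esr 1 y)))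
     + 4 / x\<^sup>2 * (sinc y * (esr 1 x * ((esr 1 P + esr 1 M) / 2)))
     - 2 / x\<^sup>2 * (sinc y * (esr 1 x * esr 1 x))
     - 4 / x\<^sup>2 * (sinc y * (esr 1 x * esr 1 y)))) UNIV"
  unfolding T2_def ipi_coeff_def[symmetric]
  by (rule has_sum_eqI[OF gf_diff[OF gf_diff[OF gf_add[OF gf_diff[OF gf_diff[OF gf_T2_sum1 gf_T2_sum2] gf_T2_sum3] gf_T2_sum4] gf_T2_sum5] gf_T2_sum6]]) simp

lemma gf_T3_term4': "((\<lambda>(a, b). 2 * of_real (zeta1 (2 * b + 2)) * ((\<i> * of_real pi) ^ (2 * a + 2) / fact (2 * a + 3)) * X ^ (2 * a) * Y ^ (2 * b)) has_sum
   2 / X\<^sup>2 * (of_real (sinc x - 1) * of_real (osr 1 y / y))) UNIV"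
proof -
  have "2 * (a + 1) = 2 * a + 2" "2 * a + 2 + 1 = 2 * a + 3" for a :: nat by auto
  then show ?thesis using gf_T3_term4 unfolding ipi_coeff_def by (simp only:)
qed

lemma gf_T3:
  assumes xy: "((\<lambda>(a, b). euler_coeff a b * of_real x ^ (2 * a) * of_real y ^ (2 * b)) has_sum of_real (euler_gf x y)) UNIV"
    and y0: "((\<lambda>(a, b). euler_coeff a b * of_real 0 ^ (2 * a) * of_real y ^ (2 * b)) has_sum of_real (euler_gf 0 y)) UNIV"
  shows "((\<lambda>(a, b). T3 a b * X ^ (2 * a) * Y ^ (2 * b)) has_sum of_real
    (- (3 * (pi\<^sup>2 / 6) / x\<^sup>2 * (euler_gf x y - euler_gf 0 y)) + 3 * (pi\<^sup>2 / 6) * (osr 1 x / x * euler_gf x y)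
      + ((sinc x - 1) / x\<^sup>2 - (sinc y - 1) / y\<^sup>2) / (x\<^sup>2 - y\<^sup>2) + 2 / x\<^sup>2 * ((sinc x - 1) * (osr 1 y / y))
      - 4 / x\<^sup>2 * ((osr 1 x / x - pi\<^sup>2 / 6) * sinc y)
      - 2 / (x * y) * (sinc x * (osr 1 (P / 2) / P - osr 1 (M / 2) / M))
      - 4 / x * (sinc x * (osr 1 y / y * ((osr (-1) P + osr (-1) M) / 2)))
      + 2 * (sinc y * (((osr 1 P + osr 1 M) / 2 - x * ((d2 y + d2 (- y)) / 2)) / x ^ 3 - ((osr 1 P - osr 1 M) / 2 - osr 1 y) / (x\<^sup>2 * y)))
      + 2 * (sinc y * ((osr 1 x / x - osr 1 y / y) / (x\<^sup>2 - y\<^sup>2))) + 2 * (sinc y * (osr 1 x / x * (osr 1 x / x))))) UNIV"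
  unfolding T3_def ipi_coeff_def[symmetric]
  by (rule has_sum_eqI[OF gf_add[OF gf_add[OF gf_add[OF gf_diff[OF gf_diff[OF gf_diff[OF gf_add[OF gf_add[OF gf_add[OF
     gf_uminus[OF gf_T3_sum1[OF xy y0]] gf_T3_sum2[OF xy]] gf_T3_term3] gf_T3_term4'] gf_T3_sum5] gf_T3_sum6] gf_T3_sum7] gf_T3_sum8] gf_T3_sum9] gf_T3_sum10]])
     (simp add: zeta1_2)

text \<open>The values \<open>FA1\<close>, \<open>FA2\<close>, \<open>FA3\<close>, \<open>FB\<close>
  cancel against \<open>T1\<close> and the products with \<open>esr\<close> against
  \<open>T2\<close>. From \<open>T3\<close> the sum with halved arguments and the one with
  alternating \<open>osr\<close> cancel directly; the rest is \<open>closure\<close>.\<close>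

lemma gf_difference:
  assumes xy: "((\<lambda>(a, b). euler_coeff a b * of_real x ^ (2 * a) * of_real y ^ (2 * b)) has_sum of_real (euler_gf x y)) UNIV"
    and y0: "((\<lambda>(a, b). euler_coeff a b * of_real 0 ^ (2 * a) * of_real y ^ (2 * b)) has_sum of_real (euler_gf 0 y)) UNIV"
  shows "((\<lambda>(a, b). ((- 1) ^ (a + b) * complex_of_real (mzv (replicate a 2 @ [4] @ replicate b 2)) - (T1 a b + T2 a b + T3 a b))
      * X ^ (2 * a) * Y ^ (2 * b)) has_sum 0) UNIV"
proof -
  define An Bn where "An = (\<Sum>k. aser x (- y) (Suc k)) - (\<Sum>k. aser x y (Suc k))"
    and "Bn = (\<Sum>k. bser x y (Suc k)) + (\<Sum>k. bser x (- y) (Suc k))"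
  have "((\<lambda>(a, b). (- 1) ^ (a + b) * complex_of_real (mzv (replicate a 2 @ [4] @ replicate b 2)) * X ^ (2 * a) * Y ^ (2 * b)) has_sum
     of_real (sinc x / y * An - sinc y * Bn)) UNIV"
    using has_sum_of_real[OF has_sum_mzv_gf[OF x y], where 'a = complex] by (simp add: case_prod_unfold An_def Bn_def)
  note gf = gf_diff[OF this gf_add[OF gf_add[OF gf_T1 gf_T2] gf_T3[OF xy y0]]]
  define c1 c2 where "c1 = sinc x / (x * y)" and "c2 = sinc y / x\<^sup>2"
  have c: "k / (x * y) * (sinc x * t) = k * c1 * t" "k / x\<^sup>2 * (sinc y * t) = k * c2 * t"
    "4 / x * (sinc x * (osr 1 y / y * t)) = 4 * c1 * osr 1 y * t" for k t
    by (simp_all add: c1_def c2_def)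
  define RA where "RA = - 2 * esr 1 y * (esr (-1) P - esr (-1) M) - 2 * osr 1 y * (osr (-1) P + osr (-1) M)
    + esr 1 x * ((esr (-1) P - esr 1 P) - (esr (-1) M - esr 1 M)) - osr 1 x * ((osr (-1) P - osr 1 P) - (osr (-1) M - osr 1 M))
    - (osr 1 P - osr 1 M - 2 * osr 1 y) / x - 2 * (osr 1 (P / 2) / P - osr 1 (M / 2) / M)"
  define RB where "RB = (osr 1 P + osr 1 M) / x + 2 * (osr 1 P - osr 1 M) / y - (d2 x + d2 (- x)) + 4 * osr 1 y / y + (d2 y + d2 (- y))
     - 2 * osr 1 y * (osr 1 P - osr 1 M) - 2 * osr 1 x * (osr 1 P + osr 1 M) - 4 * (osr 1 y)\<^sup>2 + 2 * (osr 1 x)\<^sup>2 - 10 * (pi\<^sup>2 / 6)"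
  have A: "x * An = RA - FA1 + FA2 / 2 + FA3 / 2"
    using main_A[OF x y ne] unfolding RA_def An_def FA1_def FA2_def FA3_def P_def M_def by linarith
  have B: "x\<^sup>2 * Bn = 4 * esr 1 x * esr 1 y + 2 * esr 1 y * (esr 1 P + esr 1 M) - 2 * esr 1 x * (esr 1 P + esr 1 M) - 4 * (esr 1 y)\<^sup>2 + 2 * (esr 1 x)\<^sup>2 + RB - FB"
    using main_B[OF x y ne] unfolding RB_def Bn_def FB_def P_def M_def by linarith
  have "sinc x / y * An - sinc y * Bn = c1 * (x * An) - c2 * (x\<^sup>2 * Bn)"
    using xy_bounds by (simp add: c1_def c2_def)
  note F = this[unfolded A B RA_def]
  note cl = closure[folded RB_def, folded c1_def c2_def]
  show ?thesis
    by (rule has_sum_eqI[OF gf])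
       (unfold F c of_real_diff[symmetric] of_real_add[symmetric] of_real_eq_0_iff, use cl in \<open>simp add: algebra_simps power2_eq_square add_divide_distrib diff_divide_distrib\<close>)
qed

end

theorem theoremA7:
  fixes a b :: nat
  shows "complex_of_real (mzv (replicate a 2 @ [4] @ replicate b 2))
           = (- 1) ^ (a + b) * (T1 a b + T2 a b + T3 a b)"
proof -
  obtain \<rho> where \<rho>: "0 < \<rho>"
    "\<And>x y :: real. \<bar>x\<bar> + \<bar>y\<bar> < \<rho> \<Longrightarrow> ((\<lambda>(a, b). euler_coeff a b * of_real x ^ (2 * a) * of_real y ^ (2 * b)) has_sum of_real (euler_gf x y)) UNIV"
    by (rule gf_euler_even) blast
  have "(- 1) ^ (a + b) * complex_of_real (mzv (replicate a 2 @ [4] @ replicate b 2)) - (T1 a b + T2 a b + T3 a b) = 0"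
  proof (rule has_sum_zero_imp_coeff_zero2[where c = "\<lambda>a b. (- 1) ^ (a + b) * complex_of_real (mzv (replicate a 2 @ [4] @ replicate b 2)) - (T1 a b + T2 a b + T3 a b)"])
    \<comment> \<open>The 1/4 is the bound of \<open>small_point\<close>; \<rho>/2 keeps |x| + |y|
      inside the neighbourhood of the Euler series.\<close>
    show "0 < min (1/4) (\<rho> / 2)" using \<rho>(1) by simp
    fix x y :: real assume xy: "0 < x" "x < min (1/4) (\<rho> / 2)" "0 < y" "y < min (1/4) (\<rho> / 2)" "x \<noteq> y"
    then interpret small_point x y by unfold_locales auto
    have "\<bar>x\<bar> + \<bar>y\<bar> < \<rho>" "\<bar>0\<bar> + \<bar>y\<bar> < \<rho>" using xy by auto
    then show "((\<lambda>(a, b). ((- 1) ^ (a + b) * complex_of_real (mzv (replicate a 2 @ [4] @ replicate b 2)) - (T1 a b + T2 a b + T3 a b))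
      * of_real x ^ (2 * a) * of_real y ^ (2 * b)) has_sum 0) UNIV"
      by (intro gf_difference \<rho>(2)[of 0 y, unfolded of_real_0] \<rho>(2))
  qed
  then have e: "(- 1) ^ (a + b) * complex_of_real (mzv (replicate a 2 @ [4] @ replicate b 2)) = T1 a b + T2 a b + T3 a b" by simp
  show ?thesis unfolding e[symmetric] by (simp flip: mult.assoc power_add)
qed

end
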